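(* Let $\varrho=e^{\pi i/3}$, $\mathsf Q(x)=(1-\frac{x}{\varrho})(1-x\varrho)$, and $$\mathsf A_3(t,\tau)=\frac{(1-\frac{t}{\tau})(1-t\tau)}{\mathsf Q(t)},\quad \mathsf B_3(\tau)=\frac{\tau^2}{(1+\tau)^2\mathsf Q(\tau)},\quad \mathsf C_3(\tau)=\frac{(1+\tau)^2}{3\tau}.$$ For integers $n\ge0$ define $$\mathsf X_3^{(n)}(\tau)=\int_{-1}^{\tau}\frac{\log^n\mathsf A_3(t,\tau)\,dt}{\mathsf Q(t)}-\frac{\pi\log^n\mathsf C_3(\tau)}{\sqrt3},\qquad \mathsf Y_3^{(n)}(\tau)=\frac{\tau-1}{\tau+1}\frac{\log^n\mathsf B_3(\tau)}{\mathsf Q(\tau)},$$ $$\Xi_3^{(n)}(\tau)=\int_{-1}^{1}\left[\log^n\mathsf A_3(t,\tau)-\log^n\mathsf C_3(\tau)\right]\frac{dt}{\mathsf Q(t)}.$$ Then for every positive integer $k$, $$\pi\,m_k(1+x_1+x_2)\in \mathrm{Span}_{\mathbb Q}\left\{\sqrt3\,\pi^{2n_2}\log^{n_1}3\int_0^1\mathsf X_3^{(n_3)}(\tau)\mathsf Y_3^{(n_4)}(\tau)\,d\tau\;\middle|\; n_1,n_2,n_3,n_4\in\mathbb Z_{\ge0},\ n_1+(2n_2+1)+n_3+n_4=k\right\}$$ $$+\mathrm{Span}_{\mathbb Q}\left\{\sqrt3\,\pi^{2n_2}\log^{n_1}3\int_1^{\varrho}\Xi_3^{(n_3)}(\tau)\mathsf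 Y_3^{(n_4)}(\tau)\,d\tau\;\middle|\; n_1,n_2,n_3,n_4\in\mathbb Z_{\ge0},\ n_1+(2n_2+1)+n_3+n_4=k\right\},$$ and this sum of spans is contained in $i\,\mathfrak Z_{k+1}(6)$.
   Context: For a nonzero Laurent polynomial $P$ in $n$ variables and a positive integer $k$, the $k$-Mahler measure is $m_k(P)=\int_0^1\cdots\int_0^1\log^k|P(e^{2\pi i t_1},\dots,e^{2\pi i t_n})|\,dt_1\cdots dt_n$. For positive integers $a_1,\dots,a_n$ and complex $z_1,\dots,z_n$, $\mathrm{Li}_{a_1,\dots,a_n}(z_1,\dots,z_n)=\sum_{\ell_1>\dots>\ell_n>0}\prod_{j=1}^n z_j^{\ell_j}/\ell_j^{a_j}$. For integers $k,N\ge1$, $\mathfrak Z_k(N)$ is the $\mathbb Q$-vector space spanned by all convergent values $\mathrm{Li}_{a_1,\dots,a_n}(z_1,\dots,z_n)$ with $n\ge1$, $a_j\in\mathbb Z_{>0}$, $z_j^N=1$ for all $j$, and $\sum_j a_j=k$ (convergence holds iff $(a_1,z_1)\ne(1,1)$); $\mathfrak Z_0(N)=\mathbb Q$. The integrals over $t$ and over $\tau$ are along straight line segments; logarithms are principal branches. *)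

theory Defs
  imports
    "HOL-Complex_Analysis.Complex_Analysis"
    "HOL-Library.Poly_Mapping"
    "HOL-Library.Set_Algebras"
begin

subsection \<open>Mahler measures of Laurent polynomials\<close>

text \<open>
  A Laurent polynomial over the complex numbers in the variables indexed by the naturals is a
  finitely supported map from exponent vectors to coefficients.  Those in \<open>n\<close> variables
  are the ones that only involve the indices 1, ..., \<open>n\<close>.
\<close>

type_synonym laurent_poly = "(nat \<Rightarrow>\<^sub>0 int) \<Rightarrow>\<^sub>0 complex"

definition laurent_var :: "nat \<Rightarrow> laurent_poly" where
  "laurent_var j = Poly_Mapping.single (Poly_Mapping.single j 1) 1"

definition laurent_eval :: "laurent_poly \<Rightarrow> (nat \<Rightarrow> complex) \<Rightarrow> complex" where
  "laurent_eval P z =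
     (\<Sum>m\<in>Poly_Mapping.keys P. Poly_Mapping.lookup P m *
        (\<Prod>j\<in>Poly_Mapping.keys m. z j powi Poly_Mapping.lookup m j))"

text \<open>
  The iterated integral of \<open>f\<close> over \<open>t 1\<close>, ..., \<open>t n\<close> in the unit
  interval, with \<open>t 1\<close> innermost.  Coordinates other than 1, ..., \<open>n\<close> are
  set to 0; they play no role for a function of \<open>n\<close> variables.
\<close>

primrec cube_integral :: "nat \<Rightarrow> ((nat \<Rightarrow> real) \<Rightarrow> real) \<Rightarrow> real" where
  "cube_integral 0 f = f (\<lambda>_. 0)"
| "cube_integral (Suc n) f =
     integral {0..1} (\<lambda>s. cube_integral n (\<lambda>t. f (t(Suc n := s))))"

definition k_mahler_measure :: "nat \<Rightarrow> nat \<Rightarrow> laurent_poly \<Rightarrow> real" where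
  "k_mahler_measure n k P =
     cube_integral n
       (\<lambda>t. ln (cmod (laurent_eval P (\<lambda>j. exp (2 * of_real pi * \<i> * of_real (t j))))) ^ k)"

subsection \<open>Multiple polylogarithms at roots of unity\<close>

definition rat_span :: "complex set \<Rightarrow> complex set" where
  "rat_span = module.span (\<lambda>(q::rat) z. of_rat q * z)"

lemma vector_space_rat_complex: "vector_space (\<lambda>(q::rat) (z::complex). of_rat q * z)"
  by unfold_locales (simp_all add: algebra_simps of_rat_add of_rat_mult)

text \<open>
  The series may converge only conditionally (when the first index is 1), so it is
  summed as the limit of the partial sums over all indices below a common bound.  The list of
  summation indices is strictly decreasing.
\<close>

definition multi_polylog_partial :: "nat list \<Rightarrow> complex list \<Rightarrow> nat \<Rightarrow> complex" where
  "multi_polylog_partial as zs M =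
     (\<Sum>ls | length ls = length as \<and> sorted_wrt (>) ls \<and> set ls \<subseteq> {0<..<M}.
        \<Prod>j<length as. (zs ! j) ^ (ls ! j) / of_nat (ls ! j) ^ (as ! j))"

definition multi_polylog :: "nat list \<Rightarrow> complex list \<Rightarrow> complex" where
  "multi_polylog as zs = lim (multi_polylog_partial as zs)"

definition polylog_space :: "nat \<Rightarrow> nat \<Rightarrow> complex set" where
  "polylog_space k N =
     (if k = 0 then \<rat>
      else rat_span {multi_polylog as zs | as zs.
             as \<noteq> [] \<and> length zs = length as \<and>
             (\<forall>a\<in>set as. 0 < a) \<and> (\<forall>z\<in>set zs. z ^ N = 1) \<and> sum_list as = k \<and>
             convergent (multi_polylog_partial as zs)})"

subsection \<open>The integrands\<close>

definition rho :: complex where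
  "rho = exp (of_real pi * \<i> / 3)"

definition Q3 :: "complex \<Rightarrow> complex" where
  "Q3 x = (1 - x / rho) * (1 - x * rho)"

definition A3 :: "complex \<Rightarrow> complex \<Rightarrow> complex" where
  "A3 t \<tau> = (1 - t / \<tau>) * (1 - t * \<tau>) / Q3 t"

definition B3 :: "complex \<Rightarrow> complex" where
  "B3 \<tau> = \<tau>\<^sup>2 / ((1 + \<tau>)\<^sup>2 * Q3 \<tau>)"

definition C3 :: "complex \<Rightarrow> complex" where
  "C3 \<tau> = (1 + \<tau>)\<^sup>2 / (3 * \<tau>)"

definition X3 :: "nat \<Rightarrow> complex \<Rightarrow> complex" where
  "X3 n \<tau> =
     contour_integral (linepath (- 1) \<tau>) (\<lambda>t. ln (A3 t \<tau>) ^ n / Q3 t)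
     - of_real pi * ln (C3 \<tau>) ^ n / of_real (sqrt 3)"

definition Y3 :: "nat \<Rightarrow> complex \<Rightarrow> complex" where
  "Y3 n \<tau> = (\<tau> - 1) / (\<tau> + 1) * (ln (B3 \<tau>) ^ n / Q3 \<tau>)"

definition Xi3 :: "nat \<Rightarrow> complex \<Rightarrow> complex" where
  "Xi3 n \<tau> =
     contour_integral (linepath (- 1) 1) (\<lambda>t. (ln (A3 t \<tau>) ^ n - ln (C3 \<tau>) ^ n) / Q3 t)"

end

theory Submission
  imports Defs "HOL-Real_Asymp.Real_Asymp" "HOL-Computational_Algebra.Fundamental_Theorem_Algebra"
begin

text \<open>
  Put \<open>C = C3 \<tau>\<close> and \<open>u = t / Q t\<close>; then \<open>A3 t \<tau> = 1 - 3 u (C - 1)\<close> and \<open>B3 \<tau> = 1 / (9 C (C - 1))\<close>.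
  The generators are iterated integrals of hyperlogarithms whose letters are 0 and sixth roots of
  unity.  Such functions have asymptotic expansions at the end points 0, 1 and \<open>rho\<close> with
  coefficients in the algebra of multiple polylogarithm values, graded by weight, so convergent
  integrals take values there.

  For the Mahler measure put \<open>R = |1 + x1 + x2|^2\<close>.  The image of the measure
  \<open>dC dt / (C (C - 1) Q t)\<close> under \<open>y = A3 / (C (C - 1))\<close> has density proportional to
  \<open>E [1 / (y + R)]\<close>: its fibre integrals are periods of an elliptic curve, and the 2-isogeny given
  by \<open>v = 1 + 1 / (C - 1) - y C\<close> carries them to those of \<open>R\<close>.  Integrating \<open>y powr a\<close> and comparing
  coefficients of powers of \<open>a\<close> expresses \<open>E [ln R ^ k]\<close> by integrals over \<open>C > 1\<close>.  The part
  \<open>C > 4/3\<close> is the integral of \<open>X3 Y3\<close>; the part \<open>C < 4/3\<close> is deformed in the strip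
  \<open>1 < Re C < 4/3\<close> to that of \<open>Xi3 Y3\<close>.
\<close>

section \<open>Truncated multiple polylogarithms\<close>

fun trunc_polylog :: "(nat \<times> complex) list \<Rightarrow> nat \<Rightarrow> complex" where
  "trunc_polylog [] M = 1"
| "trunc_polylog ((a, z) # w) M = (\<Sum>l=1..<M. z^l/of_nat l^a * trunc_polylog w l)"

definition weight :: "(nat \<times> complex) list \<Rightarrow> nat" where
  "weight w = sum_list (map fst w)"

lemma weight_simps [simp]: "weight [] = 0" "weight ((a, z) # w) = a + weight w"
  by (auto simp: weight_def)

lemma trunc_polylog_Suc:
  "trunc_polylog ((a, z) # w) (Suc M) =
    trunc_polylog ((a, z) # w) M + (if M = 0 then 0 else z^M/of_nat M^a * trunc_polylog w M)"
  by (cases M) auto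

lemma multi_polylog_partial_Cons:
  assumes "length zs = length as"
  shows "multi_polylog_partial (a # as) (z # zs) M =
    (\<Sum>l\<in>{0<..<M}. z^l/of_nat l^a * multi_polylog_partial as zs l)"
proof -
  define S where "S M = {ls. length ls = length as \<and> sorted_wrt (>) ls \<and> set ls \<subseteq> {0<..<M::nat}}"
    for M
  define g where "g ls = (\<Prod>j<length as. (zs ! j)^(ls ! j)/of_nat (ls ! j)^(as ! j))" for ls
  have finite_S: "finite (S l)" for l
  proof (rule finite_subset)
    show "S l \<subseteq> {xs. set xs \<subseteq> {0<..<l} \<and> length xs = length as}"
      by (auto simp: S_def)
  qed (rule finite_lists_length_eq, simp)
  have lists_eq: "{ls. length ls = length (a # as) \<and> sorted_wrt (>) ls \<and> set ls \<subseteq> {0<..<M}} =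
    (\<lambda>(l, ls). l # ls) ` (SIGMA l:{0<..<M}. S l)" (is "?L = ?R")
  proof
    show "?L \<subseteq> ?R"
    proof
      fix ls assume ls: "ls \<in> ?L"
      then obtain l ls' where "ls = l # ls'" by (cases ls) auto
      with ls show "ls \<in> ?R" by (auto simp: S_def image_iff)
    qed
    show "?R \<subseteq> ?L" by (auto simp: S_def) (meson greaterThanLessThan_iff order_less_trans subsetD)
  qed
  have inj: "inj_on (\<lambda>(l, ls). l # ls) (SIGMA l:{0<..<M}. S l)"
    by (auto simp: inj_on_def)
  have "multi_polylog_partial (a # as) (z # zs) M =
    (\<Sum>(l, ls)\<in>(SIGMA l:{0<..<M}. S l). z^l/of_nat l^a * g ls)"
    unfolding multi_polylog_partial_def lists_eq
    by (subst sum.reindex[OF inj]) (auto intro!: sum.cong simp: g_def prod.lessThan_Suc_shift simp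
      del: prod.lessThan_Suc)
  also have "... = (\<Sum>l\<in>{0<..<M}. z^l/of_nat l^a * (\<Sum>ls\<in>S l. g ls))"
    by (subst sum.Sigma[symmetric]) (auto simp: finite_S sum_distrib_left)
  finally show ?thesis unfolding multi_polylog_partial_def S_def g_def .
qed

lemma multi_polylog_partial_eq_trunc_polylog:
  "multi_polylog_partial (map fst w) (map snd w) M = trunc_polylog w M"
proof (induction w arbitrary: M)
  case Nil
  have "{ls. length ls = 0 \<and> sorted_wrt (>) ls \<and> set ls \<subseteq> {0<..<M}} = {[]}" by auto
  thus ?case by (simp add: multi_polylog_partial_def)
next
  case (Cons x w)
  obtain a z where [simp]: "x = (a, z)" by (cases x)
  have "{0<..<M} = {1..<M}" by auto
  with Cons show ?case by (simp add: multi_polylog_partial_Cons)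
qed

lemma sum_inverse_sqrt_le: "(\<Sum>l=1..<M. 1/sqrt (real l)) \<le> 3 * sqrt (real M)"
proof (induction M)
  case (Suc M)
  show ?case
  proof (cases "M = 0")
    case False
    let ?d = "sqrt (real (Suc M)) - sqrt (real M)" and ?s = "sqrt (real (Suc M)) + sqrt (real M)"
    have "?d * ?s = 1" by (simp add: algebra_simps)
    moreover have "?s > 0" by (simp add: add_pos_nonneg)
    ultimately have d: "?d = 1/?s" by (simp add: eq_divide_eq)
    have "sqrt (real (Suc M)) \<le> 2 * sqrt (real M)"
      using False by (intro real_le_lsqrt) (auto simp: power_mult_distrib)
    hence "1/sqrt (real M) \<le> 3 * ?d" unfolding d using False by (auto simp: field_simps add_pos_pos)
    thus ?thesis using Suc False by (simp add: algebra_simps)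
  qed simp
qed simp

lemma summable_inverse_mult_sqrt: "summable (\<lambda>n. K/(real n * sqrt (real n)))"
proof -
  have "summable (\<lambda>n. K * real n powr (-3/2))"
    by (intro summable_mult) (auto simp: summable_real_powr_iff)
  moreover have "real n powr (-3/2) = 1/(real n * sqrt (real n))" for n
  proof (cases "n = 0")
    case False
    have "real n powr (-3/2) = 1/(real n powr (1 + 1/2))" by (simp add: powr_minus divide_simps)
    also have "real n powr (1 + 1/2) = real n * sqrt (real n)"
      using False by (subst powr_add) (simp add: powr_half_sqrt)
    finally show ?thesis .
  qed simp
  ultimately show ?thesis by (simp only: times_divide_eq_right mult_1_right)
qed

lemma summable_power_mult_bounded_variation:
  fixes z :: complex and b :: "nat \<Rightarrow> complex"
  assumes "norm z = 1" "z \<noteq> 1" "b \<longlonglongrightarrow> 0" "summable (\<lambda>n. norm (b (Suc n) - b n))"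
  shows "summable (\<lambda>n. z^n * b n)"
proof -
  let ?T = "\<lambda>N. b 0 - z^N * b N + (\<Sum>n<N. z^Suc n * (b (Suc n) - b n))"
  have "summable (\<lambda>n. norm (z^Suc n * (b (Suc n) - b n)))"
    using assms by (simp add: norm_mult norm_power)
  hence sum: "convergent (\<lambda>N. \<Sum>n<N. z^Suc n * (b (Suc n) - b n))"
    by (simp only: summable_norm_cancel flip: summable_iff_convergent)
  have boundary: "convergent (\<lambda>N. z^N * b N)" using assms
    by (intro convergentI[of _ 0]) (subst tendsto_norm_zero_iff[symmetric], auto simp: norm_mult
      norm_power tendsto_norm_zero)
  have limit: "convergent (\<lambda>N. ?T N * inverse (1 - z))"
    by (intro convergent_mult[OF convergent_add[OF convergent_diff[OF convergent_const boundary]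
      sum]] convergent_const)
  have telescope: "(1 - z) * (\<Sum>n<N. z^n * b n) = ?T N" for N
  proof (induction N)
    case (Suc N)
    show ?case unfolding sum.lessThan_Suc distrib_left Suc by (simp add: algebra_simps)
  qed simp
  have "?T N * inverse (1 - z) = (\<Sum>n<N. z^n * b n)" for N
    unfolding telescope[symmetric] using assms(2) by simp
  with limit show ?thesis by (simp add: summable_iff_convergent)
qed

fun stuffle :: "(nat \<times> complex) list \<Rightarrow> (nat \<times> complex) list \<Rightarrow> (nat \<times> complex) list list" where
  "stuffle [] v = [v]"
| "stuffle u [] = [u]"
| "stuffle ((a, z) # u) ((b, t) # v) =
  map (Cons (a, z)) (stuffle u ((b, t) # v)) @ map (Cons (b, t)) (stuffle ((a, z) # u) v) @ map
  (Cons (a + b, z * t)) (stuffle u v)"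

lemma weight_stuffle: "w \<in> set (stuffle u v) \<Longrightarrow> weight w = weight u + weight v"
  by (induction u v arbitrary: w rule: stuffle.induct) auto

lemma sum_list_trunc_polylog_Cons_Suc:
  assumes "M > 0"
  shows "(\<Sum>w\<leftarrow>map (Cons (c, r)) W. trunc_polylog w (Suc M)) =
    (\<Sum>w\<leftarrow>map (Cons (c, r)) W. trunc_polylog w M) + r^M/of_nat M^c * (\<Sum>w\<leftarrow>W. trunc_polylog w M)"
  using assms
  by (induction W) (simp_all add: trunc_polylog_Suc algebra_simps del: trunc_polylog.simps)

lemma trunc_polylog_mult:
  "trunc_polylog u M * trunc_polylog v M = (\<Sum>w\<leftarrow>stuffle u v. trunc_polylog w M)"
proof (induction u v arbitrary: M rule: stuffle.induct)
  case (3 a z u b t v)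
  note IH = 3[symmetric]
  show ?case
  proof (induction M)
    case 0
    show ?case by (simp add: o_def)
  next
    case (Suc M)
    show ?case
    proof (cases "M = 0")
      case True
      thus ?thesis by (simp add: o_def)
    next
      case False
      have "(\<Sum>w\<leftarrow>stuffle ((a, z) # u) ((b, t) # v). trunc_polylog w (Suc M)) =
        trunc_polylog ((a, z) # u) M * trunc_polylog ((b, t) # v) M + z^M/of_nat M^a *
        (trunc_polylog u M * trunc_polylog ((b, t) # v) M) + t^M/of_nat M^b *
        (trunc_polylog ((a, z) # u) M * trunc_polylog v M) + (z * t)^M/of_nat M^(a + b) *
        (trunc_polylog u M * trunc_polylog v M)"
        using False unfolding Suc IH[symmetric]
        by (simp add: sum_list_trunc_polylog_Cons_Suc IH del: trunc_polylog.simps map_map)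
      also have "... = trunc_polylog ((a, z) # u) (Suc M) * trunc_polylog ((b, t) # v) (Suc M)"
        using False unfolding trunc_polylog_Suc
        by (simp add: algebra_simps power_add power_mult_distrib del: trunc_polylog.simps)
      finally show ?thesis ..
    qed
  qed
qed auto

locale roots_of_unity =
  fixes N :: nat
  assumes N_pos: "N > 0"
begin

lemma norm_root_unity: "z^N = 1 \<Longrightarrow> norm (z :: complex) = 1"
  using N_pos by (metis norm_ge_zero norm_one norm_power power_eq_1_iff less_irrefl)

definition index_word :: "(nat \<times> complex) list \<Rightarrow> bool" where
  "index_word w \<longleftrightarrow> (\<forall>(a, z)\<in>set w. 0 < a \<and> z^N = 1)"

definition admissible :: "(nat \<times> complex) list \<Rightarrow> bool" where
  "admissible w \<longleftrightarrow> index_word w \<and> (w = [] \<or> hd w \<noteq> (1, 1))"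

lemma index_word_simps [simp]:
  "index_word []" "index_word ((a, z) # w) \<longleftrightarrow> 0 < a \<and> z^N = 1 \<and> index_word w"
  by (auto simp: index_word_def)

lemma admissible_Nil [simp]: "admissible []"
  by (simp add: admissible_def)

lemma admissible_Cons: "admissible ((a, z) # w) \<longleftrightarrow> index_word ((a, z) # w) \<and> (a, z) \<noteq> (1, 1)"
  by (simp add: admissible_def)

lemma norm_polylog_term: "z^N = 1 \<Longrightarrow> norm (z^n/of_nat n^a * x) = norm x/real n^a" for z x :: complex
  by (simp add: norm_root_unity norm_mult norm_divide norm_power)

lemma trunc_polylog_bound:
  assumes "index_word w"
  obtains K where "K > 0" "\<And>n. n \<ge> 1 \<Longrightarrow> norm (trunc_polylog w n) \<le> K * sqrt (real n)"
  using assms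
proof (induction w arbitrary: thesis)
  case Nil
  show ?case by (rule Nil(1)[of 1]) auto
next
  case (Cons x w)
  obtain a z where [simp]: "x = (a, z)" by (cases x)
  have a: "a > 0" and z: "z^N = 1" using Cons.prems by auto
  obtain K where K: "K > 0" "\<And>n. n \<ge> 1 \<Longrightarrow> norm (trunc_polylog w n) \<le> K * sqrt (real n)"
    using Cons by auto
  have "norm (trunc_polylog (x # w) n) \<le> 3 * K * sqrt (real n)" for n
  proof -
    have "norm (trunc_polylog (x # w) n) \<le> (\<Sum>l=1..<n. K * (1/sqrt (real l)))"
      unfolding \<open>x = _\<close> trunc_polylog.simps
    proof (rule sum_norm_le)
      fix l assume l: "l \<in> {1..<n}"
      have "norm (trunc_polylog w l)/real l^a \<le> (K * sqrt (real l))/real l^1"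
        using K(2)[of l] l a \<open>K > 0\<close> by (intro frac_le power_increasing) auto
      also have "... = K * (1/sqrt (real l))" using l by (simp add: real_div_sqrt field_simps)
      finally show "norm (z^l/of_nat l^a * trunc_polylog w l) \<le> K * (1/sqrt (real l))"
        unfolding norm_polylog_term[OF z] .
    qed
    also have "... \<le> K * (3 * sqrt (real n))"
      unfolding sum_distrib_left[symmetric] using sum_inverse_sqrt_le K(1)
      by (intro mult_left_mono) auto
    finally show ?thesis by simp
  qed
  thus ?case using K(1) by (intro Cons.prems(1)[of "3 * K"]) auto
qed

lemma trunc_polylog_increment_bound:
  assumes "index_word w"
  obtains K where "K > 0" "\<And>n. n \<ge> 1 \<Longrightarrow> norm (trunc_polylog w (Suc n) - trunc_polylog w n) \<le>
    K/sqrt (real n)"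
proof (cases w)
  case Nil
  show ?thesis using Nil by (intro that[of 1]) auto
next
  case (Cons x w')
  obtain a z where [simp]: "x = (a, z)" by (cases x)
  have w': "index_word w'" "a > 0" "z^N = 1" using assms Cons by auto
  obtain K where K: "K > 0" "\<And>n. n \<ge> 1 \<Longrightarrow> norm (trunc_polylog w' n) \<le> K * sqrt (real n)"
    using trunc_polylog_bound[OF w'(1)] by blast
  have "norm (trunc_polylog w (Suc n) - trunc_polylog w n) \<le> K/sqrt (real n)" if n: "n \<ge> 1" for n
  proof -
    have "norm (trunc_polylog w (Suc n) - trunc_polylog w n) = norm (trunc_polylog w' n)/real n^a"
      using n norm_polylog_term[OF w'(3)] unfolding Cons \<open>x = _\<close> trunc_polylog_Suc by simp
    also have "... \<le> (K * sqrt (real n))/real n^1"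
      using K(2)[OF n] n w'(2) K(1) by (intro frac_le power_increasing) auto
    also have "... = K/sqrt (real n)" using n by (simp add: field_simps real_div_sqrt)
    finally show ?thesis .
  qed
  thus ?thesis using K(1) that by blast
qed

lemma summable_polylog_weight_one:
  assumes "index_word w" "z^N = 1" "z \<noteq> 1"
  shows "summable (\<lambda>l. z^l * (trunc_polylog w l/of_nat l))"
proof -
  define b where "b l = trunc_polylog w l/of_nat l" for l
  obtain K where K: "K > 0" "\<And>n. n \<ge> 1 \<Longrightarrow> norm (trunc_polylog w n) \<le> K * sqrt (real n)"
    using trunc_polylog_bound[OF assms(1)] by blast
  obtain K' where K': "K' > 0" "\<And>n. n \<ge> 1 \<Longrightarrow> norm (trunc_polylog w (Suc n) - trunc_polylog w n) \<le>
    K'/sqrt (real n)"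
    using trunc_polylog_increment_bound[OF assms(1)] by blast
  have b_le: "norm (b n) \<le> K/sqrt (real n)" if "n \<ge> 1" for n
  proof -
    have "norm (b n) \<le> (K * sqrt (real n))/real n"
      using K(2)[OF that] by (simp add: b_def norm_divide divide_right_mono)
    also have "... = K/sqrt (real n)" using that by (simp add: field_simps real_div_sqrt)
    finally show ?thesis .
  qed
  have "b \<longlonglongrightarrow> 0"
  proof (rule Lim_null_comparison)
    show "\<forall>\<^sub>F n in sequentially. norm (b n) \<le> K/sqrt (real n)"
      using eventually_ge_at_top[of 1] by eventually_elim (use b_le in auto)
    show "(\<lambda>n. K/sqrt (real n)) \<longlonglongrightarrow> 0" by real_asymp
  qed
  moreover have "summable (\<lambda>n. norm (b (Suc n) - b n))"
  proof (rule summable_comparison_test[OF _ summable_inverse_mult_sqrt[of "K' + K"]], intro exI allI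
    impI)
    fix n :: nat assume n: "n \<ge> 1"
    let ?d = "trunc_polylog w (Suc n) - trunc_polylog w n"
    have "b (Suc n) - b n = ?d/of_nat (Suc n) - b n/of_nat (Suc n)"
      using n by (simp add: b_def field_simps del: of_nat_Suc) (simp add: algebra_simps)
    hence "norm (b (Suc n) - b n) \<le> norm ?d/real (Suc n) + norm (b n)/real (Suc n)"
      by (metis norm_divide norm_of_nat norm_triangle_ineq4)
    also have "... \<le> (K'/sqrt (real n))/real n + (K/sqrt (real n))/real n"
      using n K' K b_le by (intro add_mono frac_le) auto
    also have "... = (K' + K)/(real n * sqrt (real n))" using n by (simp add: field_simps)
    finally show "norm (norm (b (Suc n) - b n)) \<le> (K' + K)/(real n * sqrt (real n))" by simp
  qed
  ultimately have "summable (\<lambda>n. z^n * b n)"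
    by (rule summable_power_mult_bounded_variation[OF norm_root_unity[OF assms(2)] assms(3)])
  thus ?thesis by (simp add: b_def)
qed

lemma summable_polylog_weight_ge2:
  assumes "index_word w" "z^N = 1" "a \<ge> 2"
  shows "summable (\<lambda>l. z^l * (trunc_polylog w l/of_nat l^a))"
proof -
  obtain K where K: "K > 0" "\<And>n. n \<ge> 1 \<Longrightarrow> norm (trunc_polylog w n) \<le> K * sqrt (real n)"
    using trunc_polylog_bound[OF assms(1)] by blast
  show ?thesis
  proof (rule summable_comparison_test[OF _ summable_inverse_mult_sqrt[of K]], intro exI allI impI)
    fix n :: nat assume n: "n \<ge> 1"
    have "norm (trunc_polylog w n)/real n^a \<le> (K * sqrt (real n))/real n^2"
      using K(2)[OF n] n assms(3) K(1) by (intro frac_le power_increasing) auto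
    also have "... = K/(real n * sqrt (real n))" using n by (simp add: field_simps power2_eq_square)
    finally show "norm (z^n * (trunc_polylog w n/of_nat n^a)) \<le> K/(real n * sqrt (real n))"
      using norm_polylog_term[OF assms(2)] by simp
  qed
qed

lemma trunc_polylog_convergent:
  assumes "admissible w"
  shows "convergent (trunc_polylog w)"
proof (cases w)
  case Nil
  hence "trunc_polylog w = (\<lambda>_. 1)" by auto
  thus ?thesis by (simp add: convergent_const)
next
  case (Cons x w')
  obtain a z where [simp]: "x = (a, z)" by (cases x)
  have w': "index_word w'" "a > 0" "z^N = 1" "(a, z) \<noteq> (1, 1)"
    using assms Cons by (auto simp: admissible_def)
  have "summable (\<lambda>l. z^l * (trunc_polylog w' l/of_nat l^a))"
  proof (cases "a = 1")
    case True
    thus ?thesis using summable_polylog_weight_one[OF w'(1,3)] w'(4) by simp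
  next
    case False
    thus ?thesis using w' by (intro summable_polylog_weight_ge2) auto
  qed
  hence "convergent (\<lambda>M. \<Sum>l<M. z^l * (trunc_polylog w' l/of_nat l^a))"
    by (simp add: summable_iff_convergent)
  also have "(\<lambda>M. \<Sum>l<M. z^l * (trunc_polylog w' l/of_nat l^a)) = trunc_polylog w"
  proof
    fix M
    show "(\<Sum>l<M. z^l * (trunc_polylog w' l/of_nat l^a)) = trunc_polylog w M"
      using w'(2) by (cases M) (simp_all add: Cons lessThan_atLeast0 sum.atLeast_Suc_lessThan)
  qed
  finally show ?thesis .
qed

lemma index_word_stuffle: "w \<in> set (stuffle u v) \<Longrightarrow> index_word u \<Longrightarrow> index_word v \<Longrightarrow> index_word w"
  by (induction u v arbitrary: w rule: stuffle.induct) (auto simp: power_mult_distrib)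

lemma admissible_stuffle:
  assumes "w \<in> set (stuffle u v)" "admissible u" "admissible v"
  shows "admissible w"
  using assms index_word_stuffle[OF assms(1)]
  by (induction u v arbitrary: w rule: stuffle.induct) (auto simp: admissible_def)

inductive polylog_value :: "nat \<Rightarrow> complex \<Rightarrow> bool" where
  word: "admissible w \<Longrightarrow> trunc_polylog w \<longlonglongrightarrow> x \<Longrightarrow> polylog_value (weight w) x"
| zero: "polylog_value k 0"
| add: "polylog_value k x \<Longrightarrow> polylog_value k y \<Longrightarrow> polylog_value k (x + y)"
| scale: "polylog_value k x \<Longrightarrow> polylog_value k (of_rat q * x)"

lemma polylog_value_of_rat: "polylog_value 0 (of_rat q)"
proof -
  have "trunc_polylog [] = (\<lambda>_. 1)" by auto
  hence "trunc_polylog [] \<longlonglongrightarrow> 1" by simp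
  from scale[OF word[OF _ this], of q] show ?thesis by simp
qed

lemma polylog_value_1: "polylog_value 0 1"
  using polylog_value_of_rat[of 1] by simp

lemma polylog_value_uminus: "polylog_value k x \<Longrightarrow> polylog_value k (-x)"
  using scale[of k x "-1"] by simp

lemma polylog_value_diff: "polylog_value k x \<Longrightarrow> polylog_value k y \<Longrightarrow> polylog_value k (x - y)"
  using add[of k x "-y"] polylog_value_uminus by simp

lemma polylog_value_of_nat_mult: "polylog_value k x \<Longrightarrow> polylog_value k (of_nat n * x)"
  using scale[of k x "of_nat n"] by simp

lemma polylog_value_sum_list:
  assumes "\<And>w. w \<in> set ws \<Longrightarrow> admissible w \<and> weight w = k"
  shows "\<exists>s. polylog_value k s \<and> (\<lambda>M. \<Sum>w\<leftarrow>ws. trunc_polylog w M) \<longlonglongrightarrow> s"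
  using assms
proof (induction ws)
  case Nil
  show ?case by (auto intro: zero)
next
  case (Cons w ws)
  then obtain s where s: "polylog_value k s" "(\<lambda>M. \<Sum>w\<leftarrow>ws. trunc_polylog w M) \<longlonglongrightarrow> s" by auto
  obtain t where t: "trunc_polylog w \<longlonglongrightarrow> t"
    using trunc_polylog_convergent Cons.prems[of w] by (auto simp: convergent_def)
  have "polylog_value k t" using word[OF _ t] Cons.prems[of w] by auto
  thus ?case using s t by (intro exI[of _ "t + s"]) (auto intro: add tendsto_add)
qed

lemma polylog_value_mult_word:
  assumes u: "admissible u" "trunc_polylog u \<longlonglongrightarrow> x" and v: "admissible v" "trunc_polylog v \<longlonglongrightarrow> y"
  shows "polylog_value (weight u + weight v) (x * y)"
proof -
  obtain s where s: "polylog_value (weight u + weight v) s"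
    "(\<lambda>M. \<Sum>w\<leftarrow>stuffle u v. trunc_polylog w M) \<longlonglongrightarrow> s"
    using polylog_value_sum_list[of "stuffle u v"] admissible_stuffle u(1) v(1) weight_stuffle
    by blast
  have "(\<lambda>M. \<Sum>w\<leftarrow>stuffle u v. trunc_polylog w M) \<longlonglongrightarrow> x * y"
    using tendsto_mult[OF u(2) v(2)] by (simp add: trunc_polylog_mult)
  with s show ?thesis using LIMSEQ_unique by blast
qed

lemma polylog_value_mult: "polylog_value j x \<Longrightarrow> polylog_value k y \<Longrightarrow> polylog_value (j + k) (x * y)"
proof (induction rule: polylog_value.induct)
  case (word u x)
  from word(3) word(1,2) show ?case
  proof (induction rule: polylog_value.induct)
    case (word v y)
    thus ?case using polylog_value_mult_word by blast
  next
    case (scale k y q)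
    thus ?case using polylog_value.scale[of "weight u + k" "x * y" q] by (simp add: algebra_simps)
  qed (auto simp: algebra_simps intro: polylog_value.zero polylog_value.add)
next
  case (scale j x q)
  thus ?case using polylog_value.scale[of "j + k" "x * y" q] by (simp add: algebra_simps)
qed (auto simp: algebra_simps intro: polylog_value.zero polylog_value.add)

lemma polylog_value_power: "polylog_value k x \<Longrightarrow> polylog_value (n * k) (x^n)"
  by (induction n) (auto intro: polylog_value_1 polylog_value_mult)

lemma polylog_value_imp_polylog_space:
  assumes "polylog_value k x" "k > 0"
  shows "x \<in> polylog_space k N"
proof -
  interpret vector_space "\<lambda>(q::rat) (z::complex). of_rat q * z" by (rule vector_space_rat_complex)
  show ?thesis using assms
  proof (induction rule: polylog_value.induct)
    case (word w x)
    have "w \<noteq> []" using word(3) by auto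
    moreover have "multi_polylog_partial (map fst w) (map snd w) = trunc_polylog w"
      by (rule ext) (rule multi_polylog_partial_eq_trunc_polylog)
    ultimately have "x = multi_polylog (map fst w) (map snd w) \<and> map fst w \<noteq> [] \<and>
      length (map snd w) = length (map fst w) \<and> (\<forall>a\<in>set (map fst w). 0 < a) \<and>
      (\<forall>z\<in>set (map snd w). z^N = 1) \<and> sum_list (map fst w) = weight w \<and> convergent
      (multi_polylog_partial (map fst w) (map snd w))"
      using word limI[OF word(2)] convergentI[OF word(2)]
      by (auto simp: multi_polylog_def weight_def index_word_def admissible_def)
    hence "x \<in> span {multi_polylog as zs | as zs. as \<noteq> [] \<and> length zs = length as \<and>
      (\<forall>a\<in>set as. 0 < a) \<and> (\<forall>z\<in>set zs. z^N = 1) \<and> sum_list as = weight w \<and> convergent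
      (multi_polylog_partial as zs)}"
      by (intro span_base) blast
    thus ?case using word(3) by (simp add: polylog_space_def rat_span_def)
  qed (auto simp: polylog_space_def rat_span_def intro: span_zero span_add span_scale)
qed

end

section \<open>Expansions in powers of the logarithm\<close>

lemma power_series_minus_sum:
  fixes a :: "nat \<Rightarrow> complex"
  assumes a: "a sums S" and z: "norm z < 1"
  defines "r n \<equiv> (\<Sum>i<Suc n. a i) - S"
  shows "summable (\<lambda>n. norm (r n * z^n))"
    and "suminf (\<lambda>n. a n * z^n) - S = (1 - z) * suminf (\<lambda>n. r n * z^n)"
proof -
  define s where "s n = (\<Sum>i<n. a i)" for n
  have s: "s \<longlonglongrightarrow> S" using a by (simp add: sums_def s_def[abs_def])
  have r: "r n = s (Suc n) - S" for n by (simp add: r_def s_def)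
  have "r \<longlonglongrightarrow> 0" unfolding r[abs_def] using LIMSEQ_Suc[OF s] by (simp add: LIM_zero)
  hence "Bseq r" by (rule convergent_imp_Bseq[OF convergentI])
  then obtain B where B: "\<And>n. norm (r n) \<le> B" by (auto simp: Bseq_def)
  show summable: "summable (\<lambda>n. norm (r n * z^n))"
  proof (rule summable_comparison_test)
    show "\<exists>N. \<forall>n\<ge>N. norm (norm (r n * z^n)) \<le> B * norm z^n"
      using B by (auto simp: norm_mult norm_power intro!: mult_right_mono)
    show "summable (\<lambda>n. B * norm z^n)" using z by (intro summable_mult summable_geometric) auto
  qed
  have partial: "(\<Sum>n<N. a n * z^n) = (1 - z) * (\<Sum>n<N. r n * z^n) + (s N - S) * z^N + S" for N
  proof (induction N)
    case (Suc N)
    have "s (Suc N) = s N + a N" by (simp add: s_def)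
    thus ?case unfolding sum.lessThan_Suc distrib_left Suc r by (simp add: algebra_simps)
  qed (simp add: s_def)
  have "(\<lambda>N. (1 - z) * (\<Sum>n<N. r n * z^n) + (s N - S) * z^N + S) \<longlonglongrightarrow> (1 - z) * suminf (\<lambda>n. r n * z^n)
    + (S - S) * 0 + S"
    by (intro tendsto_intros summable_LIMSEQ[OF summable_norm_cancel[OF summable]] s
      LIMSEQ_power_zero[OF z])
  hence "(\<lambda>n. a n * z^n) sums ((1 - z) * suminf (\<lambda>n. r n * z^n) + S)"
    unfolding sums_def partial by simp
  thus "suminf (\<lambda>n. a n * z^n) - S = (1 - z) * suminf (\<lambda>n. r n * z^n)"
    by (simp add: sums_iff)
qed

lemma norm_power_series_le:
  fixes r :: "nat \<Rightarrow> complex"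
  assumes "summable (\<lambda>n. norm (r n * z^n))" "norm z < 1" "0 \<le> c" "\<And>n. n \<ge> N \<Longrightarrow> norm (r n) \<le> c"
  shows "norm (suminf (\<lambda>n. r n * z^n)) \<le> (\<Sum>n<N. norm (r n)) + c/(1 - norm z)"
proof -
  let ?b = "\<lambda>n. if n < N then norm (r n) else 0"
  have "norm (suminf (\<lambda>n. r n * z^n)) \<le> suminf (\<lambda>n. norm (r n * z^n))"
    by (rule summable_norm[OF assms(1)])
  also have "... \<le> suminf (\<lambda>n. ?b n + c * norm z^n)"
  proof (rule suminf_le[OF _ assms(1)])
    fix n
    have "norm z^n \<le> 1" using assms(2) by (simp add: power_le_one)
    moreover have "norm (r n) * norm z^n \<le> c * norm z^n" if "n \<ge> N"
      using assms(4)[OF that] by (intro mult_right_mono) auto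
    ultimately show "norm (r n * z^n) \<le> ?b n + c * norm z^n"
      using assms(3)
      by (auto simp: norm_mult norm_power not_less intro!: add_increasing2 mult_right_le_one_le)
    show "summable (\<lambda>n. ?b n + c * norm z^n)" using assms(2)
      by (intro summable_add summable_mult summable_geometric summable_finite[of "{..<N}"]) auto
  qed
  also have "... = (\<Sum>n<N. norm (r n)) + c * (1/(1 - norm z))"
    using assms(2) sums_If_finite_set[of "{..<N}" "\<lambda>n. norm (r n)"]
    by (intro sums_unique[symmetric] sums_add sums_mult geometric_sums) simp_all
  finally show ?thesis by simp
qed

text \<open>Abel's limit theorem in a Stolz region: the chord from \<open>1\<close> to \<open>rho\<close> does not meet the
 unit circle radially.\<close>

lemma Abel_Stolz_limit:
  fixes a :: "nat \<Rightarrow> complex"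
  assumes a: "a sums S"
    and K: "K > 0"
    and stolz: "\<forall>\<^sub>F x in F. norm (w x) < 1 \<and> norm (1 - w x) \<le> K * (1 - norm (w x))"
    and w: "(w \<longlongrightarrow> 1) F"
  shows "((\<lambda>x. suminf (\<lambda>n. a n * w x^n)) \<longlongrightarrow> S) F"
proof (rule tendstoI)
  fix e :: real assume e: "e > 0"
  define r where "r n = (\<Sum>i<Suc n. a i) - S" for n
  have "r \<longlonglongrightarrow> 0"
    using LIMSEQ_Suc[of "\<lambda>n. \<Sum>i<n. a i" S] a by (simp add: sums_def r_def[abs_def] LIM_zero)
  then obtain N where N: "\<And>n. n \<ge> N \<Longrightarrow> norm (r n) < e/(2 * K)"
    using LIMSEQ_D[of r 0 "e/(2 * K)"] e K by auto
  define M where "M = (\<Sum>n<N. norm (r n)) + 1"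
  have M: "M > 0" unfolding M_def by (intro add_nonneg_pos sum_nonneg) auto
  have "\<forall>\<^sub>F x in F. dist (w x) 1 < e/(2 * M)" using w e M by (intro tendstoD) auto
  with stolz show "\<forall>\<^sub>F x in F. dist (suminf (\<lambda>n. a n * w x^n)) S < e"
  proof eventually_elim
    case (elim x)
    let ?z = "w x"
    have z: "norm ?z < 1" "norm (1 - ?z) \<le> K * (1 - norm ?z)" "norm (1 - ?z) < e/(2 * M)"
      using elim by (auto simp: dist_norm norm_minus_commute)
    note series = power_series_minus_sum[OF a z(1), folded r_def]
    have "norm (suminf (\<lambda>n. r n * ?z^n)) \<le> (\<Sum>n<N. norm (r n)) + e/(2 * K)/(1 - norm ?z)"
      using N e K by (intro norm_power_series_le series(1) z(1)) (auto simp: less_imp_le)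
    hence "norm (1 - ?z) * norm (suminf (\<lambda>n. r n * ?z^n)) \<le>
      norm (1 - ?z) * (M + e/(2 * K)/(1 - norm ?z))"
      by (intro mult_left_mono) (auto simp: M_def)
    also have "... = norm (1 - ?z) * M + norm (1 - ?z)/(1 - norm ?z) * (e/(2 * K))"
      by (simp add: distrib_left)
    also have "... < e/(2 * M) * M + K * (e/(2 * K))"
    proof (intro add_less_le_mono mult_strict_right_mono mult_right_mono)
      show "norm (1 - ?z)/(1 - norm ?z) \<le> K" using z by (simp add: pos_divide_le_eq)
    qed (use z M e K in auto)
    also have "... = e" using M K by (simp add: field_simps)
    finally show ?case by (simp add: dist_norm series(2) norm_mult)
  qed
qed

lemma chord_in_Stolz_region:
  assumes "norm e = 1" "Re e \<ge> 1/2" "0 < s" "s \<le> 1/2"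
  shows "norm (1 - of_real s * e) < 1" "norm (1 - (1 - of_real s * e)) \<le>
    4 * (1 - norm (1 - of_real s * e))"
proof -
  let ?n = "norm (1 - of_real s * e)"
  have "(Re e)\<^sup>2 + (Im e)\<^sup>2 = 1" using assms(1) by (simp add: cmod_def)
  hence "?n\<^sup>2 = 1 - 2 * s * Re e + s\<^sup>2"
    unfolding cmod_power2
    by (simp add: power2_eq_square algebra_simps) (metis distrib_left mult.right_neutral)
  also have "... \<le> 1 - s/2"
  proof -
    have "s * s \<le> s * (1/2)" using assms by (intro mult_left_mono) auto
    moreover have "s * 1 \<le> s * (2 * Re e)" using assms by (intro mult_left_mono) auto
    ultimately show ?thesis by (simp add: power2_eq_square)
  qed
  finally have n2: "?n\<^sup>2 \<le> 1 - s/2" .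
  hence "?n\<^sup>2 < 1\<^sup>2" using assms by simp
  thus lt: "?n < 1" using power2_less_imp_less zero_le_one by blast
  have "1 - ?n\<^sup>2 = (1 - ?n) * (1 + ?n)" by (simp add: power2_eq_square algebra_simps)
  also have "... \<le> (1 - ?n) * 2" using lt by (intro mult_left_mono) auto
  finally show "norm (1 - (1 - of_real s * e)) \<le> 4 * (1 - ?n)"
    using n2 assms by (simp add: norm_mult)
qed

lemma eventually_at_right_0: "0 < d \<Longrightarrow> \<forall>\<^sub>F s in at_right 0. 0 < s \<and> s < (d :: real)"
  using eventually_at_right_real[of 0 d] by (auto elim: eventually_mono)

lemma eventually_at_right_0_1:
  "\<forall>\<^sub>F s in at_right 0. 0 < s \<and> s < (1 :: real)"
    and eventually_at_right_0_half: "\<forall>\<^sub>F s in at_right 0. 0 < s \<and> s < (1/2 :: real)"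
  by (rule eventually_at_right_0, simp)+

definition chord_from :: "complex \<Rightarrow> complex \<Rightarrow> real \<Rightarrow> complex" where
  "chord_from p e s = p * (1 - of_real s * e)"

lemma tendsto_chord_from: "(chord_from p e \<longlongrightarrow> p) (at_right 0)"
proof -
  have "((\<lambda>s. p * (1 - of_real s * e)) \<longlongrightarrow> p * (1 - of_real 0 * e)) (at_right 0)"
    by (intro tendsto_intros)
  thus ?thesis by (simp add: chord_from_def[abs_def])
qed

abbreviation powr_bound :: "real \<Rightarrow> (real \<Rightarrow> 'a::real_normed_vector) \<Rightarrow> bool" where
  "powr_bound a f \<equiv> (\<lambda>s. norm (f s)) \<in> O[at_right 0](\<lambda>s. s powr a)"

definition power_decay :: "(real \<Rightarrow> complex) \<Rightarrow> bool" where
  "power_decay f \<longleftrightarrow> (\<exists>\<delta>>0. powr_bound \<delta> f)"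

definition slow_growth :: "(real \<Rightarrow> complex) \<Rightarrow> bool" where
  "slow_growth f \<longleftrightarrow> (\<forall>\<delta>>0. powr_bound (-\<delta>) f)"

definition shifted_ln :: "complex \<Rightarrow> real \<Rightarrow> complex" where
  "shifted_ln \<kappa> s = of_real (ln s) + \<kappa>"

lemma powr_bigo_powr: "a \<le> b \<Longrightarrow> (\<lambda>s. s powr b) \<in> O[at_right 0](\<lambda>s::real. s powr a)"
proof (rule bigoI[of _ 1])
  assume "a \<le> b"
  show "\<forall>\<^sub>F s in at_right 0. norm (s powr b) \<le> 1 * norm (s powr a)"
    using eventually_at_right_0_1
    by (rule eventually_mono) (use \<open>a \<le> b\<close> in \<open>auto intro: powr_mono'\<close>)
qed

lemma norm_add_bigo:
  assumes "(\<lambda>s. norm (f s)) \<in> O[F](h)" "(\<lambda>s. norm (g s)) \<in> O[F](h)"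
  shows "(\<lambda>s. norm (f s + g s :: complex)) \<in> O[F](h :: real \<Rightarrow> real)"
proof -
  have "(\<lambda>s. norm (f s + g s)) \<in> O[F](\<lambda>s. norm (f s) + norm (g s))"
    by (rule bigoI[of _ 1]) (auto intro!: always_eventually norm_triangle_ineq)
  also have "(\<lambda>s. norm (f s) + norm (g s)) \<in> O[F](h)" using assms by (rule sum_in_bigo)
  finally show ?thesis .
qed

lemma power_decay_0: "power_decay (\<lambda>_. 0)"
  by (auto simp: power_decay_def intro!: exI[of _ 1])

lemma power_decay_add:
  assumes "power_decay f" "power_decay g"
  shows "power_decay (\<lambda>s. f s + g s)"
proof -
  obtain a b where ab: "a > 0" "b > 0" "powr_bound a f" "powr_bound b g"
    using assms unfolding power_decay_def by blast
  have "powr_bound (min a b) f" "powr_bound (min a b) g"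
    using ab(3,4) powr_bigo_powr[of "min a b" a] powr_bigo_powr[of "min a b" b]
    by (auto intro: landau_o.big_trans)
  thus ?thesis
    unfolding power_decay_def using ab by (intro exI[of _ "min a b"]) (auto intro: norm_add_bigo)
qed

lemma power_decay_mult_slow_growth:
  assumes "power_decay f" "slow_growth g"
  shows "power_decay (\<lambda>s. f s * g s)"
proof -
  obtain a where a: "a > 0" "powr_bound a f" using assms unfolding power_decay_def by blast
  have "powr_bound (-(a/2)) g" using assms(2) a unfolding slow_growth_def by (meson half_gt_zero)
  from landau_o.big.mult[OF a(2) this]
  have "powr_bound (a/2) (\<lambda>s. f s * g s)"
    by (simp add: norm_mult flip: powr_add)
  thus ?thesis unfolding power_decay_def using a by (intro exI[of _ "a/2"]) auto
qed

lemma slow_growth_add: "slow_growth f \<Longrightarrow> slow_growth g \<Longrightarrow> slow_growth (\<lambda>s. f s + g s)"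
  unfolding slow_growth_def by (auto intro: norm_add_bigo)

lemma slow_growth_mult:
  assumes "slow_growth f" "slow_growth g"
  shows "slow_growth (\<lambda>s. f s * g s)"
  unfolding slow_growth_def
proof safe
  fix d :: real assume "d > 0"
  hence "powr_bound (-(d/2)) f" "powr_bound (-(d/2)) g"
    using assms unfolding slow_growth_def by (meson half_gt_zero)+
  from landau_o.big.mult[OF this] show "powr_bound (-d) (\<lambda>s. f s * g s)"
    by (simp add: norm_mult flip: powr_add)
qed

lemma slow_growth_bounded:
  assumes "\<forall>\<^sub>F s in at_right 0. norm (f s) \<le> B"
  shows "slow_growth f"
  unfolding slow_growth_def
proof safe
  fix d :: real assume d: "d > 0"
  have "(\<lambda>s. norm (f s)) \<in> O[at_right 0](\<lambda>_. 1)"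
    by (rule bigoI[of _ B]) (use assms in auto)
  also have "(\<lambda>_. 1) \<in> O[at_right 0](\<lambda>s::real. s powr 0)"
    by (rule bigoI[of _ 1]) (use eventually_at_right_less[of "0::real"] in
      \<open>auto elim: eventually_mono\<close>)
  also have "(\<lambda>s::real. s powr 0) \<in> O[at_right 0](\<lambda>s. s powr (-d))"
    using d by (intro powr_bigo_powr) simp
  finally show "powr_bound (-d) f" .
qed

lemma eventually_norm_le_of_tendsto:
  assumes "(f \<longlongrightarrow> l) F"
  shows "\<forall>\<^sub>F s in F. norm (f s) \<le> norm l + 1"
  using order_tendstoD(2)[OF tendsto_norm[OF assms], of "norm l + 1"]
  by (auto elim: eventually_mono)

lemma slow_growth_tendsto: "(f \<longlongrightarrow> l) (at_right 0) \<Longrightarrow> slow_growth f"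
  by (rule slow_growth_bounded[OF eventually_norm_le_of_tendsto])

lemma slow_growth_const: "slow_growth (\<lambda>_. c)"
  by (rule slow_growth_tendsto[OF tendsto_const])

lemma slow_growth_shifted_ln: "slow_growth (shifted_ln \<kappa>)"
proof -
  have "slow_growth (\<lambda>s. of_real (ln s))" unfolding slow_growth_def
  proof safe
    fix d :: real assume "d > 0"
    thus "powr_bound (-d) (\<lambda>s. complex_of_real (ln s))" unfolding norm_of_real by real_asymp
  qed
  thus ?thesis unfolding shifted_ln_def[abs_def] by (intro slow_growth_add slow_growth_const)
qed

lemma slow_growth_power: "slow_growth f \<Longrightarrow> slow_growth (\<lambda>s. f s^n)"
  by (induction n) (simp_all add: slow_growth_const slow_growth_mult)

lemma power_decay_of_real: "power_decay (\<lambda>s. of_real s)"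
proof -
  have "powr_bound 1 complex_of_real"
    using eventually_at_right_less[of "0::real"]
    by (intro bigoI[of _ 1]) (auto elim: eventually_mono)
  thus ?thesis unfolding power_decay_def by (intro exI[of _ 1]) auto
qed

lemma power_decay_tendsto:
  assumes "power_decay f"
  shows "(f \<longlongrightarrow> 0) (at_right 0)"
proof -
  obtain a where a: "a > 0" "powr_bound a f" using assms unfolding power_decay_def by blast
  obtain K where "\<forall>\<^sub>F s in at_right 0. norm (norm (f s)) \<le> K * norm (s powr a)"
    using landau_o.bigE[OF a(2)] by blast
  hence "\<forall>\<^sub>F s in at_right 0. norm (f s) \<le> K * s powr a" by simp
  moreover have "((\<lambda>s. K * s powr a) \<longlongrightarrow> 0) (at_right 0)" using a by real_asymp
  ultimately show ?thesis by (rule Lim_null_comparison)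
qed

lemma power_decay_imp_slow_growth: "power_decay f \<Longrightarrow> slow_growth f"
  using power_decay_tendsto slow_growth_tendsto by blast

lemma power_decay_cong:
  assumes "power_decay f" "\<forall>\<^sub>F s in at_right 0. f s = g s"
  shows "power_decay g"
proof -
  have norm: "\<forall>\<^sub>F s in at_right 0. norm (f s) = norm (g s)"
    using assms(2) by (auto elim: eventually_mono)
  show ?thesis using assms(1) unfolding power_decay_def landau_o.big.in_cong[OF norm] .
qed

lemma eventually_norm_shifted_ln_ge: "\<forall>\<^sub>F s in at_right 0. r \<le> norm (shifted_ln \<kappa> s)"
proof -
  have "filterlim (\<lambda>s::real. -ln s - norm \<kappa>) at_top (at_right 0)" by real_asymp
  hence "\<forall>\<^sub>F s in at_right 0. r \<le> -ln s - norm \<kappa>" by (auto simp: filterlim_at_top)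
  thus ?thesis
  proof eventually_elim
    case (elim s)
    have "norm (complex_of_real (ln s)) \<le> norm (shifted_ln \<kappa> s) + norm \<kappa>"
      unfolding shifted_ln_def by (metis add_diff_cancel_right' norm_triangle_ineq4)
    thus ?case using elim by simp
  qed
qed

lemma norm_diff_le_powr_diff:
  fixes f :: "real \<Rightarrow> 'a::real_normed_vector"
  assumes "0 < \<eta>" "0 < r" "r < s"
    and f': "\<And>x. r \<le> x \<Longrightarrow> x \<le> s \<Longrightarrow> (f has_vector_derivative f' x) (at x)"
    and bound: "\<And>x. r \<le> x \<Longrightarrow> x \<le> s \<Longrightarrow> norm (f' x) \<le> K * x powr (\<eta> - 1)"
  shows "norm (f s - f r) \<le> K / \<eta> * s powr \<eta> - K / \<eta> * r powr \<eta>"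
proof (rule differentiable_bound_general[OF \<open>r < s\<close>])
  show "continuous_on {r..s} f"
    using f' by (auto intro!: continuous_at_imp_continuous_on has_vector_derivative_continuous)
  show "continuous_on {r..s} (\<lambda>x. K / \<eta> * x powr \<eta>)" using assms by (auto intro!: continuous_intros)
  fix x assume x: "r < x" "x < s"
  show "(f has_vector_derivative f' x) (at x)" "norm (f' x) \<le> K * x powr (\<eta> - 1)"
    using f'[of x] bound[of x] x by auto
  show "((\<lambda>x. K / \<eta> * x powr \<eta>) has_vector_derivative K * x powr (\<eta> - 1)) (at x)"
    unfolding has_real_derivative_iff_has_vector_derivative[symmetric] using assms x
    by (auto intro!: derivative_eq_intros)
qed

lemma limit_at_right_0_of_powr_bound:
  fixes f :: "real \<Rightarrow> 'a::{real_normed_vector, complete_space}"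
  assumes "0 < \<eta>" "0 < d" "0 \<le> K"
    and bound: "\<And>r s. 0 < r \<Longrightarrow> r < s \<Longrightarrow> s < d \<Longrightarrow> norm (f s - f r) \<le> K * s powr \<eta> - K * r powr \<eta>"
  shows "\<exists>v. \<forall>s\<in>{0<..<d}. norm (f s - v) \<le> K * s powr \<eta>"
proof - \<comment> \<open>In the variable \<open>s powr \<eta>\<close> the function is Lipschitz, hence extends continuously to \<open>0\<close>.\<close>
  define g where "g u = f (u powr (1 / \<eta>))" for u
  have "lipschitz_on K {0<..<d powr \<eta>} g"
  proof (rule lipschitz_on_leI)
    fix u w assume u: "u \<in> {0<..<d powr \<eta>}" and w: "w \<in> {0<..<d powr \<eta>}" and "u \<le> w"
    have "w powr (1 / \<eta>) < (d powr \<eta>) powr (1 / \<eta>)" using w assms by (intro powr_less_mono2) auto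
    hence "w powr (1 / \<eta>) < d" using assms by (simp add: powr_powr)
    moreover have "u < w \<Longrightarrow> u powr (1 / \<eta>) < w powr (1 / \<eta>)"
      using u assms by (intro powr_less_mono2) auto
    ultimately show "dist (g u) (g w) \<le> K * dist u w"
      using bound[of "u powr (1 / \<eta>)" "w powr (1 / \<eta>)"] u \<open>u \<le> w\<close> assms
      by (cases "u = w") (auto simp: g_def powr_powr dist_norm norm_minus_commute
        right_diff_distrib)
  qed (use assms in auto)
  from lipschitz_extend_closure[OF this] obtain h where h:
    "lipschitz_on K (closure {0<..<d powr \<eta>}) h" "\<And>u. u \<in> {0<..<d powr \<eta>} \<Longrightarrow> h u = g u"
    by blast
  have "norm (f s - h 0) \<le> K * s powr \<eta>" if s: "0 < s" "s < d" for s
  proof -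
    have u: "s powr \<eta> \<in> {0<..<d powr \<eta>}" using s assms by (auto intro: powr_less_mono2)
    have "0 \<in> closure {0<..<d powr \<eta>}" using assms by (simp add: closure_greaterThanLessThan)
    hence "dist (h (s powr \<eta>)) (h 0) \<le> K * dist (s powr \<eta>) 0"
      by (intro lipschitz_onD[OF h(1)] subsetD[OF closure_subset u])
    thus ?thesis using h(2)[OF u] s assms by (simp add: g_def powr_powr dist_norm)
  qed
  thus ?thesis by (intro exI[of _ "h 0"]) simp
qed

lemma power_decay_minus_limit:
  fixes f :: "real \<Rightarrow> complex"
  assumes f': "\<forall>\<^sub>F s in at_right 0. (f has_vector_derivative f' s) (at s)"
    and decay: "power_decay (\<lambda>s. of_real s * f' s)"
  shows "\<exists>v. power_decay (\<lambda>s. f s - v)"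
proof -
  obtain \<eta> where \<eta>: "\<eta> > 0" and bound: "powr_bound \<eta> (\<lambda>s. of_real s * f' s)"
    using decay unfolding power_decay_def by blast
  obtain K where K: "K > 0" "\<forall>\<^sub>F s in at_right 0. norm (norm (of_real s * f' s)) \<le>
    K * norm (s powr \<eta>)"
    using landau_o.bigE[OF bound] by blast
  from f' K(2) eventually_at_right_0_1
  have "\<forall>\<^sub>F s in at_right 0. (f has_vector_derivative f' s) (at s) \<and>
    norm (f' s) \<le> K * s powr (\<eta> - 1)"
  proof eventually_elim
    case (elim s)
    hence "s * norm (f' s) \<le> K * (s * s powr (\<eta> - 1))" by (simp add: norm_mult powr_mult_base)
    thus ?case using elim by (simp add: mult.left_commute[of K])
  qed
  then obtain d where d: "d > 0" and "\<And>s. 0 < s \<Longrightarrow> s < d \<Longrightarrow> (f has_vector_derivative f' s) (at s) \<and>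
    norm (f' s) \<le> K * s powr (\<eta> - 1)"
    by (auto simp: eventually_at_right_field)
  hence "norm (f s - f r) \<le> K / \<eta> * s powr \<eta> - K / \<eta> * r powr \<eta>" if "0 < r" "r < s" "s < d" for r s
    using that \<eta> by (intro norm_diff_le_powr_diff[where f' = f']) auto
  from limit_at_right_0_of_powr_bound[OF \<eta> d _ this] obtain v where
    "\<forall>s\<in>{0<..<d}. norm (f s - v) \<le> K / \<eta> * s powr \<eta>"
    using \<eta> K by auto
  hence "powr_bound \<eta> (\<lambda>s. f s - v)"
    using eventually_at_right_0[OF d] by (intro bigoI[of _ "K / \<eta>"]) (auto elim!: eventually_mono)
  thus ?thesis using \<eta> unfolding power_decay_def by blast
qed

context roots_of_unity
begin

inductive log_expansion :: "complex \<Rightarrow> nat \<Rightarrow> (real \<Rightarrow> complex) \<Rightarrow> bool" for \<kappa> where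
  monomial: "polylog_value a c \<Longrightarrow> a + j = k \<Longrightarrow> log_expansion \<kappa> k (\<lambda>s. c * shifted_ln \<kappa> s^j)"
| decay: "power_decay f \<Longrightarrow> log_expansion \<kappa> k f"
| add: "log_expansion \<kappa> k f \<Longrightarrow> log_expansion \<kappa> k g \<Longrightarrow> log_expansion \<kappa> k (\<lambda>s. f s + g s)"

lemma log_expansion_slow_growth: "log_expansion \<kappa> k f \<Longrightarrow> slow_growth f"
proof (induction rule: log_expansion.induct)
  case (monomial a c j k)
  show ?case
    by (rule slow_growth_mult[OF slow_growth_const slow_growth_power[OF slow_growth_shifted_ln]])
next
  case (add k f g)
  thus ?case by (intro slow_growth_add)
qed (fact power_decay_imp_slow_growth)

lemma log_expansion_cong:
  assumes "log_expansion \<kappa> k f" "\<forall>\<^sub>F s in at_right 0. f s = g s"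
  shows "log_expansion \<kappa> k g"
proof -
  have "power_decay (\<lambda>s. g s - f s)"
    by (rule power_decay_cong[OF power_decay_0]) (use assms(2) in \<open>auto elim: eventually_mono\<close>)
  from log_expansion.add[OF assms(1) decay[OF this]] show ?thesis by simp
qed

lemma log_expansion_const: "polylog_value k c \<Longrightarrow> log_expansion \<kappa> k (\<lambda>_. c)"
  using monomial[of k c 0 k] by simp

lemma log_expansion_shifted_ln: "log_expansion \<kappa> 1 (shifted_ln \<kappa>)"
  using monomial[of 0 1 1 1] polylog_value_1 by simp

lemma log_expansion_mult:
  "log_expansion \<kappa> j f \<Longrightarrow> log_expansion \<kappa> k g \<Longrightarrow> log_expansion \<kappa> (j + k) (\<lambda>s. f s * g s)"
proof (induction rule: log_expansion.induct)
  case (monomial a c i j)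
  from monomial(3) monomial(1,2) show ?case
  proof (induction rule: log_expansion.induct)
    case (monomial b d l k)
    from log_expansion.monomial[OF polylog_value_mult[OF monomial(3,1)], where \<kappa> = \<kappa> and j = "i + l"
      and k = "j + k"]
    show ?case using monomial by (simp add: power_add mult_ac)
  next
    case (decay g k)
    thus ?case
      using power_decay_mult_slow_growth[OF decay(1) slow_growth_mult[OF slow_growth_const
        slow_growth_power[OF slow_growth_shifted_ln]], of c \<kappa> i]
      by (intro log_expansion.decay) (simp add: mult.commute)
  next
    case (add k f g)
    thus ?case using log_expansion.add[OF add.IH] by (simp add: distrib_left)
  qed
next
  case (decay f j)
  thus ?case using power_decay_mult_slow_growth[OF decay(1) log_expansion_slow_growth]
    by (intro log_expansion.decay) blast
next
  case (add j f g)
  thus ?case using log_expansion.add[OF add.IH] by (simp add: distrib_right)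
qed

lemma log_expansion_cmult:
  "polylog_value j c \<Longrightarrow> log_expansion \<kappa> k f \<Longrightarrow> log_expansion \<kappa> (j + k) (\<lambda>s. c * f s)"
  by (intro log_expansion_mult log_expansion_const)

lemma log_expansion_rat_mult: "log_expansion \<kappa> k f \<Longrightarrow> log_expansion \<kappa> k (\<lambda>s. of_rat q * f s)"
  using log_expansion_cmult[OF polylog_value_of_rat, of \<kappa> k f q] by simp

lemma log_expansion_diff:
  "log_expansion \<kappa> k f \<Longrightarrow> log_expansion \<kappa> k g \<Longrightarrow> log_expansion \<kappa> k (\<lambda>s. f s - g s)"
  using log_expansion.add[of \<kappa> k f "\<lambda>s. of_rat (-1) * g s"] log_expansion_rat_mult[of \<kappa> k g "-1"]
  by simp

lemma log_expansion_power: "log_expansion \<kappa> k f \<Longrightarrow> log_expansion \<kappa> (n * k) (\<lambda>s. f s^n)"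
proof (induction n)
  case 0
  show ?case using log_expansion_const[OF polylog_value_1] by simp
next
  case (Suc n)
  thus ?case using log_expansion_mult[of \<kappa> k f "n * k" "\<lambda>s. f s^n"] by simp
qed

lemma log_expansion_sum:
  "(\<And>i. i \<in> I \<Longrightarrow> log_expansion \<kappa> k (f i)) \<Longrightarrow> log_expansion \<kappa> k (\<lambda>s. \<Sum>i\<in>I. f i s)"
proof (induction I rule: infinite_finite_induct)
  case (insert i I)
  thus ?case using log_expansion.add[of \<kappa> k "f i" "\<lambda>s. \<Sum>i\<in>I. f i s"] by simp
qed (simp_all add: log_expansion_const polylog_value.zero)

lemma log_expansion_coeffs:
  assumes "log_expansion \<kappa> k f"
  shows "\<exists>c. (\<forall>j\<le>k. polylog_value (k - j) (c j)) \<and>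
    power_decay (\<lambda>s. f s - (\<Sum>j\<le>k. c j * shifted_ln \<kappa> s^j))"
  using assms
proof (induction rule: log_expansion.induct)
  case (monomial a c j k)
  have "(\<Sum>i\<le>k. (if i = j then c else 0) * shifted_ln \<kappa> s^i) = c * shifted_ln \<kappa> s^j" for s
    using monomial by (simp add: if_distrib[of "\<lambda>x. x * _"] sum.delta cong: if_cong)
  thus ?case using monomial
    by (intro exI[of _ "\<lambda>i. if i = j then c else 0"]) (auto simp: power_decay_0 intro:
      polylog_value.zero)
next
  case (decay f k)
  thus ?case by (intro exI[of _ "\<lambda>_. 0"]) (auto intro: polylog_value.zero)
next
  case (add k f g)
  then obtain c d where c: "\<forall>j\<le>k. polylog_value (k - j) (c j)"
    "power_decay (\<lambda>s. f s - (\<Sum>j\<le>k. c j * shifted_ln \<kappa> s^j))"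
    and d: "\<forall>j\<le>k. polylog_value (k - j) (d j)"
    "power_decay (\<lambda>s. g s - (\<Sum>j\<le>k. d j * shifted_ln \<kappa> s^j))"
    by blast
  have "(f s - (\<Sum>j\<le>k. c j * shifted_ln \<kappa> s^j)) + (g s - (\<Sum>j\<le>k. d j * shifted_ln \<kappa> s^j)) =
    f s + g s - (\<Sum>j\<le>k. (c j + d j) * shifted_ln \<kappa> s^j)" for s
    by (simp add: algebra_simps sum.distrib)
  with power_decay_add[OF c(2) d(2)] c d show ?case
    by (intro exI[of _ "\<lambda>j. c j + d j"]) (auto intro: polylog_value.add)
qed

lemma log_expansion_bounded:
  assumes "log_expansion \<kappa> k f" "\<forall>\<^sub>F s in at_right 0. norm (f s) \<le> B"
  shows "\<exists>v. polylog_value k v \<and> power_decay (\<lambda>s. f s - v)"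
proof -
  obtain c where c: "\<forall>j\<le>k. polylog_value (k - j) (c j)"
    "power_decay (\<lambda>s. f s - (\<Sum>j\<le>k. c j * shifted_ln \<kappa> s^j))"
    using log_expansion_coeffs[OF assms(1)] by blast
  define q where "q = (\<Sum>j<k. monom (c (Suc j)) j)"
  have poly_eq: "poly (pCons (c 0) q) x = (\<Sum>j\<le>k. c j * x^j)" for x
  proof -
    have "(\<Sum>j\<le>k. c j * x^j) = c 0 + (\<Sum>j<k. c (Suc j) * x^Suc j)"
      by (subst sum.atMost_shift) simp
    thus ?thesis by (simp add: q_def poly_sum poly_monom sum_distrib_left mult_ac)
  qed
  have "q = 0"
  proof (rule ccontr)
    assume "q \<noteq> 0"
    then obtain r where r: "\<And>z. r \<le> norm z \<Longrightarrow> B + 2 \<le> norm (poly (pCons (c 0) q) z)"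
      using poly_infinity[of q "B + 2" "c 0"] by blast
    have "\<forall>\<^sub>F s in at_right 0. norm (f s - (\<Sum>j\<le>k. c j * shifted_ln \<kappa> s^j)) < 1"
      using tendstoD[OF power_decay_tendsto[OF c(2)] zero_less_one] by (simp add: dist_norm)
    with assms(2) eventually_norm_shifted_ln_ge[of r \<kappa>] have "\<forall>\<^sub>F s::real in at_right 0. False"
    proof eventually_elim
      case (elim s)
      have "norm (\<Sum>j\<le>k. c j * shifted_ln \<kappa> s^j) \<le>
        norm (f s) + norm (f s - (\<Sum>j\<le>k. c j * shifted_ln \<kappa> s^j))"
        by (metis norm_minus_commute norm_triangle_sub)
      with elim r[OF elim(2)] show False unfolding poly_eq by simp
    qed
    thus False by (simp add: trivial_limit_at_right_real eventually_False)
  qed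
  hence "(\<Sum>j\<le>k. c j * shifted_ln \<kappa> s^j) = c 0" for s using poly_eq[of "shifted_ln \<kappa> s"] by simp
  with c show ?thesis by (intro exI[of _ "c 0"]) auto
qed

lemma log_expansion_tendsto:
  assumes "log_expansion \<kappa> k f" "(f \<longlongrightarrow> l) (at_right 0)"
  shows "polylog_value k l" "power_decay (\<lambda>s. f s - l)"
proof -
  obtain v where v: "polylog_value k v" "power_decay (\<lambda>s. f s - v)"
    using log_expansion_bounded[OF assms(1) eventually_norm_le_of_tendsto[OF assms(2)]] by blast
  have "(f \<longlongrightarrow> v) (at_right 0)" using power_decay_tendsto[OF v(2)] by (rule LIM_zero_cancel)
  with assms(2) have "l = v" using tendsto_unique trivial_limit_at_right_real by blast
  with v show "polylog_value k l" "power_decay (\<lambda>s. f s - l)" by auto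
qed

end

section \<open>Hyperlogarithms\<close>

fun hyperlog_coeff :: "complex list \<Rightarrow> nat \<Rightarrow> complex" where
  "hyperlog_coeff [] n = (if n = 0 then 1 else 0)"
| "hyperlog_coeff (a # W) n =
  (if a = 0 then hyperlog_coeff W n/of_nat n else -(\<Sum>m<n. hyperlog_coeff W m/a^(n - m))/of_nat n)"

definition hyperlog :: "complex list \<Rightarrow> complex \<Rightarrow> complex" where
  "hyperlog W z = eval_fps (Abs_fps (hyperlog_coeff W)) z"

lemma hyperlog_coeff_0: "W \<noteq> [] \<Longrightarrow> hyperlog_coeff W 0 = 0"
  by (cases W) auto

lemma hyperlog_coeff_singleton: "b \<noteq> 0 \<Longrightarrow> 0 < n \<Longrightarrow> hyperlog_coeff [b] n = -((1/b)^n/of_nat n)"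
proof -
  assume "b \<noteq> 0" "0 < n"
  hence "(\<Sum>m<n. hyperlog_coeff [] m/b^(n - m)) = 1/b^n"
    by (subst sum.remove[of _ 0]) (auto simp: power_one_over)
  thus ?thesis using \<open>b \<noteq> 0\<close> by (simp add: power_one_over)
qed

lemma hyperlog_0: "hyperlog W 0 = (if W = [] then 1 else 0)"
  by (simp add: hyperlog_def eval_fps_at_0 hyperlog_coeff_0)

lemma hyperlog_Nil: "hyperlog [] z = 1"
proof -
  have "Abs_fps (hyperlog_coeff []) = 1" by (rule fps_ext) auto
  thus ?thesis by (simp add: hyperlog_def)
qed

lemma fps_deriv_hyperlog:
  assumes "W \<noteq> [] \<or> a \<noteq> 0"
  shows "(fps_X - fps_const a) * fps_deriv (Abs_fps (hyperlog_coeff (a # W))) =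
    Abs_fps (hyperlog_coeff W)" (is "(fps_X - fps_const a) * fps_deriv ?F = _")
proof (rule fps_ext)
  fix n
  have X: "fps_nth (fps_X * fps_deriv ?F) n = of_nat n * hyperlog_coeff (a # W) n"
    by (cases n) auto
  show "fps_nth ((fps_X - fps_const a) * fps_deriv ?F) n = fps_nth (Abs_fps (hyperlog_coeff W)) n"
  proof (cases "a = 0")
    case True
    thus ?thesis using X assms by (cases "n = 0") (auto simp: hyperlog_coeff_0)
  next
    case False
    have lower: "of_nat n * hyperlog_coeff (a # W) n = -(\<Sum>m<n. hyperlog_coeff W m/a^(n - m))"
      using False by (cases "n = 0") auto
    have "of_nat (Suc n) * hyperlog_coeff (a # W) (Suc n) =
      -(\<Sum>m<Suc n. hyperlog_coeff W m/a^(Suc n - m))"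
      using False by (simp del: sum.lessThan_Suc of_nat_Suc)
    hence "a * (of_nat (Suc n) * hyperlog_coeff (a # W) (Suc n)) =
      -(\<Sum>m<Suc n. a * (hyperlog_coeff W m/a^(Suc n - m)))"
      by (simp only: mult_minus_right sum_distrib_left)
    also have "(\<Sum>m<Suc n. a * (hyperlog_coeff W m/a^(Suc n - m))) =
      (\<Sum>m<Suc n. hyperlog_coeff W m/a^(n - m))"
      using False by (intro sum.cong) (auto simp: Suc_diff_le)
    finally have upper: "a * (of_nat (Suc n) * hyperlog_coeff (a # W) (Suc n)) =
      -(\<Sum>m<Suc n. hyperlog_coeff W m/a^(n - m))" .
    have "fps_nth ((fps_X - fps_const a) * fps_deriv ?F) n = of_nat n * hyperlog_coeff (a # W) n
      - a * (of_nat (Suc n) * hyperlog_coeff (a # W) (Suc n))"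
      by (simp add: left_diff_distrib X del: hyperlog_coeff.simps of_nat_Suc)
    thus ?thesis unfolding lower upper by simp
  qed
qed

lemma equal_of_equal_derivative_off_0:
  fixes f g :: "complex \<Rightarrow> complex"
  assumes "continuous_on (ball 0 1) f" "continuous_on (ball 0 1) g" "f 0 = g 0" "\<And>z. norm z < 1 \<Longrightarrow>
    z \<noteq> 0 \<Longrightarrow> (f has_field_derivative h z) (at z)" "\<And>z. norm z < 1 \<Longrightarrow> z \<noteq> 0 \<Longrightarrow> (g has_field_derivative h
    z) (at z)" "norm z < 1"
  shows "f z = g z"
proof -
  have "f z - g z = 0"
  proof (rule has_derivative_zero_unique_strong_convex[where f = "\<lambda>z. f z - g z" and S = "ball 0 1"
    and K = "{0}" and c = 0])
    show "((\<lambda>z. f z - g z) has_derivative (\<lambda>h. 0)) (at x within ball 0 1)" if "x \<in> ball 0 1 - {0}"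
      for x
    proof -
      have "((\<lambda>z. f z - g z) has_field_derivative h x - h x) (at x)"
        using that by (intro DERIV_diff assms) auto
      moreover have "(*) (h x - h x) = (\<lambda>h::complex. 0)" by auto
      ultimately show ?thesis by (simp add: has_field_derivative_def has_derivative_at_withinI)
    qed
  qed (use assms in \<open>auto intro!: continuous_intros\<close>)
  thus ?thesis by simp
qed

fun insert_at :: "'a \<Rightarrow> nat \<Rightarrow> 'a list \<Rightarrow> 'a list" where
  "insert_at p 0 V = p # V"
| "insert_at p (Suc i) [] = [p]"
| "insert_at p (Suc i) (a # V) = a # insert_at p i V"

lemma length_insert_at: "length (insert_at p i V) = Suc (length V)"
  by (induction p i V rule: insert_at.induct) auto

lemma set_insert_at: "set (insert_at p i V) = insert p (set V)"
  by (induction p i V rule: insert_at.induct) auto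

lemma insert_at_not_Nil: "insert_at p i V \<noteq> []"
  using length_insert_at[of p i V] by auto

lemma last_insert_at: "last (insert_at p i V) = p \<or> V \<noteq> [] \<and> last (insert_at p i V) = last V"
  by (induction p i V rule: insert_at.induct) (auto simp: insert_at_not_Nil)

lemma insert_at_leading: "i \<le> length (takeWhile (\<lambda>a. a = p) V) \<Longrightarrow> insert_at p i V = p # V"
  by (induction p i V rule: insert_at.induct) (auto split: if_splits)

lemma takeWhile_insert_at:
  "length (takeWhile (\<lambda>a. a = p) V) < i \<Longrightarrow> i \<le> length V \<Longrightarrow>
    takeWhile (\<lambda>a. a = p) (insert_at p i V) = takeWhile (\<lambda>a. a = p) V"
  by (induction p i V rule: insert_at.induct) (auto split: if_splits)

context roots_of_unity
begin

definition letter :: "complex \<Rightarrow> bool" where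
  "letter a \<longleftrightarrow> a = 0 \<or> a^N = 1"

definition hyperlog_word :: "complex list \<Rightarrow> bool" where
  "hyperlog_word W \<longleftrightarrow> (\<forall>a\<in>set W. letter a) \<and> (W = [] \<or> last W \<noteq> 0)"

lemma hyperlog_word_Nil [simp]: "hyperlog_word []"
  by (simp add: hyperlog_word_def)

lemma hyperlog_word_Cons: "hyperlog_word (a # W) \<longleftrightarrow> letter a \<and> hyperlog_word W \<and> (W = [] \<longrightarrow> a \<noteq> 0)"
  by (auto simp: hyperlog_word_def)

lemma hyperlog_word_letters: "hyperlog_word W \<Longrightarrow> \<forall>a\<in>set W. letter a"
  by (simp add: hyperlog_word_def)

lemma letter_0 [simp]: "letter 0"
  by (simp add: letter_def)

lemma root_unity_nonzero: "z^N = 1 \<Longrightarrow> z \<noteq> (0 :: complex)"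
  using norm_root_unity by fastforce

lemma letter_cases: "letter a \<Longrightarrow> a = 0 \<or> norm a = 1"
  using norm_root_unity by (auto simp: letter_def)

lemma norm_hyperlog_coeff_le:
  assumes "\<forall>a\<in>set W. letter a"
  shows "norm (hyperlog_coeff W n) \<le> 1"
  using assms
proof (induction W arbitrary: n)
  case (Cons a W)
  show ?case
  proof (cases "n = 0")
    case False
    show ?thesis
    proof (cases "a = 0")
      case True
      have "norm (hyperlog_coeff W n) \<le> 1" using Cons by auto
      also have "... \<le> real n" using False by simp
      finally show ?thesis using True False by (simp add: norm_divide)
    next
      case a: False
      have "norm (\<Sum>m<n. hyperlog_coeff W m/a^(n - m)) \<le> (\<Sum>m<n. 1)"
        using Cons a letter_cases[of a] by (intro sum_norm_le) (auto simp: norm_divide norm_power)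
      thus ?thesis using a False by (simp add: norm_divide)
    qed
  qed (simp add: hyperlog_coeff_0)
qed auto

lemma hyperlog_conv_radius:
  assumes "\<forall>a\<in>set W. letter a"
  shows "fps_conv_radius (Abs_fps (hyperlog_coeff W)) \<ge> 1"
  unfolding fps_conv_radius_def
proof (rule conv_radius_geI_ex)
  fix r :: real assume r: "0 < r" "ereal r < 1"
  have "summable (\<lambda>n. fps_nth (Abs_fps (hyperlog_coeff W)) n * of_real r^n)"
  proof (rule summable_comparison_test)
    show "\<exists>N. \<forall>n\<ge>N. norm (fps_nth (Abs_fps (hyperlog_coeff W)) n * of_real r^n) \<le> r^n"
      using norm_hyperlog_coeff_le[OF assms] r
      by (auto simp: norm_mult norm_power intro!: mult_left_le_one_le)
    show "summable (\<lambda>n. r^n)" using r by (intro summable_geometric) auto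
  qed
  thus "\<exists>z. norm z = r \<and> summable (\<lambda>n. fps_nth (Abs_fps (hyperlog_coeff W)) n * z^n)"
    using r by (intro exI[of _ "of_real r"]) auto
qed

lemma norm_less_hyperlog_conv_radius:
  assumes "\<forall>a\<in>set W. letter a" "norm z < 1"
  shows "ereal (norm z) < fps_conv_radius (Abs_fps (hyperlog_coeff W))"
  using hyperlog_conv_radius[OF assms(1)] assms(2) by (metis ereal_less(3) less_le_trans)

lemma hyperlog_sums:
  assumes "\<forall>a\<in>set W. letter a" "norm z < 1"
  shows "(\<lambda>n. hyperlog_coeff W n * z^n) sums hyperlog W z"
  using sums_eval_fps[OF norm_less_hyperlog_conv_radius[OF assms]] by (simp add: hyperlog_def)

lemma continuous_on_hyperlog:
  assumes "\<forall>a\<in>set W. letter a"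
  shows "continuous_on (ball 0 1) (hyperlog W)"
  unfolding hyperlog_def[abs_def]
  by (intro continuous_on_eval_fps' continuous_intros) (use norm_less_hyperlog_conv_radius[OF assms]
    in \<open>auto simp: eball_def\<close>)

lemma has_field_derivative_hyperlog:
  assumes "hyperlog_word (a # W)" "norm z < 1" "z \<noteq> 0"
  shows "(hyperlog (a # W) has_field_derivative hyperlog W z/(z - a)) (at z)"
proof -
  let ?F = "Abs_fps (hyperlog_coeff (a # W))"
  have za: "z \<noteq> a" using assms letter_cases[of a] by (auto simp: hyperlog_word_Cons)
  have r: "ereal (norm z) < fps_conv_radius ?F"
    using assms by (intro norm_less_hyperlog_conv_radius hyperlog_word_letters)
  hence r': "ereal (norm z) < fps_conv_radius (fps_deriv ?F)"
    using fps_conv_radius_deriv[of ?F] by (meson less_le_trans)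
  have inf: "fps_conv_radius (fps_X - fps_const a) = \<infinity>"
    using fps_conv_radius_diff[of "fps_X" "fps_const a"] by (simp add: top.extremum_unique)
  have "hyperlog W z = eval_fps ((fps_X - fps_const a) * fps_deriv ?F) z"
    using assms(1) by (subst fps_deriv_hyperlog) (auto simp: hyperlog_word_Cons hyperlog_def)
  also have "... = (z - a) * eval_fps (fps_deriv ?F) z"
    using r' inf by (subst eval_fps_mult) (auto simp: eval_fps_diff)
  finally have "eval_fps (fps_deriv ?F) z = hyperlog W z/(z - a)"
    using za by (simp add: field_simps)
  moreover have "(eval_fps ?F has_field_derivative eval_fps (fps_deriv ?F) z) (at z)"
    using r by (intro has_field_derivative_eval_fps) auto
  ultimately show ?thesis by (simp add: hyperlog_def[abs_def])
qed

text \<open>Up to a sign, the coefficients of a hyperlogarithm are the terms of a polylogarithm sum.\<close>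

definition coeffs_of_polylog ::
  "complex list \<Rightarrow> complex \<Rightarrow> nat \<Rightarrow> complex \<Rightarrow> (nat \<times> complex) list \<Rightarrow> bool" where
  "coeffs_of_polylog W s a z w \<longleftrightarrow> (s = 1 \<or> s = -1) \<and> index_word ((a, z) # w) \<and>
    weight ((a, z) # w) = length W \<and> (a = 1 \<longrightarrow> hd W \<noteq> 0 \<and> z = 1/hd W) \<and> (\<forall>n>0. hyperlog_coeff W n = s
    * (z^n/of_nat n^a * trunc_polylog w n))"

lemma coeffs_of_polylog_singleton: "b^N = 1 \<Longrightarrow> coeffs_of_polylog [b] (-1) 1 (1/b) []"
  using root_unity_nonzero[of b]
  by (auto simp: coeffs_of_polylog_def hyperlog_coeff_singleton power_divide simp del:
    hyperlog_coeff.simps)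

lemma coeffs_of_polylog_Cons_0:
  "coeffs_of_polylog W s a z w \<Longrightarrow> coeffs_of_polylog (0 # W) s (Suc a) z w"
  by (auto simp: coeffs_of_polylog_def divide_divide_eq_left mult.commute)

lemma coeffs_of_polylog_Cons_root:
  assumes "coeffs_of_polylog W s a z w" "b^N = 1" "W \<noteq> []"
  shows "coeffs_of_polylog (b # W) (-s) 1 (1/b) ((a, z * b) # w)"
proof -
  have b: "b \<noteq> 0" using root_unity_nonzero[OF assms(2)] .
  have "hyperlog_coeff (b # W) n = (-s) * ((1/b)^n/of_nat n^1 * trunc_polylog ((a, z * b) # w) n)"
    if "n > 0" for n
  proof -
    have "(\<Sum>m<n. hyperlog_coeff W m/b^(n - m)) = (\<Sum>m=1..<n. hyperlog_coeff W m/b^(n - m))"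
      using that assms(3)
      by (subst lessThan_atLeast0, subst sum.atLeast_Suc_lessThan) (auto simp: hyperlog_coeff_0)
    also have "... = (\<Sum>m=1..<n. s/b^n * ((z * b)^m/of_nat m^a * trunc_polylog w m))"
      using assms(1) b
      by (intro sum.cong) (auto simp: coeffs_of_polylog_def power_diff power_mult_distrib
        field_simps)
    also have "... = s/b^n * trunc_polylog ((a, z * b) # w) n"
      by (simp add: sum_distrib_left)
    finally have "hyperlog_coeff (b # W) n = -(s/b^n * trunc_polylog ((a, z * b) # w) n)/of_nat n"
      using b by simp
    thus ?thesis by (simp add: power_one_over del: trunc_polylog.simps hyperlog_coeff.simps)
  qed
  thus ?thesis
    using assms b
    by (auto simp: coeffs_of_polylog_def power_divide power_mult_distrib simp del:
      hyperlog_coeff.simps trunc_polylog.simps)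
qed

lemma ex_coeffs_of_polylog:
  assumes "hyperlog_word W" "W \<noteq> []"
  shows "\<exists>s a z w. coeffs_of_polylog W s a z w"
  using assms
proof (induction W)
  case (Cons b W)
  show ?case
  proof (cases "W = []")
    case True
    thus ?thesis using Cons.prems coeffs_of_polylog_singleton[of b]
      by (auto simp: hyperlog_word_Cons letter_def)
  next
    case False
    then obtain s a z w where W: "coeffs_of_polylog W s a z w"
      using Cons by (auto simp: hyperlog_word_Cons)
    show ?thesis
    proof (cases "b = 0")
      case True
      thus ?thesis using coeffs_of_polylog_Cons_0[OF W] by blast
    next
      case b: False
      hence "b^N = 1" using Cons.prems by (auto simp: hyperlog_word_Cons letter_def)
      thus ?thesis using coeffs_of_polylog_Cons_root[OF W _ False] by blast
    qed
  qed
qed simp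

lemma hyperlog_coeff_sums_at_root:
  assumes W: "hyperlog_word W" "W \<noteq> []" "hd W \<noteq> p" and p: "p^N = 1"
  shows "\<exists>v. polylog_value (length W) v \<and> (\<lambda>n. hyperlog_coeff W n * p^n) sums v"
proof -
  obtain s a z w where "coeffs_of_polylog W s a z w" using ex_coeffs_of_polylog[OF W(1,2)] by blast
  hence s: "s = 1 \<or> s = -1" and w: "index_word ((a, z) # w)" "weight ((a, z) # w) = length W"
    and head: "a = 1 \<longrightarrow> hd W \<noteq> 0 \<and> z = 1/hd W"
    and coeff: "\<forall>n>0. hyperlog_coeff W n = s * (z^n/of_nat n^a * trunc_polylog w n)"
    by (auto simp: coeffs_of_polylog_def)
  let ?w = "(a, z * p) # w"
  have admissible: "admissible ?w" "weight ?w = length W"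
    using w head p W(3) by (auto simp: admissible_Cons power_mult_distrib field_simps)
  then obtain v where v: "trunc_polylog ?w \<longlonglongrightarrow> v"
    using trunc_polylog_convergent[of ?w] by (auto simp: convergent_def)
  have "(\<Sum>n<M. hyperlog_coeff W n * p^n) = s * trunc_polylog ?w M" for M
  proof (induction M)
    case (Suc M)
    thus ?case using coeff W(2)
      by (cases "M = 0") (auto simp: trunc_polylog_Suc hyperlog_coeff_0 power_mult_distrib
        algebra_simps simp del: trunc_polylog.simps)
  qed simp
  hence "(\<lambda>n. hyperlog_coeff W n * p^n) sums (s * v)"
    using v by (auto simp: sums_def intro: tendsto_mult_left simp del: trunc_polylog.simps)
  moreover have "polylog_value (length W) (s * v)"
    using s polylog_value.word[OF admissible(1) v] admissible(2)
    by (auto intro: polylog_value_uminus)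
  ultimately show ?thesis by blast
qed

lemma norm_chord_from_less_1:
  assumes "p^N = 1" "norm e = 1" "Re e \<ge> 1/2" "0 < s" "s \<le> 1/2"
  shows "norm (chord_from p e s) < 1"
  using chord_in_Stolz_region(1)[OF assms(2-5)] norm_root_unity[OF assms(1)]
  by (simp add: chord_from_def norm_mult)

lemma hyperlog_tendsto_root:
  assumes W: "hyperlog_word W" "W \<noteq> []" "hd W \<noteq> p" and p: "p^N = 1" and e: "norm e = 1" "Re e \<ge> 1/2"
  shows "\<exists>v. polylog_value (length W) v \<and> ((\<lambda>s. hyperlog W (chord_from p e s)) \<longlongrightarrow> v) (at_right 0)"
proof -
  obtain v where v: "polylog_value (length W) v" "(\<lambda>n. hyperlog_coeff W n * p^n) sums v"
    using hyperlog_coeff_sums_at_root[OF W p] by blast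
  note small = eventually_at_right_0_half
  have "((\<lambda>s. suminf (\<lambda>n. (hyperlog_coeff W n * p^n) * (1 - of_real s * e)^n)) \<longlongrightarrow> v) (at_right 0)"
  proof (rule Abel_Stolz_limit[OF v(2), of 4])
    show "\<forall>\<^sub>F s in at_right 0. norm (1 - of_real s * e) < 1 \<and> norm (1 - (1 - of_real s * e)) \<le>
      4 * (1 - norm (1 - of_real s * e))"
      using small by eventually_elim (use chord_in_Stolz_region[OF e] in \<open>auto simp: less_imp_le\<close>)
    show "((\<lambda>s. 1 - of_real s * e) \<longlongrightarrow> 1) (at_right 0)"
      using tendsto_chord_from[of 1 e] by (simp add: chord_from_def[abs_def])
  qed auto
  moreover have
    "\<forall>\<^sub>F s in at_right 0. suminf (\<lambda>n. (hyperlog_coeff W n * p^n) * (1 - of_real s * e)^n) =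
    hyperlog W (chord_from p e s)"
    using small
  proof eventually_elim
    case (elim s)
    hence "norm (chord_from p e s) < 1" by (intro norm_chord_from_less_1[OF p e]) auto
    from hyperlog_sums[OF hyperlog_word_letters[OF W(1)] this] show ?case
      by (auto simp: sums_iff chord_from_def power_mult_distrib mult.assoc)
  qed
  ultimately have "((\<lambda>s. hyperlog W (chord_from p e s)) \<longlongrightarrow> v) (at_right 0)"
    by (rule Lim_transform_eventually)
  with v(1) show ?thesis by blast
qed

lemma hyperlog_singleton:
  assumes "b^N = 1" "norm z < 1"
  shows "hyperlog [b] z = Ln (1 - z/b)"
proof -
  have b: "b \<noteq> 0" "norm b = 1" using assms root_unity_nonzero norm_root_unity by auto
  have "hyperlog_coeff [b] n * z^n = (-1)^Suc n/of_nat n * (-z/b)^n" for n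
  proof (cases "n = 0")
    case False
    have "(-1)^Suc n * (-z/b)^n = -(((-1) * (-z/b))^n)" by (subst power_mult_distrib) simp
    thus ?thesis
      using False b by (simp add: hyperlog_coeff_singleton power_divide del: hyperlog_coeff.simps)
  qed simp
  moreover have "(\<lambda>n. (-1)^Suc n/of_nat n * (-z/b)^n) sums Ln (1 + (-z/b))"
    using b assms by (intro Ln_series) (auto simp: norm_divide)
  ultimately have "(\<lambda>n. hyperlog_coeff [b] n * z^n) sums Ln (1 - z/b)" by simp
  moreover have "(\<lambda>n. hyperlog_coeff [b] n * z^n) sums hyperlog [b] z"
    using assms by (intro hyperlog_sums) (auto simp: letter_def)
  ultimately show ?thesis using sums_unique2 by blast
qed

lemma polylog_value_Ln_one_minus_root:
  assumes "z^N = 1" "z \<noteq> 1"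
  shows "polylog_value 1 (Ln (1 - z))"
proof -
  have z0: "z \<noteq> 0" "norm z = 1" using assms root_unity_nonzero norm_root_unity by auto
  have iz: "(1/z)^N = 1" using assms by (simp add: power_one_over)
  then obtain v where v: "polylog_value 1 v"
    "((\<lambda>s. hyperlog [1/z] (chord_from 1 1 s)) \<longlongrightarrow> v) (at_right 0)"
    using hyperlog_tendsto_root[of "[1/z]" 1 1] assms z0
    by (auto simp: hyperlog_word_Cons letter_def)
  have "Re z < 1"
  proof (rule ccontr)
    assume "\<not> Re z < 1"
    hence "Re z = 1" using complex_Re_le_cmod[of z] z0 by simp
    moreover have "Im z = 0" using z0 \<open>Re z = 1\<close> by (simp add: cmod_def)
    ultimately show False using assms by (simp add: complex_eq_iff)
  qed
  hence "1 - z \<notin> \<real>\<^sub>\<le>\<^sub>0" by (auto simp: complex_nonpos_Reals_iff)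
  hence "((\<lambda>s. Ln (1 - chord_from 1 1 s/(1/z))) \<longlongrightarrow> Ln (1 - 1/(1/z))) (at_right 0)"
    using z0 by (intro tendsto_intros tendsto_chord_from) auto
  moreover have "\<forall>\<^sub>F s in at_right 0. Ln (1 - chord_from 1 1 s/(1/z)) =
    hyperlog [1/z] (chord_from 1 1 s)"
    using eventually_at_right_0_half
  proof eventually_elim
    case (elim s)
    hence "norm (chord_from 1 1 s) < 1" by (intro norm_chord_from_less_1) auto
    thus ?case using hyperlog_singleton[OF iz] by simp
  qed
  ultimately have "((\<lambda>s. hyperlog [1/z] (chord_from 1 1 s)) \<longlongrightarrow> Ln (1 - z)) (at_right 0)"
    using Lim_transform_eventually z0 by force
  with v(2) have "v = Ln (1 - z)" using tendsto_unique trivial_limit_at_right_real by blast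
  with v show ?thesis by simp
qed

lemma hyperlog_word_insert_at:
  assumes "hyperlog_word W" "p^N = 1"
  shows "hyperlog_word (insert_at p i W)"
  using assms last_insert_at[of p i W] root_unity_nonzero
  by (auto simp: hyperlog_word_def letter_def set_insert_at)

lemma hyperlog_singleton_mult:
  assumes "hyperlog_word W" "p^N = 1" "norm z < 1"
  shows "hyperlog [p] z * hyperlog W z = (\<Sum>i\<le>length W. hyperlog (insert_at p i W) z)"
  using assms
proof (induction W arbitrary: z)
  case Nil
  thus ?case by (simp add: hyperlog_Nil)
next
  case (Cons b W)
  have W: "hyperlog_word W" "hyperlog_word (b # W)" "hyperlog_word [p]"
    using Cons.prems root_unity_nonzero by (auto simp: hyperlog_word_Cons letter_def)
  have insert: "hyperlog_word (p # b # W)" "\<And>i. hyperlog_word (b # insert_at p i W)"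
    using hyperlog_word_insert_at[OF Cons.prems(1,2), of 0] hyperlog_word_insert_at[OF
      Cons.prems(1,2), of "Suc _"]
    by simp_all
  note letters = hyperlog_word_letters
  let ?R = "\<lambda>z. hyperlog (p # b # W) z + (\<Sum>i\<le>length W. hyperlog (b # insert_at p i W) z)"
  let ?L = "\<lambda>z. hyperlog [p] z * hyperlog (b # W) z"
  have "?L z = ?R z"
  proof (rule equal_of_equal_derivative_off_0[where f = ?L and g = ?R
    and h = "\<lambda>z. hyperlog (b # W) z/(z - p) + hyperlog [p] z * hyperlog W z/(z - b)"])
    show "continuous_on (ball 0 1) ?L"
      using W letters by (intro continuous_intros continuous_on_hyperlog) auto
    show "continuous_on (ball 0 1) ?R"
      using letters[OF insert(1)] letters[OF insert(2)]
      by (intro continuous_intros continuous_on_hyperlog)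
    show "?L 0 = ?R 0" by (simp add: hyperlog_0)
  next
    fix z :: complex assume z: "norm z < 1" "z \<noteq> 0"
    have "(hyperlog [p] has_field_derivative 1/(z - p)) (at z)"
      using has_field_derivative_hyperlog[OF W(3) z] by (simp add: hyperlog_Nil)
    from DERIV_mult[OF this has_field_derivative_hyperlog[OF W(2) z]]
    show "(?L has_field_derivative
      hyperlog (b # W) z/(z - p) + hyperlog [p] z * hyperlog W z/(z - b)) (at z)"
      by (simp add: algebra_simps)
    have "(?R has_field_derivative
      hyperlog (b # W) z/(z - p) + (\<Sum>i\<le>length W. hyperlog (insert_at p i W) z/(z - b))) (at z)"
      by (intro DERIV_add DERIV_sum has_field_derivative_hyperlog insert z)
    thus "(?R has_field_derivative
      hyperlog (b # W) z/(z - p) + hyperlog [p] z * hyperlog W z/(z - b)) (at z)"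
      using Cons.IH[OF W(1) Cons.prems(2) z(1)] by (simp flip: sum_divide_distrib)
  qed (use Cons.prems in auto)
  thus ?case by (simp add: sum.atMost_Suc_shift del: sum.atMost_Suc)
qed

lemma hyperlog_Cons_eq_shuffle:
  fixes p V
  defines "q \<equiv> Suc (length (takeWhile (\<lambda>a. a = p) V))"
  assumes "hyperlog_word V" "p^N = 1" "norm z < 1"
  shows "of_nat q * hyperlog (p # V) z =
    hyperlog [p] z * hyperlog V z - (\<Sum>i=q..length V. hyperlog (insert_at p i V) z)"
proof -
  have "q \<le> Suc (length V)" using length_takeWhile_le[of "\<lambda>a. a = p" V] by (simp add: q_def)
  hence "{..length V} = {..<q} \<union> {q..length V}" by auto
  hence "(\<Sum>i\<le>length V. hyperlog (insert_at p i V) z) = (\<Sum>i<q. hyperlog (insert_at p i V) z)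
    + (\<Sum>i=q..length V. hyperlog (insert_at p i V) z)"
    by (simp add: sum.union_disjoint ivl_disj_int)
  also have "(\<Sum>i<q. hyperlog (insert_at p i V) z) = of_nat q * hyperlog (p # V) z"
    by (simp add: insert_at_leading q_def)
  finally show ?thesis using hyperlog_singleton_mult[OF assms(2-4)] by simp
qed

lemma log_expansion_hyperlog_singleton:
  assumes p: "p^N = 1" and e: "norm e = 1" "Re e \<ge> 1/2"
  shows "log_expansion (Ln e) 1 (\<lambda>s. hyperlog [p] (chord_from p e s))"
proof (rule log_expansion_cong[OF log_expansion_shifted_ln])
  show "\<forall>\<^sub>F s in at_right 0. shifted_ln (Ln e) s = hyperlog [p] (chord_from p e s)"
    using eventually_at_right_0_half
  proof eventually_elim
    case (elim s)
    hence "norm (chord_from p e s) < 1" by (intro norm_chord_from_less_1[OF p e]) auto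
    hence "hyperlog [p] (chord_from p e s) = Ln (of_real s * e)"
      using hyperlog_singleton[OF p] root_unity_nonzero[OF p] by (simp add: chord_from_def)
    also have "... = shifted_ln (Ln e) s"
      using elim e by (subst Ln_times_of_real) (auto simp: shifted_ln_def Ln_of_real)
    finally show ?case ..
  qed
qed

lemma has_vector_derivative_hyperlog_chord_from:
  assumes p: "p^N = 1"
    and e: "norm e = 1" "Re e \<ge> 1/2"
    and W: "hyperlog_word (b # V)"
    and s: "0 < s" "s < 1/2"
  shows "((\<lambda>s. hyperlog (b # V) (chord_from p e s)) has_vector_derivative
    -(p * e) * (hyperlog V (chord_from p e s)/(chord_from p e s - b))) (at s)"
proof -
  have "norm (of_real s * e) \<noteq> 1" using s e by (simp add: norm_mult)
  hence "chord_from p e s \<noteq> 0" using root_unity_nonzero[OF p] by (auto simp: chord_from_def)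
  moreover have "norm (chord_from p e s) < 1" using s by (intro norm_chord_from_less_1[OF p e]) auto
  ultimately have
    "(hyperlog (b # V) has_field_derivative hyperlog V (chord_from p e s)/(chord_from p e s - b))
    (at (chord_from p e s))"
    by (intro has_field_derivative_hyperlog W)
  moreover have "(chord_from p e has_vector_derivative -(p * e)) (at s)"
    by (auto intro!: derivative_eq_intros simp: chord_from_def[abs_def] has_vector_derivative_def)
      (auto simp: fun_eq_iff scaleR_conv_of_real)
  ultimately show ?thesis using field_vector_diff_chain_at unfolding o_def by blast
qed

lemma log_expansion_hyperlog_Cons:
  assumes p: "p^N = 1"
    and e: "norm e = 1" "Re e \<ge> 1/2"
    and W: "hyperlog_word (b # V)" "b \<noteq> p"
    and V: "log_expansion (Ln e) (length V) (\<lambda>s. hyperlog V (chord_from p e s))"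
  shows "log_expansion (Ln e) (Suc (length V)) (\<lambda>s. hyperlog (b # V) (chord_from p e s))"
proof -
  let ?\<gamma> = "chord_from p e"
  obtain v where v: "polylog_value (Suc (length V)) v"
    "((\<lambda>s. hyperlog (b # V) (?\<gamma> s)) \<longlongrightarrow> v) (at_right 0)"
    using hyperlog_tendsto_root[OF W(1) _ _ p e] W(2) by auto
  define f' where "f' s = -(p * e) * (hyperlog V (?\<gamma> s)/(?\<gamma> s - b))" for s
  have "((\<lambda>s. -(p * e) * (1/(?\<gamma> s - b))) \<longlongrightarrow> -(p * e) * (1/(p - b))) (at_right 0)"
    using W(2) by (intro tendsto_intros tendsto_chord_from) auto
  from slow_growth_mult[OF slow_growth_tendsto[OF this] log_expansion_slow_growth[OF V]]
  have "slow_growth f'" by (simp add: f'_def[abs_def])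
  hence decay: "power_decay (\<lambda>s. of_real s * f' s)"
    by (rule power_decay_mult_slow_growth[OF power_decay_of_real])
  have "\<forall>\<^sub>F s in at_right 0. ((\<lambda>s. hyperlog (b # V) (?\<gamma> s)) has_vector_derivative f' s) (at s)"
    using eventually_at_right_0_half unfolding f'_def
    by eventually_elim (blast intro: has_vector_derivative_hyperlog_chord_from[OF p e W(1)])
  from power_decay_minus_limit[OF this decay]
  obtain v' where v': "power_decay (\<lambda>s. hyperlog (b # V) (?\<gamma> s) - v')" by auto
  have "((\<lambda>s. hyperlog (b # V) (?\<gamma> s)) \<longlongrightarrow> v') (at_right 0)"
    using power_decay_tendsto[OF v'] by (rule LIM_zero_cancel)
  with v(2) have "v = v'" using tendsto_unique trivial_limit_at_right_real by blast
  from log_expansion.add[OF log_expansion_const[OF v(1)] log_expansion.decay[OF v'], folded this, of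
    "Ln e"]
  show ?thesis by simp
qed

lemma log_expansion_hyperlog_Cons_same:
  fixes p V
  defines "q \<equiv> Suc (length (takeWhile (\<lambda>a. a = p) V))"
  assumes p: "p^N = 1"
    and e: "norm e = 1" "Re e \<ge> 1/2"
    and V: "hyperlog_word V"
    and expansion: "log_expansion (Ln e) (length V) (\<lambda>s. hyperlog V (chord_from p e s))"
    and insert: "\<And>i. i \<in> {q..length V} \<Longrightarrow>
      log_expansion (Ln e) (Suc (length V)) (\<lambda>s. hyperlog (insert_at p i V) (chord_from p e s))"
  shows "log_expansion (Ln e) (Suc (length V)) (\<lambda>s. hyperlog (p # V) (chord_from p e s))"
proof -
  let ?\<gamma> = "chord_from p e"
  let ?g = "\<lambda>s. hyperlog [p] (?\<gamma> s) * hyperlog V (?\<gamma> s)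
    - (\<Sum>i=q..length V. hyperlog (insert_at p i V) (?\<gamma> s))"
  have "log_expansion (Ln e) (Suc (length V)) ?g"
    using log_expansion_mult[OF log_expansion_hyperlog_singleton[OF p e] expansion]
    by (intro log_expansion_diff log_expansion_sum insert) auto
  from log_expansion_rat_mult[OF this, of "1/of_nat q"] show ?thesis
  proof (rule log_expansion_cong)
    show "\<forall>\<^sub>F s in at_right 0. of_rat (1/of_nat q) * ?g s = hyperlog (p # V) (?\<gamma> s)"
      using eventually_at_right_0_half
    proof eventually_elim
      case (elim s)
      hence "norm (?\<gamma> s) < 1" by (intro norm_chord_from_less_1[OF p e]) auto
      from hyperlog_Cons_eq_shuffle[OF V p this] have "of_nat q * hyperlog (p # V) (?\<gamma> s) = ?g s"
        by (simp only: q_def)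
      moreover have "of_nat q \<noteq> (0 :: complex)" by (simp add: q_def del: of_nat_Suc)
      ultimately show ?case by (simp add: of_rat_divide field_simps)
    qed
  qed
qed

text \<open>A word starting with \<open>q\<close> copies of \<open>p\<close> is reduced by the shuffle relation to words starting with
 fewer copies and to shorter words.\<close>

lemma log_expansion_hyperlog:
  assumes p: "p^N = 1" and e: "norm e = 1" "Re e \<ge> 1/2" and W: "hyperlog_word W"
  shows "log_expansion (Ln e) (length W) (\<lambda>s. hyperlog W (chord_from p e s))"
  using W
proof (induction W rule: wf_induct_rule[OF wf_measures[of
  "[length, \<lambda>W. length (takeWhile (\<lambda>a. a = p) W)]"], case_names less])
  case (less W)
  show ?case
  proof (cases W)
    case Nil
    thus ?thesis using log_expansion_const[OF polylog_value_1] by (simp add: hyperlog_Nil)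
  next
    case (Cons b V)
    have V: "hyperlog_word V" using less.prems Cons by (auto simp: hyperlog_word_Cons)
    have expansion: "log_expansion (Ln e) (length V) (\<lambda>s. hyperlog V (chord_from p e s))"
      using less.IH[of V] V Cons by auto
    show ?thesis
    proof (cases "b = p")
      case False
      from log_expansion_hyperlog_Cons[OF p e less.prems[unfolded Cons] this expansion] show ?thesis
        by (simp add: Cons)
    next
      case True
      have "log_expansion (Ln e) (Suc (length V))
        (\<lambda>s. hyperlog (insert_at p i V) (chord_from p e s))" if "i \<in>
        {Suc (length (takeWhile (\<lambda>a. a = p) V))..length V}" for i
        using that less.IH[of "insert_at p i V"] hyperlog_word_insert_at[OF V p, of i]
        by (simp add: Cons True length_insert_at takeWhile_insert_at)
      from log_expansion_hyperlog_Cons_same[OF p e V expansion this] show ?thesis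
        by (simp add: Cons True)
    qed
  qed
qed

end

definition half_disc :: "complex set" where
  "half_disc = {z. norm z < 1 \<and> 0 < Re z}"

lemma half_disc_nonzero:
  "z \<in> half_disc \<Longrightarrow> z \<noteq> 0" and half_disc_norm: "z \<in> half_disc \<Longrightarrow> norm z < 1"
    and half_disc_nonpos: "z \<in> half_disc \<Longrightarrow> z \<notin> \<real>\<^sub>\<le>\<^sub>0"
  by (auto simp: half_disc_def complex_nonpos_Reals_iff)

lemma of_real_in_half_disc: "of_real x \<in> half_disc \<longleftrightarrow> 0 < x \<and> x < 1"
  by (auto simp: half_disc_def)

lemma convex_half_disc: "convex half_disc"
proof -
  have "half_disc = ball 0 1 \<inter> {z. Re z > 0}" by (auto simp: half_disc_def)
  thus ?thesis using convex_Int[OF convex_ball[of 0 1] convex_halfspace_Re_gt[of 0]] by simp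
qed

lemma has_integral_derivative_limits:
  fixes f :: "real \<Rightarrow> 'a :: banach"
  assumes "a < b"
    and f': "\<And>x. a < x \<Longrightarrow> x < b \<Longrightarrow> (f has_vector_derivative f' x) (at x)"
    and l: "(f \<longlongrightarrow> l) (at_right a)"
    and r: "(f \<longlongrightarrow> r) (at_left b)"
  shows "(f' has_integral (r - l)) {a..b}"
proof -
  define h where "h x = (if x \<le> a then l else if x \<ge> b then r else f x)" for x
  have h': "(h has_vector_derivative f' x) (at x)" if "x \<in> {a<..<b}" for x
    by (rule has_vector_derivative_transform_within_open[of f _ x "{a<..<b}"])
      (use that f' in \<open>auto simp: h_def\<close>)
  have "continuous_on {a..b} h"
  proof (rule continuous_on_IccI[OF _ _ _ \<open>a < b\<close>])
    have "(h \<longlongrightarrow> l) (at_right a)"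
      using l
      by (rule Lim_transform_eventually) (use eventually_at_right_real[OF \<open>a < b\<close>] in
        \<open>auto elim!: eventually_mono simp: h_def\<close>)
    thus "(h \<longlongrightarrow> h a) (at_right a)" by (simp add: h_def)
    have "(h \<longlongrightarrow> r) (at_left b)"
      using r
      by (rule Lim_transform_eventually) (use eventually_at_left_real[OF \<open>a < b\<close>] in
        \<open>auto elim!: eventually_mono simp: h_def\<close>)
    thus "(h \<longlongrightarrow> h b) (at_left b)" using \<open>a < b\<close> by (simp add: h_def)
    show "h \<midarrow>x\<rightarrow> h x" if "a < x" "x < b" for x
      using has_vector_derivative_continuous[OF h'[of x]] that by (simp add: isCont_def)
  qed
  from fundamental_theorem_of_calculus_interior[OF _ this h'] show ?thesis
    using \<open>a < b\<close> by (simp add: h_def)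
qed

context roots_of_unity
begin

lemma half_disc_letter: "z \<in> half_disc \<Longrightarrow> letter a \<Longrightarrow> z \<noteq> a"
  using letter_cases[of a] by (auto simp: half_disc_def)

text \<open>On \<open>S\<close>, the function is a combination of products of powers of \<open>Ln\<close> and hyperlogarithms of total
 weight \<open>k\<close>; a form is a combination of such functions times \<open>1 / (z - a)\<close> for letters \<open>a\<close>.\<close>

inductive hyperlog_on :: "complex set \<Rightarrow> nat \<Rightarrow> (complex \<Rightarrow> complex) \<Rightarrow> bool" for S where
  monomial: "polylog_value a c \<Longrightarrow> hyperlog_word W \<Longrightarrow> a + j + length W = k \<Longrightarrow>
    hyperlog_on S k (\<lambda>z. c * Ln z^j * hyperlog W z)"
| add: "hyperlog_on S k f \<Longrightarrow> hyperlog_on S k g \<Longrightarrow> hyperlog_on S k (\<lambda>z. f z + g z)"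
| eq_on: "hyperlog_on S k f \<Longrightarrow> (\<And>z. z \<in> S \<Longrightarrow> g z = f z) \<Longrightarrow> hyperlog_on S k g"

inductive hyperlog_form :: "complex set \<Rightarrow> nat \<Rightarrow> (complex \<Rightarrow> complex) \<Rightarrow> bool" for S where
  pole: "hyperlog_on S k f \<Longrightarrow> letter a \<Longrightarrow> hyperlog_form S k (\<lambda>z. f z/(z - a))"
| add: "hyperlog_form S k f \<Longrightarrow> hyperlog_form S k g \<Longrightarrow> hyperlog_form S k (\<lambda>z. f z + g z)"
| eq_on: "hyperlog_form S k f \<Longrightarrow> (\<And>z. z \<in> S \<Longrightarrow> g z = f z) \<Longrightarrow> hyperlog_form S k g"

definition expansion_path :: "complex set \<Rightarrow> (real \<Rightarrow> complex) \<Rightarrow> complex \<Rightarrow> bool" where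
  "expansion_path S \<gamma> \<kappa> \<longleftrightarrow> (\<forall>\<^sub>F s in at_right 0. \<gamma> s \<in> S) \<and>
    (\<forall>k f. hyperlog_on S k f \<longrightarrow> log_expansion \<kappa> k (\<lambda>s. f (\<gamma> s)))"

lemma hyperlog_on_subset: "hyperlog_on S k f \<Longrightarrow> T \<subseteq> S \<Longrightarrow> hyperlog_on T k f"
proof (induction rule: hyperlog_on.induct)
  case (eq_on k f g)
  thus ?case by (intro hyperlog_on.eq_on[of T k f g]) auto
qed (auto intro: hyperlog_on.intros)

lemma expansion_path_mono: "expansion_path S \<gamma> \<kappa> \<Longrightarrow> S \<subseteq> T \<Longrightarrow> expansion_path T \<gamma> \<kappa>"
  unfolding expansion_path_def by (auto dest: hyperlog_on_subset elim: eventually_mono)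

lemma hyperlog_on_const: "polylog_value k c \<Longrightarrow> hyperlog_on S k (\<lambda>_. c)"
  using hyperlog_on.monomial[of k c "[]" 0 k] by (simp add: hyperlog_Nil)

lemma hyperlog_on_hyperlog: "hyperlog_word W \<Longrightarrow> hyperlog_on S (length W) (hyperlog W)"
  using hyperlog_on.monomial[OF polylog_value_1, of W 0 "length W"] by simp

lemma hyperlog_on_mult_of_monomials:
  assumes "hyperlog_on S k f"
    and "\<And>a c W j. polylog_value a c \<Longrightarrow> hyperlog_word W \<Longrightarrow> a + j + length W = k \<Longrightarrow>
      hyperlog_on S k' (\<lambda>z. h z * (c * Ln z^j * hyperlog W z))"
  shows "hyperlog_on S k' (\<lambda>z. h z * f z)"
  using assms
proof (induction rule: hyperlog_on.induct)
  case (add k f g)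
  thus ?case
    using hyperlog_on.add[of S k' "\<lambda>z. h z * f z" "\<lambda>z. h z * g z"] by (simp add: distrib_left)
next
  case (eq_on k f g)
  show ?case by (rule hyperlog_on.eq_on[OF eq_on.IH[OF eq_on.prems]]) (simp_all add: eq_on.hyps)
qed

lemma hyperlog_on_cmult:
  assumes "hyperlog_on S k f" "polylog_value a c"
  shows "hyperlog_on S (a + k) (\<lambda>z. c * f z)"
proof (rule hyperlog_on_mult_of_monomials[OF assms(1)])
  fix b d W j assume W: "polylog_value b d" "hyperlog_word W" "b + j + length W = k"
  from hyperlog_on.monomial[OF polylog_value_mult[OF assms(2) W(1)] W(2), of j "a + k"] W(3)
  show "hyperlog_on S (a + k) (\<lambda>z. c * (d * Ln z^j * hyperlog W z))" by (simp add: mult.assoc)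
qed

lemma hyperlog_on_Ln_power_mult:
  assumes "hyperlog_on S k f"
  shows "hyperlog_on S (k + i) (\<lambda>z. Ln z^i * f z)"
proof (rule hyperlog_on_mult_of_monomials[OF assms])
  fix a c W j assume W: "polylog_value a c" "hyperlog_word W" "a + j + length W = k"
  from hyperlog_on.monomial[OF W(1,2), of "i + j" "k + i"] W(3)
  show "hyperlog_on S (k + i) (\<lambda>z. Ln z^i * (c * Ln z^j * hyperlog W z))"
    by (simp add: mult_ac power_add)
qed

lemma hyperlog_on_diff:
  assumes "hyperlog_on S k f" "hyperlog_on S k g"
  shows "hyperlog_on S k (\<lambda>z. f z - g z)"
  using hyperlog_on.add[OF assms(1) hyperlog_on_cmult[OF assms(2) polylog_value_of_rat[of "-1"],
    simplified]]
  by simp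

lemma log_expansion_hyperlog_on:
  "expansion_path S \<gamma> \<kappa> \<Longrightarrow> hyperlog_on S k f \<Longrightarrow> log_expansion \<kappa> k (\<lambda>s. f (\<gamma> s))"
    and eventually_expansion_path: "expansion_path S \<gamma> \<kappa> \<Longrightarrow> \<forall>\<^sub>F s in at_right 0. \<gamma> s \<in> S"
  by (auto simp: expansion_path_def)

lemma expansion_pathI:
  assumes S: "\<forall>\<^sub>F s in at_right 0. \<gamma> s \<in> S"
    and Ln: "log_expansion \<kappa> 1 (\<lambda>s. Ln (\<gamma> s))"
    and hyperlog: "\<And>W. hyperlog_word W \<Longrightarrow> log_expansion \<kappa> (length W) (\<lambda>s. hyperlog W (\<gamma> s))"
  shows "expansion_path S \<gamma> \<kappa>"
  unfolding expansion_path_def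
proof (intro conjI allI impI S)
  fix k f assume "hyperlog_on S k f"
  thus "log_expansion \<kappa> k (\<lambda>s. f (\<gamma> s))"
  proof (induction rule: hyperlog_on.induct)
    case (monomial a c W j k)
    from log_expansion_mult[OF log_expansion_cmult[OF monomial(1) log_expansion_power[OF Ln, of j]]
      hyperlog[OF monomial(2)]]
    show ?case using monomial(3) by simp
  next
    case (add k f g)
    show ?case by (rule log_expansion.add[OF add.IH])
  next
    case (eq_on k f g)
    show ?case
      by (rule log_expansion_cong[OF eq_on.IH]) (use S eq_on.hyps in \<open>auto elim: eventually_mono\<close>)
  qed
qed

lemma power_decay_hyperlog_at_0:
  assumes "hyperlog_word W" "W \<noteq> []"
  shows "power_decay (\<lambda>s. hyperlog W (of_real s))"
proof -
  have bound: "norm (hyperlog W (of_real s)) \<le> 2 * s" if s: "0 < s" "s < 1/2" for s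
  proof -
    have "(\<lambda>n. hyperlog_coeff W n * of_real s^n) sums hyperlog W (of_real s)"
      using assms s by (intro hyperlog_sums hyperlog_word_letters) auto
    hence "(\<lambda>n. hyperlog_coeff W (Suc n) * of_real s^Suc n) sums hyperlog W (of_real s)"
      using assms(2) by (subst sums_Suc_iff) (simp add: hyperlog_coeff_0)
    moreover have "(\<lambda>n. s * s^n) sums (s * (1/(1 - s)))"
      using s by (intro sums_mult geometric_sums) auto
    ultimately have "norm (hyperlog W (of_real s)) \<le> s * (1/(1 - s))"
    proof (rule norm_sums_le)
      fix n
      have "norm (hyperlog_coeff W (Suc n)) \<le> 1"
        using assms by (intro norm_hyperlog_coeff_le hyperlog_word_letters)
      thus "norm (hyperlog_coeff W (Suc n) * of_real s^Suc n) \<le> s * s^n"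
        using s by (simp add: norm_mult norm_power mult_left_le_one_le del: hyperlog_coeff.simps)
    qed
    also have "... \<le> s * 2" using s by (intro mult_left_mono) (auto simp: field_simps)
    finally show ?thesis by simp
  qed
  have "powr_bound 1 (\<lambda>s. hyperlog W (of_real s))"
    using eventually_at_right_0_half bound by (intro bigoI[of _ 2]) (auto elim!: eventually_mono)
  thus ?thesis unfolding power_decay_def by (intro exI[of _ 1]) auto
qed

lemma expansion_path_of_real:
  assumes S: "\<forall>\<^sub>F s in at_right 0. of_real s \<in> S"
  shows "expansion_path S of_real 0"
proof (rule expansion_pathI[OF S])
  show "log_expansion 0 1 (\<lambda>s. Ln (of_real s))"
  proof (rule log_expansion_cong[OF log_expansion_shifted_ln])
    show "\<forall>\<^sub>F s in at_right 0. shifted_ln 0 s = Ln (of_real s)"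
      using eventually_at_right_less[of "0::real"]
      by eventually_elim (simp add: shifted_ln_def Ln_of_real)
  qed
  fix W assume "hyperlog_word W"
  thus "log_expansion 0 (length W) (\<lambda>s. hyperlog W (of_real s))"
    using log_expansion_const[OF polylog_value_1] power_decay_hyperlog_at_0
    by (cases "W = []") (auto simp: hyperlog_Nil intro: log_expansion.decay)
qed

lemma power_decay_Ln_diff:
  assumes "p \<notin> \<real>\<^sub>\<le>\<^sub>0"
  shows "power_decay (\<lambda>s. Ln (chord_from p e s) - Ln p)"
proof -
  let ?\<gamma> = "chord_from p e"
  define D where "D z = (if z = p then 1/p else (Ln z - Ln p)/(z - p))" for z
  have "((\<lambda>z. (Ln z - Ln p)/(z - p)) \<longlongrightarrow> inverse p) (at p)"
    using has_field_derivative_Ln[OF assms] by (simp add: has_field_derivative_iff)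
  hence "isCont D p"
    unfolding isCont_def D_def
    by (rule Lim_transform_eventually[THEN tendsto_eq_rhs]) (auto simp: eventually_at_filter
      divide_inverse)
  hence "((\<lambda>s. D (?\<gamma> s)) \<longlongrightarrow> D p) (at_right 0)"
    by (rule isCont_tendsto_compose[OF _ tendsto_chord_from])
  hence "slow_growth (\<lambda>s. D (?\<gamma> s) * (-(p * e)))"
    by (intro slow_growth_mult slow_growth_const slow_growth_tendsto)
  from power_decay_mult_slow_growth[OF power_decay_of_real this] show ?thesis
  proof (rule power_decay_cong)
    have "of_real s * (D (?\<gamma> s) * -(p * e)) = Ln (?\<gamma> s) - Ln p" for s
    proof -
      have "D (?\<gamma> s) * (?\<gamma> s - p) = Ln (?\<gamma> s) - Ln p" by (simp add: D_def)
      moreover have "?\<gamma> s - p = of_real s * -(p * e)" by (simp add: chord_from_def algebra_simps)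
      ultimately show ?thesis by (simp add: mult_ac)
    qed
    thus "\<forall>\<^sub>F s in at_right 0. of_real s * (D (?\<gamma> s) * -(p * e)) = Ln (?\<gamma> s) - Ln p" by simp
  qed
qed

lemma expansion_path_root:
  assumes p: "p^N = 1" "p \<notin> \<real>\<^sub>\<le>\<^sub>0" "polylog_value 1 (Ln p)"
    and e: "norm e = 1" "Re e \<ge> 1/2"
    and S: "\<forall>\<^sub>F s in at_right 0. chord_from p e s \<in> S"
  shows "expansion_path S (chord_from p e) (Ln e)"
proof (rule expansion_pathI[OF S _ log_expansion_hyperlog[OF p(1) e]])
  from log_expansion.add[OF log_expansion_const[OF p(3)]
    log_expansion.decay[OF power_decay_Ln_diff[OF p(2)]]]
  show "log_expansion (Ln e) 1 (\<lambda>s. Ln (chord_from p e s))" by simp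
qed

lemma Ln_power_primitive:
  shows "\<exists>F. hyperlog_on S (Suc j) F \<and> (\<forall>z. z \<notin> \<real>\<^sub>\<le>\<^sub>0 \<longrightarrow> (F has_field_derivative Ln z^j/z) (at z))"
proof (intro exI conjI allI impI)
  let ?q = "of_rat (1/of_nat (Suc j)) :: complex"
  show "hyperlog_on S (Suc j) (\<lambda>z. ?q * Ln z^Suc j * hyperlog [] z)"
    by (rule hyperlog_on.monomial[OF polylog_value_of_rat]) auto
  fix z :: complex assume z: "z \<notin> \<real>\<^sub>\<le>\<^sub>0"
  have "((\<lambda>z. ?q * Ln z^Suc j) has_field_derivative
    ?q * (of_nat (Suc j) * (inverse z * Ln z^(Suc j - Suc 0)))) (at z)"
    by (rule DERIV_cmult[OF DERIV_power[OF has_field_derivative_Ln[OF z]]])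
  moreover have "?q * (of_nat (Suc j) * y) = y" for y by (simp add: of_rat_divide del: of_nat_Suc)
  hence "?q * (of_nat (Suc j) * (inverse z * Ln z^(Suc j - Suc 0))) = Ln z^j/z"
    by (simp only: diff_Suc_Suc diff_zero) (simp only: divide_inverse mult.commute)
  ultimately show "((\<lambda>z. ?q * Ln z^Suc j * hyperlog [] z) has_field_derivative Ln z^j/z) (at z)"
    by (simp only: hyperlog_Nil mult_1_right)
qed

lemma has_field_derivative_Ln_power_hyperlog_by_parts:
  assumes z: "z \<notin> \<real>\<^sub>\<le>\<^sub>0" "norm z < 1"
    and W: "hyperlog_word (a # W)"
    and G: "(G has_field_derivative Ln z^i * hyperlog (a # W) z/z) (at z)"
  shows "((\<lambda>z. Ln z^Suc i * hyperlog (a # W) z - of_nat (Suc i) * G z) has_field_derivative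
    Ln z^Suc i * hyperlog W z/(z - a)) (at z)"
proof -
  have "z \<noteq> 0" using z by auto
  hence "((\<lambda>z. Ln z^Suc i * hyperlog (a # W) z - of_nat (Suc i) * G z) has_field_derivative
    of_nat (Suc i) * (inverse z * Ln z^(Suc i - Suc 0)) * hyperlog (a # W) z + hyperlog W z/(z - a)
    * Ln z^Suc i - of_nat (Suc i) * (Ln z^i * hyperlog (a # W) z/z)) (at z)"
    by (intro DERIV_diff DERIV_mult DERIV_cmult DERIV_power has_field_derivative_Ln z G
      has_field_derivative_hyperlog W)
  thus ?thesis by (rule DERIV_cong) (simp add: divide_inverse del: of_nat_Suc)
qed

lemma Ln_power_hyperlog_primitive:
  assumes S: "S \<subseteq> half_disc" and "hyperlog_word W" "letter a"
  shows "\<exists>F. hyperlog_on S (Suc (j + length W)) F \<and>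
    (\<forall>z\<in>S. (F has_field_derivative Ln z^j * hyperlog W z/(z - a)) (at z))"
proof (cases "a = 0 \<and> W = []")
  case True
  obtain F where "hyperlog_on S (Suc j) F" "\<forall>z. z \<notin> \<real>\<^sub>\<le>\<^sub>0 \<longrightarrow>
    (F has_field_derivative Ln z^j/z) (at z)"
    using Ln_power_primitive by blast
  thus ?thesis using True S half_disc_nonpos by (intro exI[of _ F]) (auto simp: hyperlog_Nil)
next
  case False
  hence "hyperlog_word (a # W)" using assms by (auto simp: hyperlog_word_Cons)
  thus ?thesis
  proof (induction j arbitrary: W a)
    case 0
    have "hyperlog_on S (Suc (0 + length W)) (hyperlog (a # W))"
      using hyperlog_on_hyperlog[OF 0] by simp
    thus ?case using has_field_derivative_hyperlog[OF 0] half_disc_norm half_disc_nonzero S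
      by (intro exI[of _ "hyperlog (a # W)"]) auto
  next
    case (Suc i)
    obtain G where G: "hyperlog_on S (Suc (i + length (a # W))) G" "\<And>z. z \<in> S \<Longrightarrow>
      (G has_field_derivative Ln z^i * hyperlog (a # W) z/(z - 0)) (at z)"
      using Suc.IH[of 0 "a # W"] Suc.prems by (auto simp: hyperlog_word_Cons)
    have "hyperlog_on S (Suc (i + length (a # W))) (\<lambda>z. 1 * Ln z^Suc i * hyperlog (a # W) z
      - of_rat (of_nat (Suc i)) * G z)"
      using hyperlog_on_cmult[OF G(1) polylog_value_of_rat]
      by (intro hyperlog_on_diff hyperlog_on.monomial[OF polylog_value_1 Suc.prems]) auto
    moreover have
      "((\<lambda>z. Ln z^Suc i * hyperlog (a # W) z - of_nat (Suc i) * G z) has_field_derivative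
      Ln z^Suc i * hyperlog W z/(z - a)) (at z)" if "z \<in> S" for z
      using that S G(2) Suc.prems half_disc_nonpos half_disc_norm
      by (intro has_field_derivative_Ln_power_hyperlog_by_parts) auto
    ultimately show ?case
      by (intro exI[of _ "\<lambda>z. Ln z^Suc i * hyperlog (a # W) z - of_nat (Suc i) * G z"])
        (simp del: of_nat_Suc power_Suc)
  qed
qed

lemma hyperlog_on_primitive:
  assumes "hyperlog_on S k f" "S \<subseteq> half_disc" "letter a"
  shows "\<exists>F. hyperlog_on S (Suc k) F \<and> (\<forall>z\<in>S. (F has_field_derivative f z/(z - a)) (at z))"
  using assms
proof (induction rule: hyperlog_on.induct)
  case (monomial b c W j k)
  obtain F where F: "hyperlog_on S (Suc (j + length W)) F"
    "\<forall>z\<in>S. (F has_field_derivative Ln z^j * hyperlog W z/(z - a)) (at z)"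
    using Ln_power_hyperlog_primitive[OF monomial(4,2,5)] by blast
  have "hyperlog_on S (Suc k) (\<lambda>z. c * F z)"
    using hyperlog_on_cmult[OF F(1) monomial(1)] monomial(3) by (auto simp: add.assoc)
  moreover have "((\<lambda>z. c * F z) has_field_derivative c * Ln z^j * hyperlog W z/(z - a)) (at z)"
    if "z \<in> S" for z
    using DERIV_cmult[OF F(2)[rule_format, OF that], of c] by (simp add: mult.assoc)
  ultimately show ?case by blast
next
  case (add k f g)
  then obtain F G where F: "hyperlog_on S (Suc k) F"
    "\<forall>z\<in>S. (F has_field_derivative f z/(z - a)) (at z)" and G: "hyperlog_on S (Suc k) G"
    "\<forall>z\<in>S. (G has_field_derivative g z/(z - a)) (at z)"
    by blast
  show ?case using hyperlog_on.add[OF F(1) G(1)] DERIV_add[OF F(2)[rule_format] G(2)[rule_format]]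
    by (intro exI[of _ "\<lambda>z. F z + G z"]) (simp add: add_divide_distrib)
next
  case (eq_on k f g)
  thus ?case by auto
qed

lemma hyperlog_form_primitive:
  assumes "hyperlog_form S k g" "S \<subseteq> half_disc"
  shows "\<exists>F. hyperlog_on S (Suc k) F \<and> (\<forall>z\<in>S. (F has_field_derivative g z) (at z))"
  using assms
proof (induction rule: hyperlog_form.induct)
  case (pole k f a)
  thus ?case using hyperlog_on_primitive by blast
next
  case (add k f g)
  then obtain F G where F: "hyperlog_on S (Suc k) F" "\<forall>z\<in>S. (F has_field_derivative f z) (at z)"
    and G: "hyperlog_on S (Suc k) G" "\<forall>z\<in>S. (G has_field_derivative g z) (at z)"
    by blast
  show ?case using hyperlog_on.add[OF F(1) G(1)] DERIV_add[OF F(2)[rule_format] G(2)[rule_format]]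
    by (intro exI[of _ "\<lambda>z. F z + G z"]) simp
next
  case (eq_on k f g)
  thus ?case by auto
qed

lemma hyperlog_on_of_derivative:
  assumes \<gamma>: "expansion_path S \<gamma> \<kappa>"
    and S: "convex S" "S \<subseteq> half_disc"
    and F: "\<And>z. z \<in> S \<Longrightarrow> (F has_field_derivative g z) (at z within S)"
    and g: "hyperlog_form S k g"
    and lim: "((\<lambda>s. F (\<gamma> s)) \<longlongrightarrow> v) (at_right 0)"
    and v: "polylog_value (Suc k) v"
  shows "hyperlog_on S (Suc k) F"
proof -
  obtain G where G: "hyperlog_on S (Suc k) G" "\<And>z. z \<in> S \<Longrightarrow> (G has_field_derivative g z) (at z)"
    using hyperlog_form_primitive[OF g S(2)] by blast
  have "\<exists>c. \<forall>z\<in>S. F z - G z = c"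
  proof (rule has_field_derivative_zero_constant[OF S(1)])
    fix z assume z: "z \<in> S"
    have "((\<lambda>z. F z - G z) has_field_derivative g z - g z) (at z within S)"
      using z by (intro DERIV_diff F has_field_derivative_at_within[OF G(2)])
    thus "((\<lambda>z. F z - G z) has_field_derivative 0) (at z within S)" by simp
  qed
  then obtain c where c: "\<And>z. z \<in> S \<Longrightarrow> F z - G z = c" by blast
  have "((\<lambda>s. F (\<gamma> s) - c) \<longlongrightarrow> v - c) (at_right 0)" by (intro tendsto_intros lim)
  moreover have "\<forall>\<^sub>F s in at_right 0. F (\<gamma> s) - c = G (\<gamma> s)"
    using eventually_expansion_path[OF \<gamma>] by eventually_elim (use c in \<open>auto simp: algebra_simps\<close>)
  ultimately have "((\<lambda>s. G (\<gamma> s)) \<longlongrightarrow> v - c) (at_right 0)" by (rule Lim_transform_eventually)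
  from log_expansion_tendsto(1)[OF log_expansion_hyperlog_on[OF \<gamma> G(1)] this]
  have "polylog_value (Suc k) c" using polylog_value_diff[OF v] by fastforce
  from hyperlog_on.add[OF G(1) hyperlog_on_const[OF this]] show ?thesis
    by (rule hyperlog_on.eq_on) (use c in \<open>auto simp: algebra_simps\<close>)
qed

lemma hyperlog_on_hyperlog_Cons_mult:
  assumes words: "hyperlog_word (a # V)" "hyperlog_word (b # W)"
    and "hyperlog_on half_disc k (\<lambda>z. hyperlog V z * hyperlog (b # W) z)"
    and "hyperlog_on half_disc k (\<lambda>z. hyperlog (a # V) z * hyperlog W z)"
  shows "hyperlog_on half_disc (Suc k) (\<lambda>z. hyperlog (a # V) z * hyperlog (b # W) z)"
proof (rule hyperlog_on_of_derivative[OF expansion_path_of_real convex_half_disc subset_refl])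
  show "\<forall>\<^sub>F s in at_right 0. of_real s \<in> half_disc"
    using eventually_at_right_0_1 by (simp add: of_real_in_half_disc)
  fix z assume z: "z \<in> half_disc"
  note z' = half_disc_norm[OF z] half_disc_nonzero[OF z]
  show "((\<lambda>z. hyperlog (a # V) z * hyperlog (b # W) z) has_field_derivative
    hyperlog V z * hyperlog (b # W) z/(z - a) + hyperlog (a # V) z * hyperlog W z/(z - b))
    (at z within half_disc)"
    by (rule has_field_derivative_at_within, rule
      DERIV_cong[OF DERIV_mult[OF has_field_derivative_hyperlog[OF words(1) z']
      has_field_derivative_hyperlog[OF words(2) z']]]) (simp add: mult.commute)
next
  show "hyperlog_form half_disc k (\<lambda>z. hyperlog V z * hyperlog (b # W) z/(z - a)
    + hyperlog (a # V) z * hyperlog W z/(z - b))"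
    using assms by (intro hyperlog_form.add hyperlog_form.pole) (auto simp: hyperlog_word_Cons)
  have "power_decay (\<lambda>s. hyperlog (a # V) (of_real s) * hyperlog (b # W) (of_real s))" using words
    by (intro power_decay_mult_slow_growth power_decay_imp_slow_growth power_decay_hyperlog_at_0)
      auto
  thus "((\<lambda>s. hyperlog (a # V) (of_real s) * hyperlog (b # W) (of_real s)) \<longlongrightarrow> 0) (at_right 0)"
    by (rule power_decay_tendsto)
qed (rule polylog_value.zero)

lemma hyperlog_on_hyperlog_mult:
  assumes "hyperlog_word V" "hyperlog_word W"
  shows "hyperlog_on half_disc (length V + length W) (\<lambda>z. hyperlog V z * hyperlog W z)"
  using assms
proof (induction "length V + length W" arbitrary: V W rule: less_induct)
  case less
  show ?case
  proof (cases "V = [] \<or> W = []")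
    case True
    thus ?thesis using hyperlog_on_hyperlog[OF less.prems(1)] hyperlog_on_hyperlog[OF less.prems(2)]
      by (auto simp: hyperlog_Nil)
  next
    case False
    then obtain a V' b W' where VW: "V = a # V'" "W = b # W'" by (auto simp: neq_Nil_conv)
    have "hyperlog_word V'" "hyperlog_word W'"
      using less.prems VW by (auto simp: hyperlog_word_Cons)
    thus ?thesis
      using less.hyps[of V' W] less.hyps[of V W'] less.prems hyperlog_on_hyperlog_Cons_mult[of a V'
        b W' "Suc (length V' + length W')"]
      by (simp add: VW)
  qed
qed

lemma hyperlog_on_mult:
  assumes S: "S \<subseteq> half_disc" and f: "hyperlog_on S j f" and g: "hyperlog_on S k g"
  shows "hyperlog_on S (j + k) (\<lambda>z. f z * g z)"
proof (rule hyperlog_on_mult_of_monomials[OF g])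
  fix b d W l assume W: "polylog_value b d" "hyperlog_word W" "b + l + length W = k"
  have "hyperlog_on S (j + k) (\<lambda>z. d * Ln z^l * hyperlog W z * f z)"
  proof (rule hyperlog_on_mult_of_monomials[OF f])
    fix a c V i assume V: "polylog_value a c" "hyperlog_word V" "a + i + length V = j"
    have "a + b + (length V + length W + (i + l)) = j + k" using V(3) W(3) by simp
    hence "hyperlog_on S (j + k) (\<lambda>z. c * d * (Ln z^(i + l) * (hyperlog V z * hyperlog W z)))"
      using hyperlog_on_cmult[OF hyperlog_on_Ln_power_mult[OF
        hyperlog_on_subset[OF hyperlog_on_hyperlog_mult[OF V(2) W(2)] S], of "i + l"]
        polylog_value_mult[OF V(1) W(1)]]
      by simp
    thus "hyperlog_on S (j + k) (\<lambda>z. d * Ln z^l * hyperlog W z * (c * Ln z^i * hyperlog V z))"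
      by (rule hyperlog_on.eq_on) (simp add: power_add mult_ac)
  qed
  thus "hyperlog_on S (j + k) (\<lambda>z. f z * (d * Ln z^l * hyperlog W z))" by (simp add: mult.commute)
qed

lemma hyperlog_on_power: "S \<subseteq> half_disc \<Longrightarrow> hyperlog_on S k f \<Longrightarrow> hyperlog_on S (n * k) (\<lambda>z. f z^n)"
proof (induction n)
  case 0
  thus ?case using hyperlog_on_const[OF polylog_value_1] by simp
next
  case (Suc n)
  thus ?case using hyperlog_on_mult[of S k f "n * k" "\<lambda>z. f z^n"] by simp
qed

lemma hyperlog_form_mult_of_poles:
  assumes "hyperlog_form S k g"
    and "\<And>f a. hyperlog_on S k f \<Longrightarrow> letter a \<Longrightarrow> hyperlog_form S k' (\<lambda>z. h z * f z/(z - a))"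
  shows "hyperlog_form S k' (\<lambda>z. h z * g z)"
  using assms
proof (induction rule: hyperlog_form.induct)
  case (add k f g)
  thus ?case
    using hyperlog_form.add[of S k' "\<lambda>z. h z * f z" "\<lambda>z. h z * g z"] by (simp add: distrib_left)
next
  case (eq_on k f g)
  show ?case by (rule hyperlog_form.eq_on[OF eq_on.IH[OF eq_on.prems]]) (simp_all add: eq_on.hyps)
qed simp

lemma hyperlog_form_mult:
  "S \<subseteq> half_disc \<Longrightarrow> hyperlog_on S j f \<Longrightarrow> hyperlog_form S k g \<Longrightarrow>
    hyperlog_form S (j + k) (\<lambda>z. f z * g z)"
  by (rule hyperlog_form_mult_of_poles) (auto intro: hyperlog_form.pole hyperlog_on_mult)

lemma hyperlog_form_pole_mult:
  "hyperlog_on S k f \<Longrightarrow> letter a \<Longrightarrow> hyperlog_form S k (\<lambda>z. 1/(z - a) * f z)"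
  using hyperlog_form.pole[of S k f a] by simp

lemma hyperlog_form_0: "hyperlog_form S k (\<lambda>_. 0)"
  using hyperlog_form.pole[OF hyperlog_on_const[OF polylog_value.zero], of 0 S k] by simp

lemma hyperlog_form_simple_pole: "letter a \<Longrightarrow> hyperlog_form S 0 (\<lambda>z. 1/(z - a))"
  using hyperlog_form.pole[OF hyperlog_on_const[OF polylog_value_1], of a S] by simp

lemma hyperlog_form_rat_mult:
  assumes "hyperlog_form S k g"
  shows "hyperlog_form S k (\<lambda>z. of_rat q * g z)"
proof (rule hyperlog_form_mult_of_poles[OF assms])
  fix f a assume f: "hyperlog_on S k f" "letter a"
  from hyperlog_form.pole[OF hyperlog_on_cmult[OF f(1) polylog_value_of_rat] f(2)]
  show "hyperlog_form S k (\<lambda>z. of_rat q * f z/(z - a))" by simp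
qed

lemma hyperlog_form_of_nat_mult: "hyperlog_form S k g \<Longrightarrow> hyperlog_form S k (\<lambda>z. of_nat n * g z)"
  using hyperlog_form_rat_mult[of S k g "of_nat n"] by simp

lemma hyperlog_form_uminus: "hyperlog_form S k g \<Longrightarrow> hyperlog_form S k (\<lambda>z. -g z)"
  using hyperlog_form_rat_mult[of S k g "-1"] by simp

lemma hyperlog_form_diff:
  "hyperlog_form S k f \<Longrightarrow> hyperlog_form S k g \<Longrightarrow> hyperlog_form S k (\<lambda>z. f z - g z)"
  using hyperlog_form.add[OF _ hyperlog_form_uminus, of S k f g] by simp

lemma hyperlog_on_path_limit:
  assumes G: "hyperlog_on S k G"
    and \<gamma>: "expansion_path S \<gamma> \<kappa>"
    and f': "\<forall>\<^sub>F s in at_right 0. ((\<lambda>s. G (\<gamma> s)) has_vector_derivative f' s) (at s)"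
    and decay: "power_decay (\<lambda>s. of_real s * f' s)"
  shows "\<exists>v. polylog_value k v \<and> ((\<lambda>s. G (\<gamma> s)) \<longlongrightarrow> v) (at_right 0)"
proof -
  obtain v where "power_decay (\<lambda>s. G (\<gamma> s) - v)" using power_decay_minus_limit[OF f' decay] by blast
  hence "((\<lambda>s. G (\<gamma> s)) \<longlongrightarrow> v) (at_right 0)" by (intro LIM_zero_cancel[OF power_decay_tendsto])
  thus ?thesis using log_expansion_tendsto(1)[OF log_expansion_hyperlog_on[OF \<gamma> G]] by blast
qed

theorem hyperlog_form_contour_integral:
  assumes S: "S \<subseteq> half_disc" "\<And>x. 0 < x \<Longrightarrow> x < 1 \<Longrightarrow> linepath P Q x \<in> S"
    and g: "hyperlog_form S k g"
    and start: "expansion_path S (linepath P Q) \<kappa>"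
      "power_decay (\<lambda>s. of_real s * g (linepath P Q s))"
    and finish: "expansion_path S (linepath Q P) \<kappa>'"
      "power_decay (\<lambda>s. of_real s * g (linepath Q P s))"
  shows "\<exists>v. polylog_value (Suc k) v \<and> (g has_contour_integral v) (linepath P Q)"
proof -
  obtain G where G: "hyperlog_on S (Suc k) G" "\<And>z. z \<in> S \<Longrightarrow> (G has_field_derivative g z) (at z)"
    using hyperlog_form_primitive[OF g S(1)] by blast
  have derivative:
    "((\<lambda>x. G (linepath A B x)) has_vector_derivative g (linepath A B x) * (B - A)) (at x)"
    if "linepath A B x \<in> S" for A B x
    using field_vector_diff_chain_at[OF has_vector_derivative_linepath_within G(2)[OF that]]
    by (simp add: o_def mult.commute)
  have endpoint: "\<exists>v. polylog_value (Suc k) v \<and> ((\<lambda>s. G (linepath A B s)) \<longlongrightarrow> v) (at_right 0)"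
    if "expansion_path S (linepath A B) \<kappa>" "power_decay (\<lambda>s. of_real s * g (linepath A B s))"
    for A B \<kappa>
  proof (rule hyperlog_on_path_limit[OF G(1) that(1)
    eventually_mono[OF eventually_expansion_path[OF that(1)] derivative]])
    show "power_decay (\<lambda>s. of_real s * (g (linepath A B s) * (B - A)))"
      using power_decay_mult_slow_growth[OF that(2) slow_growth_const[of "B - A"]]
      by (simp add: mult.assoc)
  qed
  obtain v0 where v0: "polylog_value (Suc k) v0" "((\<lambda>s. G (linepath P Q s)) \<longlongrightarrow> v0) (at_right 0)"
    using endpoint[OF start] by blast
  obtain v1 where v1: "polylog_value (Suc k) v1" "((\<lambda>s. G (linepath Q P s)) \<longlongrightarrow> v1) (at_right 0)"
    using endpoint[OF finish] by blast
  have "linepath Q P s = linepath P Q (1 - s)" for s by (simp add: linepath_def algebra_simps)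
  with v1(2) have "((\<lambda>s. G (linepath P Q s)) \<longlongrightarrow> v1) (at_left 1)"
    by (subst filterlim_at_left_to_right, subst filterlim_at_right_to_0) (simp add: algebra_simps)
  from has_integral_derivative_limits[OF _ derivative[OF S(2)] v0(2) this]
  have "(g has_contour_integral (v1 - v0)) (linepath P Q)"
    by (simp add: has_contour_integral_linepath)
  thus ?thesis using polylog_value_diff[OF v1(1) v0(1)] by blast
qed

end

section \<open>Integrals of powers of a logarithm along moving paths\<close>

interpretation roots_of_unity 6 by unfold_locales simp

lemma rho_explicit: "rho = Complex (1/2) (sqrt 3/2)"
proof -
  have "rho = cis (pi/3)" by (simp add: rho_def cis_conv_exp mult.commute)
  thus ?thesis by (simp add: complex_eq_iff cos_60 sin_60)
qed

lemma Re_rho: "Re rho = 1/2" and Im_rho: "Im rho = sqrt 3/2"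
  by (simp_all add: rho_explicit)

lemma rho_add_cnj: "rho + cnj rho = 1" and rho_mult_cnj: "rho * cnj rho = 1"
  by (simp_all add: rho_explicit complex_eq_iff)

definition Q3_root :: "complex \<Rightarrow> bool" where
  "Q3_root b \<longleftrightarrow> b = rho \<or> b = cnj rho"

lemma Q3_root_rho [simp]: "Q3_root rho" and Q3_root_cnj_rho [simp]: "Q3_root (cnj rho)"
  by (simp_all add: Q3_root_def)

lemma Q3_root_cnj: "Q3_root b \<Longrightarrow> Q3_root (cnj b)"
  by (auto simp: Q3_root_def)

lemma Q3_root_add_cnj: "Q3_root b \<Longrightarrow> b + cnj b = 1" and Q3_root_mult_cnj: "Q3_root b \<Longrightarrow> b * cnj b = 1"
  using rho_add_cnj rho_mult_cnj by (auto simp: Q3_root_def add.commute mult.commute)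

lemma Q3_root_pow_6: "Q3_root b \<Longrightarrow> b^6 = 1"
proof -
  assume "Q3_root b"
  hence "b^2 - b + 1 = 0" using Q3_root_add_cnj[of b] Q3_root_mult_cnj[of b] by algebra
  thus ?thesis by algebra
qed

lemma letter_Q3_root:
  "Q3_root b \<Longrightarrow> letter b" and letter_1 [simp]: "letter 1" and letter_minus_1 [simp]: "letter (-1)"
  using Q3_root_pow_6 by (auto simp: letter_def)

lemma letter_rho [simp]: "letter rho" and letter_cnj_rho [simp]: "letter (cnj rho)"
  by (simp_all add: letter_Q3_root)

lemma Q3_root_nonzero: "Q3_root b \<Longrightarrow> b \<noteq> 0" and norm_Q3_root: "Q3_root b \<Longrightarrow> norm b = 1"
  using Q3_root_pow_6 norm_root_unity by fastforce+

lemma rho_nonzero [simp]: "rho \<noteq> 0" and norm_rho [simp]: "norm rho = 1"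
  by (simp_all add: Q3_root_nonzero norm_Q3_root)

lemma inverse_rho: "inverse rho = cnj rho"
  using rho_mult_cnj by (simp add: field_simps)

lemma Q3_eq: "Q3 x = x\<^sup>2 - x + 1"
proof -
  have "Q3 x = (1 - x * cnj rho) * (1 - x * rho)" unfolding Q3_def divide_inverse inverse_rho ..
  thus ?thesis using rho_add_cnj rho_mult_cnj by algebra
qed

lemma Q3_factors: "Q3 x = (x - rho) * (x - cnj rho)"
  unfolding Q3_eq using rho_add_cnj rho_mult_cnj by algebra

definition dlogA_t :: "complex \<Rightarrow> complex \<Rightarrow> complex" where
  "dlogA_t t w = 1/(t - w) - w/(1 - t * w) - 1/(t - rho) - 1/(t - cnj rho)"

definition dlogA_w :: "complex \<Rightarrow> complex \<Rightarrow> complex" where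
  "dlogA_w t w = -1/(t - w) - 1/w - t/(1 - t * w)"

lemma dlogA_t_Q3_root:
  "Q3_root b \<Longrightarrow> dlogA_t t w = 1/(t - w) - w/(1 - t * w) - 1/(t - b) - 1/(t - cnj b)"
  by (auto simp: dlogA_t_def Q3_root_def)

lemma pole_kernel_identity:
  assumes b: "Q3_root b"
    and "t - w \<noteq> 0" "1 - t * w \<noteq> 0" "t - b \<noteq> 0" "t - cnj b \<noteq> 0" "w - b \<noteq> 0" "w - cnj b \<noteq> 0" "w \<noteq> 0"
  shows "dlogA_t t w * (-1/(w - b)) - dlogA_w t w * (1/(t - b)) =
    (1/w - 1/(w - cnj b)) * (1/(t - b)) + 1/(w - b) * (1/(t - cnj b)) +
    (1/w + 1/(w - b) - 1/(w - cnj b)) * (w/(1 - t * w))"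
proof -
  define p q r s u v x where inverses: "p = 1/(t - w)" "q = 1/(1 - t * w)" "r = 1/(t - b)"
    "s = 1/(t - cnj b)" "u = 1/(w - b)" "v = 1/(w - cnj b)" "x = 1/w"
  have "p * (t - w) = 1" "q * (1 - t * w) = 1" "r * (t - b) = 1" "s * (t - cnj b) = 1"
    "u * (w - b) = 1" "v * (w - cnj b) = 1" "x * w = 1"
    using assms by (auto simp: inverses)
  hence "-(p - w * q - r - s) * u + (p + x + t * q) * r =
    (x - v) * r + u * s + (x + u - v) * (w * q)"
    using Q3_root_mult_cnj[OF b] by algebra
  thus ?thesis
    unfolding dlogA_t_Q3_root[OF b] dlogA_w_def inverses by (simp add: divide_inverse algebra_simps)
qed

lemma reflected_kernel_identity:
  assumes "t - w \<noteq> 0" "1 - t * w \<noteq> 0" "t - rho \<noteq> 0" "t - cnj rho \<noteq> 0" "w - rho \<noteq> 0"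
    "w - cnj rho \<noteq> 0" "w - 1 \<noteq> 0" "w + 1 \<noteq> 0" "w \<noteq> 0"
  shows "dlogA_t t w * (t/(1 - t * w) + 1/(w - 1) + 1/(w + 1)) - dlogA_w t w * (w/(1 - t * w)) =
    (1/(w - cnj rho) - 1/(w - 1) - 1/(w + 1)) * (1/(t - rho)) + (1/(w - rho) - 1/(w - 1) -
    1/(w + 1)) * (1/(t - cnj rho)) + (1/(w - rho) + 1/(w - cnj rho) - 2 * (1/(w - 1)) - 2 *
    (1/(w + 1))) * (w/(1 - t * w))"
proof -
  define p q r s u v x y z where inverses: "p = 1/(t - w)" "q = 1/(1 - t * w)" "r = 1/(t - rho)"
    "s = 1/(t - cnj rho)" "u = 1/(w - rho)" "v = 1/(w - cnj rho)" "x = 1/w" "y = 1/(w - 1)"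
    "z = 1/(w + 1)"
  have "p * (t - w) = 1" "q * (1 - t * w) = 1" "r * (t - rho) = 1" "s * (t - cnj rho) = 1"
    "u * (w - rho) = 1" "v * (w - cnj rho) = 1" "x * w = 1" "y * (w - 1) = 1" "z * (w + 1) = 1"
    using assms by (auto simp: inverses)
  hence "(p - w * q - r - s) * (t * q + y + z) + (p + x + t * q) * (w * q) =
    (v - y - z) * r + (u - y - z) * s + (u + v - 2 * y - 2 * z) * (w * q)"
    using rho_mult_cnj by algebra
  thus ?thesis
    unfolding dlogA_t_def dlogA_w_def inverses by (simp add: divide_inverse algebra_simps)
qed

abbreviation continuous_family :: "complex set \<Rightarrow> (complex \<Rightarrow> real \<Rightarrow> complex) \<Rightarrow> bool" where
  "continuous_family S f \<equiv> continuous_on (S \<times> {0..1}) (\<lambda>x. f (fst x) (snd x))"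

lemma leibniz_by_parts:
  fixes h h' k r :: "complex \<Rightarrow> real \<Rightarrow> complex"
  assumes S: "convex S" "w \<in> S"
    and h: "\<And>w u. w \<in> S \<Longrightarrow> u \<in> {0..1} \<Longrightarrow> ((\<lambda>w. h w u) has_field_derivative h' w u) (at w within S)"
    and cont_h: "\<And>w. w \<in> S \<Longrightarrow> continuous_on {0..1} (h w)"
    and cont_h': "continuous_family S h'"
    and cont_k: "continuous_on {0..1} (k w)"
    and k: "\<And>u. u \<in> {0<..<1} \<Longrightarrow> (k w has_vector_derivative h' w u + r w u) (at u)"
    and cont_r: "continuous_on {0..1} (r w)"
  shows "((\<lambda>w. integral {0..1} (h w)) has_field_derivative k w 1 - k w 0 - integral {0..1} (r w))
    (at w within S)"
proof -
  have derivative: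
    "((\<lambda>w. integral (cbox 0 1) (h w)) has_field_derivative integral (cbox 0 1) (h' w))
    (at w within S)"
    using assms
    by (intro leibniz_rule_field_derivative) (auto intro: integrable_continuous_real simp:
      case_prod_beta)
  have "((\<lambda>u. h' w u + r w u) has_integral (k w 1 - k w 0)) {0..1}"
    by (rule fundamental_theorem_of_calculus_interior) (use cont_k k in auto)
  moreover have "(r w has_integral integral {0..1} (r w)) {0..1}"
    using cont_r by (intro integrable_integral integrable_continuous_real)
  ultimately have
    "((\<lambda>u. h' w u + r w u - r w u) has_integral (k w 1 - k w 0 - integral {0..1} (r w))) {0..1}"
    by (rule has_integral_diff)
  hence "integral {0..1} (h' w) = k w 1 - k w 0 - integral {0..1} (r w)"
    by (simp add: integral_unique)
  with derivative show ?thesis by simp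
qed

lemma continuous_on_slice:
  assumes "continuous_on (A \<times> B) (\<lambda>x. f (fst x) (snd x))" "a \<in> A"
  shows "continuous_on B (f a)"
  using continuous_on_compose2[OF assms(1), of B "\<lambda>y. (a, y)"] assms(2)
    continuous_on_Pair[OF continuous_on_const continuous_on_id, of B a]
  by auto

text \<open>For every \<open>w \<in> S\<close>, the map \<open>t w\<close> traces a path along which \<open>L w\<close> is a branch of \<open>log A\<^sub>3\<close>.\<close>

locale moving_path =
  fixes S :: "complex set" and t t_u t_w L L_w :: "complex \<Rightarrow> real \<Rightarrow> complex"
    and m :: "complex \<Rightarrow> complex"
  assumes S: "convex S" "S \<subseteq> half_disc"
    and t_u: "\<And>w u. w \<in> S \<Longrightarrow> u \<in> {0..1} \<Longrightarrow> (t w has_vector_derivative t_u w u) (at u)"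
    and t_w: "\<And>w u. w \<in> S \<Longrightarrow> u \<in> {0..1} \<Longrightarrow> ((\<lambda>w. t w u) has_field_derivative t_w w u) (at w within S)"
    and t_u_w: "\<And>w u. w \<in> S \<Longrightarrow> u \<in> {0..1} \<Longrightarrow>
      ((\<lambda>w. t_u w u) has_field_derivative t_u w u * m w) (at w within S)"
    and t_w_u: "\<And>w u. w \<in> S \<Longrightarrow> u \<in> {0..1} \<Longrightarrow> (t_w w has_vector_derivative t_u w u * m w) (at u)"
    and L_u: "\<And>w u. w \<in> S \<Longrightarrow> u \<in> {0<..<1} \<Longrightarrow>
      (L w has_vector_derivative dlogA_t (t w u) w * t_u w u) (at u)"
    and L_w: "\<And>w u. w \<in> S \<Longrightarrow> u \<in> {0..1} \<Longrightarrow> ((\<lambda>w. L w u) has_field_derivative L_w w u) (at w within S)"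
    and L_w_eq: "\<And>w u. w \<in> S \<Longrightarrow> u \<in> {0<..<1} \<Longrightarrow>
      L_w w u = dlogA_w (t w u) w + dlogA_t (t w u) w * t_w w u"
    and t_regular: "\<And>w u. w \<in> S \<Longrightarrow> u \<in> {0..1} \<Longrightarrow> t w u \<noteq> rho \<and> t w u \<noteq> cnj rho \<and> 1 - t w u * w \<noteq> 0"
    and t_neq: "\<And>w u. w \<in> S \<Longrightarrow> u \<in> {0<..<1} \<Longrightarrow> t w u \<noteq> w"
    and cont_t: "continuous_family S t"
    and cont_t_w: "continuous_family S t_w"
    and cont_L_w: "continuous_family S L_w"
    and cont_L: "\<And>n. continuous_family S (\<lambda>w u. L w u^n * t_u w u)"
    and cont_m: "continuous_on S m"
    and cont_pole_boundary: "\<And>n w b. w \<in> S \<Longrightarrow> Q3_root b \<Longrightarrow>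
      continuous_on {0..1} (\<lambda>u. L w u^n * (1/(t w u - b) * t_w w u + (-1/(w - b))))"
    and cont_reflected_boundary: "\<And>n w. w \<in> S \<Longrightarrow>
      continuous_on {0..1}
      (\<lambda>u. L w u^n * (w/(1 - t w u * w) * t_w w u + (t w u/(1 - t w u * w) + 1/(w - 1) +
      1/(w + 1))))"
begin

definition integrand :: "(complex \<Rightarrow> complex \<Rightarrow> complex) \<Rightarrow> nat \<Rightarrow> complex \<Rightarrow> real \<Rightarrow> complex" where
  "integrand \<phi> n w u = L w u^n * t_u w u * \<phi> (t w u) w"

definition path_integral :: "(complex \<Rightarrow> complex \<Rightarrow> complex) \<Rightarrow> nat \<Rightarrow> complex \<Rightarrow> complex" where
  "path_integral \<phi> n w = integral {0..1} (integrand \<phi> n w)"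

definition boundary ::
  "(complex \<Rightarrow> complex \<Rightarrow> complex) \<Rightarrow> (complex \<Rightarrow> complex \<Rightarrow> complex) \<Rightarrow> nat \<Rightarrow> complex \<Rightarrow> real \<Rightarrow> complex"
  where
  "boundary \<phi> \<psi> n w u = L w u^n * (\<phi> (t w u) w * t_w w u + \<psi> (t w u) w)"

abbreviation pole_integral :: "complex \<Rightarrow> nat \<Rightarrow> complex \<Rightarrow> complex" where
  "pole_integral b \<equiv> path_integral (\<lambda>z w. 1/(z - b))"

abbreviation reflected_integral :: "nat \<Rightarrow> complex \<Rightarrow> complex" where
  "reflected_integral \<equiv> path_integral (\<lambda>z w. w/(1 - z * w))"

abbreviation pole_boundary :: "complex \<Rightarrow> nat \<Rightarrow> complex \<Rightarrow> real \<Rightarrow> complex" where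
  "pole_boundary b \<equiv> boundary (\<lambda>z w. 1/(z - b)) (\<lambda>z w. -1/(w - b))"

abbreviation reflected_boundary :: "nat \<Rightarrow> complex \<Rightarrow> real \<Rightarrow> complex" where
  "reflected_boundary \<equiv>
  boundary (\<lambda>z w. w/(1 - z * w)) (\<lambda>z w. z/(1 - z * w) + 1/(w - 1) + 1/(w + 1))"

lemma t_neq_Q3_root: "w \<in> S \<Longrightarrow> u \<in> {0..1} \<Longrightarrow> Q3_root b \<Longrightarrow> t w u - b \<noteq> 0"
  using t_regular by (auto simp: Q3_root_def)

lemma S_neq_letter: "w \<in> S \<Longrightarrow> letter a \<Longrightarrow> w - a \<noteq> 0"
  using S half_disc_letter by auto

lemma continuous_pole_integrand:
  "w \<in> S \<Longrightarrow> Q3_root b \<Longrightarrow> continuous_on {0..1} (integrand (\<lambda>z w. 1/(z - b)) n w)"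
  unfolding integrand_def
  by (intro continuous_intros continuous_on_slice[OF cont_L] continuous_on_slice[OF cont_t])
    (use t_neq_Q3_root in auto)

lemma continuous_reflected_integrand:
  "w \<in> S \<Longrightarrow> continuous_on {0..1} (integrand (\<lambda>z w. w/(1 - z * w)) n w)"
  unfolding integrand_def
  by (intro continuous_intros continuous_on_slice[OF cont_L] continuous_on_slice[OF cont_t])
    (use t_regular in auto)

lemma has_vector_derivative_L_power:
  assumes "w \<in> S" "u \<in> {0<..<1}"
  shows "((\<lambda>u. L w u^n) has_vector_derivative
    dlogA_t (t w u) w * t_u w u * (of_nat n * L w u^(n - 1))) (at u)"
proof -
  have "((\<lambda>z. z^n) has_field_derivative of_nat n * L w u^(n - 1)) (at (L w u))"
    by (auto intro!: derivative_eq_intros)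
  from field_vector_diff_chain_at[OF L_u[OF assms] this] show ?thesis by (simp add: o_def)
qed

lemma has_vector_derivative_boundary:
  assumes w: "w \<in> S"
    and u: "u \<in> {0<..<1}"
    and \<phi>_t: "((\<lambda>z. \<phi> z w) has_field_derivative \<phi>') (at (t w u))"
    and \<psi>_t: "((\<lambda>z. \<psi> z w) has_field_derivative \<psi>') (at (t w u))"
  shows "(boundary \<phi> \<psi> n w has_vector_derivative
    L w u^(n - 1) * t_u w u * (of_nat n * L_w w u * \<phi> (t w u) w) + L w u^n * t_u w u *
    (m w * \<phi> (t w u) w + \<phi>' * t_w w u + \<psi>') + of_nat n * (L w u^(n - 1) * t_u w u *
    (dlogA_t (t w u) w * \<psi> (t w u) w - dlogA_w (t w u) w * \<phi> (t w u) w))) (at u)"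
proof -
  have u': "u \<in> {0..1}" using u by auto
  note chain = field_vector_diff_chain_at[OF t_u[OF w u'], unfolded o_def]
  have "(boundary \<phi> \<psi> n w has_vector_derivative
    L w u^n * (\<phi> (t w u) w * (t_u w u * m w) + t_u w u * \<phi>' * t_w w u + t_u w u * \<psi>') + dlogA_t
    (t w u) w * t_u w u * (of_nat n * L w u^(n - 1)) * (\<phi> (t w u) w * t_w w u + \<psi> (t w u) w))
    (at u)"
    unfolding boundary_def
    by (intro has_vector_derivative_mult has_vector_derivative_add has_vector_derivative_L_power[OF
      w u] t_w_u[OF w u'] chain \<phi>_t \<psi>_t)
  thus ?thesis unfolding L_w_eq[OF w u] by (simp add: algebra_simps)
qed

lemma has_field_derivative_path_integral:
  fixes \<phi> \<psi> \<phi>' \<psi>' \<theta> :: "complex \<Rightarrow> complex \<Rightarrow> complex"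
  assumes w: "w \<in> S"
    and \<phi>_w: "\<And>w u. w \<in> S \<Longrightarrow> u \<in> {0..1} \<Longrightarrow>
      ((\<lambda>w. \<phi> (t w u) w) has_field_derivative \<phi>' (t w u) w * t_w w u + \<psi>' (t w u) w)
      (at w within S)"
    and \<phi>_t: "\<And>u. u \<in> {0..1} \<Longrightarrow> ((\<lambda>z. \<phi> z w) has_field_derivative \<phi>' (t w u) w) (at (t w u))"
    and \<psi>_t: "\<And>u. u \<in> {0..1} \<Longrightarrow> ((\<lambda>z. \<psi> z w) has_field_derivative \<psi>' (t w u) w) (at (t w u))"
    and cont: "continuous_family S (\<lambda>w u. \<phi> (t w u) w)" "continuous_family S (\<lambda>w u. \<phi>' (t w u) w)"
      "continuous_family S (\<lambda>w u. \<psi>' (t w u) w)"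
    and cont_boundary: "continuous_on {0..1} (boundary \<phi> \<psi> n w)"
    and cont_\<theta>: "continuous_on {0..1} (integrand \<theta> (n - 1) w)"
    and \<theta>: "\<And>u. u \<in> {0<..<1} \<Longrightarrow> dlogA_t (t w u) w * \<psi> (t w u) w - dlogA_w (t w u) w * \<phi> (t w u) w =
      \<theta> (t w u) w"
  shows "(path_integral \<phi> n has_field_derivative boundary \<phi> \<psi> n w 1 - boundary \<phi> \<psi> n w 0
    - of_nat n * path_integral \<theta> (n - 1) w) (at w within S)"
proof -
  let ?h' = "\<lambda>w u. L w u^(n - 1) * t_u w u * (of_nat n * L_w w u * \<phi> (t w u) w)
    + L w u^n * t_u w u * (m w * \<phi> (t w u) w + \<phi>' (t w u) w * t_w w u + \<psi>' (t w u) w)"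
  have "((\<lambda>w. integral {0..1} (integrand \<phi> n w)) has_field_derivative
    boundary \<phi> \<psi> n w 1 - boundary \<phi> \<psi> n w 0 - integral {0..1} (\<lambda>u. of_nat n * integrand \<theta> (n - 1) w
    u)) (at w within S)"
  proof (rule leibniz_by_parts[OF S(1) w, where h'="?h'"])
    show "((\<lambda>w. integrand \<phi> n w u) has_field_derivative ?h' w u) (at w within S)"
      if "w \<in> S" "u \<in> {0..1}" for w u
      unfolding integrand_def
      by (auto intro!: derivative_eq_intros L_w[OF that] t_u_w[OF that] \<phi>_w[OF that])
        (simp add: algebra_simps)
    have "continuous_family S (integrand \<phi> n)" unfolding integrand_def
      by (intro continuous_intros cont_L cont)
    thus "continuous_on {0..1} (integrand \<phi> n w)" if "w \<in> S" for w
      using that by (rule continuous_on_slice)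
    show "continuous_family S ?h'"
      by (intro continuous_intros cont_L cont_L_w cont_t_w cont continuous_on_compose2[OF cont_m])
        auto
    show "(boundary \<phi> \<psi> n w has_vector_derivative ?h' w u + of_nat n * integrand \<theta> (n - 1) w u)
      (at u)" if "u \<in> {0<..<1}" for u
      using has_vector_derivative_boundary[where \<phi>=\<phi> and \<psi>=\<psi> and n=n, OF w that \<phi>_t \<psi>_t] that
      by (simp add: integrand_def \<theta>)
  qed (intro cont_boundary continuous_on_mult_left cont_\<theta>)+
  thus ?thesis by (simp add: path_integral_def[abs_def])
qed

lemma
  fixes A B C :: complex
  assumes w: "w \<in> S" and b: "Q3_root b"
  defines "\<theta> \<equiv> \<lambda>z w. A * (1/(z - b)) + B * (1/(z - cnj b)) + C * (w/(1 - z * w))"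
  shows continuous_kernel_integrand: "continuous_on {0..1} (integrand \<theta> n w)"
    and path_integral_kernel:
      "path_integral \<theta> n w = A * pole_integral b n w + B * pole_integral (cnj b) n w
      + C * reflected_integral n w" (is ?integral)
proof -
  note continuous = continuous_pole_integrand[OF w b] continuous_pole_integrand[OF w
    Q3_root_cnj[OF b]] continuous_reflected_integrand[OF w]
  have \<theta>: "integrand \<theta> n w =
    (\<lambda>u. A * integrand (\<lambda>z w. 1/(z - b)) n w u + B * integrand (\<lambda>z w. 1/(z - cnj b)) n w u + C *
    integrand (\<lambda>z w. w/(1 - z * w)) n w u)"
    by (rule ext) (simp add: integrand_def \<theta>_def algebra_simps)
  show "continuous_on {0..1} (integrand \<theta> n w)" unfolding \<theta>
    by (intro continuous_on_add continuous_on_mult_left continuous)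
  show ?integral unfolding path_integral_def \<theta>
    by (intro integral_unique has_integral_add has_integral_mult_right integrable_integral
      continuous[THEN integrable_continuous_real])
qed

lemma has_field_derivative_pole_integral:
  assumes w: "w \<in> S" and b: "Q3_root b"
  shows "(pole_integral b n has_field_derivative pole_boundary b n w 1 - pole_boundary b n w 0
    - of_nat n * ((1/w - 1/(w - cnj b)) * pole_integral b (n - 1) w + 1/(w - b) * pole_integral
    (cnj b) (n - 1) w + (1/w + 1/(w - b) - 1/(w - cnj b)) * reflected_integral (n - 1) w))
    (at w within S)"
  unfolding path_integral_kernel[OF w b, symmetric]
proof (rule has_field_derivative_path_integral[OF w _ _ _ _ _ _ _ continuous_kernel_integrand[OF w
  b], where \<phi>'="\<lambda>z w. -1/(z - b)^2" and \<psi>'="\<lambda>z w. 0"])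
  have nonzero: "t w u - b \<noteq> 0" if "w \<in> S" "u \<in> {0..1}" for w u using t_neq_Q3_root that b by blast
  show "((\<lambda>w. 1/(t w u - b)) has_field_derivative -1/(t w u - b)^2 * t_w w u + 0) (at w within S)"
    if "w \<in> S" "u \<in> {0..1}" for w u
    using nonzero[OF that]
    by (auto intro!: derivative_eq_intros t_w[OF that] simp: power2_eq_square divide_inverse)
  show "((\<lambda>z. 1/(z - b)) has_field_derivative -1/(t w u - b)^2) (at (t w u))" if "u \<in> {0..1}" for u
    using nonzero[OF w that] by (auto intro!: derivative_eq_intros simp: power2_eq_square)
  show "continuous_family S (\<lambda>w u. 1/(t w u - b))" "continuous_family S (\<lambda>w u. -1/(t w u - b)^2)"
    by (intro continuous_intros cont_t; use nonzero in auto)+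
  show "continuous_on {0..1} (pole_boundary b n w)"
    unfolding boundary_def by (rule cont_pole_boundary[OF w b])
  fix u :: real assume u: "u \<in> {0<..<1}"
  hence "u \<in> {0..1}" by auto
  with t_neq_Q3_root[OF w] t_regular[OF w] t_neq[OF w u] S_neq_letter[OF w] b letter_0
  show "dlogA_t (t w u) w * (-1/(w - b)) - dlogA_w (t w u) w * (1/(t w u - b)) =
    (1/w - 1/(w - cnj b)) * (1/(t w u - b)) + 1/(w - b) * (1/(t w u - cnj b)) +
    (1/w + 1/(w - b) - 1/(w - cnj b)) * (w/(1 - t w u * w))"
    by (intro pole_kernel_identity[OF b]) (auto simp: Q3_root_cnj letter_Q3_root)
qed auto

lemma has_field_derivative_reflected_integral:
  assumes w: "w \<in> S"
  shows "(reflected_integral n has_field_derivative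
    reflected_boundary n w 1 - reflected_boundary n w 0 - of_nat n *
    ((1/(w - cnj rho) - 1/(w - 1) - 1/(w + 1)) * pole_integral rho (n - 1) w +
    (1/(w - rho) - 1/(w - 1) - 1/(w + 1)) * pole_integral (cnj rho) (n - 1) w +
    (1/(w - rho) + 1/(w - cnj rho) - 2 * (1/(w - 1)) - 2 * (1/(w + 1))) * reflected_integral (n - 1)
    w)) (at w within S)"
  unfolding path_integral_kernel[OF w Q3_root_rho, symmetric]
proof (rule has_field_derivative_path_integral[OF w _ _ _ _ _ _ _ continuous_kernel_integrand[OF w
  Q3_root_rho], where \<phi>'="\<lambda>z w. w^2/(1 - z * w)^2" and \<psi>'="\<lambda>z w. 1/(1 - z * w)^2"])
  have nonzero: "1 - t w u * w \<noteq> 0" if "w \<in> S" "u \<in> {0..1}" for w u using t_regular that by blast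
  show "((\<lambda>w. w/(1 - t w u * w)) has_field_derivative
    w^2/(1 - t w u * w)^2 * t_w w u + 1/(1 - t w u * w)^2) (at w within S)" if "w \<in> S" "u \<in>
    {0..1}" for w u
    using nonzero[OF that]
    by (auto intro!: derivative_eq_intros t_w[OF that]) (simp add: divide_simps power2_eq_square,
      simp add: algebra_simps)
  show "((\<lambda>z. w/(1 - z * w)) has_field_derivative w^2/(1 - t w u * w)^2) (at (t w u))"
    "((\<lambda>z. z/(1 - z * w) + 1/(w - 1) + 1/(w + 1)) has_field_derivative
    1/(1 - t w u * w)^2) (at (t w u))" if "u \<in> {0..1}" for u
    using nonzero[OF w that] by (auto intro!: derivative_eq_intros simp: power2_eq_square)
  show "continuous_family S (\<lambda>w u. w/(1 - t w u * w))"
    "continuous_family S (\<lambda>w u. w^2/(1 - t w u * w)^2)"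
    "continuous_family S (\<lambda>w u. 1/(1 - t w u * w)^2)"
    by (intro continuous_intros cont_t; use nonzero in auto)+
  show "continuous_on {0..1} (reflected_boundary n w)"
    unfolding boundary_def by (rule cont_reflected_boundary[OF w])
  fix u :: real assume u: "u \<in> {0<..<1}"
  hence "u \<in> {0..1}" by auto
  with t_regular[OF w] t_neq[OF w u] S_neq_letter[OF w] S_neq_letter[OF w, of
    "-1"] S_neq_letter[OF w letter_0]
  show "dlogA_t (t w u) w * (t w u/(1 - t w u * w) + 1/(w - 1) + 1/(w + 1))
    - dlogA_w (t w u) w * (w/(1 - t w u * w)) = (1/(w - cnj rho) - 1/(w - 1) - 1/(w + 1)) *
    (1/(t w u - rho)) + (1/(w - rho) - 1/(w - 1) - 1/(w + 1)) * (1/(t w u - cnj rho)) +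
    (1/(w - rho) + 1/(w - cnj rho) - 2 * (1/(w - 1)) - 2 * (1/(w + 1))) * (w/(1 - t w u * w))"
    by (intro reflected_kernel_identity) auto
qed

lemma hyperlog_form_of_nat_pole_mult:
  assumes "letter a" "\<And>n'. n' < n \<Longrightarrow> hyperlog_on S (Suc n') (f n')"
  shows "hyperlog_form S n (\<lambda>w. of_nat n * (1/(w - a) * f (n - 1) w))"
  using hyperlog_form_of_nat_mult[OF hyperlog_form_pole_mult[OF assms(2,1)], of "n - 1"
    n] hyperlog_form_0
  by (cases n) auto

theorem hyperlog_on_path_integral:
  assumes \<gamma>: "expansion_path S \<gamma> \<kappa>"
    and pole_boundary: "\<And>b n. Q3_root b \<Longrightarrow>
      hyperlog_form S n (\<lambda>w. pole_boundary b n w 1 - pole_boundary b n w 0)"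
    and reflected_boundary:
      "\<And>n. hyperlog_form S n (\<lambda>w. reflected_boundary n w 1 - reflected_boundary n w 0)"
    and pole_limit: "\<And>b n. Q3_root b \<Longrightarrow> \<exists>v. polylog_value (Suc n) v \<and>
      ((\<lambda>s. pole_integral b n (\<gamma> s)) \<longlongrightarrow> v) (at_right 0)"
    and reflected_limit: "\<And>n. \<exists>v. polylog_value (Suc n) v \<and>
      ((\<lambda>s. reflected_integral n (\<gamma> s)) \<longlongrightarrow> v) (at_right 0)"
  shows "(\<forall>b. Q3_root b \<longrightarrow> hyperlog_on S (Suc n) (pole_integral b n)) \<and>
    hyperlog_on S (Suc n) (reflected_integral n)"
proof (induction n rule: less_induct)
  case (less n)
  let ?p = "\<lambda>a b w. of_nat n * (1/(w - a) * pole_integral b (n - 1) w)"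
  let ?q = "\<lambda>a w. of_nat n * (1/(w - a) * reflected_integral (n - 1) w)"
  have forms: "Q3_root b \<Longrightarrow> letter a \<Longrightarrow> hyperlog_form S n (?p a b)" "letter a \<Longrightarrow>
    hyperlog_form S n (?q a)" for a b
    using less hyperlog_form_of_nat_pole_mult[of a n "pole_integral b"]
      hyperlog_form_of_nat_pole_mult[of a n reflected_integral]
    by auto
  have "hyperlog_on S (Suc n) (pole_integral b n)" if b: "Q3_root b" for b
  proof -
    obtain v where v: "polylog_value (Suc n) v" "((\<lambda>s. pole_integral b n (\<gamma> s)) \<longlongrightarrow> v) (at_right 0)"
      using pole_limit[OF b] by blast
    have "hyperlog_form S n (\<lambda>w. pole_boundary b n w 1 - pole_boundary b n w 0
      - (?p 0 b w - ?p (cnj b) b w + ?p b (cnj b) w + (?q 0 w + ?q b w - ?q (cnj b) w)))"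
      by (rule hyperlog_form_diff[OF pole_boundary[OF b]], intro hyperlog_form_diff
        hyperlog_form.add forms) (simp_all add: b Q3_root_cnj letter_Q3_root)
    from hyperlog_on_of_derivative[OF \<gamma> S _ this v(2,1)] has_field_derivative_pole_integral[OF _ b,
      of _ n]
    show ?thesis by (simp add: algebra_simps)
  qed
  moreover
  obtain v where v: "polylog_value (Suc n) v" "((\<lambda>s. reflected_integral n (\<gamma> s)) \<longlongrightarrow> v) (at_right 0)"
    using reflected_limit by blast
  have "hyperlog_form S n (\<lambda>w. reflected_boundary n w 1 - reflected_boundary n w 0
    - (?p (cnj rho) rho w - ?p 1 rho w - ?p (-1) rho w + (?p rho (cnj rho) w - ?p 1 (cnj rho) w - ?p
    (-1) (cnj rho) w) + (?q rho w + ?q (cnj rho) w - of_nat 2 * ?q 1 w - of_nat 2 * ?q (-1) w)))"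
    by (rule hyperlog_form_diff[OF reflected_boundary], intro hyperlog_form_diff hyperlog_form.add
      hyperlog_form_of_nat_mult[of _ _ _ 2] forms) simp_all
  from hyperlog_on_of_derivative[OF \<gamma> S _ this v(2,1)] has_field_derivative_reflected_integral[of _
    n]
  have "hyperlog_on S (Suc n) (reflected_integral n)" by (simp add: algebra_simps)
  ultimately show ?case by blast
qed

end

lemma nonpos_Reals_Re: "0 < Re z \<Longrightarrow> z \<notin> \<real>\<^sub>\<le>\<^sub>0"
  by (auto simp: complex_nonpos_Reals_iff)

lemma one_minus_notin_nonpos_Reals: "norm z < 1 \<Longrightarrow> 1 - z \<notin> \<real>\<^sub>\<le>\<^sub>0" for z :: complex
  using complex_Re_le_cmod[of z] by (intro nonpos_Reals_Re) auto

lemma has_vector_derivative_Ln_one_minus: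
  assumes "(f has_vector_derivative d) (at u)" "1 - f u * c \<notin> \<real>\<^sub>\<le>\<^sub>0"
  shows "((\<lambda>u. Ln (1 - f u * c)) has_vector_derivative d * (-c/(1 - f u * c))) (at u)"
proof -
  have "((\<lambda>z. Ln (1 - z * c)) has_field_derivative -c/(1 - f u * c)) (at (f u))"
    using assms(2) by (auto intro!: derivative_eq_intros simp: divide_inverse)
  from field_vector_diff_chain_at[OF assms(1) this] show ?thesis by (simp add: o_def)
qed

lemma half_disc_neq:
  assumes "w \<in> half_disc"
  shows "w \<noteq> 0" "w - 1 \<noteq> 0" "w + 1 \<noteq> 0" "Q3_root b \<Longrightarrow> w - b \<noteq> 0"
  using half_disc_letter[OF assms] half_disc_letter[OF assms, of "-1"] letter_Q3_root letter_0
  by (auto simp: add_eq_0_iff2)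

lemma reflected_Q3_root: "Q3_root b \<Longrightarrow> cnj b/(1 - z * cnj b) = -1/(z - b)"
proof -
  assume b: "Q3_root b"
  hence "1 - z * cnj b = -cnj b * (z - b)" using Q3_root_mult_cnj[OF b] by (simp add: algebra_simps)
  thus ?thesis using Q3_root_nonzero[OF b] by simp
qed

lemma reflected_rho:
  "cnj rho/(1 - z * cnj rho) = -1/(z - rho)" "rho/(1 - z * rho) = -1/(z - cnj rho)"
  using reflected_Q3_root[OF Q3_root_rho] reflected_Q3_root[OF Q3_root_cnj_rho] by simp_all

lemma tendsto_integral_param:
  fixes f :: "complex \<Rightarrow> real \<Rightarrow> complex"
  assumes "continuous_family T f" "p \<in> T" and "(\<gamma> \<longlongrightarrow> p) F" "\<forall>\<^sub>F s in F. \<gamma> s \<in> T"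
  shows "((\<lambda>s. integral {0..1} (f (\<gamma> s))) \<longlongrightarrow> integral {0..1} (f p)) F"
proof -
  have "continuous_on T (\<lambda>w. integral (cbox 0 1) (f w))"
    by (rule integral_continuous_on_param) (use assms(1) in \<open>simp add: case_prod_beta\<close>)
  from continuous_on_tendsto_compose[OF this assms(3,2,4)] show ?thesis by simp
qed

section \<open>The segment from the origin to the moving singularity\<close>

text \<open>The quadratic parametrization makes \<open>(log A\<^sub>3)\<^sup>n\<close> times the velocity continuous at the
 endpoint \<open>t = w\<close>, where \<open>1 - t/w = u\<^sup>2\<close>.\<close>

definition segment_point :: "complex \<Rightarrow> real \<Rightarrow> complex" where
  "segment_point w u = of_real (1 - u\<^sup>2) * w"

definition segment_regular_log :: "complex \<Rightarrow> real \<Rightarrow> complex" where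
  "segment_regular_log w u = Ln (1 - segment_point w u * w) - Ln (1 - segment_point w u * cnj rho)
    - Ln (1 - segment_point w u * rho)"

definition segment_log :: "complex \<Rightarrow> real \<Rightarrow> complex" where
  "segment_log w u = of_real (2 * ln u) + segment_regular_log w u"

definition segment_log_w :: "complex \<Rightarrow> real \<Rightarrow> complex" where
  "segment_log_w w u = -(2 * of_real (1 - u\<^sup>2) * w)/(1 - segment_point w u * w)
    - of_real (1 - u\<^sup>2)/(segment_point w u - rho) - of_real (1 - u\<^sup>2)/(segment_point w u - cnj rho)"

lemma norm_segment_point:
  assumes "norm w < 1" "u \<in> {0..1}"
  shows "norm (segment_point w u) < 1"
proof -
  have u2: "0 \<le> 1 - u\<^sup>2" "1 - u\<^sup>2 \<le> 1" using assms by (auto simp: power_le_one)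
  have "norm (segment_point w u) = (1 - u\<^sup>2) * norm w"
    using u2 unfolding segment_point_def norm_mult norm_of_real by simp
  also have "... \<le> norm w" using u2 by (intro mult_left_le_one_le) auto
  finally show ?thesis using assms by simp
qed

lemma segment_point_regular:
  assumes "norm w < 1" "u \<in> {0..1}"
  shows "1 - segment_point w u * w \<notin> \<real>\<^sub>\<le>\<^sub>0" "1 - segment_point w u * cnj rho \<notin> \<real>\<^sub>\<le>\<^sub>0"
    "1 - segment_point w u * rho \<notin> \<real>\<^sub>\<le>\<^sub>0" "1 - segment_point w u * w \<noteq> 0" "Q3_root b \<Longrightarrow>
    segment_point w u - b \<noteq> 0"
proof -
  have n: "norm (segment_point w u) < 1" using norm_segment_point[OF assms] .
  have "norm (segment_point w u) * norm w \<le> norm (segment_point w u) * 1"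
    using assms by (intro mult_left_mono) auto
  thus notin: "1 - segment_point w u * w \<notin> \<real>\<^sub>\<le>\<^sub>0"
    using n by (intro one_minus_notin_nonpos_Reals) (simp add: norm_mult)
  show "1 - segment_point w u * cnj rho \<notin> \<real>\<^sub>\<le>\<^sub>0" "1 - segment_point w u * rho \<notin> \<real>\<^sub>\<le>\<^sub>0"
    using n by (auto intro!: one_minus_notin_nonpos_Reals simp: norm_mult)
  show "1 - segment_point w u * w \<noteq> 0" using notin by auto
  show "Q3_root b \<Longrightarrow> segment_point w u - b \<noteq> 0" using n norm_Q3_root by auto
qed

lemma continuous_on_of_real_mult_ln_power: "continuous_on {0..1} (\<lambda>u. of_real u * shifted_ln 0 u^k)"
  unfolding continuous_on_eq_continuous_within
proof
  fix u :: real assume u: "u \<in> {0..1}"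
  show "continuous (at u within {0..1}) (\<lambda>u. of_real u * shifted_ln 0 u^k)"
  proof (cases "u = 0")
    case True
    have "((\<lambda>u. of_real u * shifted_ln 0 u^k) \<longlongrightarrow> 0) (at_right 0)"
      by (intro power_decay_tendsto power_decay_mult_slow_growth power_decay_of_real
        slow_growth_power slow_growth_shifted_ln)
    thus ?thesis unfolding True continuous_within by (simp add: at_within_Icc_at_right)
  next
    case False
    thus ?thesis unfolding shifted_ln_def using u by (intro continuous_intros) auto
  qed
qed

lemma continuous_segment_point: "continuous_on A (\<lambda>x. segment_point (fst x) (snd x))"
  unfolding segment_point_def by (intro continuous_intros)

lemma continuous_segment_log_power:
  "continuous_family (ball 0 1) (\<lambda>w u. segment_log w u^n * of_real u)"
proof -
  let ?c = "\<lambda>x. complex_of_real (snd x)"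
  have expand: "segment_log (fst x) (snd x)^n * ?c x =
    (\<Sum>k\<le>n. of_nat (n choose k) * 2^k * (?c x * shifted_ln 0 (snd x)^k) * segment_regular_log (fst x)
    (snd x)^(n - k))" for x
    unfolding segment_log_def binomial_ring sum_distrib_right
    by (intro sum.cong) (auto simp: shifted_ln_def power_mult_distrib mult_ac)
  have ln: "continuous_on (ball (0::complex) 1 \<times> {0..1}) (\<lambda>x. ?c x * shifted_ln 0 (snd x)^k)" for k
    by (rule continuous_on_compose2[OF continuous_on_of_real_mult_ln_power
      continuous_on_snd[OF continuous_on_id]]) auto
  have "continuous_family (ball 0 1) segment_regular_log" unfolding segment_regular_log_def
    by (intro continuous_intros continuous_on_Ln continuous_segment_point)
      (use segment_point_regular in auto)
  thus ?thesis
    unfolding expand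
    by (intro continuous_on_sum continuous_on_mult continuous_on_const continuous_on_power ln)
qed

lemma has_vector_derivative_segment_point:
  "(segment_point w has_vector_derivative of_real (-2 * u) * w) (at u)"
  unfolding segment_point_def
  by (auto intro!: derivative_eq_intros simp: has_vector_derivative_def scaleR_conv_of_real
    algebra_simps)

lemma has_field_derivative_segment_log_w:
  assumes "norm w < 1" "u \<in> {0..1}"
  shows "((\<lambda>w. segment_log w u) has_field_derivative segment_log_w w u) (at w within S)"
proof -
  let ?v = "complex_of_real (1 - u\<^sup>2)"
  have point: "((\<lambda>w. segment_point w u) has_field_derivative ?v) (at w within S)"
    unfolding segment_point_def by (auto intro!: derivative_eq_intros)
  have "((\<lambda>w. segment_log w u) has_field_derivative
    -(?v * w + 1 * segment_point w u)/(1 - segment_point w u * w) + ?v *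
    (cnj rho/(1 - segment_point w u * cnj rho)) + ?v * (rho/(1 - segment_point w u * rho)))
    (at w within S)"
    unfolding segment_log_def segment_regular_log_def
    by (rule derivative_eq_intros point segment_point_regular[OF assms] refl | simp add:
      divide_inverse)+
  moreover have "?v * w + 1 * segment_point w u = 2 * ?v * w" by (simp add: segment_point_def)
  ultimately show ?thesis unfolding reflected_rho segment_log_w_def by (simp only:) simp
qed

lemma has_vector_derivative_segment_log:
  assumes w: "w \<noteq> 0" "norm w < 1" and u: "u \<in> {0<..<1}"
  shows "(segment_log w has_vector_derivative
    dlogA_t (segment_point w u) w * (of_real (-2 * u) * w)) (at u)"
proof -
  let ?d = "of_real (-2 * u) * w"
  note regular = segment_point_regular[OF w(2), of u]
  have "((\<lambda>u. complex_of_real (2 * ln u)) has_vector_derivative of_real (2/u)) (at u)"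
    using u
    by (intro has_vector_derivative_of_real) (auto intro!: derivative_eq_intros simp:
      has_real_derivative_iff_has_vector_derivative[symmetric])
  hence "(segment_log w has_vector_derivative
    of_real (2/u) + (?d * (-w/(1 - segment_point w u * w)) - ?d *
    (-cnj rho/(1 - segment_point w u * cnj rho)) - ?d * (-rho/(1 - segment_point w u * rho))))
    (at u)"
    unfolding segment_log_def[abs_def] segment_regular_log_def using u
    by (intro has_vector_derivative_add has_vector_derivative_diff regular
      has_vector_derivative_Ln_one_minus[OF has_vector_derivative_segment_point]) auto
  moreover have diff: "segment_point w u - w = -(of_real (u\<^sup>2) * w)"
    by (simp add: segment_point_def algebra_simps)
  have "of_real (2/u) = ?d/(segment_point w u - w)"
    unfolding diff using w u by (simp add: power2_eq_square field_simps)
  ultimately show ?thesis unfolding dlogA_t_def minus_divide_left[symmetric] reflected_rho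
    by (simp add: algebra_simps)
qed

lemma segment_log_w_eq:
  assumes "w \<noteq> 0" "u \<in> {0<..<1}"
  shows "segment_log_w w u =
    dlogA_w (segment_point w u) w + dlogA_t (segment_point w u) w * of_real (1 - u\<^sup>2)"
proof -
  let ?v = "complex_of_real (1 - u\<^sup>2)"
  have diff: "segment_point w u - w = -(of_real (u\<^sup>2) * w)"
    by (simp add: segment_point_def algebra_simps)
  have "?v * (1/(segment_point w u - w)) - 1/(segment_point w u - w) - 1/w = 0"
    unfolding diff using assms by (simp add: field_simps)
  moreover have "segment_point w u = ?v * w" by (simp add: segment_point_def)
  ultimately show ?thesis unfolding segment_log_w_def dlogA_w_def dlogA_t_def
    by (simp add: algebra_simps add_divide_distrib del: of_real_diff)
qed

lemma continuous_segment_boundary: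
  assumes "w \<in> half_disc" "continuous_on {0..1} g" and "\<And>u. u \<in> {0..1} \<Longrightarrow> of_real u * g u = f u"
  shows "continuous_on {0..1} (\<lambda>u. segment_log w u^n * f u)"
proof (rule continuous_on_eq)
  have "continuous_on {0..1} (\<lambda>u. segment_log w u^n * of_real u)"
    using continuous_on_slice[OF continuous_segment_log_power, of w n] half_disc_norm[OF assms(1)]
    by simp
  thus "continuous_on {0..1} (\<lambda>u. segment_log w u^n * of_real u * g u)"
    by (rule continuous_on_mult[OF _ assms(2)])
qed (use assms(3) in \<open>simp add: mult.assoc\<close>)

lemma continuous_segment_pole_boundary:
  assumes w: "w \<in> half_disc" and b: "Q3_root b"
  shows "continuous_on {0..1}
    (\<lambda>u. segment_log w u^n * (1/(segment_point w u - b) * of_real (1 - u\<^sup>2) + (-1/(w - b))))"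
proof (rule continuous_segment_boundary[OF w])
  have nonzero: "segment_point w u - b \<noteq> 0" if "u \<in> {0..1}" for u
    using segment_point_regular(5)[OF half_disc_norm[OF w] that b] .
  show "continuous_on {0..1} (\<lambda>u. b * of_real u * (1/(segment_point w u - b)) * (1/(w - b)))"
    using nonzero unfolding segment_point_def by (intro continuous_intros) auto
  fix u :: real assume "u \<in> {0..1}"
  define p q where inverses: "p = 1/(segment_point w u - b)" "q = 1/(w - b)"
  have "p * (of_real (1 - u\<^sup>2) * w - b) = 1" "q * (w - b) = 1"
    using nonzero[OF \<open>u \<in> {0..1}\<close>] half_disc_neq(4)[OF w b]
    by (auto simp: inverses segment_point_def)
  hence "of_real u * (b * of_real u * p * q) = p * of_real (1 - u\<^sup>2) - q"
    unfolding of_real_diff of_real_power of_real_1 by algebra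
  thus "of_real u * (b * of_real u * (1/(segment_point w u - b)) * (1/(w - b))) =
    1/(segment_point w u - b) * of_real (1 - u\<^sup>2) + (-1/(w - b))"
    by (simp add: inverses)
qed

lemma continuous_segment_reflected_boundary:
  assumes w: "w \<in> half_disc"
  shows "continuous_on {0..1}
    (\<lambda>u. segment_log w u^n * (w/(1 - segment_point w u * w) * of_real (1 - u\<^sup>2) +
    (segment_point w u/(1 - segment_point w u * w) + 1/(w - 1) + 1/(w + 1))))"
proof (rule continuous_segment_boundary[OF w])
  have nonzero: "1 - segment_point w u * w \<noteq> 0" if "u \<in> {0..1}" for u
    using segment_point_regular(4)[OF half_disc_norm[OF w] that] .
  show "continuous_on {0..1} (\<lambda>u. 2 * w * of_real u * (1/(1 - segment_point w u * w)) *
    (1/(w - 1)) * (1/(w + 1)))"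
    using nonzero unfolding segment_point_def by (intro continuous_intros) auto
  fix u :: real assume "u \<in> {0..1}"
  define p q r where inverses: "p = 1/(1 - segment_point w u * w)" "q = 1/(w - 1)" "r = 1/(w + 1)"
  have "p * (1 - of_real (1 - u\<^sup>2) * w * w) = 1" "q * (w - 1) = 1" "r * (w + 1) = 1"
    using nonzero[OF \<open>u \<in> {0..1}\<close>] half_disc_neq[OF w] by (auto simp: inverses segment_point_def)
  hence "of_real u * (2 * w * of_real u * p * q * r) =
    w * p * of_real (1 - u\<^sup>2) + (of_real (1 - u\<^sup>2) * w * p + q + r)"
    unfolding of_real_diff of_real_power of_real_1 by algebra
  thus "of_real u *
    (2 * w * of_real u * (1/(1 - segment_point w u * w)) * (1/(w - 1)) * (1/(w + 1))) =
    w/(1 - segment_point w u * w) * of_real (1 - u\<^sup>2) +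
    (segment_point w u/(1 - segment_point w u * w) + 1/(w - 1) + 1/(w + 1))"
    unfolding inverses by (simp add: segment_point_def)
qed

interpretation segment: moving_path half_disc segment_point "\<lambda>w u. of_real (-2 * u) * w"
  "\<lambda>w u. of_real (1 - u\<^sup>2)" segment_log segment_log_w "\<lambda>w. 1/w"
proof
  fix w :: complex and u :: real assume w: "w \<in> half_disc" and u: "u \<in> {0..1}"
  note regular = segment_point_regular[OF half_disc_norm[OF w] u]
  show "((\<lambda>w. segment_point w u) has_field_derivative of_real (1 - u\<^sup>2)) (at w within half_disc)"
    unfolding segment_point_def by (auto intro!: derivative_eq_intros)
  show "((\<lambda>w. of_real (-2 * u) * w) has_field_derivative of_real (-2 * u) * w * (1/w))
    (at w within half_disc)"
    using half_disc_nonzero[OF w] by (auto intro!: derivative_eq_intros)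
  show "((\<lambda>u. of_real (1 - u\<^sup>2)) has_vector_derivative of_real (-2 * u) * w * (1/w)) (at u)"
    using half_disc_nonzero[OF w]
    by (auto intro!: derivative_eq_intros simp: has_vector_derivative_def scaleR_conv_of_real
      algebra_simps)
  show "((\<lambda>w. segment_log w u) has_field_derivative segment_log_w w u) (at w within half_disc)"
    by (rule has_field_derivative_segment_log_w[OF half_disc_norm[OF w] u])
  show "segment_point w u \<noteq> rho \<and> segment_point w u \<noteq> cnj rho \<and> 1 - segment_point w u * w \<noteq> 0"
    using regular(4) regular(5)[of rho] regular(5)[of "cnj rho"] by simp
next
  fix w :: complex and u :: real assume w: "w \<in> half_disc" and u: "u \<in> {0<..<1}"
  note w' = half_disc_nonzero[OF w] half_disc_norm[OF w]
  show "segment_point w u \<noteq> w" using w' u by (auto simp: segment_point_def)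
  show "(segment_log w has_vector_derivative dlogA_t (segment_point w u) w * (of_real (-2 * u) * w))
    (at u)"
    by (rule has_vector_derivative_segment_log[OF w' u])
  show "segment_log_w w u =
    dlogA_w (segment_point w u) w + dlogA_t (segment_point w u) w * of_real (1 - u\<^sup>2)"
    by (rule segment_log_w_eq[OF w'(1) u])
next
  show "continuous_family half_disc (\<lambda>w u. of_real (1 - u\<^sup>2))"
    by (intro continuous_intros)
  show "continuous_family half_disc segment_log_w" unfolding segment_log_w_def
    by (intro continuous_intros continuous_segment_point) (use segment_point_regular(4,5)
      half_disc_norm Q3_root_rho Q3_root_cnj_rho in \<open>auto simp del: right_minus_eq\<close>)
  fix n
  have "continuous_family half_disc (\<lambda>w u. segment_log w u^n * of_real u * (-2 * w))"
    by (intro continuous_intros continuous_on_subset[OF continuous_segment_log_power])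
      (auto dest: half_disc_norm)
  thus "continuous_family half_disc (\<lambda>w u. segment_log w u^n * (of_real (-2 * u) * w))"
    by (simp add: mult_ac)
  show "continuous_on half_disc (\<lambda>w. 1/w)"
    by (intro continuous_intros) (use half_disc_nonzero in auto)
qed (intro convex_half_disc subset_refl has_vector_derivative_segment_point continuous_segment_point
  continuous_segment_pole_boundary continuous_segment_reflected_boundary; assumption)+

lemma segment_path_integral_tendsto_0:
  assumes "continuous_family (ball 0 1) (\<lambda>w u. \<phi> (segment_point w u) w)"
  shows "((\<lambda>s. segment.path_integral \<phi> n (of_real s)) \<longlongrightarrow> 0) (at_right 0)"
proof -
  let ?f = "\<lambda>w u. segment_log w u^n * (of_real (-2 * u) * w) * \<phi> (segment_point w u) w"
  have "((\<lambda>s. integral {0..1} (?f (of_real s))) \<longlongrightarrow> integral {0..1} (?f 0)) (at_right 0)"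
  proof (rule tendsto_integral_param)
    have "continuous_family (ball 0 1) (\<lambda>w u. segment_log w u^n * of_real u * (-2 * w) *
      \<phi> (segment_point w u) w)"
      by (intro continuous_intros continuous_segment_log_power assms)
    thus "continuous_family (ball 0 1) ?f" by (simp add: mult_ac)
    show "(complex_of_real \<longlongrightarrow> 0) (at_right 0)" by (intro tendsto_eq_intros) auto
    show "\<forall>\<^sub>F s in at_right 0. complex_of_real s \<in> ball 0 1"
      using eventually_at_right_0_1 by eventually_elim simp
  qed simp
  thus ?thesis unfolding segment.path_integral_def segment.integrand_def[abs_def] by simp
qed

lemma segment_log_1: "segment_log w 1 = 0"
  by (simp add: segment_log_def segment_regular_log_def segment_point_def)

lemma hyperlog_form_segment_pole_boundary:
  assumes b: "Q3_root b"
  shows "hyperlog_form half_disc n (\<lambda>w. segment.pole_boundary b n w 1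
    - segment.pole_boundary b n w 0)"
proof (rule hyperlog_form.eq_on)
  show "hyperlog_form half_disc n (\<lambda>w. if n = 0 then -(1/(w - b)) else 0)"
    using hyperlog_form_uminus[OF hyperlog_form_simple_pole] hyperlog_form_0 letter_Q3_root[OF b]
    by (cases "n = 0") simp_all
qed (unfold segment.boundary_def, simp add: segment_log_1 segment_point_def)

lemma hyperlog_form_segment_reflected_boundary:
  "hyperlog_form half_disc n (\<lambda>w. segment.reflected_boundary n w 1
    - segment.reflected_boundary n w 0)"
proof (rule hyperlog_form.eq_on)
  show "hyperlog_form half_disc n (\<lambda>w. if n = 0 then 1/(w - 1) + 1/(w - (-1)) else 0)"
    using hyperlog_form.add[OF hyperlog_form_simple_pole[OF letter_1] hyperlog_form_simple_pole[OF
      letter_minus_1]] hyperlog_form_0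
    by (cases "n = 0") simp_all
  fix w assume w: "w \<in> half_disc"
  have "w * w \<noteq> 1" using half_disc_neq(2,3)[OF w] by (simp add: square_eq_1_iff add_eq_0_iff2)
  hence "2 * w/(1 - w * w) = -(1/(w - 1) + 1/(w + 1))"
    using half_disc_neq(2,3)[OF w] by (simp add: divide_simps, simp add: algebra_simps)
  thus "segment.reflected_boundary n w 1 - segment.reflected_boundary n w 0 =
    (if n = 0 then 1/(w - 1) + 1/(w - (-1)) else 0)"
    unfolding segment.boundary_def by (simp add: segment_log_1 segment_point_def)
qed

theorem hyperlog_on_segment_integral:
  "(\<forall>b. Q3_root b \<longrightarrow> hyperlog_on half_disc (Suc n) (segment.pole_integral b n)) \<and>
    hyperlog_on half_disc (Suc n) (segment.reflected_integral n)"
proof (rule segment.hyperlog_on_path_integral[OF expansion_path_of_real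
  hyperlog_form_segment_pole_boundary hyperlog_form_segment_reflected_boundary])
  show "\<forall>\<^sub>F s in at_right 0. of_real s \<in> half_disc"
    using eventually_at_right_0_1 by (simp add: of_real_in_half_disc)
  fix n
  have "((\<lambda>s. segment.pole_integral b n (of_real s)) \<longlongrightarrow> 0) (at_right 0)" if "Q3_root b" for b
    by (rule segment_path_integral_tendsto_0, intro continuous_intros continuous_segment_point)
      (use segment_point_regular(5) that in \<open>auto simp del: right_minus_eq\<close>)
  thus "\<exists>v. polylog_value (Suc n) v \<and>
    ((\<lambda>s. segment.pole_integral b n (of_real s)) \<longlongrightarrow> v) (at_right 0)" if "Q3_root b" for b
    using that polylog_value.zero by blast
  have "((\<lambda>s. segment.reflected_integral n (of_real s)) \<longlongrightarrow> 0) (at_right 0)"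
    by (rule segment_path_integral_tendsto_0, intro continuous_intros continuous_segment_point)
      (use segment_point_regular(4) in auto)
  thus "\<exists>v. polylog_value (Suc n) v \<and>
    ((\<lambda>s. segment.reflected_integral n (of_real s)) \<longlongrightarrow> v) (at_right 0)"
    using polylog_value.zero by blast
qed

section \<open>The segments from the origin to -1 and 1\<close>

lemma DERIV_mult_log_derivative:
  assumes "(f has_field_derivative f z * l) (at z within A)"
    "(g has_field_derivative g z * m) (at z within A)"
  shows "((\<lambda>x. f x * g x) has_field_derivative (f z * g z) * (l + m)) (at z within A)"
  using DERIV_mult[OF assms] by (simp add: algebra_simps)

lemma DERIV_divide_log_derivative:
  assumes "(f has_field_derivative f z * l) (at z within A)"
    "(g has_field_derivative g z * m) (at z within A)" "g z \<noteq> 0"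
  shows "((\<lambda>x. f x/g x) has_field_derivative (f z/g z) * (l - m)) (at z within A)"
proof -
  have "(f z * l * g z - f z * (g z * m))/(g z * g z) = (f z/g z) * (l - m)"
    using assms(3) by (simp add: field_simps)
  thus ?thesis using DERIV_divide[OF assms] by simp
qed

lemma DERIV_linear_log_derivative:
  fixes z :: "'a :: real_normed_field"
  assumes "z - a \<noteq> 0"
  shows "((\<lambda>z. z - a) has_field_derivative (z - a) * (1/(z - a))) (at z within A)"
  using assms by (auto intro!: derivative_eq_intros)

lemma DERIV_Ln_log_derivative:
  assumes "(f has_field_derivative f z * l) (at z within A)" "f z \<notin> \<real>\<^sub>\<le>\<^sub>0"
  shows "((\<lambda>z. Ln (f z)) has_field_derivative l) (at z within A)"
proof -
  have "f z \<noteq> 0" using assms(2) by auto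
  thus ?thesis using DERIV_chain2[OF has_field_derivative_Ln[OF assms(2)] assms(1)]
    by (simp add: mult.assoc[symmetric])
qed

lemma A3_factors: "A3 t w = (1 - t/w) * (1 - t * w)/((t - rho) * (t - cnj rho))"
  unfolding A3_def Q3_factors ..

lemma A3_log_derivative_t:
  assumes "w \<noteq> 0" "t - rho \<noteq> 0" "t - cnj rho \<noteq> 0" "t - w \<noteq> 0" "1 - t * w \<noteq> 0"
  shows "((\<lambda>t. A3 t w) has_field_derivative A3 t w * dlogA_t t w) (at t)"
proof -
  have "(1 - t/w) * (1/(t - w)) = -1/w" using assms(1,4) by (simp add: divide_simps)
  hence "((\<lambda>t. 1 - t/w) has_field_derivative (1 - t/w) * (1/(t - w))) (at t)"
    using assms(1) by (auto intro!: derivative_eq_intros)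
  moreover have "((\<lambda>t. 1 - t * w) has_field_derivative (1 - t * w) * (-w/(1 - t * w))) (at t)"
    using assms by (auto intro!: derivative_eq_intros)
  ultimately have
    "((\<lambda>t. A3 t w) has_field_derivative
    A3 t w * (1/(t - w) + (-w/(1 - t * w)) - (1/(t - rho) + 1/(t - cnj rho)))) (at t)"
    unfolding A3_factors using assms
    by (intro DERIV_divide_log_derivative DERIV_mult_log_derivative DERIV_linear_log_derivative)
      auto
  thus ?thesis by (simp add: dlogA_t_def diff_diff_eq add.assoc)
qed

lemma A3_log_derivative_w:
  assumes "w \<noteq> 0" "t - w \<noteq> 0" "1 - t * w \<noteq> 0"
  shows "((\<lambda>w. A3 t w) has_field_derivative A3 t w * dlogA_w t w) (at w)"
proof -
  have "(1 - t/w) * (-1/(t - w) - 1/w) = t/w\<^sup>2"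
    using assms(1,2) by (simp add: divide_simps power2_eq_square, (simp add: algebra_simps)?)
  hence "((\<lambda>w. 1 - t/w) has_field_derivative (1 - t/w) * (-1/(t - w) - 1/w)) (at w)"
    using assms(1) by (auto intro!: derivative_eq_intros simp: power2_eq_square)
  moreover have "((\<lambda>w. 1 - t * w) has_field_derivative (1 - t * w) * (-t/(1 - t * w))) (at w)"
    using assms by (auto intro!: derivative_eq_intros)
  ultimately have
    "((\<lambda>w. (1 - t/w) * (1 - t * w)) has_field_derivative
    (1 - t/w) * (1 - t * w) * (-1/(t - w) - 1/w + (-t/(1 - t * w)))) (at w)"
    by (rule DERIV_mult_log_derivative)
  from DERIV_cdivide[OF this, of "Q3 t"] show ?thesis by (simp add: A3_def dlogA_w_def)
qed

lemma A3_0: "A3 0 w = 1"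
  by (simp add: A3_def Q3_def)

lemma A3_rho: "t - rho \<noteq> 0 \<Longrightarrow> t - cnj rho \<noteq> 0 \<Longrightarrow> A3 t rho = 1"
  using Q3_factors[of t] by (simp add: A3_def Q3_def)

lemma of_real_neq_Q3_root: "Q3_root b \<Longrightarrow> of_real x - b \<noteq> 0"
  by (auto simp: Q3_root_def complex_eq_iff Re_rho Im_rho)

definition chord :: "real \<Rightarrow> complex" where
  "chord = chord_from rho rho"

lemma chord_eq_linepath: "chord s = linepath rho 1 s"
proof -
  have "rho * (1 - x * rho) = (1 - x) * rho + x" for x using rho_add_cnj rho_mult_cnj by algebra
  thus ?thesis by (simp add: chord_def chord_from_def linepath_def scaleR_conv_of_real)
qed

lemma Re_chord: "Re (chord s) = 1/2 + s/2" and Im_chord: "Im (chord s) = sqrt 3/2 * (1 - s)"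
  by (simp_all add: chord_eq_linepath linepath_def Re_rho Im_rho algebra_simps)

lemma norm_chord_square: "(norm (chord s))\<^sup>2 = 1 - s + s\<^sup>2"
  unfolding cmod_power2 Re_chord Im_chord
  by (simp add: power_mult_distrib power_divide) (simp add: power2_eq_square field_simps)

lemma chord_tendsto: "(chord \<longlongrightarrow> rho) (at_right 0)"
  unfolding chord_def by (rule tendsto_chord_from)

definition upper_corner :: "complex set" where
  "upper_corner = {z. norm z < 1 \<and> 1/2 < Re z \<and> 0 < Im z}"

lemma upper_corner_subset: "upper_corner \<subseteq> half_disc"
  by (auto simp: upper_corner_def half_disc_def)

lemma convex_upper_corner: "convex upper_corner"
proof -
  have eq: "upper_corner = ball 0 1 \<inter> ({z. Re z > 1/2} \<inter> {z. Im z > 0})"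
    by (auto simp: upper_corner_def)
  show ?thesis
    unfolding eq by (intro convex_Int convex_ball convex_halfspace_Re_gt convex_halfspace_Im_gt)
qed

lemma chord_in_upper_corner: "0 < s \<Longrightarrow> s < 1 \<Longrightarrow> chord s \<in> upper_corner"
proof -
  assume s: "0 < s" "s < 1"
  have "s * s < s * 1" using s by (intro mult_strict_left_mono) auto
  hence "(norm (chord s))\<^sup>2 < 1\<^sup>2" unfolding norm_chord_square by (simp add: power2_eq_square)
  hence "norm (chord s) < 1" by (rule power2_less_imp_less) simp
  thus ?thesis using s by (simp add: upper_corner_def Re_chord Im_chord)
qed

lemma eventually_chord: "\<forall>\<^sub>F s in at_right 0. chord s \<in> upper_corner"
  using eventually_at_right_0_1 by eventually_elim (auto intro: chord_in_upper_corner)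

lemma polylog_value_Ln_rho: "polylog_value 1 (Ln rho)"
proof -
  have "rho = 1 - cnj rho" using rho_add_cnj by (simp add: algebra_simps)
  moreover have "cnj rho \<noteq> 1" by (auto simp: complex_eq_iff Re_rho)
  ultimately show ?thesis
    using polylog_value_Ln_one_minus_root[OF Q3_root_pow_6[OF Q3_root_cnj_rho]] by simp
qed

lemma expansion_path_chord: "expansion_path upper_corner chord (Ln rho)"
  unfolding chord_def
  by (rule expansion_path_root[OF _ _ polylog_value_Ln_rho])
    (simp_all add: eventually_chord[unfolded chord_def] Q3_root_pow_6 nonpos_Reals_Re Re_rho)

lemma Q3_of_real: "Q3 (of_real x) = of_real (x\<^sup>2 - x + 1)"
  by (simp add: Q3_eq)

lemma quadratic_pos: "x\<^sup>2 - x + 1 > (0::real)"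
proof -
  have "x\<^sup>2 - x + 1 = (x - 1/2)\<^sup>2 + 3/4" by (simp add: power2_eq_square algebra_simps)
  also have "... > 0" by (intro add_nonneg_pos) auto
  finally show ?thesis .
qed

lemma A3_of_real:
  "w \<noteq> 0 \<Longrightarrow> A3 (of_real x) w = (1 + of_real (x\<^sup>2) - of_real x * (w + 1/w))/of_real (x\<^sup>2 - x + 1)"
  unfolding A3_def Q3_of_real by (simp add: algebra_simps power2_eq_square)

lemma Re_add_inverse:
  "w \<noteq> 0 \<Longrightarrow> Re (w + 1/w) = Re w * (1 + 1/(norm w)\<^sup>2)" and Im_add_inverse: "w \<noteq> 0 \<Longrightarrow>
    Im (w + 1/w) = Im w * (1 - 1/(norm w)\<^sup>2)"
  by (simp_all add: Re_divide Im_divide cmod_power2 algebra_simps)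

lemma A3_of_real_in_nonpos_Reals_iff:
  "w \<noteq> 0 \<Longrightarrow> A3 (of_real x) w \<in> \<real>\<^sub>\<le>\<^sub>0 \<longleftrightarrow> x * Im (w + 1/w) = 0 \<and> 1 + x\<^sup>2 \<le> x * Re (w + 1/w)"
  unfolding A3_of_real using quadratic_pos[of x]
  by (auto simp: complex_nonpos_Reals_iff divide_le_0_iff Re_divide_of_real Im_divide_of_real)

lemma A3_notin_nonpos_Reals_left:
  assumes "w \<in> half_disc" "x \<le> 0"
  shows "A3 (of_real x) w \<notin> \<real>\<^sub>\<le>\<^sub>0"
proof -
  note w = half_disc_nonzero[OF assms(1)]
  have "Re (w + 1/w) > 0" using assms(1) unfolding Re_add_inverse[OF w]
    by (intro mult_pos_pos add_pos_nonneg) (auto simp: half_disc_def)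
  hence "x * Re (w + 1/w) \<le> 0" using assms(2) by (simp add: mult_nonpos_nonneg)
  hence "\<not> 1 + x\<^sup>2 \<le> x * Re (w + 1/w)" using zero_le_power2[of x] by linarith
  thus ?thesis unfolding A3_of_real_in_nonpos_Reals_iff[OF w] by simp
qed

lemma A3_notin_nonpos_Reals_right:
  assumes "w \<in> upper_corner"
  shows "A3 (of_real x) w \<notin> \<real>\<^sub>\<le>\<^sub>0"
proof (cases "x = 0")
  case False
  have w: "w \<in> half_disc" using assms upper_corner_subset by auto
  have "0 < norm w" "norm w < 1" using half_disc_nonzero[OF w] half_disc_norm[OF w] by auto
  hence "1 - 1/(norm w)\<^sup>2 < 0" by (simp add: power_less_one_iff)
  hence "Im (w + 1/w) < 0"
    unfolding Im_add_inverse[OF half_disc_nonzero[OF w]] using assms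
    by (intro mult_pos_neg) (auto simp: upper_corner_def)
  thus ?thesis
    using False unfolding A3_of_real_in_nonpos_Reals_iff[OF half_disc_nonzero[OF w]] by simp
qed (simp add: A3_0)

locale ray =
  fixes \<epsilon> :: real and S :: "complex set"
  assumes \<epsilon>: "\<epsilon> = 1 \<or> \<epsilon> = -1" and convex_S: "convex S" and S_subset: "S \<subseteq> half_disc"
    and upper_corner_subset_S: "upper_corner \<subseteq> S"
    and A3_S: "\<And>w u. w \<in> S \<Longrightarrow> u \<in> {0..1} \<Longrightarrow> A3 (of_real (\<epsilon> * u)) w \<notin> \<real>\<^sub>\<le>\<^sub>0"
begin

definition point :: "real \<Rightarrow> complex" where
  "point u = of_real (\<epsilon> * u)"

definition log_A :: "complex \<Rightarrow> real \<Rightarrow> complex" where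
  "log_A w u = Ln (A3 (point u) w)"

lemma point_neq_Q3_root: "Q3_root b \<Longrightarrow> point u - b \<noteq> 0"
  by (simp only: point_def of_real_neq_Q3_root not_False_eq_True)

lemma has_vector_derivative_point: "(point has_vector_derivative of_real \<epsilon>) (at u)"
  unfolding point_def
  by (auto intro!: derivative_eq_intros simp: has_vector_derivative_def scaleR_conv_of_real
    algebra_simps)

lemma A3_point_rho: "A3 (point u) rho = 1"
  using point_neq_Q3_root by (intro A3_rho) simp_all

lemma A3_notin_nonpos_Reals:
  assumes "w \<in> insert rho S" "u \<in> {0..1}"
  shows "A3 (point u) w \<notin> \<real>\<^sub>\<le>\<^sub>0"
  using A3_S[of w u] assms A3_point_rho[of u] by (auto simp: point_def simp del: of_real_mult)

lemma point_regular:
  assumes "w \<in> insert rho S" "u \<in> {0..1}"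
  shows "w \<noteq> 0" "point u - w \<noteq> 0" "1 - point u * w \<noteq> 0"
proof -
  show w: "w \<noteq> 0" using half_disc_nonzero S_subset assms by auto
  show "point u - w \<noteq> 0" using A3_notin_nonpos_Reals[OF assms] w by (auto simp: A3_def)
  show "1 - point u * w \<noteq> 0" using A3_notin_nonpos_Reals[OF assms] by (auto simp: A3_def)
qed

lemma continuous_point: "continuous_on A point"
  unfolding point_def by (intro continuous_intros)

lemma continuous_point_snd: "continuous_on A (\<lambda>x. point (snd x))"
  by (rule continuous_on_compose2[OF continuous_point continuous_on_snd[OF continuous_on_id]
    subset_UNIV])

lemma continuous_log_A: "continuous_family (insert rho S) log_A"
  unfolding log_A_def
proof (intro continuous_on_Ln')
  show "continuous_family (insert rho S) (\<lambda>w u. A3 (point u) w)" unfolding A3_factors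
    by (intro continuous_intros continuous_point_snd) (use point_regular point_neq_Q3_root in
      \<open>auto simp del: right_minus_eq\<close>)
qed (use A3_notin_nonpos_Reals in auto)

lemma has_field_derivative_log_A_w:
  assumes "w \<in> S" "u \<in> {0..1}"
  shows "((\<lambda>w. log_A w u) has_field_derivative dlogA_w (point u) w) (at w within S)"
  unfolding log_A_def using assms
  by (intro DERIV_Ln_log_derivative has_field_derivative_at_within[OF A3_log_derivative_w]
    point_regular A3_notin_nonpos_Reals) auto

lemma has_vector_derivative_log_A:
  assumes "w \<in> S" "u \<in> {0..1}"
  shows "(log_A w has_vector_derivative dlogA_t (point u) w * of_real \<epsilon>) (at u)"
proof -
  have w: "w \<in> insert rho S" using assms by simp
  have "((\<lambda>t. Ln (A3 t w)) has_field_derivative dlogA_t (point u) w) (at (point u))"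
    by (intro DERIV_Ln_log_derivative A3_log_derivative_t A3_notin_nonpos_Reals[OF w assms(2)]
      point_regular[OF w assms(2)] point_neq_Q3_root Q3_root_rho Q3_root_cnj_rho)
  from field_vector_diff_chain_at[OF has_vector_derivative_point this]
  show ?thesis unfolding log_A_def[abs_def] o_def by (simp add: mult.commute)
qed

sublocale moving_path S "\<lambda>w. point" "\<lambda>w u. of_real \<epsilon>" "\<lambda>w u. 0" log_A "\<lambda>w u. dlogA_w (point u) w"
  "\<lambda>w. 0"
proof
  have log_A: "continuous_family S log_A"
    by (rule continuous_on_subset[OF continuous_log_A]) auto
  show "continuous_family S (\<lambda>w u. log_A w u^n * of_real \<epsilon>)" for n
    by (intro continuous_intros log_A)
  show "continuous_family S (\<lambda>w u. dlogA_w (point u) w)"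
    unfolding dlogA_w_def
    by (intro continuous_intros continuous_point_snd)
      (use point_regular in \<open>auto simp del: right_minus_eq\<close>)
  fix w assume w: "w \<in> S"
  note slice = continuous_on_slice[OF log_A w]
  show "continuous_on {0..1} (\<lambda>u. log_A w u^n * (1/(point u - b) * 0 + (-1/(w - b))))" for n b
    unfolding mult_zero_right by (intro continuous_intros slice)
  show "continuous_on {0..1}
    (\<lambda>u. log_A w u^n * (w/(1 - point u * w) * 0 + (point u/(1 - point u * w) + 1/(w - 1) +
    1/(w + 1))))" for n
    unfolding mult_zero_right
    by (intro continuous_intros slice continuous_point) (use point_regular[of w] w in auto)
next
  fix w and u :: real assume w: "w \<in> S" and u: "u \<in> {0<..<1}"
  thus "(log_A w has_vector_derivative dlogA_t (point u) w * of_real \<epsilon>) (at u)"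
    by (intro has_vector_derivative_log_A) auto
  show "point u \<noteq> w" using point_regular(2)[of w u] w u by auto
next
  fix w and u :: real assume w: "w \<in> S" and u: "u \<in> {0..1}"
  show "point u \<noteq> rho \<and> point u \<noteq> cnj rho \<and> 1 - point u * w \<noteq> 0"
    using point_regular[of w u] w u point_neq_Q3_root[of rho u] point_neq_Q3_root[of "cnj rho" u]
    by auto
qed (auto intro!: derivative_eq_intros convex_S S_subset[THEN subsetD] has_vector_derivative_point
  has_field_derivative_log_A_w continuous_point_snd)

lemma \<epsilon>_root: "complex_of_real \<epsilon>^6 = 1" "letter (of_real \<epsilon>)" "letter (-of_real \<epsilon>)"
  "complex_of_real \<epsilon> * of_real \<epsilon> = 1"
  using \<epsilon> by (auto simp: letter_def)

lemma expansion_path_chord_S: "expansion_path S chord (Ln rho)"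
  by (rule expansion_path_mono[OF expansion_path_chord upper_corner_subset_S])

lemma tendsto_integral_chord:
  fixes f :: "complex \<Rightarrow> real \<Rightarrow> complex"
  assumes "continuous_family (insert rho S) f"
  shows "((\<lambda>s. integral {0..1} (f (chord s))) \<longlongrightarrow> integral {0..1} (f rho)) (at_right 0)"
  by (rule tendsto_integral_param[OF assms insertI1 chord_tendsto])
    (use eventually_expansion_path[OF expansion_path_chord_S] in \<open>auto elim: eventually_mono\<close>)

lemma Ln_A3_\<epsilon>_tendsto_0: "((\<lambda>s. Ln (A3 (of_real \<epsilon>) (chord s))) \<longlongrightarrow> 0) (at_right 0)"
proof -
  have "((\<lambda>s. A3 (of_real \<epsilon>) (chord s)) \<longlongrightarrow> A3 (of_real \<epsilon>) rho) (at_right 0)"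
    unfolding A3_factors using of_real_neq_Q3_root[of _ \<epsilon>]
    by (intro tendsto_intros chord_tendsto) (auto simp del: right_minus_eq)
  hence "((\<lambda>s. A3 (of_real \<epsilon>) (chord s)) \<longlongrightarrow> 1) (at_right 0)"
    using A3_point_rho[of 1] by (simp add: point_def)
  hence "((\<lambda>s. Ln (A3 (of_real \<epsilon>) (chord s))) \<longlongrightarrow> Ln 1) (at_right 0)" by (intro tendsto_Ln) auto
  thus ?thesis by simp
qed

lemma hyperlog_on_Ln_A3_\<epsilon>: "hyperlog_on S 1 (\<lambda>w. Ln (A3 (of_real \<epsilon>) w))"
proof -
  have "hyperlog_on S (Suc 0) (\<lambda>w. log_A w 1)"
  proof (rule hyperlog_on_of_derivative[OF expansion_path_chord_S convex_S S_subset])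
    show "((\<lambda>w. log_A w 1) has_field_derivative dlogA_w (point 1) w) (at w within S)" if "w \<in> S"
      for w
      by (rule has_field_derivative_log_A_w[OF that]) simp
    have "hyperlog_form S 0 (\<lambda>w. of_nat 2 * (1/(w - of_real \<epsilon>)) - 1/(w - 0))"
      by (intro hyperlog_form_diff hyperlog_form_of_nat_mult hyperlog_form_simple_pole \<epsilon>_root
        letter_0)
    thus "hyperlog_form S 0 (dlogA_w (point 1))"
    proof (rule hyperlog_form.eq_on)
      fix w assume w: "w \<in> S"
      have "point 1 - w \<noteq> 0" using point_regular[of w 1] w by auto
      define p q where inverses: "p = 1/(point 1 - w)" "q = 1/(1 - point 1 * w)"
      have "p * (of_real \<epsilon> - w) = 1" "q * (1 - of_real \<epsilon> * w) = 1"
        using point_regular[of w 1] w by (auto simp: inverses point_def)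
      hence "-p - of_real \<epsilon> * q = -2 * p" using \<epsilon>_root(4) by algebra
      moreover have "1/(w - of_real \<epsilon>) = -p"
        by (simp add: inverses point_def flip: minus_divide_right)
          (metis minus_diff_eq minus_divide_right)
      ultimately show "dlogA_w (point 1) w = of_nat 2 * (1/(w - of_real \<epsilon>)) - 1/(w - 0)"
        unfolding dlogA_w_def inverses by (simp add: point_def)
    qed
  qed (use Ln_A3_\<epsilon>_tendsto_0 in \<open>auto simp: log_A_def point_def intro: polylog_value.zero\<close>)
  thus ?thesis by (simp add: log_A_def point_def)
qed

definition pole_constant :: "complex \<Rightarrow> complex" where
  "pole_constant b = integral {0..1} (\<lambda>u. of_real \<epsilon> * (1/(point u - b)))"

lemma polylog_value_pole_constant:
  assumes b: "Q3_root b"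
  shows "polylog_value 1 (pole_constant b)"
proof -
  have notin: "1 - point u * cnj b \<notin> \<real>\<^sub>\<le>\<^sub>0" if "u \<in> {0..1}" for u
  proof (rule nonpos_Reals_Re)
    have "\<epsilon> * u \<le> 1" using \<epsilon> that by auto
    moreover have "Re (1 - point u * cnj b) = 1 - \<epsilon> * u/2"
      using b by (auto simp: Q3_root_def point_def Re_rho)
    ultimately show "Re (1 - point u * cnj b) > 0" by linarith
  qed
  have "((\<lambda>u. Ln (1 - point u * cnj b)) has_vector_derivative of_real \<epsilon> * (1/(point u - b))) (at u)"
    if "u \<in> {0..1}" for u
    using has_vector_derivative_Ln_one_minus[OF has_vector_derivative_point notin[OF that]]
    unfolding minus_divide_left[symmetric] reflected_Q3_root[OF b] by simp
  hence "((\<lambda>u. of_real \<epsilon> * (1/(point u - b))) has_integral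
    (Ln (1 - point 1 * cnj b) - Ln (1 - point 0 * cnj b))) {0..1}"
    by (rule fundamental_theorem_of_calculus[OF zero_le_one has_vector_derivative_at_within])
  hence "pole_constant b = Ln (1 - of_real \<epsilon> * cnj b)"
    by (simp add: integral_unique pole_constant_def point_def)
  moreover have "(of_real \<epsilon> * cnj b)^6 = 1" "of_real \<epsilon> * cnj b \<noteq> 1"
    using Q3_root_pow_6[OF Q3_root_cnj[OF b]] \<epsilon>_root(1) notin[of 1]
    by (auto simp: power_mult_distrib point_def)
  ultimately show ?thesis using polylog_value_Ln_one_minus_root by simp
qed

lemma pole_integral_0: "pole_integral b 0 w = pole_constant b"
  by (simp add: path_integral_def integrand_def[abs_def] pole_constant_def)

lemma pole_integral_chord_tendsto:
  assumes b: "Q3_root b"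
  shows "((\<lambda>s. pole_integral b n (chord s)) \<longlongrightarrow> (if n = 0 then pole_constant b else 0)) (at_right 0)"
proof -
  have "((\<lambda>s. pole_integral b n (chord s)) \<longlongrightarrow>
    integral {0..1} (\<lambda>u. log_A rho u^n * of_real \<epsilon> * (1/(point u - b)))) (at_right 0)"
    unfolding path_integral_def integrand_def[abs_def]
    by (rule tendsto_integral_chord, intro continuous_intros continuous_log_A continuous_point_snd)
      (use point_neq_Q3_root[OF b] in auto)
  thus ?thesis
    by (cases "n = 0") (simp_all add: log_A_def A3_point_rho pole_constant_def power_0_left)
qed

lemma reflected_integral_chord_tendsto:
  "((\<lambda>s. reflected_integral n (chord s)) \<longlongrightarrow> (if n = 0 then -pole_constant (cnj rho) else 0))
    (at_right 0)"
proof -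
  have "((\<lambda>s. reflected_integral n (chord s)) \<longlongrightarrow>
    integral {0..1} (\<lambda>u. log_A rho u^n * of_real \<epsilon> * (rho/(1 - point u * rho)))) (at_right 0)"
    unfolding path_integral_def integrand_def[abs_def]
    by (rule tendsto_integral_chord[where
      f="\<lambda>w u. log_A w u^n * of_real \<epsilon> * (w/(1 - point u * w))"], intro continuous_intros
      continuous_log_A continuous_point_snd) (use point_regular(3) in auto)
  moreover have "integral {0..1} (\<lambda>u. of_real \<epsilon> * (rho/(1 - point u * rho))) =
    -pole_constant (cnj rho)"
    unfolding pole_constant_def reflected_rho by (simp flip: integral_neg)
  ultimately show ?thesis by (cases "n = 0") (simp_all add: log_A_def A3_point_rho power_0_left)
qed

lemma hyperlog_form_power_0: "hyperlog_form S 0 g \<Longrightarrow> hyperlog_form S n (\<lambda>w. 0^n * g w)"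
  using hyperlog_form_0 by (cases n) simp_all

lemma log_A_0: "log_A w 0 = 0" and log_A_1: "log_A w 1 = Ln (A3 (of_real \<epsilon>) w)"
  by (simp_all add: log_A_def point_def A3_0)

lemma hyperlog_form_Ln_A3_power_pole:
  "letter a \<Longrightarrow> hyperlog_form S n (\<lambda>w. Ln (A3 (of_real \<epsilon>) w)^n * (1/(w - a)))"
  using hyperlog_form.pole[OF hyperlog_on_power[OF S_subset hyperlog_on_Ln_A3_\<epsilon>, of n]] by simp

lemma hyperlog_form_pole_boundary:
  assumes "Q3_root b"
  shows "hyperlog_form S n (\<lambda>w. pole_boundary b n w 1 - pole_boundary b n w 0)"
proof (rule hyperlog_form.eq_on)
  show "hyperlog_form S n (\<lambda>w. -(Ln (A3 (of_real \<epsilon>) w)^n * (1/(w - b))) + 0^n * (1/(w - b)))"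
    using assms
    by (intro hyperlog_form.add hyperlog_form_uminus hyperlog_form_Ln_A3_power_pole
      hyperlog_form_power_0 hyperlog_form_simple_pole letter_Q3_root)
qed (simp add: boundary_def log_A_0 log_A_1)

lemma hyperlog_form_reflected_boundary:
  "hyperlog_form S n (\<lambda>w. reflected_boundary n w 1 - reflected_boundary n w 0)"
proof (rule hyperlog_form.eq_on)
  show "hyperlog_form S n (\<lambda>w. Ln (A3 (of_real \<epsilon>) w)^n * (1/(w - (-of_real \<epsilon>)))
    - 0^n * (1/(w - 1) + 1/(w - (-1))))"
    by (intro hyperlog_form_diff hyperlog_form.add hyperlog_form_Ln_A3_power_pole
      hyperlog_form_power_0 hyperlog_form_simple_pole \<epsilon>_root letter_1 letter_minus_1)
  fix w assume "w \<in> S"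
  hence "w - 1 \<noteq> 0" "1 - w \<noteq> 0" using half_disc_neq[of w] S_subset by auto
  hence "1/(1 - w) + 1/(w - 1) = 0" by (simp add: divide_simps)
  hence "of_real \<epsilon>/(1 - of_real \<epsilon> * w) + 1/(w - 1) + 1/(w + 1) = 1/(w - (-of_real \<epsilon>))"
    using \<epsilon> by (auto simp: add.commute)
  thus "reflected_boundary n w 1 - reflected_boundary n w 0 =
    Ln (A3 (of_real \<epsilon>) w)^n * (1/(w - (-of_real \<epsilon>))) - 0^n * (1/(w - 1) + 1/(w - (-1)))"
    by (simp add: boundary_def log_A_0 log_A_1) (simp add: point_def)
qed

theorem hyperlog_on_ray_integral:
  "(\<forall>b. Q3_root b \<longrightarrow> hyperlog_on S (Suc n) (pole_integral b n)) \<and>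
    hyperlog_on S (Suc n) (reflected_integral n)"
proof (rule hyperlog_on_path_integral[OF expansion_path_chord_S hyperlog_form_pole_boundary
  hyperlog_form_reflected_boundary])
  fix n
  show "\<exists>v. polylog_value (Suc n) v \<and> ((\<lambda>s. pole_integral b n (chord s)) \<longlongrightarrow> v) (at_right 0)"
    if "Q3_root b" for b
    using pole_integral_chord_tendsto[OF that, of n] polylog_value_pole_constant[OF that]
      polylog_value.zero
    by (cases n) auto
  show "\<exists>v. polylog_value (Suc n) v \<and> ((\<lambda>s. reflected_integral n (chord s)) \<longlongrightarrow> v) (at_right 0)"
    using reflected_integral_chord_tendsto[of n]
      polylog_value_uminus[OF polylog_value_pole_constant[of "cnj rho"]] polylog_value.zero
    by (cases n) auto
qed

lemma has_integral_pole_integral: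
  assumes "w \<in> S" "Q3_root b"
  shows "((\<lambda>u. of_real \<epsilon> * (Ln (A3 (of_real (\<epsilon> * u)) w)^n * (1/(of_real (\<epsilon> * u) - b)))) has_integral
    pole_integral b n w) {0..1}"
proof -
  have "(integrand (\<lambda>z w. 1/(z - b)) n w has_integral pole_integral b n w) {0..1}"
    unfolding path_integral_def
    by (intro integrable_integral integrable_continuous_real continuous_pole_integrand assms)
  thus ?thesis unfolding integrand_def[abs_def] log_A_def point_def by (simp only: mult_ac)
qed

end

interpretation negative_ray: ray "-1" half_disc
  using convex_half_disc upper_corner_subset A3_notin_nonpos_Reals_left[of _ "-u" for u]
  by unfold_locales auto

interpretation positive_ray: ray 1 upper_corner
  using convex_upper_corner upper_corner_subset A3_notin_nonpos_Reals_right
  by unfold_locales auto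

section \<open>The generating integrals\<close>

lemma Ln_rho: "Ln rho = \<i> * of_real pi/3"
proof -
  have "Ln (exp (\<i> * of_real pi/3)) = \<i> * of_real pi/3"
    by (rule Ln_exp) (use pi_gt_zero in simp_all)
  thus ?thesis by (simp add: rho_def mult.commute)
qed

lemma polylog_value_ii_pi: "polylog_value 1 (\<i> * of_real pi)"
  using polylog_value_of_nat_mult[OF polylog_value_Ln_rho, of 3] by (simp add: Ln_rho)

lemma polylog_value_pi_even_power: "polylog_value (2 * n) (of_real (pi^(2 * n)))"
proof -
  have "polylog_value 2 (-(\<i> * of_real pi * (\<i> * of_real pi)))"
    using polylog_value_uminus[OF polylog_value_mult[OF polylog_value_ii_pi polylog_value_ii_pi]]
    by (simp add: numeral_2_eq_2)
  moreover have "-(\<i> * of_real pi * (\<i> * of_real pi)) = of_real (pi^2)"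
    by (simp add: power2_eq_square complex_eq_iff)
  ultimately have "polylog_value 2 (of_real (pi^2))" by simp
  from polylog_value_power[OF this, of n] show ?thesis by (simp add: mult.commute[of n] power_mult)
qed

lemma polylog_value_ln_3: "polylog_value 1 (of_real (ln 3))"
proof -
  let ?w="1 + cnj rho"
  have w: "1 - rho\<^sup>2 = ?w" "1 - (cnj rho)\<^sup>2 = cnj ?w"
    using rho_add_cnj rho_mult_cnj unfolding complex_cnj_add complex_cnj_one complex_cnj_cnj
    by algebra+
  have notin: "?w \<notin> \<real>\<^sub>\<le>\<^sub>0" by (rule nonpos_Reals_Re) (simp add: Re_rho)
  have "polylog_value 1 (Ln (1 - b\<^sup>2))" if "Q3_root b" for b
  proof (rule polylog_value_Ln_one_minus_root)
    have "(b\<^sup>2)^6 = (b^6)\<^sup>2" by (simp flip: power_mult)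
    thus "(b\<^sup>2)^6 = 1" by (simp add: Q3_root_pow_6[OF that])
    show "b\<^sup>2 \<noteq> 1"
    proof
      assume "b\<^sup>2 = 1"
      hence "b = 2" using Q3_root_add_cnj[OF that] Q3_root_mult_cnj[OF that] by algebra
      thus False using norm_Q3_root[OF that] by simp
    qed
  qed
  from polylog_value.add[OF this[OF Q3_root_rho] this[OF Q3_root_cnj_rho]]
  have "polylog_value 1 (Ln ?w + cnj (Ln ?w))" unfolding w cnj_Ln[OF notin] .
  also have "Ln ?w + cnj (Ln ?w) = of_real (2 * Re (Ln ?w))" by (simp add: complex_add_cnj)
  also have "2 * Re (Ln ?w) = ln 3"
  proof -
    have "(norm ?w)\<^sup>2 = 3" unfolding cmod_power2 by (simp add: Re_rho Im_rho power2_eq_square)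
    moreover have "?w \<noteq> 0" using notin by auto
    hence "2 * Re (Ln ?w) = ln ((norm ?w)\<^sup>2)" by (simp add: Re_Ln ln_realpow)
    ultimately show ?thesis by simp
  qed
  finally show ?thesis .
qed

lemma polylog_value_ln_4: "polylog_value 1 (of_real (ln (1/4)))"
proof -
  have "polylog_value 1 (Ln (1 - (-1)))" by (rule polylog_value_Ln_one_minus_root) auto
  hence "polylog_value 1 (of_real (ln 2))" using Ln_of_real[of 2] by simp
  moreover have "ln (1/4 :: real) = -(2 * ln 2)"
    using ln_realpow[of "2::real" 2] by (simp add: ln_div)
  ultimately show ?thesis
    using polylog_value_uminus[OF polylog_value_of_nat_mult, of 1 _ 2] by fastforce
qed

abbreviation i_sqrt3 :: complex where "i_sqrt3 \<equiv> \<i> * of_real (sqrt 3)"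

lemma i_sqrt3_div_Q3:
  assumes "t - rho \<noteq> 0" "t - cnj rho \<noteq> 0"
  shows "i_sqrt3 * (1/Q3 t) = 1/(t - rho) - 1/(t - cnj rho)"
proof -
  have "i_sqrt3 = rho - cnj rho" by (simp add: complex_eq_iff Re_rho Im_rho)
  thus ?thesis unfolding Q3_factors using assms by (simp add: divide_simps)
qed

lemma has_integral_div_Q3:
  assumes "\<And>b. Q3_root b \<Longrightarrow> ((\<lambda>t. f t * (1/(of_real t - b))) has_integral I b) {x..y}"
  shows "((\<lambda>t. f t/Q3 (of_real t)) has_integral (I rho - I (cnj rho))/i_sqrt3) {x..y}"
proof -
  have "((\<lambda>t. f t * (1/(of_real t - rho)) - f t * (1/(of_real t - cnj rho))) has_integral
    (I rho - I (cnj rho))) {x..y}"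
    by (intro has_integral_diff assms Q3_root_rho Q3_root_cnj_rho)
  moreover have "f t * (1/(of_real t - rho)) - f t * (1/(of_real t - cnj rho)) =
    i_sqrt3 * (f t/Q3 (of_real t))" for t
    unfolding right_diff_distrib[symmetric] i_sqrt3_div_Q3[OF of_real_neq_Q3_root[OF Q3_root_rho]
      of_real_neq_Q3_root[OF Q3_root_cnj_rho], symmetric]
    by simp
  ultimately have "((\<lambda>t. i_sqrt3 * (f t/Q3 (of_real t))) has_integral (I rho - I (cnj rho))) {x..y}"
    by simp
  from has_integral_mult_right[OF this, of "1/i_sqrt3"] show ?thesis by simp
qed

lemma has_integral_negative_ray:
  assumes "w \<in> half_disc" "Q3_root b"
  shows "((\<lambda>t. Ln (A3 (of_real t) w)^n * (1/(of_real t - b))) has_integral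
    -negative_ray.pole_integral b n w) {-1..0}"
proof -
  let ?f = "\<lambda>t. Ln (A3 (of_real t) w)^n * (1/(of_real t - b))"
  have "((\<lambda>t. -?f (-t)) has_integral negative_ray.pole_integral b n w) {0..1}"
    using negative_ray.has_integral_pole_integral[OF assms, of n] by simp
  from has_integral_neg[OF this] have
    "((\<lambda>t. ?f (-t)) has_integral -negative_ray.pole_integral b n w) {-0..-(-1)}"
    by simp
  thus ?thesis using has_integral_reflect_real[of ?f _ 0 "-1"] by (simp only:)
qed

lemma segment_log_eq_Ln_A3:
  assumes x: "0 < x" "x < 1" and u: "u \<in> {0<..<1}"
  shows "segment_log (of_real x) u = Ln (A3 (segment_point (of_real x) u) (of_real x))"
proof -
  define t where "t = (1 - u\<^sup>2) * x"
  have point: "segment_point (of_real x) u = of_real t" by (simp add: segment_point_def t_def)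
  have "u\<^sup>2 < 1" "0 < u\<^sup>2" using u by (auto simp: power_less_one_iff)
  hence t: "0 < t" "t < 1" using x mult_strict_mono'[of "1 - u\<^sup>2" 1 x 1] by (auto simp: t_def)
  hence tx: "t * x < 1" using mult_strict_mono'[of t 1 x 1] x by simp
  have notin: "1 - of_real t * rho \<notin> \<real>\<^sub>\<le>\<^sub>0"
    using t by (intro one_minus_notin_nonpos_Reals) (simp add: norm_mult)
  have cnj: "1 - of_real t * cnj rho = cnj (1 - of_real t * rho)" by simp
  have real: "1 - of_real t * of_real x = complex_of_real (1 - t * x)" by simp
  have nonzero: "1 - of_real t * rho \<noteq> 0" "cnj (1 - of_real t * rho) \<noteq> 0"
    "complex_of_real (1 - t * x) \<noteq> 0"
    unfolding complex_cnj_zero_iff of_real_eq_0_iff using notin tx by auto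
  have "Im (segment_log (of_real x) u) = 0"
    unfolding segment_log_def segment_regular_log_def point cnj real cnj_Ln[OF notin, symmetric]
    using tx by (subst Ln_of_real) simp_all
  hence "Ln (exp (segment_log (of_real x) u)) = segment_log (of_real x) u" by (subst Ln_exp) auto
  moreover have "exp (segment_log (of_real x) u) = A3 (of_real t) (of_real x)"
  proof -
    have "exp (2 * ln u) = 1 - t/x" using u x by (simp add: exp_double t_def)
    hence "exp (complex_of_real (2 * ln u)) = 1 - of_real t/of_real x"
      by (metis exp_of_real of_real_1 of_real_diff of_real_divide)
    moreover have "exp (Ln (1 - of_real t * rho)) = 1 - of_real t * rho"
      "exp (Ln (1 - of_real t * cnj rho)) = 1 - of_real t * cnj rho"
      "exp (Ln (1 - of_real t * of_real x)) = 1 - complex_of_real t * of_real x"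
      unfolding cnj real by (subst exp_Ln; use nonzero in simp)+
    ultimately show ?thesis
      unfolding segment_log_def segment_regular_log_def point exp_add exp_diff A3_def Q3_def
        divide_inverse[of _ rho] inverse_rho
      by simp
  qed
  ultimately show ?thesis by (simp add: point)
qed

lemma has_integral_segment:
  assumes x: "0 < x" "x < 1" and b: "Q3_root b"
  shows "((\<lambda>t. Ln (A3 (of_real t) (of_real x))^n * (1/(of_real t - b))) has_integral
    -segment.pole_integral b n (of_real x)) {0..x}"
proof -
  have w: "of_real x \<in> half_disc" using x by (simp add: of_real_in_half_disc)
  let ?h = "\<lambda>u. segment_log (of_real x) u^n * (of_real (-2 * u) * of_real x) *
    (1/(segment_point (of_real x) u - b))"
  define H where "H v = integral {0..v} ?h" for v
  define u where "u t = sqrt (1 - t/x)" for t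
  have h: "continuous_on {0..1} ?h"
    by (rule segment.continuous_pole_integrand[OF w b, unfolded segment.integrand_def[abs_def]])
  have "continuous_on {0..1} H"
    unfolding H_def by (rule indefinite_integral_continuous_1[OF integrable_continuous_real[OF h]])
  hence cont: "continuous_on {0..x} (\<lambda>t. H (u t))"
    by (rule continuous_on_compose2) (use x in \<open>auto simp: u_def intro!: continuous_intros\<close>)
  have "((\<lambda>t. H (u t)) has_vector_derivative
    Ln (A3 (of_real t) (of_real x))^n * (1/(of_real t - b))) (at t)" if t: "t \<in> {0<..<x}" for t
  proof -
    have ut: "u t \<in> {0<..<1}" "(u t)\<^sup>2 = 1 - t/x" using t by (auto simp: u_def)
    hence "(H has_vector_derivative ?h (u t)) (at (u t))"
      using integral_has_vector_derivative[OF h, of "u t"] unfolding H_def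
      by (subst at_within_Icc_at[symmetric, of 0 _ 1]) auto
    moreover have "(u has_vector_derivative -1/(2 * x * u t)) (at t)"
      unfolding u_def has_real_derivative_iff_has_vector_derivative[symmetric] using t
      by (auto intro!: derivative_eq_intros simp: divide_simps)
    ultimately have "((\<lambda>t. H (u t)) has_vector_derivative (-1/(2 * x * u t)) *\<^sub>R ?h (u t)) (at t)"
      using vector_diff_chain_at unfolding o_def by blast
    moreover have "segment_point (of_real x) (u t) = of_real t"
      using ut(2) x by (simp add: segment_point_def)
    hence "(-1/(2 * x * u t)) *\<^sub>R ?h (u t) =
      Ln (A3 (of_real t) (of_real x))^n * (1/(of_real t - b))"
      unfolding segment_log_eq_Ln_A3[OF x ut(1)] using ut(1) x by (simp add: scaleR_conv_of_real)
    ultimately show ?thesis by simp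
  qed
  from fundamental_theorem_of_calculus_interior[OF _ cont this] show ?thesis
    unfolding segment.path_integral_def segment.integrand_def[abs_def] using x
    by (simp add: H_def u_def)
qed

lemma C3_eq_A3: "w \<noteq> 0 \<Longrightarrow> C3 w = A3 (-1) w"
  unfolding C3_def A3_def Q3_eq by (simp add: field_simps power2_eq_square)

lemma hyperlog_on_Ln_C3: "hyperlog_on half_disc 1 (\<lambda>w. Ln (C3 w))"
  using negative_ray.hyperlog_on_Ln_A3_\<epsilon>
  by (rule hyperlog_on.eq_on) (simp add: C3_eq_A3 half_disc_nonzero)

definition unit_segment :: "complex set" where
  "unit_segment = of_real ` {0<..<1}"

lemma of_real_in_unit_segment: "of_real x \<in> unit_segment \<longleftrightarrow> 0 < x \<and> x < 1"
  by (auto simp: unit_segment_def)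

lemma unit_segment_subset: "unit_segment \<subseteq> half_disc"
  by (auto simp: unit_segment_def of_real_in_half_disc)

lemma convex_unit_segment: "convex unit_segment"
  unfolding unit_segment_def
  by (rule convex_linear_image[of of_real]) (auto intro: linearI simp: scaleR_conv_of_real)

lemma X3_eq:
  assumes x: "0 < x" "x < 1"
  shows "i_sqrt3 * X3 n (of_real x) = segment.pole_integral (cnj rho) n (of_real x)
    + negative_ray.pole_integral (cnj rho) n (of_real x) - (segment.pole_integral rho n (of_real x)
    + negative_ray.pole_integral rho n (of_real x)) - \<i> * of_real pi * Ln (C3 (of_real x))^n"
proof -
  let ?I = "\<lambda>b. -negative_ray.pole_integral b n (of_real x)
    + -segment.pole_integral b n (of_real x)"
  have "((\<lambda>t. Ln (A3 (of_real t) (of_real x))^n * (1/(of_real t - b))) has_integral ?I b) {-1..x}"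
    if "Q3_root b" for b
    using x
    by (intro has_integral_combine[OF _ _ has_integral_negative_ray has_integral_segment] that)
      (auto simp: of_real_in_half_disc)
  from has_integral_div_Q3[OF this]
  have contour:
    "((\<lambda>t. Ln (A3 t (of_real x))^n/Q3 t) has_contour_integral (?I rho - ?I (cnj rho))/i_sqrt3)
    (linepath (-1) (of_real x))"
    using x by (subst has_contour_integral_linepath_Reals_iff) auto
  have "i_sqrt3 * (v/i_sqrt3 - q/of_real (sqrt 3)) = v - \<i> * q" for v q :: complex
    by (simp add: right_diff_distrib)
  thus ?thesis unfolding X3_def contour_integral_unique[OF contour] by simp
qed

lemma hyperlog_on_X3: "hyperlog_on unit_segment (Suc n) (\<lambda>w. i_sqrt3 * X3 n w)"
proof -
  have "hyperlog_on half_disc (Suc n) (\<lambda>w. \<i> * of_real pi * Ln (C3 w)^n)"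
    using hyperlog_on_cmult[OF hyperlog_on_power[OF subset_refl hyperlog_on_Ln_C3, of n]
      polylog_value_ii_pi]
    by simp
  hence "hyperlog_on half_disc (Suc n) (\<lambda>w. segment.pole_integral (cnj rho) n w
    + negative_ray.pole_integral (cnj rho) n w - (segment.pole_integral rho n w +
    negative_ray.pole_integral rho n w) - \<i> * of_real pi * Ln (C3 w)^n)"
    using hyperlog_on_segment_integral[of n] negative_ray.hyperlog_on_ray_integral[of n]
    by (intro hyperlog_on_diff hyperlog_on.add) auto
  from hyperlog_on_subset[OF this unit_segment_subset] show ?thesis
    by (rule hyperlog_on.eq_on) (auto simp: unit_segment_def X3_eq)
qed

definition full_segment_integral :: "complex \<Rightarrow> nat \<Rightarrow> complex \<Rightarrow> complex" where
  "full_segment_integral b n w = positive_ray.pole_integral b n w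
    - negative_ray.pole_integral b n w"

definition full_segment_constant :: complex where
  "full_segment_constant = positive_ray.pole_constant rho - negative_ray.pole_constant rho
    - (positive_ray.pole_constant (cnj rho) - negative_ray.pole_constant (cnj rho))"

lemma Xi3_eq:
  assumes w: "w \<in> upper_corner"
  shows "i_sqrt3 * Xi3 n w = full_segment_integral rho n w - full_segment_integral (cnj rho) n w
    - full_segment_constant * Ln (C3 w)^n"
proof -
  let ?C = "Ln (C3 w)^n"
  have w': "w \<in> half_disc" using w upper_corner_subset by auto
  have full: "((\<lambda>t. Ln (A3 (of_real t) w)^n * (1/(of_real t - b))) has_integral
    full_segment_integral b n w) {-1..1}" if "Q3_root b" for b n
    using has_integral_combine[OF _ _ has_integral_negative_ray[OF w' that, of n], of 1]
      positive_ray.has_integral_pole_integral[OF w that, of n]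
    by (simp add: full_segment_integral_def)
  let ?I = "\<lambda>b. full_segment_integral b n w - ?C * full_segment_integral b 0 w"
  have "((\<lambda>t. (Ln (A3 (of_real t) w)^n - ?C) * (1/(of_real t - b))) has_integral ?I b) {-1..1}"
    if "Q3_root b" for b
    using has_integral_diff[OF full[OF that, of n] has_integral_mult_right[OF full[OF that, of 0],
      of ?C]]
    by (simp add: left_diff_distrib diff_divide_distrib)
  from has_integral_div_Q3[OF this]
  have contour:
    "((\<lambda>t. (Ln (A3 t w)^n - ?C)/Q3 t) has_contour_integral (?I rho - ?I (cnj rho))/i_sqrt3)
    (linepath (-1) 1)"
    by (subst has_contour_integral_linepath_Reals_iff) auto
  have full_constant:
    "full_segment_constant = full_segment_integral rho 0 w - full_segment_integral (cnj rho) 0 w"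
    unfolding full_segment_integral_def full_segment_constant_def positive_ray.pole_integral_0
      negative_ray.pole_integral_0 ..
  have cancel: "i_sqrt3 * (v/i_sqrt3) = v" for v :: complex by simp
  show ?thesis
    unfolding Xi3_def contour_integral_unique[OF contour] cancel full_constant
    by (simp add: algebra_simps)
qed

lemma hyperlog_on_Xi3: "hyperlog_on upper_corner (Suc n) (\<lambda>w. i_sqrt3 * Xi3 n w)"
proof (rule hyperlog_on.eq_on[OF _ Xi3_eq])
  have "polylog_value 1 full_segment_constant" unfolding full_segment_constant_def
    by (intro polylog_value_diff positive_ray.polylog_value_pole_constant
      negative_ray.polylog_value_pole_constant) simp_all
  from hyperlog_on_cmult[OF hyperlog_on_power[OF upper_corner_subset
    hyperlog_on_subset[OF hyperlog_on_Ln_C3 upper_corner_subset], of n] this]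
  have "hyperlog_on upper_corner (Suc n) (\<lambda>w. full_segment_constant * Ln (C3 w)^n)" by simp
  moreover have "hyperlog_on upper_corner (Suc n) (full_segment_integral b n)" if "Q3_root b" for b
    unfolding full_segment_integral_def[abs_def]
    using positive_ray.hyperlog_on_ray_integral[of n] negative_ray.hyperlog_on_ray_integral[of n]
      that
    by (auto intro!: hyperlog_on_diff intro: hyperlog_on_subset[OF _ upper_corner_subset])
  ultimately show
    "hyperlog_on upper_corner (Suc n) (\<lambda>w. full_segment_integral rho n w
    - full_segment_integral (cnj rho) n w - full_segment_constant * Ln (C3 w)^n)"
    by (intro hyperlog_on_diff) simp_all
qed

lemma power_decay_Xi3_chord: "power_decay (\<lambda>s. i_sqrt3 * Xi3 n (chord s))"
proof (cases "n = 0")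
  case True
  thus ?thesis using power_decay_0 by (simp add: Xi3_def)
next
  case False
  have full: "((\<lambda>s. full_segment_integral b n (chord s)) \<longlongrightarrow> 0 - 0) (at_right 0)" if "Q3_root b" for b
    unfolding full_segment_integral_def
    using positive_ray.pole_integral_chord_tendsto[OF that, of n]
      negative_ray.pole_integral_chord_tendsto[OF that, of n] False
    by (intro tendsto_diff) auto
  have "((\<lambda>s. Ln (A3 (-1) (chord s))^n) \<longlongrightarrow> 0^n) (at_right 0)"
    using negative_ray.Ln_A3_\<epsilon>_tendsto_0 by (intro tendsto_power) simp
  hence "((\<lambda>s. full_segment_integral rho n (chord s) - full_segment_integral (cnj rho) n (chord s)
    - full_segment_constant * Ln (A3 (-1) (chord s))^n) \<longlongrightarrow> (0 - 0) - (0 - 0) - full_segment_constant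
    * 0^n) (at_right 0)"
    by (intro tendsto_diff tendsto_mult tendsto_const full) simp_all
  moreover have
    "\<forall>\<^sub>F s in at_right 0. full_segment_integral rho n (chord s)
    - full_segment_integral (cnj rho) n (chord s) - full_segment_constant * Ln (A3 (-1) (chord s))^n
    = i_sqrt3 * Xi3 n (chord s)"
    using eventually_chord
  proof eventually_elim
    case (elim s)
    hence "chord s \<noteq> 0" using upper_corner_subset half_disc_nonzero by blast
    thus ?case by (simp add: Xi3_eq[OF elim] C3_eq_A3)
  qed
  ultimately have
    "((\<lambda>s. i_sqrt3 * Xi3 n (chord s)) \<longlongrightarrow> (0 - 0) - (0 - 0) - full_segment_constant * 0^n)
    (at_right 0)"
    by (rule Lim_transform_eventually)
  hence "((\<lambda>s. i_sqrt3 * Xi3 n (chord s)) \<longlongrightarrow> 0) (at_right 0)" using False by (simp add: zero_power)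
  from log_expansion_tendsto(2)[OF log_expansion_hyperlog_on[OF expansion_path_chord
    hyperlog_on_Xi3] this]
  show ?thesis by simp
qed

lemma Y3_partial_fractions:
  assumes "w \<in> half_disc"
  shows "Y3 m w = Ln (B3 w)^m * (1/3 * (1/(w - rho) + 1/(w - cnj rho) - 2 * (1/(w - (-1)))))"
proof -
  define p q r where inverses: "p = 1/(w - rho)" "q = 1/(w - cnj rho)" "r = 1/(w + 1)"
  have "p * (w - rho) = 1" "q * (w - cnj rho) = 1" "r * (w + 1) = 1"
    using half_disc_neq[OF assms] by (auto simp: inverses)
  hence "3 * ((w - 1) * r * (p * q)) = p + q - 2 * r" using rho_add_cnj rho_mult_cnj by algebra
  from arg_cong[OF this, of "\<lambda>z. 1/3 * z"] have eq: "(w - 1) * r * (p * q) = 1/3 * (p + q - 2 * r)"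
    by simp
  have "Y3 m w = Ln (B3 w)^m * ((w - 1) * r * (p * q))" unfolding Y3_def Q3_factors inverses by simp
  thus ?thesis unfolding eq by (simp add: inverses)
qed

lemma C3_minus_1: "w \<noteq> 0 \<Longrightarrow> 3 * (C3 w - 1) = w + 1/w - 1" "w \<noteq> 0 \<Longrightarrow> C3 w - 1 = Q3 w/(3 * w)"
  unfolding C3_def Q3_eq by (simp_all add: field_simps power2_eq_square)

definition B_complex :: "complex \<Rightarrow> complex" where
  "B_complex C = 1/(9 * C * (C - 1))"

lemma B3_eq_C3: "w \<noteq> 0 \<Longrightarrow> B3 w = B_complex (C3 w)"
  unfolding B_complex_def C3_minus_1(2) unfolding C3_def B3_def by (simp add: power2_eq_square)

lemma B_complex_notin_nonpos_Reals:
  assumes "1 < Re C"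
  shows "B_complex C \<notin> \<real>\<^sub>\<le>\<^sub>0"
proof -
  have "9 * C * (C - 1) \<notin> \<real>\<^sub>\<le>\<^sub>0"
  proof
    assume "9 * C * (C - 1) \<in> \<real>\<^sub>\<le>\<^sub>0"
    hence "Im C * (2 * Re C - 1) = 0" "Re C * (Re C - 1) \<le> (Im C)\<^sup>2"
      by (auto simp: complex_nonpos_Reals_iff power2_eq_square algebra_simps)
    hence "Re C * (Re C - 1) \<le> 0" using assms by simp
    moreover have "Re C * (Re C - 1) > 0" using assms by simp
    ultimately show False by linarith
  qed
  thus ?thesis unfolding B_complex_def by (metis inverse_eq_divide nonpos_Reals_inverse_iff)
qed

lemma Re_C3:
  "w \<noteq> 0 \<Longrightarrow> Re (C3 w) = 1 + (Re w * (1 + 1/(norm w)\<^sup>2) - 1)/3" and Im_C3: "w \<noteq> 0 \<Longrightarrow>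
    Im (C3 w) = Im w * (1 - 1/(norm w)\<^sup>2)/3"
proof -
  assume w: "w \<noteq> 0"
  have "C3 w = 1 + (w + 1/w - 1)/3" using C3_minus_1(1)[OF w] by (simp add: field_simps)
  hence "Re (C3 w) = 1 + (Re (w + 1/w) - 1)/3" "Im (C3 w) = Im (w + 1/w)/3" by simp_all
  thus "Re (C3 w) = 1 + (Re w * (1 + 1/(norm w)\<^sup>2) - 1)/3" "Im (C3 w) = Im w * (1 - 1/(norm w)\<^sup>2)/3"
    by (simp_all only: Re_add_inverse[OF w] Im_add_inverse[OF w])
qed

lemma B3_log_derivative:
  assumes "w \<noteq> 0" "w + 1 \<noteq> 0" "w - rho \<noteq> 0" "w - cnj rho \<noteq> 0"
  shows "(B3 has_field_derivative
    B3 w * (1/(w - 0) + 1/(w - 0) - (1/(w - (-1)) + 1/(w - (-1)) +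
    (1/(w - rho) + 1/(w - cnj rho))))) (at w)"
proof -
  have B3: "B3 = (\<lambda>w. (w - 0) * (w - 0)/((w - (-1)) * (w - (-1)) * ((w - rho) * (w - cnj rho))))"
    by (rule ext) (simp add: B3_def Q3_factors power2_eq_square add.commute)
  show ?thesis unfolding B3 using assms
    by (intro DERIV_divide_log_derivative DERIV_mult_log_derivative DERIV_linear_log_derivative)
      auto
qed

lemma hyperlog_on_Ln_B3:
  assumes \<gamma>: "expansion_path S \<gamma> \<kappa>" "(\<gamma> \<longlongrightarrow> 1) (at_right 0)"
    and S: "convex S" "S \<subseteq> half_disc" "\<And>w. w \<in> S \<Longrightarrow> 1 < Re w * (1 + 1/(norm w)\<^sup>2)"
  shows "hyperlog_on S 1 (\<lambda>w. Ln (B3 w))"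
proof -
  have "hyperlog_on S (Suc 0) (\<lambda>w. Ln (B3 w))"
  proof (rule hyperlog_on_of_derivative[OF \<gamma>(1) S(1,2)])
    fix w assume w: "w \<in> S"
    note nonzero = half_disc_neq[OF subsetD[OF S(2) w]]
    have "B3 w \<notin> \<real>\<^sub>\<le>\<^sub>0"
      unfolding B3_eq_C3[OF nonzero(1)] using S(3)[OF w]
      by (intro B_complex_notin_nonpos_Reals) (simp add: Re_C3[OF nonzero(1)])
    thus "((\<lambda>w. Ln (B3 w)) has_field_derivative
      1/(w - 0) + 1/(w - 0) - (1/(w - (-1)) + 1/(w - (-1)) + (1/(w - rho) + 1/(w - cnj rho))))
      (at w within S)"
      using nonzero
      by (intro has_field_derivative_at_within[OF DERIV_Ln_log_derivative[OF B3_log_derivative]])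
        simp_all
  next
    show "hyperlog_form S 0 (\<lambda>w. 1/(w - 0) + 1/(w - 0)
      - (1/(w - (-1)) + 1/(w - (-1)) + (1/(w - rho) + 1/(w - cnj rho))))"
      by (intro hyperlog_form_diff hyperlog_form.add hyperlog_form_simple_pole letter_0
        letter_minus_1 letter_rho letter_cnj_rho)
    have "((\<lambda>s. B3 (\<gamma> s)) \<longlongrightarrow> B3 1) (at_right 0)"
      unfolding B3_def Q3_eq by (intro tendsto_intros \<gamma>) auto
    hence "((\<lambda>s. B3 (\<gamma> s)) \<longlongrightarrow> of_real (1/4)) (at_right 0)" by (simp add: B3_def Q3_eq)
    thus "((\<lambda>s. Ln (B3 (\<gamma> s))) \<longlongrightarrow> Ln (of_real (1/4))) (at_right 0)"
      by (rule tendsto_Ln) (simp add: complex_nonpos_Reals_iff)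
    show "polylog_value (Suc 0) (Ln (of_real (1/4)))"
      using polylog_value_ln_4 by (subst Ln_of_real) auto
  qed
  thus ?thesis by simp
qed

lemma hyperlog_form_Y3:
  assumes "S \<subseteq> half_disc" "hyperlog_on S 1 (\<lambda>w. Ln (B3 w))"
  shows "hyperlog_form S m (Y3 m)"
proof -
  have "hyperlog_form S 0
    (\<lambda>w. of_rat (1/3) * (1/(w - rho) + 1/(w - cnj rho) - of_nat 2 * (1/(w - (-1)))))"
    by (intro hyperlog_form_rat_mult hyperlog_form_diff hyperlog_form.add hyperlog_form_of_nat_mult
      hyperlog_form_simple_pole letter_minus_1 letter_rho letter_cnj_rho)
  from hyperlog_form_mult[OF assms(1) hyperlog_on_power[OF assms, of m] this]
  have "hyperlog_form S m
    (\<lambda>w. Ln (B3 w)^m * (of_rat (1/3) * (1/(w - rho) + 1/(w - cnj rho) - of_nat 2 *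
    (1/(w - (-1))))))"
    by (simp only: mult_1_right add_0_right)
  thus ?thesis
  proof (rule hyperlog_form.eq_on)
    fix w assume "w \<in> S"
    thus "Y3 m w =
      Ln (B3 w)^m * (of_rat (1/3) * (1/(w - rho) + 1/(w - cnj rho) - of_nat 2 * (1/(w - (-1)))))"
      using Y3_partial_fractions[of w m] assms(1) by (auto simp: of_rat_divide)
  qed
qed

lemma power_decay_mult_Y3:
  assumes path: "expansion_path S \<gamma> \<kappa>"
    and f: "hyperlog_on S k f"
    and B3: "hyperlog_on S 1 (\<lambda>w. Ln (B3 w))"
    and lim: "(\<gamma> \<longlongrightarrow> p) (at_right 0)" "Q3 p \<noteq> 0" "p \<noteq> -1"
  shows "power_decay (\<lambda>s. of_real s * (f (\<gamma> s) * Y3 m (\<gamma> s)))"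
proof -
  have growth: "slow_growth (\<lambda>s. g (\<gamma> s))" if "hyperlog_on S j g" for g j
    by (rule log_expansion_slow_growth[OF log_expansion_hyperlog_on[OF path that]])
  have "((\<lambda>s. (\<gamma> s - 1)/(\<gamma> s + 1)/Q3 (\<gamma> s)) \<longlongrightarrow> (p - 1)/(p + 1)/Q3 p) (at_right 0)"
    using lim(2,3) unfolding Q3_eq by (intro tendsto_intros lim(1)) (auto simp: add_eq_0_iff2)
  from slow_growth_mult[OF slow_growth_tendsto[OF this] slow_growth_power[OF growth[OF B3], of m]]
  have "slow_growth (\<lambda>s. Y3 m (\<gamma> s))" by (simp add: Y3_def)
  from power_decay_mult_slow_growth[OF power_decay_of_real slow_growth_mult[OF growth[OF f] this]]
    show ?thesis .
qed

lemma polylog_value_scaled_contour_integral: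
  assumes "hyperlog_on S (Suc n) (\<lambda>w. c * f w)" "hyperlog_form S m g" "S \<subseteq> half_disc" "c \<noteq> 0"
    and "\<And>x. 0 < x \<Longrightarrow> x < 1 \<Longrightarrow> linepath P Q x \<in> S"
    and "expansion_path S (linepath P Q) \<kappa>"
      "power_decay (\<lambda>s. of_real s * (c * f (linepath P Q s) * g (linepath P Q s)))"
    and "expansion_path S (linepath Q P) \<kappa>'"
      "power_decay (\<lambda>s. of_real s * (c * f (linepath Q P s) * g (linepath Q P s)))"
  shows "polylog_value (n + m + 2) (c * contour_integral (linepath P Q) (\<lambda>w. f w * g w))"
proof -
  obtain v where v: "polylog_value (Suc (Suc n + m)) v"
    "((\<lambda>w. c * f w * g w) has_contour_integral v) (linepath P Q)"
    using hyperlog_form_contour_integral[OF assms(3,5) hyperlog_form_mult[OF assms(3,1,2)]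
      assms(6-9)]
    by blast
  from has_contour_integral_lmul[OF v(2), of "1/c"]
  have "((\<lambda>w. f w * g w) has_contour_integral v/c) (linepath P Q)"
    using assms(4) by (simp add: mult.assoc)
  thus ?thesis using v(1) assms(4) by (simp add: contour_integral_unique)
qed

lemma polylog_value_X3_Y3:
  "polylog_value (n + m + 2) (i_sqrt3 * contour_integral (linepath 0 1) (\<lambda>w. X3 n w * Y3 m w))"
proof -
  have path: "linepath 0 1 = complex_of_real" "linepath 1 0 = chord_from 1 1"
    by (auto simp: chord_from_def linepath_def scaleR_conv_of_real)
  have interior: "1 - of_real s \<in> unit_segment" if "0 < s" "s < 1" for s
    using of_real_in_unit_segment[of "1 - s"] that by simp
  have start: "expansion_path unit_segment (linepath 0 1) 0" unfolding path
    by (rule expansion_path_of_real) (use eventually_at_right_0_1 in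
      \<open>simp add: of_real_in_unit_segment\<close>)
  have finish: "expansion_path unit_segment (linepath 1 0) (Ln 1)" unfolding path
    by (rule expansion_path_root) (use eventually_at_right_0_1 interior polylog_value.zero in
      \<open>auto simp: chord_from_def elim: eventually_mono\<close>)
  have lim0: "(linepath 0 1 \<longlongrightarrow> (0::complex)) (at_right 0)"
    unfolding path by (intro tendsto_eq_intros) auto
  have lim1: "(linepath 1 0 \<longlongrightarrow> (1::complex)) (at_right 0)"
    unfolding path by (rule tendsto_chord_from)
  have Ln_B3: "hyperlog_on unit_segment 1 (\<lambda>w. Ln (B3 w))"
  proof (rule hyperlog_on_Ln_B3[OF finish lim1 convex_unit_segment unit_segment_subset])
    fix w assume "w \<in> unit_segment"
    then obtain x where x: "w = of_real x" "0 < x" "x < 1" by (auto simp: unit_segment_def)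
    hence "1 < 1/x" by simp
    hence "1 < x + 1/x" using x by linarith
    moreover have "Re w * (1 + 1/(norm w)\<^sup>2) = x + 1/x"
      using x by (simp add: power2_eq_square distrib_left)
    ultimately show "1 < Re w * (1 + 1/(norm w)\<^sup>2)" by simp
  qed
  note decay = power_decay_mult_Y3[OF _ hyperlog_on_X3 Ln_B3]
  show ?thesis
    by (rule polylog_value_scaled_contour_integral[OF hyperlog_on_X3
      hyperlog_form_Y3[OF unit_segment_subset Ln_B3] unit_segment_subset _ _ start
      decay[OF start lim0] finish decay[OF finish lim1]]) (auto simp: path of_real_in_unit_segment
      Q3_eq)
qed

lemma linepath_1_rho: "linepath 1 rho = chord_from 1 (cnj rho)"
proof -
  have "1 - x * cnj rho = (1 - x) + x * rho" for x using rho_add_cnj by algebra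
  thus ?thesis by (simp add: fun_eq_iff chord_from_def linepath_def scaleR_conv_of_real)
qed

lemma linepath_1_rho_eq_chord: "linepath 1 rho s = chord (1 - s)"
  by (simp add: chord_eq_linepath linepath_def)

lemma expansion_path_linepath_1_rho: "expansion_path upper_corner (linepath 1 rho) (Ln (cnj rho))"
  unfolding linepath_1_rho
proof (rule expansion_path_root)
  show "\<forall>\<^sub>F s in at_right 0. chord_from 1 (cnj rho) s \<in> upper_corner"
    unfolding linepath_1_rho[symmetric] linepath_1_rho_eq_chord using eventually_at_right_0_1
    by eventually_elim (auto intro: chord_in_upper_corner)
qed (auto simp: polylog_value.zero Re_rho)

lemma power_decay_Xi3_Y3_chord:
  assumes "hyperlog_on upper_corner 1 (\<lambda>w. Ln (B3 w))"
  shows "power_decay (\<lambda>s. of_real s * (i_sqrt3 * Xi3 n (chord s) * Y3 m (chord s)))"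
proof (rule power_decay_cong)
  let ?r = "\<lambda>s. (chord s - 1)/(chord s + 1)/(chord s - cnj rho) * (-1/rho\<^sup>2)"
  have "((\<lambda>s. ?r s) \<longlongrightarrow> (rho - 1)/(rho + 1)/(rho - cnj rho) * (-1/rho\<^sup>2)) (at_right 0)"
    by (intro tendsto_intros chord_tendsto) (auto simp: complex_eq_iff Re_rho Im_rho)
  from slow_growth_mult[OF
    slow_growth_power[OF log_expansion_slow_growth[OF log_expansion_hyperlog_on[OF
    expansion_path_chord assms]]] slow_growth_tendsto[OF this]]
  show "power_decay (\<lambda>s. i_sqrt3 * Xi3 n (chord s) * (Ln (B3 (chord s))^m * ?r s))"
    by (rule power_decay_mult_slow_growth[OF power_decay_Xi3_chord])
  show "\<forall>\<^sub>F s in at_right 0. i_sqrt3 * Xi3 n (chord s) * (Ln (B3 (chord s))^m * ?r s) =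
    of_real s * (i_sqrt3 * Xi3 n (chord s) * Y3 m (chord s))"
    using eventually_at_right_0_1
  proof eventually_elim
    case (elim s)
    have "chord s - rho = -(of_real s * rho\<^sup>2)"
      by (simp add: chord_def chord_from_def algebra_simps power2_eq_square)
    hence "of_real s * (1/(chord s - rho)) = -1/rho\<^sup>2" using elim by simp
    moreover have
      "of_real s * Y3 m (chord s) =
      Ln (B3 (chord s))^m * ((chord s - 1)/(chord s + 1)/(chord s - cnj rho) *
      (of_real s * (1/(chord s - rho))))"
      unfolding Y3_def Q3_factors by (simp add: mult_ac)
    ultimately have "of_real s * Y3 m (chord s) = Ln (B3 (chord s))^m * ?r s" by (simp only:)
    thus ?case by (metis mult.left_commute)
  qed
qed

lemma polylog_value_Xi3_Y3:
  "polylog_value (n + m + 2) (i_sqrt3 * contour_integral (linepath 1 rho) (\<lambda>w. Xi3 n w * Y3 m w))"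
proof -
  note start = expansion_path_linepath_1_rho
  have lim: "(linepath 1 rho \<longlongrightarrow> 1) (at_right 0)"
    unfolding linepath_1_rho by (rule tendsto_chord_from)
  have finish: "expansion_path upper_corner (linepath rho 1) (Ln rho)"
    using expansion_path_chord by (simp add: chord_eq_linepath[abs_def])
  have Ln_B3: "hyperlog_on upper_corner 1 (\<lambda>w. Ln (B3 w))"
  proof (rule hyperlog_on_Ln_B3[OF start lim convex_upper_corner upper_corner_subset])
    fix w assume w: "w \<in> upper_corner"
    hence "0 < norm w" "norm w < 1" by (auto simp: upper_corner_def)
    hence "2 < 1 + 1/(norm w)\<^sup>2" by (simp add: power_less_one_iff)
    hence "1/2 * 2 < Re w * (1 + 1/(norm w)\<^sup>2)"
      using w by (intro mult_strict_mono) (auto simp: upper_corner_def)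
    thus "1 < Re w * (1 + 1/(norm w)\<^sup>2)" by simp
  qed
  have "power_decay
    (\<lambda>s. of_real s * (i_sqrt3 * Xi3 n (linepath 1 rho s) * Y3 m (linepath 1 rho s)))"
    by (rule power_decay_mult_Y3[OF start hyperlog_on_Xi3 Ln_B3 lim]) (simp_all add: Q3_eq)
  moreover have
    "power_decay (\<lambda>s. of_real s * (i_sqrt3 * Xi3 n (linepath rho 1 s) * Y3 m (linepath rho 1 s)))"
    using power_decay_Xi3_Y3_chord[OF Ln_B3] unfolding chord_eq_linepath .
  ultimately show ?thesis
    by (intro polylog_value_scaled_contour_integral[OF hyperlog_on_Xi3
      hyperlog_form_Y3[OF upper_corner_subset Ln_B3] upper_corner_subset _ _ start _ finish])
      (auto simp: linepath_1_rho_eq_chord intro: chord_in_upper_corner)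
qed

lemma generator_in_polylog_space:
  assumes "polylog_value (n3 + n4 + 2) (i_sqrt3 * J)" "n1 + (2 * n2 + 1) + n3 + n4 = k"
  shows "of_real (sqrt 3 * pi^(2 * n2) * ln 3^n1) * J \<in> (\<lambda>z. \<i> * z) ` polylog_space (k + 1) 6"
proof
  let ?z = "-(of_real (pi^(2 * n2)) * of_real (ln 3)^n1 * (i_sqrt3 * J))"
  have "polylog_value (2 * n2 + n1 * 1 + (n3 + n4 + 2)) ?z"
    by (intro polylog_value_uminus polylog_value_mult polylog_value_pi_even_power
      polylog_value_power polylog_value_ln_3 assms(1))
  thus "?z \<in> polylog_space (k + 1) 6"
    using polylog_value_imp_polylog_space assms(2) by (simp add: algebra_simps)
  show "of_real (sqrt 3 * pi^(2 * n2) * ln 3^n1) * J = \<i> * ?z" by (simp add: mult_ac)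
qed

section \<open>Fibre integrals and the 2-isogeny\<close>

lemma nn_integral_abs_eq_iff_has_integral:
  fixes f :: "real \<Rightarrow> real"
  assumes [measurable]: "S \<in> sets borel" "f \<in> borel_measurable borel" and r: "0 \<le> r"
  shows "(\<integral>\<^sup>+x \<in> S. ennreal \<bar>f x\<bar> \<partial>lborel) = ennreal r \<longleftrightarrow> ((\<lambda>x. \<bar>f x\<bar>) has_integral r) S"
proof
  assume "(\<integral>\<^sup>+x \<in> S. ennreal \<bar>f x\<bar> \<partial>lborel) = ennreal r"
  hence "(\<integral>\<^sup>+x. ennreal (indicator S x * \<bar>f x\<bar>) \<partial>lborel) = ennreal r"
    by (simp add: ennreal_mult' ennreal_indicator mult.commute)
  from nn_integral_has_integral[OF _ _ this r]
  have "((\<lambda>x. indicator S x * \<bar>f x\<bar>) has_integral r) UNIV" by simp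
  moreover have "(\<lambda>x. indicator S x * \<bar>f x\<bar>) = (\<lambda>x. if x \<in> S then \<bar>f x\<bar> else 0)" by auto
  ultimately show "((\<lambda>x. \<bar>f x\<bar>) has_integral r) S" by (simp add: has_integral_restrict_UNIV)
qed (rule nn_integral_has_integral_lebesgue', auto)

lemma ennreal_eq_of_real_values:
  assumes eq: "\<And>r. 0 \<le> r \<Longrightarrow> a = ennreal r \<longleftrightarrow> b = ennreal r"
  shows "a = b"
proof (cases a)
  case (real r)
  thus ?thesis using eq[of r] by simp
next
  case top
  thus ?thesis using eq[of "enn2real b"] by (cases b) simp_all
qed

lemma emeasure_differentiable_image:
  fixes g g' :: "real \<Rightarrow> real"
  assumes [measurable]: "S \<in> sets borel" "g ` S \<in> sets borel" "g' \<in> borel_measurable borel"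
    and inj: "inj_on g S"
    and der: "\<And>x. x \<in> S \<Longrightarrow> (g has_field_derivative g' x) (at x within S)"
  shows "emeasure lborel (g ` S) = (\<integral>\<^sup>+x \<in> S. ennreal \<bar>g' x\<bar> \<partial>lborel)"
proof (rule ennreal_eq_of_real_values)
  have S: "S \<in> sets lebesgue" by simp
  have abs_integrable: "f absolutely_integrable_on T \<longleftrightarrow> f integrable_on T" if "\<And>x. 0 \<le> f x"
    for f :: "real \<Rightarrow> real" and T
    using that
    by (auto intro: nonnegative_absolutely_integrable_1 set_lebesgue_integral_eq_integral)
  fix r :: real assume r: "0 \<le> r"
  hence "emeasure lborel (g ` S) = ennreal r \<longleftrightarrow> ((\<lambda>_. 1) has_integral r) (g ` S)"
    by (simp add: has_integral_iff_emeasure_lborel)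
  also have "... \<longleftrightarrow> ((\<lambda>x. \<bar>g' x\<bar>) has_integral r) S"
    unfolding has_integral_iff abs_integrable[symmetric, OF abs_ge_zero] abs_integrable[symmetric,
      OF zero_le_one]
    using has_absolute_integral_change_of_variables_1'[OF S der inj, of "\<lambda>_. 1" r]
    by (simp only: mult_1_right)
  also have "... \<longleftrightarrow> (\<integral>\<^sup>+x \<in> S. ennreal \<bar>g' x\<bar> \<partial>lborel) = ennreal r"
    using r by (intro nn_integral_abs_eq_iff_has_integral[symmetric]) measurable
  finally show "emeasure lborel (g ` S) = ennreal r \<longleftrightarrow> (\<integral>\<^sup>+x \<in> S. ennreal \<bar>g' x\<bar> \<partial>lborel) =
    ennreal r" .
qed

lemma distr_density_derivative:
  fixes g g' :: "real \<Rightarrow> real"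
  assumes [measurable]: "I \<in> sets borel" "J \<in> sets borel" "g \<in> borel_measurable borel"
    "g' \<in> borel_measurable borel"
    and bij: "bij_betw g I J"
    and der: "\<And>x. x \<in> I \<Longrightarrow> (g has_field_derivative g' x) (at x within I)"
  shows "distr (density lborel (\<lambda>x. ennreal \<bar>g' x\<bar> * indicator I x)) borel g =
    density lborel (indicator J)" (is "distr ?M _ _ = ?N")
proof (rule measure_eqI)
  fix B assume "B \<in> sets (distr ?M borel g)"
  hence [measurable]: "B \<in> sets borel" by simp
  have image: "g ` (I \<inter> g -` B) = J \<inter> B" using bij by (auto simp: bij_betw_def)
  have [measurable]: "g -` B \<in> sets borel" using measurable_sets[of g borel borel B] by simp
  have "emeasure (distr ?M borel g) B =
    (\<integral>\<^sup>+x. ennreal \<bar>g' x\<bar> * indicator I x * indicator (g -` B) x \<partial>lborel)"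
    by (subst emeasure_distr) (simp_all add: emeasure_density)
  also have "... = (\<integral>\<^sup>+x \<in> I \<inter> g -` B. ennreal \<bar>g' x\<bar> \<partial>lborel)"
    by (simp add: indicator_inter_arith mult.assoc)
  also have "... = emeasure lborel (J \<inter> B)" unfolding image[symmetric]
  proof (rule emeasure_differentiable_image[symmetric])
    show "g ` (I \<inter> g -` B) \<in> sets borel" unfolding image by measurable
    show "inj_on g (I \<inter> g -` B)" using bij by (auto simp: bij_betw_def intro: inj_on_subset)
    show "(g has_field_derivative g' x) (at x within I \<inter> g -` B)" if "x \<in> I \<inter> g -` B" for x
      using der[of x] that by (auto intro: DERIV_subset)
  qed measurable
  also have "... = emeasure ?N B" by (simp add: emeasure_density flip: indicator_inter_arith)
  finally show "emeasure (distr ?M borel g) B = emeasure ?N B" .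
qed simp

lemma nn_integral_change_of_variables:
  fixes g g' h k :: "real \<Rightarrow> real" and F :: "real \<Rightarrow> ennreal"
  assumes [measurable]: "I \<in> sets borel" "J \<in> sets borel" "g \<in> borel_measurable borel"
    "g' \<in> borel_measurable borel" "F \<in> borel_measurable borel" "k \<in> borel_measurable borel"
    and bij: "bij_betw g I J"
    and der: "\<And>x. x \<in> I \<Longrightarrow> (g has_field_derivative g' x) (at x within I)"
    and nonneg: "\<And>y. y \<in> J \<Longrightarrow> 0 \<le> k y"
    and weight: "\<And>x. x \<in> I \<Longrightarrow> h x = k (g x) * \<bar>g' x\<bar>"
  shows "(\<integral>\<^sup>+x \<in> I. F (g x) * ennreal (h x) \<partial>lborel) = (\<integral>\<^sup>+y \<in> J. F y * ennreal (k y) \<partial>lborel)"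
proof -
  let ?M = "density lborel (\<lambda>x. ennreal \<bar>g' x\<bar> * indicator I x)"
  have "F (g x) * ennreal (h x) * indicator I x =
    ennreal \<bar>g' x\<bar> * indicator I x * (F (g x) * ennreal (k (g x)))" for x
    using nonneg bij by (auto simp: indicator_def weight ennreal_mult mult_ac bij_betw_def)
  hence "(\<integral>\<^sup>+x \<in> I. F (g x) * ennreal (h x) \<partial>lborel) = (\<integral>\<^sup>+x. F (g x) * ennreal (k (g x)) \<partial> ?M)"
    by (simp add: nn_integral_density)
  also have "... = (\<integral>\<^sup>+y. F y * ennreal (k y) \<partial>distr ?M borel g)"
    by (rule nn_integral_distr[symmetric]) simp_all
  also have "... = (\<integral>\<^sup>+y \<in> J. F y * ennreal (k y) \<partial>lborel)"
    by (subst distr_density_derivative[OF assms(1-4) bij der]) (simp_all add: nn_integral_density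
      mult.commute)
  finally show ?thesis .
qed

definition Q3_real :: "real \<Rightarrow> real" where
  "Q3_real t = t\<^sup>2 - t + 1"

definition Q3_ratio :: "real \<Rightarrow> real" where
  "Q3_ratio t = t/Q3_real t"

text \<open>The value of \<open>A\<^sub>3(t, \<tau>)\<close> in terms of \<open>C = C\<^sub>3(\<tau>)\<close> and \<open>t\<close>.\<close>

definition A_real :: "real \<times> real \<Rightarrow> real" where
  "A_real x = 1 - 3 * Q3_ratio (snd x) * (fst x - 1)"

definition A_ratio :: "real \<times> real \<Rightarrow> real" where
  "A_ratio x = A_real x/(fst x * (fst x - 1))"

definition kernel_density :: "real \<times> real \<Rightarrow> real" where
  "kernel_density x =
    (if 1 < fst x \<and> -1 < snd x \<and> snd x < 1 then 1/(fst x * (fst x - 1) * Q3_real (snd x)) else 0)"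

definition fibre_defect :: "real \<Rightarrow> real \<Rightarrow> real" where
  "fibre_defect C y = C - y * C * (C - 1)"

definition in_fibre :: "real \<Rightarrow> real \<Rightarrow> bool" where
  "in_fibre C y \<longleftrightarrow> 1 < C \<and> 0 < y \<and> 0 < fibre_defect C y \<and> fibre_defect C y < 4 * (C - 1)"

definition fibre_density :: "real \<Rightarrow> real \<Rightarrow> real" where
  "fibre_density C y = 1/(sqrt 3 * sqrt (fibre_defect C y * (4 * (C - 1) - fibre_defect C y)))"

lemma Q3_real_pos: "Q3_real t > 0"
  unfolding Q3_real_def by (rule quadratic_pos)

lemma borel_measurable_Q3_real [measurable]:
  "Q3_real \<in> borel_measurable borel" and borel_measurable_Q3_ratio [measurable]:
    "Q3_ratio \<in> borel_measurable borel"
  unfolding Q3_real_def[abs_def] Q3_ratio_def[abs_def] by measurable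

lemma borel_measurable_A [measurable]:
  "A_real \<in> borel_measurable (borel \<Otimes>\<^sub>M borel)" "A_ratio \<in> borel_measurable (borel \<Otimes>\<^sub>M borel)"
    "kernel_density \<in> borel_measurable (borel \<Otimes>\<^sub>M borel)"
  unfolding A_real_def[abs_def] A_ratio_def[abs_def] kernel_density_def[abs_def] by measurable

lemma borel_measurable_fibre [measurable]:
  assumes [measurable]: "f \<in> borel_measurable M" "g \<in> borel_measurable M"
  shows "(\<lambda>x. fibre_density (f x) (g x)) \<in> borel_measurable M"
    "Measurable.pred M (\<lambda>x. in_fibre (f x) (g x))"
  unfolding fibre_density_def in_fibre_def fibre_defect_def by measurable

lemma kernel_density_nonneg: "0 \<le> kernel_density x"
  using Q3_real_pos[of "snd x"] by (simp add: kernel_density_def)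

lemma fibre_density_nonneg: "in_fibre C y \<Longrightarrow> 0 \<le> fibre_density C y"
  by (simp add: fibre_density_def in_fibre_def)

lemma one_minus_Q3_ratio:
  "1 - Q3_ratio t = (1 - t)\<^sup>2/Q3_real t"
    and one_plus_Q3_ratio: "1 + 3 * Q3_ratio t = (1 + t)\<^sup>2/Q3_real t"
  using Q3_real_pos[of t] unfolding Q3_ratio_def
  by (simp_all add: field_simps) (simp_all add: Q3_real_def power2_eq_square algebra_simps)

lemma Q3_ratio_le_1: "Q3_ratio t \<le> 1" and abs_Q3_ratio_le_1: "\<bar>Q3_ratio t\<bar> \<le> 1"
proof -
  have "(1 - t)\<^sup>2/Q3_real t \<ge> 0" "(1 + t)\<^sup>2/Q3_real t \<ge> 0" using Q3_real_pos[of t] by simp_all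
  hence "0 \<le> 1 - Q3_ratio t" "0 \<le> 1 + 3 * Q3_ratio t"
    unfolding one_minus_Q3_ratio one_plus_Q3_ratio by auto
  thus "Q3_ratio t \<le> 1" "\<bar>Q3_ratio t\<bar> \<le> 1" by linarith+
qed

lemma has_field_derivative_Q3_ratio:
  "(Q3_ratio has_field_derivative (1 - t\<^sup>2)/(Q3_real t)\<^sup>2) (at t within A)"
proof -
  have "(Q3_real has_field_derivative 2 * t - 1) (at t within A)"
    unfolding Q3_real_def[abs_def] by (auto intro!: derivative_eq_intros)
  hence "(Q3_ratio has_field_derivative (1 * Q3_real t - t * (2 * t - 1))/(Q3_real t * Q3_real t))
    (at t within A)"
    unfolding Q3_ratio_def[abs_def] using Q3_real_pos[of t] by (intro DERIV_divide DERIV_ident) auto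
  moreover have "1 * Q3_real t - t * (2 * t - 1) = 1 - t\<^sup>2"
    by (simp add: Q3_real_def power2_eq_square algebra_simps)
  ultimately show ?thesis by (simp add: power2_eq_square)
qed

lemma continuous_on_Q3_real:
  "continuous_on A Q3_real" and continuous_on_Q3_ratio: "continuous_on A Q3_ratio"
proof -
  show "continuous_on A Q3_real" for A unfolding Q3_real_def[abs_def] by (intro continuous_intros)
  thus "continuous_on A Q3_ratio"
    unfolding Q3_ratio_def[abs_def] using Q3_real_pos
    by (intro continuous_intros) (auto simp: less_le)
qed

lemma inj_on_Q3_ratio: "inj_on Q3_ratio {-1<..<1}"
proof (rule inj_onI)
  fix s t :: real assume s: "s \<in> {-1<..<1}" and t: "t \<in> {-1<..<1}" and eq: "Q3_ratio s = Q3_ratio t"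
  hence "s * Q3_real t = t * Q3_real s"
    using Q3_real_pos[of s] Q3_real_pos[of t] by (simp add: Q3_ratio_def frac_eq_eq)
  hence "(s - t) * (1 - s * t) = 0" unfolding Q3_real_def by algebra
  moreover have "\<bar>s\<bar> * \<bar>t\<bar> < 1 * 1" using s t by (intro mult_strict_mono') auto
  hence "s * t \<noteq> 1" by (auto simp flip: abs_mult)
  ultimately show "s = t" by simp
qed

lemma Q3_ratio_surj:
  assumes "-1/3 < r" "r < 1"
  obtains t where "t \<in> {-1<..<1}" "Q3_ratio t = r"
proof -
  have "Q3_ratio (-1) = -1/3" "Q3_ratio 1 = 1" by (simp_all add: Q3_ratio_def Q3_real_def)
  with IVT'[of Q3_ratio "-1" r 1, OF _ _ _ continuous_on_Q3_ratio] assms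
  obtain t where t: "-1 \<le> t" "t \<le> 1" "Q3_ratio t = r" by auto
  moreover have "t \<noteq> -1" "t \<noteq> 1" using t(3) assms \<open>Q3_ratio (-1) = -1/3\<close> \<open>Q3_ratio 1 = 1\<close> by auto
  ultimately show ?thesis using that[of t] by auto
qed

lemma fibre_defect_A_ratio:
  assumes "1 < C"
  shows "fibre_defect C (A_ratio (C, t)) = (C - 1) * (1 + t)\<^sup>2/Q3_real t"
    and "4 * (C - 1) - fibre_defect C (A_ratio (C, t)) = 3 * (C - 1) * (1 - t)\<^sup>2/Q3_real t"
      (is ?complement)
proof -
  have "A_ratio (C, t) * C * (C - 1) = A_real (C, t)" using assms by (simp add: A_ratio_def)
  hence defect: "fibre_defect C (A_ratio (C, t)) = (C - 1) * (1 + 3 * Q3_ratio t)"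
    by (simp add: fibre_defect_def A_real_def algebra_simps)
  thus "fibre_defect C (A_ratio (C, t)) = (C - 1) * (1 + t)\<^sup>2/Q3_real t"
    by (simp add: one_plus_Q3_ratio)
  have "4 * (C - 1) - fibre_defect C (A_ratio (C, t)) = 3 * (C - 1) * (1 - Q3_ratio t)"
    unfolding defect by (simp add: algebra_simps)
  thus ?complement by (simp add: one_minus_Q3_ratio)
qed

lemma bij_betw_A_ratio:
  assumes C: "1 < C"
  shows "bij_betw (\<lambda>t. A_ratio (C, t)) {t. -1 < t \<and> t < 1 \<and> 0 < A_real (C, t)} {y. in_fibre C y}"
    (is "bij_betw _ ?I _")
  unfolding bij_betw_def
proof (intro conjI subset_antisym subsetI)
  show "inj_on (\<lambda>t. A_ratio (C, t)) ?I"
  proof (rule inj_onI)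
    fix s t assume "s \<in> ?I" "t \<in> ?I" "A_ratio (C, s) = A_ratio (C, t)"
    thus "s = t" using C inj_onD[OF inj_on_Q3_ratio, of s t] by (auto simp: A_ratio_def A_real_def)
  qed
  show "y \<in> {y. in_fibre C y}" if "y \<in> (\<lambda>t. A_ratio (C, t)) ` ?I" for y
  proof -
    obtain t where t: "-1 < t" "t < 1" "0 < A_real (C, t)" "y = A_ratio (C, t)"
      using \<open>y \<in> _\<close> by auto
    hence "0 < (C - 1) * (1 + t)\<^sup>2/Q3_real t" "0 < 3 * (C - 1) * (1 - t)\<^sup>2/Q3_real t"
      using C Q3_real_pos[of t] by simp_all
    moreover have "0 < A_ratio (C, t)" using t C by (simp add: A_ratio_def)
    ultimately show ?thesis
      using C unfolding t(4) in_fibre_def mem_Collect_eq fibre_defect_A_ratio[OF C, symmetric]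
      by simp
  qed
  fix y assume "y \<in> {y. in_fibre C y}"
  hence y: "0 < y" "0 < fibre_defect C y" "fibre_defect C y < 4 * (C - 1)"
    by (auto simp: in_fibre_def)
  define r where "r = (1/(C - 1) - y * C)/3"
  have "-1/3 < r" "r < 1" using y C unfolding r_def fibre_defect_def by (auto simp: field_simps)
  then obtain t where t: "t \<in> {-1<..<1}" "Q3_ratio t = r" by (rule Q3_ratio_surj)
  have "3 * r = 1/(C - 1) - y * C" by (simp add: r_def)
  hence "3 * r * (C - 1) = 1 - y * C * (C - 1)" using C by (simp only: left_diff_distrib) simp
  hence "A_real (C, t) = y * C * (C - 1)" by (simp add: A_real_def t(2))
  thus "y \<in> (\<lambda>t. A_ratio (C, t)) ` ?I"
    using t(1) y(1) C by (intro image_eqI[of _ _ t]) (auto simp: A_ratio_def)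
qed

lemma has_field_derivative_A_ratio:
  assumes "1 < C"
  shows "((\<lambda>t. A_ratio (C, t)) has_field_derivative -3 * ((1 - t\<^sup>2)/(Q3_real t)\<^sup>2)/C)
    (at t within S)"
proof -
  have "((\<lambda>t. A_ratio (C, t)) has_field_derivative
    (0 - 3 * ((1 - t\<^sup>2)/(Q3_real t)\<^sup>2) * (C - 1))/(C * (C - 1))) (at t within S)"
    unfolding A_ratio_def A_real_def fst_conv snd_conv
    by (intro DERIV_cdivide DERIV_diff DERIV_const DERIV_cmult_right DERIV_cmult
      has_field_derivative_Q3_ratio)
  moreover have "(0 - 3 * d * x)/(C * x) = -3 * d/C" if "x \<noteq> 0" for d x using that by simp
  from this[of "C - 1"] have "(0 - 3 * d * (C - 1))/(C * (C - 1)) = -3 * d/C" for d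
    using assms by simp
  ultimately show ?thesis by (simp only:)
qed

lemma kernel_density_eq_fibre_density:
  assumes C: "1 < C" and t: "-1 < t" "t < 1"
  shows "kernel_density (C, t) =
    fibre_density C (A_ratio (C, t)) * \<bar>-3 * ((1 - t\<^sup>2)/(Q3_real t)\<^sup>2)/C\<bar>"
proof -
  have t2: "1 - t\<^sup>2 > 0" using t by (auto simp: abs_square_less_1)
  let ?e = "(C - 1) * (1 - t\<^sup>2)/Q3_real t"
  have "0 \<le> ?e" using C t2 Q3_real_pos[of t] by simp
  moreover have "(C - 1) * (1 + t)\<^sup>2/Q3_real t * (3 * (C - 1) * (1 - t)\<^sup>2/Q3_real t) = 3 * ?e\<^sup>2"
    by (simp add: power2_eq_square field_simps)
  ultimately have
    "sqrt (fibre_defect C (A_ratio (C, t)) * (4 * (C - 1) - fibre_defect C (A_ratio (C, t)))) =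
    sqrt 3 * ?e"
    unfolding fibre_defect_A_ratio(2)[OF C] unfolding fibre_defect_A_ratio(1)[OF C]
    by (simp only: real_sqrt_mult real_sqrt_abs abs_of_nonneg)
  moreover have "sqrt 3 * (sqrt 3 * e) = 3 * e" for e by (simp flip: mult.assoc)
  ultimately have "fibre_density C (A_ratio (C, t)) = 1/(3 * ?e)" by (simp only: fibre_density_def)
  moreover have "1/(C * x * q) = 1/(3 * (x * u/q)) * \<bar>-3 * (u/q\<^sup>2)/C\<bar>" if "x > 0" "u > 0" "q > 0"
    for x u q
    using C that by (simp add: abs_mult field_simps power2_eq_square)
  from this[of "C - 1" "1 - t\<^sup>2" "Q3_real t"]
  have "kernel_density (C, t) = 1/(3 * ?e) * \<bar>-3 * ((1 - t\<^sup>2)/(Q3_real t)\<^sup>2)/C\<bar>"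
    using t C t2 Q3_real_pos[of t] by (simp add: kernel_density_def)
  ultimately show ?thesis by (simp only:)
qed

lemma nn_integral_kernel_density:
  assumes [measurable]: "F \<in> borel_measurable borel"
  shows "(\<integral>\<^sup>+t \<in>
    {t. 0 < A_real (C, t)}. F (A_ratio (C, t)) * ennreal (kernel_density (C, t)) \<partial>lborel) =
    (\<integral>\<^sup>+y \<in> {y. in_fibre C y}. F y * ennreal (fibre_density C y) \<partial>lborel)"
proof (cases "1 < C")
  case C: True
  have "(\<integral>\<^sup>+t \<in>
    {t. 0 < A_real (C, t)}. F (A_ratio (C, t)) * ennreal (kernel_density (C, t)) \<partial>lborel) =
    (\<integral>\<^sup>+t \<in> {t. -1 < t \<and> t < 1 \<and> 0 < A_real (C, t)}. F (A_ratio (C, t)) * ennreal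
    (kernel_density (C, t)) \<partial>lborel)"
    by (intro nn_integral_cong) (auto simp: indicator_def kernel_density_def)
  also have "... = (\<integral>\<^sup>+y \<in> {y. in_fibre C y}. F y * ennreal (fibre_density C y) \<partial>lborel)"
    by (rule nn_integral_change_of_variables[OF _ _ _ _ _ _ bij_betw_A_ratio[OF C]
      has_field_derivative_A_ratio[OF C]]) (simp_all add: fibre_density_nonneg
      kernel_density_eq_fibre_density[OF C])
  finally show ?thesis .
qed (simp add: kernel_density_def in_fibre_def)

definition fibre_period :: "real \<Rightarrow> ennreal" where
  "fibre_period y = (\<integral>\<^sup>+C \<in> {C. in_fibre C y}. ennreal (fibre_density C y) \<partial>lborel)"

definition fibre_discriminant :: "real \<Rightarrow> real \<Rightarrow> real" where
  "fibre_discriminant y v = (y + 1 + v)\<^sup>2 - 4 * v"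

definition coordinate_density :: "real \<Rightarrow> real \<Rightarrow> real" where
  "coordinate_density y v = 1/(sqrt 3 * (sqrt (v * (4 - v)) * sqrt (fibre_discriminant y v)))"

lemma borel_measurable_fibre_discriminant [measurable]:
  assumes [measurable]: "f \<in> borel_measurable M" "g \<in> borel_measurable M"
  shows "(\<lambda>x. fibre_discriminant (f x) (g x)) \<in> borel_measurable M"
  unfolding fibre_discriminant_def by measurable

lemma borel_measurable_coordinate_density [measurable]:
  "coordinate_density y \<in> borel_measurable borel"
  unfolding coordinate_density_def[abs_def] by measurable

lemma fibre_discriminant_pos:
  assumes "0 < y" "0 \<le> v"
  shows "0 < fibre_discriminant y v"
proof -
  have "fibre_discriminant y v = y\<^sup>2 + 2 * y * (1 + v) + (1 - v)\<^sup>2"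
    by (simp add: fibre_discriminant_def power2_eq_square algebra_simps)
  moreover have "y\<^sup>2 > 0" "0 \<le> 2 * y * (1 + v)" "0 \<le> (1 - v)\<^sup>2" using assms by simp_all
  ultimately show ?thesis by linarith
qed

lemma coordinate_density_nonneg: "0 < y \<Longrightarrow> v \<in> {0<..<4} \<Longrightarrow> 0 \<le> coordinate_density y v"
  using fibre_discriminant_pos[of y v] by (simp add: coordinate_density_def)

lemma fibre_defect_coordinate: "1 < C \<Longrightarrow> fibre_defect C y = (C - 1) * (1 + 1/(C - 1) - y * C)"
  by (simp add: fibre_defect_def field_simps)

lemma fibre_coordinate_root:
  fixes y p :: real
  assumes y: "0 < y"
  obtains c where "0 < c" "1/c = y * c + p"
proof -
  define c where "c = (-p + sqrt (p\<^sup>2 + 4 * y))/(2 * y)"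
  have "\<bar>p\<bar> < sqrt (p\<^sup>2 + 4 * y)" using y by (intro real_less_rsqrt) auto
  hence c: "0 < c" using y by (simp add: c_def)
  have "2 * y * c + p = sqrt (p\<^sup>2 + 4 * y)" using y by (simp add: c_def)
  hence "(2 * y * c + p)\<^sup>2 = p\<^sup>2 + 4 * y" using y by simp
  hence "4 * y * (c * (y * c + p) - 1) = 0" by (simp add: power2_eq_square algebra_simps)
  hence "c * (y * c + p) = 1" using y by simp
  thus ?thesis using c that by (simp add: field_simps)
qed

lemma bij_betw_fibre_coordinate:
  assumes y: "0 < y"
  shows "bij_betw (\<lambda>C. 1 + 1/(C - 1) - y * C) {C. in_fibre C y} {0<..<4}" (is "bij_betw ?v _ _")
  unfolding bij_betw_def
proof (intro conjI subset_antisym subsetI)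
  have decreasing: "?v D < ?v C" if "1 < C" "C < D" for C D
  proof -
    have "1/(D - 1) < 1/(C - 1)" using that by (intro divide_strict_left_mono) auto
    moreover have "y * C < y * D" using that y by simp
    ultimately show ?thesis by linarith
  qed
  show "inj_on ?v {C. in_fibre C y}"
  proof (rule inj_onI)
    fix C D assume "C \<in> {C. in_fibre C y}" "D \<in> {C. in_fibre C y}" "?v C = ?v D"
    thus "C = D"
      using decreasing[of C D] decreasing[of D C]
      by (cases C D rule: linorder_cases) (auto simp: in_fibre_def)
  qed
  show "v \<in> {0<..<4}" if "v \<in> ?v ` {C. in_fibre C y}" for v
  proof -
    obtain C where C: "1 < C" "0 < fibre_defect C y" "fibre_defect C y < 4 * (C - 1)" "v = ?v C"
      using \<open>v \<in> _\<close> by (auto simp: in_fibre_def)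
    hence "0 < (C - 1) * v" "(C - 1) * v < (C - 1) * 4"
      by (simp_all only: fibre_defect_coordinate mult.commute[of 4])
    with C(1) show ?thesis
      by (metis zero_less_mult_pos mult_less_cancel_left_pos diff_gt_0_iff_gt
        greaterThanLessThan_iff)
  qed
  fix v :: real assume v: "v \<in> {0<..<4}"
  obtain c where c: "0 < c" "1/c = y * c + (v + y - 1)" by (rule fibre_coordinate_root[OF y])
  hence v_eq: "?v (1 + c) = v" by (simp add: algebra_simps)
  moreover have "fibre_defect (1 + c) y = (1 + c - 1) * v"
    unfolding v_eq[symmetric] using c by (intro fibre_defect_coordinate) simp
  hence "in_fibre (1 + c) y" using v y c(1) by (simp add: in_fibre_def mult.commute[of c])
  ultimately show "v \<in> ?v ` {C. in_fibre C y}" by (intro image_eqI[of _ _ "1 + c"]) auto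
qed

lemma fibre_discriminant_coordinate:
  assumes "1 < C"
  shows "fibre_discriminant y (1 + 1/(C - 1) - y * C) = (1/(C - 1) + y * (C - 1))\<^sup>2"
proof -
  define p where "p = 1/(C - 1)"
  have "p * (C - 1) = 1" using assms by (simp add: p_def)
  thus ?thesis unfolding fibre_discriminant_def p_def[symmetric] by algebra
qed

lemma fibre_period_coordinate:
  assumes y: "0 < y"
  shows "fibre_period y = (\<integral>\<^sup>+v \<in> {0<..<4}. ennreal (coordinate_density y v) \<partial>lborel)"
proof -
  have "(\<integral>\<^sup>+C \<in> {C. in_fibre C y}. 1 * ennreal (fibre_density C y) \<partial>lborel) =
    (\<integral>\<^sup>+v \<in> {0<..<4}. 1 * ennreal (coordinate_density y v) \<partial>lborel)"
  proof (rule nn_integral_change_of_variables[OF _ _ _ _ _ _ bij_betw_fibre_coordinate[OF y], where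
    g'="\<lambda>C. -(1/(C - 1)\<^sup>2) - y"])
    fix C assume "C \<in> {C. in_fibre C y}"
    hence C: "1 < C" by (simp add: in_fibre_def)
    show "((\<lambda>C. 1 + 1/(C - 1) - y * C) has_field_derivative
      -(1/(C - 1)\<^sup>2) - y) (at C within {C. in_fibre C y})"
      using C by (auto intro!: derivative_eq_intros simp: power2_eq_square)
    let ?v = "1 + 1/(C - 1) - y * C"
    have "fibre_defect C y * (4 * (C - 1) - fibre_defect C y) = (C - 1)\<^sup>2 * (?v * (4 - ?v))"
      unfolding fibre_defect_coordinate[OF C] by algebra
    hence "fibre_density C y = 1/(sqrt 3 * ((C - 1) * sqrt (?v * (4 - ?v))))"
      using C by (simp add: fibre_density_def real_sqrt_mult)
    moreover have "sqrt (fibre_discriminant y ?v) = 1/(C - 1) + y * (C - 1)"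
      unfolding fibre_discriminant_coordinate[OF C] using C y by simp
    moreover have "0 \<le> 1/(C - 1)\<^sup>2" by simp
    hence "\<bar>-(1/(C - 1)\<^sup>2) - y\<bar> = 1/(C - 1)\<^sup>2 + y" using y by linarith
    hence "\<bar>-(1/(C - 1)\<^sup>2) - y\<bar> = (1/(C - 1) + y * (C - 1))/(C - 1)"
      using C by (simp add: add_divide_distrib power2_eq_square)
    moreover have "1/(C - 1) + y * (C - 1) > 0" using C y by (intro add_pos_pos) simp_all
    ultimately show "fibre_density C y = coordinate_density y ?v * \<bar>-(1/(C - 1)\<^sup>2) - y\<bar>"
      by (simp add: coordinate_density_def)
  qed (use y coordinate_density_nonneg in auto)
  thus ?thesis by (simp add: fibre_period_def)
qed

definition unit_point :: "real \<Rightarrow> complex" where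
  "unit_point t = exp (2 * of_real pi * \<i> * of_real t)"

definition chord_square :: "real \<Rightarrow> real" where
  "chord_square s = 4 * (cos (pi * s))\<^sup>2"

definition torus_square :: "real \<times> real \<Rightarrow> real" where
  "torus_square x = (cmod (1 + unit_point (snd x) + unit_point (fst x)))\<^sup>2"

lemma unit_point_cis: "unit_point t = cis (2 * pi * t)"
  by (simp add: unit_point_def cis_conv_exp mult_ac)

lemma norm_unit_point [simp]: "cmod (unit_point t) = 1"
  by (simp add: unit_point_cis)

lemma borel_measurable_unit_point [measurable]:
  "unit_point \<in> borel_measurable borel" and borel_measurable_chord_square [measurable]:
    "chord_square \<in> borel_measurable borel"
  unfolding unit_point_def[abs_def] chord_square_def[abs_def]
  by (intro borel_measurable_continuous_onI continuous_intros)+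

lemma borel_measurable_torus_square [measurable]:
  "torus_square \<in> borel_measurable (borel \<Otimes>\<^sub>M borel)"
  unfolding torus_square_def[abs_def] by measurable

lemma chord_square_nonneg: "0 \<le> chord_square s"
  by (simp add: chord_square_def)

lemma torus_square_nonneg: "0 \<le> torus_square x"
  by (simp add: torus_square_def)

lemma chord_square_eq_norm: "chord_square s = (cmod (1 + unit_point s))\<^sup>2"
proof -
  have "(cmod (1 + unit_point s))\<^sup>2 = (1 + cos (2 * (pi * s)))\<^sup>2 + (sin (2 * (pi * s)))\<^sup>2"
    unfolding cmod_power2 unit_point_cis by (simp add: mult.assoc)
  also have "... = 2 + 2 * cos (2 * (pi * s))"
    using sin_cos_squared_add[of "2 * (pi * s)"] by algebra
  finally show ?thesis unfolding chord_square_def cos_double_cos by simp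
qed

lemma bij_betw_chord_square: "bij_betw chord_square {0<..<1/2} {0<..<4}"
proof (rule bij_betw_byWitness[where f'="\<lambda>v. arccos (sqrt v/2)/pi"])
  have angle: "0 < pi * s" "pi * s < pi/2" if "s \<in> {0<..<1/2}" for s :: real using that by auto
  show "\<forall>s\<in>{0<..<1/2}. arccos (sqrt (chord_square s)/2)/pi = s"
  proof
    fix s :: real assume s: "s \<in> {0<..<1/2}"
    hence "cos (pi * s) > 0" using angle[OF s] by (intro cos_gt_zero) auto
    thus "arccos (sqrt (chord_square s)/2)/pi = s"
      using angle[OF s] by (simp add: chord_square_def real_sqrt_mult arccos_cos)
  qed
  show "\<forall>v\<in>{0<..<4}. chord_square (arccos (sqrt v/2)/pi) = v"
  proof
    fix v :: real assume v: "v \<in> {0<..<4}"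
    hence "0 \<le> sqrt v" "sqrt v \<le> 2" using real_sqrt_le_iff[of v 4] by simp_all
    hence cos_eq: "cos (arccos (sqrt v/2)) = sqrt v/2" by (intro cos_arccos) linarith+
    have "chord_square (arccos (sqrt v/2)/pi) = 4 * (cos (arccos (sqrt v/2)))\<^sup>2"
      by (simp add: chord_square_def)
    also have "... = v" using v by (simp add: cos_eq power_divide)
    finally show "chord_square (arccos (sqrt v/2)/pi) = v" .
  qed
  show "chord_square ` {0<..<1/2} \<subseteq> {0<..<4}"
  proof safe
    fix s :: real assume s: "s \<in> {0<..<1/2}"
    have "0 < cos (pi * s)" "cos (pi * s) < 1"
      using angle[OF s] cos_monotone_0_pi[of 0 "pi * s"] by (auto intro!: cos_gt_zero)
    thus "chord_square s \<in> {0<..<4}" by (simp add: chord_square_def power_less_one_iff)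
  qed
  show "(\<lambda>v. arccos (sqrt v/2)/pi) ` {0<..<4} \<subseteq> {0<..<1/2}"
  proof safe
    fix v :: real assume v: "v \<in> {0<..<4}"
    hence bounds: "0 < sqrt v" "sqrt v < 2" using real_sqrt_less_iff[of v 4] by simp_all
    have "arccos 1 < arccos (sqrt v/2)" "arccos (sqrt v/2) < arccos 0"
      by (rule arccos_less_arccos; use bounds in linarith)+
    thus "arccos (sqrt v/2)/pi \<in> {0<..<1/2}" by (simp add: field_simps)
  qed
qed

lemma nn_integral_chord_square:
  assumes y: "0 < y"
  shows "(\<integral>\<^sup>+v \<in> {0<..<4}. ennreal (coordinate_density y v) \<partial>lborel) =
    (\<integral>\<^sup>+s \<in> {0<..<1/2}. ennreal (2 * pi/sqrt 3/sqrt (fibre_discriminant y (chord_square s)))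
    \<partial>lborel)"
proof -
  have "(\<integral>\<^sup>+s \<in>
    {0<..<1/2}. 1 * ennreal (2 * pi/sqrt 3/sqrt (fibre_discriminant y (chord_square s))) \<partial>lborel) =
    (\<integral>\<^sup>+v \<in> {0<..<4}. 1 * ennreal (coordinate_density y v) \<partial>lborel)"
  proof (rule nn_integral_change_of_variables[OF _ _ _ _ _ _ bij_betw_chord_square, where
    g'="\<lambda>s. -(8 * pi * (cos (pi * s) * sin (pi * s)))"])
    fix s :: real assume s: "s \<in> {0<..<1/2}"
    hence "0 < pi * s" "pi * s < pi/2" by auto
    hence pos: "cos (pi * s) > 0" "sin (pi * s) > 0" by (auto intro!: cos_gt_zero sin_gt_zero2)
    show "(chord_square has_field_derivative -(8 * pi * (cos (pi * s) * sin (pi * s))))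
      (at s within {0<..<1/2})"
      unfolding chord_square_def[abs_def] by (auto intro!: derivative_eq_intros)
    have "chord_square s * (4 - chord_square s) = (4 * (cos (pi * s) * sin (pi * s)))\<^sup>2"
      unfolding chord_square_def using sin_cos_squared_add[of "pi * s"] by algebra
    hence "sqrt (chord_square s * (4 - chord_square s)) = \<bar>4 * (cos (pi * s) * sin (pi * s))\<bar>"
      by (simp only: real_sqrt_abs)
    hence sqrt_eq: "sqrt (chord_square s * (4 - chord_square s)) =
      4 * (cos (pi * s) * sin (pi * s))"
      using pos by simp
    have abs_eq: "\<bar>-(8 * pi * (cos (pi * s) * sin (pi * s)))\<bar> =
      8 * pi * (cos (pi * s) * sin (pi * s))"
      using pos by simp
    have cancel: "2 * p/r/d = 1/(r * (4 * x * d)) * (8 * p * x)" if "x > 0" for p r d x :: real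
      using that by (cases "r = 0 \<or> d = 0") (auto simp: field_simps)
    show "2 * pi/sqrt 3/sqrt (fibre_discriminant y (chord_square s)) =
      coordinate_density y (chord_square s) * \<bar>-(8 * pi * (cos (pi * s) * sin (pi * s)))\<bar>"
      unfolding coordinate_density_def sqrt_eq abs_eq by (rule cancel[OF mult_pos_pos[OF pos]])
  qed (use y coordinate_density_nonneg in auto)
  thus ?thesis by simp
qed

lemma nn_integral_symmetric_unit_interval:
  fixes f :: "real \<Rightarrow> ennreal"
  assumes [measurable]: "f \<in> borel_measurable borel" and sym: "\<And>s. f (1 - s) = f s"
  shows "(\<integral>\<^sup>+s \<in> {0<..<1}. f s \<partial>lborel) = 2 * (\<integral>\<^sup>+s \<in> {0<..<1/2}. f s \<partial>lborel)"
proof -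
  have "(\<integral>\<^sup>+s \<in> {0<..<1}. f s \<partial>lborel) =
    (\<integral>\<^sup>+s. f s * indicator {0<..<1/2} s + f s * indicator {1/2<..<1} s \<partial>lborel)"
  proof (rule nn_integral_cong_AE)
    show "AE s in lborel. f s * indicator {0<..<1} s =
      f s * indicator {0<..<1/2} s + f s * indicator {1/2<..<1} s"
      using AE_lborel_singleton[of "1/2::real"] by eventually_elim (auto simp: indicator_def)
  qed
  also have "... = (\<integral>\<^sup>+s \<in> {0<..<1/2}. f s \<partial>lborel) + (\<integral>\<^sup>+s \<in> {1/2<..<1}. f s \<partial>lborel)"
    by (rule nn_integral_add) measurable
  also have "(\<integral>\<^sup>+s \<in> {1/2<..<1}. f s \<partial>lborel) =
    (\<integral>\<^sup>+s. f (1 - s) * indicator {1/2<..<1} (1 - s) \<partial>lborel)"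
    using nn_integral_real_affine[of "\<lambda>s. f s * indicator {1/2<..<1} s" "-1" 1] by simp
  also have "... = (\<integral>\<^sup>+s \<in> {0<..<1/2}. f s \<partial>lborel)"
    by (intro nn_integral_cong) (auto simp: sym indicator_def)
  finally show ?thesis by (simp add: mult_2)
qed

lemma fibre_period_chord:
  assumes y: "0 < y"
  shows "fibre_period y =
    ennreal (pi/sqrt 3) * (\<integral>\<^sup>+s \<in> {0<..<1}. ennreal (1/sqrt (fibre_discriminant y (chord_square s)))
    \<partial>lborel)"
proof -
  let ?f = "\<lambda>s. 1/sqrt (fibre_discriminant y (chord_square s))"
  have "ennreal (2 * pi/sqrt 3/sqrt (fibre_discriminant y (chord_square s))) =
    ennreal (pi/sqrt 3) * (2 * ennreal (?f s))" for s
  proof -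
    have eq: "2 * pi/sqrt 3/sqrt (fibre_discriminant y (chord_square s)) = pi/sqrt 3 * (2 * ?f s)"
      by simp
    show ?thesis
      unfolding eq
      by (subst ennreal_mult', simp, subst ennreal_mult', simp, simp only: ennreal_numeral)
  qed
  hence "fibre_period y = ennreal (pi/sqrt 3) * (2 * (\<integral>\<^sup>+s \<in> {0<..<1/2}. ennreal (?f s) \<partial>lborel))"
    unfolding fibre_period_coordinate[OF y] nn_integral_chord_square[OF y]
    by (simp add: nn_integral_cmult mult.assoc)
  moreover have "chord_square (1 - s) = chord_square s" for s
    by (simp add: chord_square_def right_diff_distrib cos_diff)
  ultimately show ?thesis by (subst nn_integral_symmetric_unit_interval) simp_all
qed

lemma mean_value_unit_circle:
  assumes "f holomorphic_on cball 0 1"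
  shows "((\<lambda>t. f (unit_point t)) has_integral f 0) {0..1}"
proof -
  have "((\<lambda>u. f u/(u - 0)) has_contour_integral (2 * of_real pi * \<i> * f 0)) (circlepath 0 1)"
    using assms by (intro Cauchy_integral_circlepath_simple) auto
  hence "((\<lambda>t. f (circlepath 0 1 t)/circlepath 0 1 t * vector_derivative (circlepath 0 1)
    (at t within {0..1})) has_integral (2 * of_real pi * \<i> * f 0)) {0..1}"
    unfolding has_contour_integral_def by simp
  moreover have
    "f (circlepath 0 1 t)/circlepath 0 1 t * vector_derivative (circlepath 0 1)
    (at t within {0..1}) = 2 * of_real pi * \<i> * f (unit_point t)" if "t \<in> {0..1}" for t
  proof -
    have "vector_derivative (circlepath 0 1) (at t within {0..1}) =
      2 * pi * \<i> * exp (2 * of_real pi * \<i> * t)"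
      using vector_derivative_circlepath01[of t 0 1] that by simp
    thus ?thesis by (simp only:) (simp add: circlepath unit_point_def)
  qed
  ultimately have
    "((\<lambda>t. 2 * of_real pi * \<i> * f (unit_point t)) has_integral (2 * of_real pi * \<i> * f 0)) {0..1}"
    by (rule has_integral_eq[rotated])
  from has_integral_mult_right[OF this, of "1/(2 * of_real pi * \<i>)"] show ?thesis by simp
qed

lemma Re_cayley_transform: "Re ((1 - w)/(1 + w)) = (1 - (cmod w)\<^sup>2)/(1 + 2 * Re w + (cmod w)\<^sup>2)"
proof -
  have "Re ((1 - w)/(1 + w)) = Re ((1 - w) * cnj (1 + w))/(cmod (1 + w))\<^sup>2"
    by (subst complex_div_cnj) (simp add: Re_divide_of_real[symmetric])
  also have "Re ((1 - w) * cnj (1 + w)) = 1 - (cmod w)\<^sup>2"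
    unfolding cmod_power2 by (simp add: power2_eq_square algebra_simps)
  also have "(cmod (1 + w))\<^sup>2 = 1 + 2 * Re w + (cmod w)\<^sup>2"
    unfolding cmod_power2 by (simp add: power2_eq_square algebra_simps)
  finally show ?thesis .
qed

lemma poisson_mean_value:
  fixes c :: complex
  assumes a: "a > 0" "a\<^sup>2 > 4 * (cmod c)\<^sup>2"
  shows "((\<lambda>t. 1/(a + 2 * Re (cnj c * unit_point t))) has_integral 1/sqrt (a\<^sup>2 - 4 * (cmod c)\<^sup>2))
    {0..1}"
proof -
  define d where "d = sqrt (a\<^sup>2 - 4 * (cmod c)\<^sup>2)"
  define k where "k = (a + d)/2"
  define f where "f z = (1 - cnj c/k * z)/(1 + cnj c/k * z)" for z
  have d: "d > 0" "d\<^sup>2 = a\<^sup>2 - 4 * (cmod c)\<^sup>2" using a by (simp_all add: d_def)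
  have k: "k > 0" using a d by (simp add: k_def)
  have roots: "k\<^sup>2 + (cmod c)\<^sup>2 = a * k" "k\<^sup>2 - (cmod c)\<^sup>2 = d * k"
    unfolding k_def using d(2) by (simp_all add: power2_eq_square field_simps)
  have "d * k > 0" using d k by simp
  hence "(cmod c)\<^sup>2 < k\<^sup>2" using roots(2) by linarith
  hence "cmod c < k" using k by (simp add: power2_less_imp_less)
  hence less_1: "cmod (cnj c/k) < 1" using k by (simp add: norm_divide)
  have "f holomorphic_on cball 0 1" unfolding f_def
  proof (intro holomorphic_intros)
    fix z assume z: "z \<in> cball (0::complex) 1"
    have "cmod (cnj c/k * z) \<le> cmod (cnj c/k) * 1"
      unfolding norm_mult using z by (intro mult_left_mono) auto
    thus "1 + cnj c/k * z \<noteq> 0" using less_1 by (auto simp: add_eq_0_iff)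
  qed
  from has_integral_mult_right[OF has_integral_Re[OF mean_value_unit_circle[OF this]], of "1/d"]
  have "((\<lambda>t. 1/d * Re (f (unit_point t))) has_integral 1/d) {0..1}" by (simp add: f_def)
  moreover have "1/d * Re (f (unit_point t)) = 1/(a + 2 * Re (cnj c * unit_point t))" for t
  proof -
    let ?r = "Re (cnj c * unit_point t)"
    have "Re (f (unit_point t)) = (1 - (cmod c/k)\<^sup>2)/(1 + 2 * (?r/k) + (cmod c/k)\<^sup>2)"
      using k by (simp add: f_def Re_cayley_transform norm_mult norm_divide)
    also have "1 - (cmod c/k)\<^sup>2 = (k\<^sup>2 - (cmod c)\<^sup>2)/k\<^sup>2"
      using k by (simp add: power_divide diff_divide_distrib)
    also have "1 + 2 * (?r/k) + (cmod c/k)\<^sup>2 = ((k\<^sup>2 + (cmod c)\<^sup>2) + 2 * ?r * k)/k\<^sup>2"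
      using k by (simp add: power_divide add_divide_distrib power2_eq_square)
    also have "(k\<^sup>2 - (cmod c)\<^sup>2)/k\<^sup>2/(((k\<^sup>2 + (cmod c)\<^sup>2) + 2 * ?r * k)/k\<^sup>2) = d/(a + 2 * ?r)"
      using k unfolding roots by (simp flip: distrib_right)
    finally show ?thesis using d by simp
  qed
  ultimately show ?thesis by (simp add: d_def)
qed

lemma mean_inverse_torus_square:
  assumes y: "y > 0"
  shows "(\<integral>\<^sup>+t \<in> {0<..<1}. ennreal (1/(y + torus_square (s, t))) \<partial>lborel) =
    ennreal (1/sqrt (fibre_discriminant y (chord_square s)))"
proof -
  define c where "c = 1 + unit_point s"
  have c: "(cmod c)\<^sup>2 = chord_square s" by (simp add: c_def chord_square_eq_norm)
  have torus_square:
    "y + torus_square (s, t) = (y + 1 + chord_square s) + 2 * Re (cnj c * unit_point t)" for t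
  proof -
    have "(cmod (c + unit_point t))\<^sup>2 = (cmod c)\<^sup>2 + (cmod (unit_point t))\<^sup>2
      + 2 * Re (cnj c * unit_point t)"
      unfolding cmod_power2 by (simp add: power2_eq_square algebra_simps)
    thus ?thesis by (simp add: torus_square_def c add_ac flip: c_def) (simp add: c_def add_ac)
  qed
  have "((\<lambda>t. 1/(y + torus_square (s, t))) has_integral
    1/sqrt (fibre_discriminant y (chord_square s))) {0..1}"
    unfolding torus_square fibre_discriminant_def c[symmetric]
  proof (rule poisson_mean_value)
    show "y + 1 + (cmod c)\<^sup>2 > 0" using y by (simp add: add_pos_nonneg)
    show "4 * (cmod c)\<^sup>2 < (y + 1 + (cmod c)\<^sup>2)\<^sup>2"
      using fibre_discriminant_pos[OF y chord_square_nonneg, of s]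
      by (simp add: fibre_discriminant_def c)
  qed
  hence "((\<lambda>t. 1/(y + torus_square (s, t))) has_integral
    1/sqrt (fibre_discriminant y (chord_square s))) {0<..<1}"
    by (simp add: has_integral_Icc_iff_Ioo)
  thus ?thesis
    using y torus_square_nonneg
    by (intro nn_integral_has_integral_lebesgue') (auto intro: add_nonneg_nonneg)
qed

definition torus :: "(real \<times> real) measure" where
  "torus = density (lborel \<Otimes>\<^sub>M lborel) (indicator ({0<..<1} \<times> {0<..<1}))"

definition kernel_measure :: "(real \<times> real) measure" where
  "kernel_measure = density (lborel \<Otimes>\<^sub>M lborel) (\<lambda>x. ennreal (kernel_density x))"

lemma sets_torus [measurable_cong]:
  "sets torus = sets (borel \<Otimes>\<^sub>M borel)" and sets_kernel_measure [measurable_cong]: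
    "sets kernel_measure = sets (borel \<Otimes>\<^sub>M borel)"
  unfolding torus_def kernel_measure_def sets_density by (intro sets_pair_measure_cong sets_lborel)+

lemma nn_integral_torus:
  assumes [measurable]: "f \<in> borel_measurable (borel \<Otimes>\<^sub>M borel)"
  shows "(\<integral>\<^sup>+x. f x \<partial>torus) = (\<integral>\<^sup>+s \<in> {0<..<1}. (\<integral>\<^sup>+t \<in> {0<..<1}. f (s, t) \<partial>lborel) \<partial>lborel)"
proof -
  have "(\<integral>\<^sup>+x. f x \<partial>torus) =
    (\<integral>\<^sup>+s. \<integral>\<^sup>+t. f (s, t) * indicator {0<..<1} t * indicator {0<..<1} s \<partial>lborel \<partial>lborel)"
    unfolding torus_def
    by (subst nn_integral_density) (auto simp: lborel.nn_integral_fst[symmetric] indicator_times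
      mult_ac)
  thus ?thesis by (simp add: nn_integral_multc)
qed

lemma nn_integral_kernel_measure:
  assumes [measurable]: "f \<in> borel_measurable (borel \<Otimes>\<^sub>M borel)"
  shows "(\<integral>\<^sup>+x. f x \<partial>kernel_measure) =
    (\<integral>\<^sup>+C. \<integral>\<^sup>+t. f (C, t) * ennreal (kernel_density (C, t)) \<partial>lborel \<partial>lborel)"
  unfolding kernel_measure_def
  by (subst nn_integral_density) (auto simp: lborel.nn_integral_fst[symmetric] mult.commute)

lemma emeasure_torus: "emeasure torus (space torus) = 1"
proof -
  have "emeasure torus (space torus) = (\<integral>\<^sup>+x. 1 \<partial>torus)" by simp
  also have "... = 1" by (subst nn_integral_torus) simp_all
  finally show ?thesis .
qed

lemma finite_measure_torus: "finite_measure torus"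
  by (rule finite_measureI) (simp add: emeasure_torus)

lemma fibre_period_torus:
  assumes y: "0 < y"
  shows "fibre_period y = ennreal (pi/sqrt 3) * (\<integral>\<^sup>+x. ennreal (1/(y + torus_square x)) \<partial>torus)"
  by (subst nn_integral_torus) (simp_all add: fibre_period_chord[OF y] mean_inverse_torus_square[OF
    y])

lemma nn_integral_A_ratio_fibres:
  assumes [measurable]: "F \<in> borel_measurable borel"
  shows "(\<integral>\<^sup>+x \<in> {x. 0 < A_real x}. F (A_ratio x) \<partial>kernel_measure) =
    (\<integral>\<^sup>+y \<in> {0<..}. F y * fibre_period y \<partial>lborel)"
proof -
  have "(\<integral>\<^sup>+x \<in> {x. 0 < A_real x}. F (A_ratio x) \<partial>kernel_measure) =
    (\<integral>\<^sup>+C. (\<integral>\<^sup>+t \<in> {t. 0 < A_real (C, t)}. F (A_ratio (C, t)) * ennreal (kernel_density (C, t))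
    \<partial>lborel) \<partial>lborel)"
    by (subst nn_integral_kernel_measure) (simp_all add: mult_ac indicator_def)
  also have "... =
    (\<integral>\<^sup>+C. (\<integral>\<^sup>+y \<in> {y. in_fibre C y}. F y * ennreal (fibre_density C y) \<partial>lborel) \<partial>lborel)"
    by (simp add: nn_integral_kernel_density)
  also have "... =
    (\<integral>\<^sup>+y. (\<integral>\<^sup>+C \<in> {C. in_fibre C y}. F y * ennreal (fibre_density C y) \<partial>lborel) \<partial>lborel)"
    unfolding indicator_def mem_Collect_eq by (rule lborel_pair.Fubini'[symmetric]) measurable
  also have "... = (\<integral>\<^sup>+y \<in> {0<..}. F y * fibre_period y \<partial>lborel)"
  proof (rule nn_integral_cong)
    fix y :: real
    show "(\<integral>\<^sup>+C \<in> {C. in_fibre C y}. F y * ennreal (fibre_density C y) \<partial>lborel) =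
      F y * fibre_period y * indicator {0<..} y"
    proof (cases "0 < y")
      case True
      thus ?thesis by (simp add: fibre_period_def mult.assoc) (rule nn_integral_cmult, measurable)
    qed (simp add: in_fibre_def)
  qed
  finally show ?thesis .
qed

theorem nn_integral_A_ratio:
  assumes [measurable]: "F \<in> borel_measurable borel"
  shows "(\<integral>\<^sup>+x \<in> {x. 0 < A_real x}. F (A_ratio x) \<partial>kernel_measure) =
    ennreal (pi/sqrt 3) * (\<integral>\<^sup>+x. (\<integral>\<^sup>+y \<in> {0<..}. F y * ennreal (1/(y + torus_square x)) \<partial>lborel)
    \<partial>torus)"
proof -
  interpret torus: finite_measure torus by (rule finite_measure_torus)
  interpret pair_sigma_finite torus lborel ..
  have "(\<integral>\<^sup>+x \<in> {x. 0 < A_real x}. F (A_ratio x) \<partial>kernel_measure) =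
    (\<integral>\<^sup>+y. ennreal (pi/sqrt 3) * (\<integral>\<^sup>+x. F y * ennreal (1/(y + torus_square x)) * indicator {0<..} y
    \<partial>torus) \<partial>lborel)"
    unfolding nn_integral_A_ratio_fibres[OF assms]
    by (intro nn_integral_cong) (auto simp: fibre_period_torus nn_integral_cmult mult_ac split:
      split_indicator)
  also have "... =
    ennreal (pi/sqrt 3) * (\<integral>\<^sup>+y. \<integral>\<^sup>+x. F y * ennreal (1/(y + torus_square x)) * indicator {0<..} y
    \<partial>torus \<partial>lborel)"
    by (rule nn_integral_cmult) measurable
  finally show ?thesis by (subst (asm) Fubini') measurable
qed

lemma has_integral_inverse_Q3_real: "((\<lambda>t. 1/Q3_real t) has_integral pi/sqrt 3) {-1..1}"
proof -
  let ?F = "\<lambda>t. 2/sqrt 3 * arctan ((2 * t - 1)/sqrt 3)"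
  have "((\<lambda>t. 1/Q3_real t) has_integral ?F 1 - ?F (-1)) {-1..1}"
  proof (rule fundamental_theorem_of_calculus)
    fix t :: real
    have "(?F has_field_derivative 2/sqrt 3 * (inverse (1 + ((2 * t - 1)/sqrt 3)\<^sup>2) * (2/sqrt 3)))
      (at t within {-1..1})"
      by (intro DERIV_cmult DERIV_chain2[where f=arctan] DERIV_arctan DERIV_cdivide)
        (auto intro!: derivative_eq_intros)
    moreover have "1 + ((2 * t - 1)/sqrt 3)\<^sup>2 = 4/3 * Q3_real t"
      by (simp add: power_divide) (simp add: Q3_real_def power2_eq_square field_simps)
    moreover have "2/sqrt 3 * (inverse (4/3 * q) * (2/sqrt 3)) = 1/q" for q :: real
      by (simp add: field_simps)
    ultimately show "(?F has_vector_derivative 1/Q3_real t) (at t within {-1..1})"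
      by (simp only: has_real_derivative_iff_has_vector_derivative)
  qed simp
  moreover have "arctan (1/sqrt 3) = pi/6"
    using arctan_unique[of "pi/6" "1/sqrt 3"] tan_30 pi_gt_zero by simp
  moreover have "arctan (sqrt 3) = pi/3"
    using arctan_unique[of "pi/3" "sqrt 3"] tan_60 pi_gt_zero by simp
  moreover have "3/sqrt 3 = sqrt 3" by (simp add: real_div_sqrt)
  ultimately show ?thesis by (simp add: arctan_minus field_simps)
qed

lemma nn_integral_C3_minus_1:
  assumes [measurable]: "F \<in> borel_measurable borel"
  shows "(\<integral>\<^sup>+x. F (1/(fst x - 1)) \<partial>kernel_measure) =
    ennreal (pi/sqrt 3) * (\<integral>\<^sup>+y \<in> {0<..}. F y * ennreal (1/(y + 1)) \<partial>lborel)"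
proof -
  have Q3: "(\<integral>\<^sup>+t \<in> {-1<..<1}. ennreal (1/Q3_real t) \<partial>lborel) = ennreal (pi/sqrt 3)"
    using has_integral_inverse_Q3_real Q3_real_pos
    by (intro nn_integral_has_integral_lebesgue') (auto simp: has_integral_Icc_iff_Ioo less_imp_le)
  have kernel: "F (1/(C - 1)) * ennreal (kernel_density (C, t)) =
    F (1/(C - 1)) * ennreal (1/(C * (C - 1))) * indicator {1<..} C *
    (ennreal (1/Q3_real t) * indicator {-1<..<1} t)" for C t
    using Q3_real_pos[of t]
    by (auto simp: kernel_density_def indicator_def mult.assoc simp flip: ennreal_mult)
  have "(\<integral>\<^sup>+x. F (1/(fst x - 1)) \<partial>kernel_measure) =
    (\<integral>\<^sup>+C. F (1/(C - 1)) * ennreal (1/(C * (C - 1))) * indicator {1<..} C * ennreal (pi/sqrt 3)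
    \<partial>lborel)"
    by (subst nn_integral_kernel_measure) (simp_all add: kernel nn_integral_cmult Q3)
  also have "... =
    ennreal (pi/sqrt 3) * (\<integral>\<^sup>+C \<in> {1<..}. F (1/(C - 1)) * ennreal (1/(C * (C - 1))) \<partial>lborel)"
    by (subst nn_integral_multc) (simp_all add: mult.commute)
  also have "(\<integral>\<^sup>+C \<in> {1<..}. F (1/(C - 1)) * ennreal (1/(C * (C - 1))) \<partial>lborel) =
    (\<integral>\<^sup>+y \<in> {0<..}. F y * ennreal (1/(y + 1)) \<partial>lborel)"
  proof (rule nn_integral_change_of_variables[where g'="\<lambda>C. -(1/(C - 1)\<^sup>2)"])
    show "bij_betw (\<lambda>C::real. 1/(C - 1)) {1<..} {0<..}"
      by (rule bij_betw_byWitness[where f'="\<lambda>y. 1 + 1/y"]) auto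
    fix C :: real assume "C \<in> {1<..}"
    hence C: "1 < C" by simp
    show "((\<lambda>C. 1/(C - 1)) has_field_derivative -(1/(C - 1)\<^sup>2)) (at C within {1<..})"
      using C by (auto intro!: derivative_eq_intros simp: power2_eq_square)
    have "1/(C - 1) + 1 = C/(C - 1)" using C by (simp add: field_simps)
    thus "1/(C * (C - 1)) = 1/(1/(C - 1) + 1) * \<bar>-(1/(C - 1)\<^sup>2)\<bar>"
      using C by simp (simp add: power2_eq_square)
  qed auto
  finally show ?thesis .
qed

definition mellin_factor :: "real \<Rightarrow> real" where
  "mellin_factor a = -pi/sin (pi * a)"

lemma sin_pi_neg:
  assumes "-1 < a" "a < 0"
  shows "sin (pi * a) < 0"
proof -
  have "pi * (-a) < pi * 1" "0 < pi * (-a)"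
    using assms by (intro mult_strict_left_mono mult_pos_pos; simp)+
  thus ?thesis using sin_gt_zero[of "pi * (-a)"] by simp
qed

lemma mellin_factor_pos: "-1 < a \<Longrightarrow> a < 0 \<Longrightarrow> mellin_factor a > 0"
  using sin_pi_neg[of a] by (simp add: mellin_factor_def divide_pos_neg)

lemma Beta_mellin_factor:
  assumes "-1 < a" "a < 0"
  shows "Beta (a + 1) (-a) = mellin_factor a"
proof -
  have "complex_of_real (Gamma (a + 1) * Gamma (-a)) =
    Gamma (complex_of_real (a + 1)) * Gamma (1 - complex_of_real (a + 1))"
    by (simp add: Gamma_complex_of_real[symmetric])
  also have "... = of_real pi/sin (of_real pi * complex_of_real (a + 1))"
    by (rule Gamma_reflection_complex)
  also have "... = complex_of_real (pi/sin (pi * (a + 1)))"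
    by (simp add: sin_of_real[symmetric] del: of_real_add)
  finally have "Gamma (a + 1) * Gamma (-a) = pi/sin (pi * (a + 1))" by (simp only: of_real_eq_iff)
  thus ?thesis by (simp add: Beta_def mellin_factor_def distrib_left sin_add)
qed

lemma nn_integral_mellin_eq_beta:
  assumes r: "r > 0"
  shows "(\<integral>\<^sup>+y \<in> {0<..}. ennreal (y powr a) * ennreal (1/(y + r)) \<partial>lborel) =
    (\<integral>\<^sup>+x \<in> {0<..<1}. ennreal (r powr a * (x powr a * (1 - x) powr (-a - 1))) \<partial>lborel)"
proof -
  have "(\<integral>\<^sup>+x \<in> {0<..<1}. 1 * ennreal (r powr a * (x powr a * (1 - x) powr (-a - 1))) \<partial>lborel) =
    (\<integral>\<^sup>+y \<in> {0<..}. 1 * ennreal (y powr a/(y + r)) \<partial>lborel)"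
  proof (rule nn_integral_change_of_variables[where g="\<lambda>x. r * x/(1 - x)" and g'="\<lambda>x. r/(1 - x)\<^sup>2"])
    have complement: "1 - y/(y + r) = r/(y + r)" if "y > 0" for y
      using that r by (simp add: field_simps)
    have shift: "r * x/(1 - x) + r = r/(1 - x)" if "x < 1" for x
      using that by (simp add: field_simps)
    show "bij_betw (\<lambda>x. r * x/(1 - x)) {0<..<1} {0<..}"
      using r by (intro bij_betw_byWitness[where f'="\<lambda>y. y/(y + r)"]) (auto simp: complement shift)
    fix x :: real assume "x \<in> {0<..<1}"
    hence x: "0 < x" "x < 1" by auto
    show "((\<lambda>x. r * x/(1 - x)) has_field_derivative r/(1 - x)\<^sup>2) (at x within {0<..<1})"
      using x by (auto intro!: derivative_eq_intros simp: power2_eq_square field_simps)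
    have "(r * x/(1 - x)) powr a = r powr a * x powr a * (1 - x) powr (-a)"
      using x r by (simp add: powr_mult powr_divide powr_minus_divide)
    moreover have "(1 - x) powr (-a - 1) = (1 - x) powr (-a)/(1 - x)"
      using x by (simp add: powr_diff)
    ultimately show "r powr a * (x powr a * (1 - x) powr (-a - 1)) =
      (r * x/(1 - x)) powr a/(r * x/(1 - x) + r) * \<bar>r/(1 - x)\<^sup>2\<bar>"
      using x r by (simp add: shift power2_eq_square)
  qed (use r in auto)
  moreover have "ennreal (y powr a) * ennreal (1/(y + r)) * indicator {0<..} y =
    ennreal (y powr a/(y + r)) * indicator {0<..} y" for y
    using r by (auto simp: indicator_def simp flip: ennreal_mult)
  ultimately show ?thesis by simp
qed

lemma nn_integral_mellin:
  assumes a: "-1 < a" "a < 0" and r: "r > 0"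
  shows "(\<integral>\<^sup>+y \<in> {0<..}. ennreal (y powr a) * ennreal (1/(y + r)) \<partial>lborel) =
    ennreal (mellin_factor a * r powr a)"
proof -
  let ?beta = "\<lambda>x. x powr a * (1 - x) powr (-a - 1)"
  have "(?beta has_integral mellin_factor a) {0..1}"
    using has_integral_Beta_real[of "a + 1" "-a"] a by (simp add: Beta_mellin_factor[OF a])
  hence "((\<lambda>x. r powr a * ?beta x) has_integral r powr a * mellin_factor a) {0<..<1}"
    unfolding has_integral_Icc_iff_Ioo by (rule has_integral_mult_right)
  hence "(\<integral>\<^sup>+x \<in> {0<..<1}. ennreal (r powr a * ?beta x) \<partial>lborel) =
    ennreal (r powr a * mellin_factor a)"
    by (intro nn_integral_has_integral_lebesgue') auto
  thus ?thesis unfolding nn_integral_mellin_eq_beta[OF r] by (simp add: mult.commute)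
qed

section \<open>Logarithmic moments on the torus\<close>

lemma abs_sin_lower_bound:
  assumes "\<bar>x\<bar> \<le> 2 * pi/3"
  shows "\<bar>x\<bar>/4 \<le> \<bar>sin x\<bar>"
proof -
  have nonneg: "x/4 \<le> sin x" if x: "0 \<le> x" "x \<le> 2 * pi/3" for x
  proof -
    define y where "y = x/2"
    have y: "0 \<le> y" "y \<le> pi/3" using x by (auto simp: y_def)
    have cos: "1/2 \<le> cos z" if "0 \<le> z" "z \<le> y" for z
      using cos_monotone_0_pi_le[of z "pi/3"] that y pi_gt_zero by (simp add: cos_60)
    have "sin 0 - 0/2 \<le> sin y - y/2"
    proof (rule DERIV_nonneg_imp_nondecreasing[OF y(1)])
      fix z assume "0 \<le> z" "z \<le> y"
      thus "\<exists>d. ((\<lambda>y. sin y - y/2) has_real_derivative d) (at z) \<and> 0 \<le> d"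
        using cos[of z] by (intro exI[of _ "cos z - 1/2"]) (auto intro!: derivative_eq_intros)
    qed
    hence "2 * (y/2) * (1/2) \<le> 2 * sin y * cos y" using cos[of y] y by (intro mult_mono) auto
    thus ?thesis using sin_double[of y] by (simp add: y_def)
  qed
  show ?thesis using assms nonneg[of x] nonneg[of "-x"] by (cases "x \<ge> 0") auto
qed

lemma abs_chord_square_minus_1:
  assumes s: "0 < s" "s < 1"
  shows "2 * (\<bar>s - 1/3\<bar> * \<bar>s - 2/3\<bar>) \<le> \<bar>chord_square s - 1\<bar>"
proof -
  have ps: "0 < pi * s" "pi * s < pi" using s by simp_all
  have "\<bar>pi * s - pi/3\<bar>/4 \<le> \<bar>sin (pi * s - pi/3)\<bar>"
    "\<bar>pi * s - 2 * pi/3\<bar>/4 \<le> \<bar>sin (pi * s - 2 * pi/3)\<bar>"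
    by (intro abs_sin_lower_bound abs_leI; use ps in linarith)+
  moreover have "pi * s - pi/3 = pi * (s - 1/3)" "pi * s - 2 * pi/3 = pi * (s - 2/3)"
    by (simp_all add: right_diff_distrib)
  ultimately have sin_bounds: "pi * \<bar>s - 1/3\<bar>/4 \<le> \<bar>sin (pi * s - pi/3)\<bar>"
    "pi * \<bar>s - 2/3\<bar>/4 \<le> \<bar>sin (pi * s - 2 * pi/3)\<bar>"
    by (simp_all add: abs_mult)
  have "sin (pi * s - pi/3) * sin (pi * s - 2 * pi/3) = (cos (pi * s))\<^sup>2 * 3/4 - (sin (pi * s))\<^sup>2/4"
    by (simp only: sin_diff cos_60 sin_60 sin_120 cos_120) (simp add: power2_eq_square
      algebra_simps)
  hence "chord_square s - 1 = 4 * (sin (pi * s - pi/3) * sin (pi * s - 2 * pi/3))"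
    unfolding chord_square_def using sin_cos_squared_add[of "pi * s"] by linarith
  hence "\<bar>chord_square s - 1\<bar> = 4 * (\<bar>sin (pi * s - pi/3)\<bar> * \<bar>sin (pi * s - 2 * pi/3)\<bar>)"
    by (simp add: abs_mult)
  moreover have "(pi * \<bar>s - 1/3\<bar>/4) * (pi * \<bar>s - 2/3\<bar>/4) \<le>
    \<bar>sin (pi * s - pi/3)\<bar> * \<bar>sin (pi * s - 2 * pi/3)\<bar>"
    using sin_bounds by (intro mult_mono) auto
  ultimately have "pi * pi/4 * (\<bar>s - 1/3\<bar> * \<bar>s - 2/3\<bar>) \<le> \<bar>chord_square s - 1\<bar>"
    by (simp add: mult_ac)
  moreover have "3 * 3 \<le> pi * pi" using pi_gt3 by (intro mult_mono) auto
  hence "2 * (\<bar>s - 1/3\<bar> * \<bar>s - 2/3\<bar>) \<le> pi * pi/4 * (\<bar>s - 1/3\<bar> * \<bar>s - 2/3\<bar>)"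
    by (intro mult_right_mono) auto
  ultimately show ?thesis by linarith
qed

lemma torus_square_lower_bound:
  assumes s: "0 < s" "s < 1"
  shows "(2/3 * (\<bar>s - 1/3\<bar> * \<bar>s - 2/3\<bar>))\<^sup>2 \<le> torus_square (s, t)"
proof -
  define c where "c = cmod (1 + unit_point s)"
  have c: "0 \<le> c" "c \<le> 2" using norm_triangle_ineq[of 1 "unit_point s"] by (auto simp: c_def)
  have "chord_square s - 1 = (c - 1) * (c + 1)"
    by (simp add: chord_square_eq_norm c_def power2_eq_square algebra_simps)
  hence "\<bar>chord_square s - 1\<bar> = \<bar>c - 1\<bar> * (c + 1)" using c by (simp add: abs_mult)
  also have "... \<le> \<bar>c - 1\<bar> * 3" using c by (intro mult_left_mono) auto
  finally have "2/3 * (\<bar>s - 1/3\<bar> * \<bar>s - 2/3\<bar>) \<le> \<bar>c - 1\<bar>"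
    using abs_chord_square_minus_1[OF s] by simp
  also have "... \<le> cmod (1 + unit_point t + unit_point s)"
    using norm_triangle_ineq3[of "1 + unit_point s" "-unit_point t"] by (simp add: c_def add_ac)
  finally show ?thesis unfolding torus_square_def by (intro power_mono) auto
qed

lemma torus_square_le_9: "torus_square x \<le> 9"
proof -
  have "cmod (1 + unit_point (snd x) + unit_point (fst x)) \<le> 3"
    using norm_triangle_ineq[of "1 + unit_point (snd x)" "unit_point (fst x)"]
      norm_triangle_ineq[of 1 "unit_point (snd x)"]
    by simp
  hence "torus_square x \<le> 3\<^sup>2" unfolding torus_square_def by (intro power_mono) auto
  thus ?thesis by simp
qed

lemma nn_integral_abs_diff_powr:
  fixes a p :: real
  assumes a: "-1 < a" and p: "0 \<le> p" "p \<le> 1"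
  shows "(\<integral>\<^sup>+s \<in> {0<..<1}. ennreal (\<bar>s - p\<bar> powr a) \<partial>lborel) < \<infinity>"
proof -
  define f where "f x = ennreal (x powr a) * indicator {0<..<1} x" for x :: real
  have [measurable]: "f \<in> borel_measurable borel" unfolding f_def by measurable
  have "(\<integral>\<^sup>+x. f x \<partial>lborel) = ennreal (1 powr (a + 1)/(a + 1))"
    unfolding f_def using has_integral_powr_from_0[OF a, of 1]
    by (intro nn_integral_has_integral_lebesgue') (auto simp: has_integral_Icc_iff_Ioo)
  hence finite: "(\<integral>\<^sup>+x. f x \<partial>lborel) < \<infinity>" by simp
  have "ennreal (\<bar>s - p\<bar> powr a) * indicator {0<..<1} s \<le> f (-p + 1 * s) + f (p + (-1) * s)" for s
  proof (cases "0 < s \<and> s < 1")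
    case True
    consider "s = p" | "s > p" | "s < p" by linarith
    thus ?thesis using True p by cases (auto simp: f_def add.commute)
  qed (auto simp: indicator_def)
  hence "(\<integral>\<^sup>+s \<in> {0<..<1}. ennreal (\<bar>s - p\<bar> powr a) \<partial>lborel) \<le>
    (\<integral>\<^sup>+s. f (-p + 1 * s) + f (p + (-1) * s) \<partial>lborel)"
    by (rule nn_integral_mono)
  also have "... = (\<integral>\<^sup>+s. f (-p + 1 * s) \<partial>lborel) + (\<integral>\<^sup>+s. f (p + (-1) * s) \<partial>lborel)"
    by (rule nn_integral_add) measurable
  also have "... = (\<integral>\<^sup>+x. f x \<partial>lborel) + (\<integral>\<^sup>+x. f x \<partial>lborel)"
    using nn_integral_real_affine[of f 1 "-p"] nn_integral_real_affine[of f "-1" p] by simp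
  finally show ?thesis using finite by (auto simp: ennreal_add_less_top intro: order.strict_trans1)
qed

lemma torus_square_powr_le:
  assumes s: "0 < s" "s < 1" "s \<noteq> 1/3" "s \<noteq> 2/3"
  shows "torus_square (s, t) powr (-1/8) \<le> 2 * \<bar>s - 1/3\<bar> powr (-1/2) + 2 * \<bar>s - 2/3\<bar> powr (-1/2)"
proof -
  define p q where "p = \<bar>s - 1/3\<bar>" and "q = \<bar>s - 2/3\<bar>"
  have pq: "p > 0" "q > 0" using s by (auto simp: p_def q_def)
  have "torus_square (s, t) powr (-1/8) \<le> ((2/3 * (p * q))\<^sup>2) powr (-1/8)"
    using torus_square_lower_bound[OF s(1,2), of t] pq unfolding p_def[symmetric] q_def[symmetric]
    by (intro powr_mono2') auto
  also have "... = (2/3) powr (-1/4) * (p powr (-1/4) * q powr (-1/4))"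
    using pq powr_mult[of "2/3" "p * q" "-1/4"] powr_mult[of p q "-1/4"]
    by (simp add: powr_powr flip: powr_numeral)
  also have "... \<le> 2 * (p powr (-1/4) * q powr (-1/4))"
  proof (rule mult_right_mono)
    have "(2/3::real) powr (-1/4) \<le> (2/3) powr (-1)" by (rule powr_mono') auto
    thus "(2/3::real) powr (-1/4) \<le> 2" by (simp add: powr_minus)
  qed simp
  also have "... \<le> (p powr (-1/4))\<^sup>2 + (q powr (-1/4))\<^sup>2"
    using sum_squares_bound[of "p powr (-1/4)" "q powr (-1/4)"] by simp
  also have "... = p powr (-1/2) + q powr (-1/2)"
    using pq by (simp add: power2_eq_square flip: powr_add)
  also have "... \<le> 2 * p powr (-1/2) + 2 * q powr (-1/2)" by simp
  finally show ?thesis by (simp add: p_def q_def)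
qed

lemma AE_torus_square_pos: "AE x in torus. 0 < torus_square x"
proof -
  have "AE x in lborel \<Otimes>\<^sub>M lborel. x \<in> {0<..<1} \<times> {0<..<1} \<longrightarrow> 0 < torus_square x"
  proof (rule lborel_pair.AE_pair_measure)
    show "AE s in lborel. AE t in lborel. (s, t) \<in> {0<..<1} \<times> {0<..<1} \<longrightarrow> 0 < torus_square (s, t)"
      using AE_lborel_singleton[of "1/3::real"] AE_lborel_singleton[of "2/3::real"]
    proof eventually_elim
      case (elim s)
      hence "0 < (2/3 * (\<bar>s - 1/3\<bar> * \<bar>s - 2/3\<bar>))\<^sup>2" by simp
      hence "0 < torus_square (s, t)" if "0 < s" "s < 1" for t
        using torus_square_lower_bound[OF that, of t] by linarith
      thus ?case by (intro AE_I2) auto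
    qed
  qed measurable
  thus ?thesis unfolding torus_def by (subst AE_density) (auto simp: indicator_def)
qed

lemma nn_integral_torus_square_powr: "(\<integral>\<^sup>+x. ennreal (torus_square x powr (-1/8)) \<partial>torus) < \<infinity>"
proof -
  let ?f = "\<lambda>p s. ennreal (\<bar>s - p\<bar> powr (-1/2)) * indicator {0<..<1} (s::real)"
  have "(\<integral>\<^sup>+x. ennreal (torus_square x powr (-1/8)) \<partial>torus) =
    (\<integral>\<^sup>+s \<in> {0<..<1}. (\<integral>\<^sup>+t \<in> {0<..<1}. ennreal (torus_square (s, t) powr (-1/8)) \<partial>lborel) \<partial>lborel)"
    by (rule nn_integral_torus) measurable
  also have "... \<le> (\<integral>\<^sup>+s. 2 * ?f (1/3) s + 2 * ?f (2/3) s \<partial>lborel)"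
  proof (rule nn_integral_mono_AE)
    show "AE s in lborel. (\<integral>\<^sup>+t \<in> {0<..<1}. ennreal (torus_square (s, t) powr (-1/8)) \<partial>lborel) *
      indicator {0<..<1} s \<le> 2 * ?f (1/3) s + 2 * ?f (2/3) s"
      using AE_lborel_singleton[of "1/3::real"] AE_lborel_singleton[of "2/3::real"]
    proof eventually_elim
      case (elim s)
      show ?case
      proof (cases "0 < s \<and> s < 1")
        case True
        let ?c = "ennreal (2 * \<bar>s - 1/3\<bar> powr (-1/2) + 2 * \<bar>s - 2/3\<bar> powr (-1/2))"
        have "(\<integral>\<^sup>+t \<in> {0<..<1}. ennreal (torus_square (s, t) powr (-1/8)) \<partial>lborel) \<le>
          (\<integral>\<^sup>+t \<in> {0<..<1::real}. ?c \<partial>lborel)"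
          using torus_square_powr_le[of s] True elim
          by (intro nn_integral_mono mult_right_mono ennreal_leI) auto
        also have "... = ?c" by (simp add: nn_integral_cmult_indicator)
        finally show ?thesis using True by (simp add: ennreal_mult')
      qed auto
    qed
  qed
  also have "... = 2 * (\<integral>\<^sup>+s. ?f (1/3) s \<partial>lborel) + 2 * (\<integral>\<^sup>+s. ?f (2/3) s \<partial>lborel)"
    by (simp add: nn_integral_add nn_integral_cmult)
  also have "... < \<infinity>"
    using nn_integral_abs_diff_powr[of "-1/2" "1/3"] nn_integral_abs_diff_powr[of "-1/2" "2/3"]
    by (simp add: ennreal_add_less_top ennreal_mult_less_top)
  finally show ?thesis .
qed

lemma AE_kernel_measure: "AE x in kernel_measure. 1 < fst x"
  unfolding kernel_measure_def
  by (subst AE_density) (auto simp: kernel_density_def split: if_splits)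

lemma powr_le_sum:
  fixes r a b :: real
  assumes r: "0 < r" and a: "\<bar>a\<bar> \<le> b"
  shows "r powr a \<le> r powr (-b) + r powr b"
proof (cases "r \<ge> 1")
  case True
  have "r powr a \<le> r powr b" using True a by (intro powr_mono) auto
  thus ?thesis using powr_ge_zero[of r "-b"] by linarith
next
  case False
  have "r powr a \<le> r powr (-b)" using False r a by (intro powr_mono') auto
  thus ?thesis using powr_ge_zero[of r b] by linarith
qed

lemma exp_abs_ln_le: "0 < r \<Longrightarrow> exp (b * \<bar>ln r\<bar>) \<le> r powr (-b) + r powr b" for r b :: real
  by (cases "ln r \<ge> 0") (auto simp: powr_def abs_if)

lemma integrable_torus_square_powr:
  assumes a: "\<bar>a\<bar> \<le> 1/8"
  shows "integrable torus (\<lambda>x. torus_square x powr a)"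
proof -
  interpret finite_measure torus by (rule finite_measure_torus)
  have "integrable torus (\<lambda>x. torus_square x powr (-1/8))"
    using nn_integral_torus_square_powr by (intro integrableI_bounded) auto
  hence "integrable torus (\<lambda>x. torus_square x powr (-1/8) + 9)"
    by (intro Bochner_Integration.integrable_add) simp_all
  thus ?thesis
  proof (rule Bochner_Integration.integrable_bound)
    show "AE x in torus. norm (torus_square x powr a) \<le> norm (torus_square x powr (-1/8) + 9)"
      using AE_torus_square_pos
    proof eventually_elim
      case (elim x)
      have "torus_square x powr (1/8) \<le> 9 powr (1/8)"
        using torus_square_le_9[of x] elim by (intro powr_mono2) auto
      also have "... \<le> 9 powr 1" by (intro powr_mono) auto
      finally have "torus_square x powr (1/8) \<le> 9" by simp
      thus ?case using powr_le_sum[OF elim a] by simp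
    qed
  qed measurable
qed

definition torus_zeta :: "real \<Rightarrow> real" where
  "torus_zeta a = (\<integral>x. torus_square x powr a \<partial>torus)"

lemma has_bochner_integral_A_ratio_powr:
  assumes a: "-1/8 \<le> a" "a < 0"
  shows "has_bochner_integral kernel_measure (\<lambda>x. if 0 < A_real x then A_ratio x powr a else 0)
    (pi/sqrt 3 * mellin_factor a * torus_zeta a)"
proof (rule has_bochner_integral_nn_integral)
  have mellin: "mellin_factor a > 0" using a by (intro mellin_factor_pos) auto
  show "0 \<le> pi/sqrt 3 * mellin_factor a * torus_zeta a"
    using mellin unfolding torus_zeta_def by (intro mult_nonneg_nonneg integral_nonneg) auto
  have "(\<integral>\<^sup>+x. ennreal (if 0 < A_real x then A_ratio x powr a else 0) \<partial>kernel_measure) =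
    (\<integral>\<^sup>+x \<in> {x. 0 < A_real x}. ennreal (A_ratio x powr a) \<partial>kernel_measure)"
    by (intro nn_integral_cong) (simp add: indicator_def)
  also have "... =
    ennreal (pi/sqrt 3) * (\<integral>\<^sup>+x. (\<integral>\<^sup>+y \<in> {0<..}. ennreal (y powr a) * ennreal
    (1/(y + torus_square x)) \<partial>lborel) \<partial>torus)"
    by (rule nn_integral_A_ratio) measurable
  also have "... =
    ennreal (pi/sqrt 3) * (\<integral>\<^sup>+x. ennreal (mellin_factor a * torus_square x powr a) \<partial>torus)"
  proof (intro arg_cong[where f="\<lambda>x. _ * x"] nn_integral_cong_AE)
    show "AE x in torus. (\<integral>\<^sup>+y \<in>
      {0<..}. ennreal (y powr a) * ennreal (1/(y + torus_square x)) \<partial>lborel) = ennreal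
      (mellin_factor a * torus_square x powr a)"
      using AE_torus_square_pos by eventually_elim (rule nn_integral_mellin, use a in auto)
  qed
  also have "(\<integral>\<^sup>+x. ennreal (mellin_factor a * torus_square x powr a) \<partial>torus) =
    ennreal (\<integral>x. mellin_factor a * torus_square x powr a \<partial>torus)"
    using mellin a
    by (intro nn_integral_eq_integral integrable_mult_right integrable_torus_square_powr) auto
  finally show "(\<integral>\<^sup>+x. ennreal (if 0 < A_real x then A_ratio x powr a else 0) \<partial>kernel_measure) =
    ennreal (pi/sqrt 3 * mellin_factor a * torus_zeta a)"
    using ennreal_mult'[of "pi/sqrt 3" "mellin_factor a * torus_zeta a"]
    by (simp add: torus_zeta_def mult.assoc)
qed auto

lemma has_bochner_integral_inverse_powr:
  assumes a: "-1 < a" "a < 0"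
  shows "has_bochner_integral kernel_measure (\<lambda>x. (1/(fst x - 1)) powr a)
    (pi/sqrt 3 * mellin_factor a)"
proof (rule has_bochner_integral_nn_integral)
  have mellin: "mellin_factor a > 0" using a by (intro mellin_factor_pos) auto
  thus "0 \<le> pi/sqrt 3 * mellin_factor a" by simp
  show "(\<integral>\<^sup>+x. ennreal ((1/(fst x - 1)) powr a) \<partial>kernel_measure) =
    ennreal (pi/sqrt 3 * mellin_factor a)"
    using nn_integral_mellin[OF a, of 1] ennreal_mult'[of "pi/sqrt 3" "mellin_factor a"]
    by (subst nn_integral_C3_minus_1) simp_all
qed auto

lemma exp_partial_sum_le:
  fixes x :: real
  assumes x: "0 \<le> x"
  shows "(\<Sum>N<n. x^N/fact N) \<le> exp x"
proof -
  have "(\<lambda>N. x^N/fact N) sums exp x"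
    using exp_converges[of x] by (simp add: divide_inverse mult.commute)
  thus ?thesis using x by (subst sums_unique) (auto intro!: sum_le_suminf sums_summable)
qed

lemma abs_power_diff_le:
  fixes x z M :: real
  assumes "\<bar>x\<bar> \<le> M" "\<bar>z\<bar> \<le> M"
  shows "\<bar>x^Suc n - z^Suc n\<bar> \<le> real (Suc n) * \<bar>x - z\<bar> * M^n"
proof (induction n)
  case (Suc n)
  have M: "M \<ge> 0" using assms(1) by linarith
  have "x^Suc (Suc n) - z^Suc (Suc n) = x * (x^Suc n - z^Suc n) + (x - z) * z^Suc n"
    by (simp add: algebra_simps)
  hence "\<bar>x^Suc (Suc n) - z^Suc (Suc n)\<bar> \<le> \<bar>x\<bar> * \<bar>x^Suc n - z^Suc n\<bar> + \<bar>x - z\<bar> * \<bar>z\<bar>^Suc n"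
    by (metis abs_mult abs_triangle_ineq power_abs)
  also have "... \<le> M * (real (Suc n) * \<bar>x - z\<bar> * M^n) + \<bar>x - z\<bar> * M^Suc n"
    using Suc assms M by (intro add_mono mult_mono power_mono) auto
  also have "... = real (Suc (Suc n)) * \<bar>x - z\<bar> * M^Suc n" by (simp add: algebra_simps)
  finally show ?case .
qed simp

lemma sum_abs_power_diff_le:
  fixes b d x z M :: real
  assumes b: "0 \<le> b" and M: "\<bar>x\<bar> \<le> M" "\<bar>z\<bar> \<le> M" and d: "\<bar>x - z\<bar> \<le> d"
  shows "(\<Sum>N<n. b^N/fact N * \<bar>x^N - z^N\<bar>) \<le> b * d * exp (b * M)"
proof -
  have nonneg: "0 \<le> d" "0 \<le> M" using d M by linarith+
  have "(\<Sum>N<n. b^N/fact N * \<bar>x^N - z^N\<bar>) \<le> (\<Sum>N<Suc n. b^N/fact N * \<bar>x^N - z^N\<bar>)" using b by simp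
  also have "... = (\<Sum>N<n. b^Suc N/fact (Suc N) * \<bar>x^Suc N - z^Suc N\<bar>)"
    by (subst sum.lessThan_Suc_shift) simp
  also have "... \<le> (\<Sum>N<n. b * d * ((b * M)^N/fact N))"
  proof (rule sum_mono)
    fix N
    have "\<bar>x^Suc N - z^Suc N\<bar> \<le> real (Suc N) * \<bar>x - z\<bar> * M^N" by (rule abs_power_diff_le[OF M])
    also have "... \<le> real (Suc N) * d * M^N"
      using d nonneg by (intro mult_right_mono mult_left_mono) auto
    finally have "b^Suc N/fact (Suc N) * \<bar>x^Suc N - z^Suc N\<bar> \<le>
      b^Suc N/fact (Suc N) * (real (Suc N) * d * M^N)"
      using b by (intro mult_left_mono) auto
    also have "... = b * d * ((b * M)^N/fact N)" by (simp add: power_mult_distrib del: of_nat_Suc)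
    finally show "b^Suc N/fact (Suc N) * \<bar>x^Suc N - z^Suc N\<bar> \<le> b * d * ((b * M)^N/fact N)" .
  qed
  also have "... \<le> b * d * exp (b * M)"
    unfolding sum_distrib_left[symmetric] using b nonneg exp_partial_sum_le[of "b * M" n]
    by (intro mult_left_mono) auto
  finally show ?thesis .
qed

lemma sum_abs_power_le:
  fixes b x :: real
  assumes "0 \<le> b"
  shows "(\<Sum>N<n. b^N/fact N * \<bar>x^N\<bar>) \<le> exp (b * \<bar>x\<bar>)"
  using exp_partial_sum_le[of "b * \<bar>x\<bar>" n] assms by (simp add: power_mult_distrib power_abs)

lemma A_real_near_1:
  assumes C: "1 < C" "C - 1 < 1/6"
  shows "1/2 \<le> A_real (C, t)" "\<bar>ln (A_real (C, t))\<bar> \<le> 6 * (C - 1)"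
proof -
  let ?A = "A_real (C, t)"
  define c where "c = C - 1"
  have c: "0 < c" "c < 1/6" using C by (auto simp: c_def)
  have "3 * \<bar>Q3_ratio t\<bar> * c \<le> 3 * 1 * c"
    using c abs_Q3_ratio_le_1[of t] by (intro mult_right_mono) auto
  hence A: "\<bar>?A - 1\<bar> \<le> 3 * c" using c by (simp add: A_real_def abs_mult flip: c_def)
  thus half: "1/2 \<le> ?A" using c by linarith
  have "-ln ?A = ln (1/?A)" using half by (simp add: ln_div)
  also have "... \<le> 1/?A - 1" using half by (intro ln_le_minus_one) auto
  also have "... = (1 - ?A)/?A" using half by (simp add: field_simps)
  also have "... \<le> 3 * c/(1/2)" using A half c by (intro frac_le) auto
  finally have lower: "-ln ?A \<le> 6 * c" by simp
  have "ln ?A \<le> ?A - 1" using half by (intro ln_le_minus_one) auto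
  thus "\<bar>ln ?A\<bar> \<le> 6 * (C - 1)" unfolding c_def[symmetric] using lower A c by linarith
qed

lemma ln_A_ratio:
  "1 < C \<Longrightarrow> 0 < A_real (C, t) \<Longrightarrow> ln (A_ratio (C, t)) = ln (A_real (C, t)) - ln C - ln (C - 1)"
  unfolding A_ratio_def by (simp add: ln_div ln_mult)

lemma A_ratio_pos: "1 < fst x \<Longrightarrow> 0 < A_real x \<Longrightarrow> 0 < A_ratio x"
  by (simp add: A_ratio_def)

lemma A_ratio_le:
  assumes C: "1 < C"
  shows "A_ratio (C, t) \<le> 1/(C - 1)"
proof -
  have "C - A_real (C, t) = (C - 1) * ((1 + t)\<^sup>2/Q3_real t)"
    unfolding one_plus_Q3_ratio[symmetric] by (simp add: A_real_def algebra_simps)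
  moreover have "0 \<le> (C - 1) * ((1 + t)\<^sup>2/Q3_real t)" using C Q3_real_pos[of t] by simp
  ultimately have "A_real (C, t) \<le> C" by linarith
  hence "A_real (C, t)/(C * (C - 1)) \<le> C/(C * (C - 1))" using C by (intro divide_right_mono) auto
  thus ?thesis using C by (simp add: A_ratio_def)
qed

definition log_moment_integrand :: "nat \<Rightarrow> real \<times> real \<Rightarrow> real" where
  "log_moment_integrand N x = (if 0 < A_real x then ln (A_ratio x)^N else 0) - ln (1/(fst x - 1))^N"

definition log_moment_bound :: "real \<times> real \<Rightarrow> real" where
  "log_moment_bound x = (if 0 < A_real x then A_ratio x powr (-1/8) else 0)
    + 5 * (1/(fst x - 1)) powr (-1/8)"

lemma log_moment_bound_nonneg: "0 \<le> log_moment_bound x"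
  by (simp add: log_moment_bound_def)

lemma borel_measurable_log_moment_integrand [measurable]:
  "log_moment_integrand N \<in> borel_measurable kernel_measure"
  unfolding log_moment_integrand_def[abs_def] by measurable

lemma powr_eighth_le:
  fixes y :: real
  assumes y: "0 < y" "y \<le> 6"
  shows "y powr (1/8) \<le> 2 * y powr (-1/8)"
proof -
  have "y powr (1/4) \<le> 16 powr (1/4)" using y by (intro powr_mono2) auto
  also have "(16::real) powr (1/4) = 2" using powr_powr[of "2::real" 4 "1/4"] by simp
  finally have "y powr (1/4) * y powr (-1/8) \<le> 2 * y powr (-1/8)" by (intro mult_right_mono) auto
  thus ?thesis by (simp flip: powr_add)
qed

lemma exp_abs_ln_inverse_le:
  fixes C :: real
  assumes C: "1 < C" "1/6 \<le> C - 1"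
  shows "exp (1/8 * \<bar>ln (1/(C - 1))\<bar>) \<le> 3 * (1/(C - 1)) powr (-1/8)"
proof -
  have y: "0 < 1/(C - 1)" "1/(C - 1) \<le> 6" using C by (auto simp: field_simps)
  show ?thesis using exp_abs_ln_le[OF y(1), of "1/8"] powr_eighth_le[OF y] by simp
qed

lemma exp_abs_ln_A_ratio_le:
  assumes C: "1 < C" "1/6 \<le> C - 1" and A: "0 < A_real (C, t)"
  shows "exp (1/8 * \<bar>ln (A_ratio (C, t))\<bar>) \<le>
    A_ratio (C, t) powr (-1/8) + 2 * (1/(C - 1)) powr (-1/8)"
proof -
  have pos: "0 < A_ratio (C, t)" using C A by (intro A_ratio_pos) auto
  have "0 < 1/(C - 1)" "1/(C - 1) \<le> 6" using C by (auto simp: field_simps)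
  hence "(1/(C - 1)) powr (1/8) \<le> 2 * (1/(C - 1)) powr (-1/8)" by (rule powr_eighth_le)
  moreover have "A_ratio (C, t) powr (1/8) \<le> (1/(C - 1)) powr (1/8)"
    using A_ratio_le[OF C(1), of t] pos by (intro powr_mono2) auto
  ultimately show ?thesis using exp_abs_ln_le[OF pos, of "1/8"] by simp
qed

lemma log_moment_series_le_away:
  assumes C: "1 < C" "1/6 \<le> C - 1"
  shows "(\<Sum>N<n. (1/8)^N/fact N * \<bar>log_moment_integrand N (C, t)\<bar>) \<le> log_moment_bound (C, t)"
proof -
  define P :: real where "P = (if 0 < A_real (C, t) then 1 else 0)"
  define u v where "u = ln (A_ratio (C, t))" and "v = ln (1/(C - 1))"
  have "(\<Sum>N<n. (1/8)^N/fact N * \<bar>log_moment_integrand N (C, t)\<bar>) \<le>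
    (\<Sum>N<n. P * ((1/8)^N/fact N * \<bar>u^N\<bar>) + (1/8)^N/fact N * \<bar>v^N\<bar>)"
  proof (rule sum_mono)
    fix N
    have "\<bar>log_moment_integrand N (C, t)\<bar> \<le> P * \<bar>u^N\<bar> + \<bar>v^N\<bar>"
      using abs_triangle_ineq4[of "u^N" "v^N"]
      by (simp add: log_moment_integrand_def P_def u_def v_def)
    hence "(1/8)^N/fact N * \<bar>log_moment_integrand N (C, t)\<bar> \<le> (1/8)^N/fact N * (P * \<bar>u^N\<bar> + \<bar>v^N\<bar>)"
      by (intro mult_left_mono) auto
    thus "(1/8)^N/fact N * \<bar>log_moment_integrand N (C, t)\<bar> \<le>
      P * ((1/8)^N/fact N * \<bar>u^N\<bar>) + (1/8)^N/fact N * \<bar>v^N\<bar>"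
      by (simp only: distrib_left mult.left_commute)
  qed
  also have "... = P * (\<Sum>N<n. (1/8)^N/fact N * \<bar>u^N\<bar>) + (\<Sum>N<n. (1/8)^N/fact N * \<bar>v^N\<bar>)"
    by (simp only: sum.distrib sum_distrib_left)
  also have "... \<le> P * exp (1/8 * \<bar>u\<bar>) + exp (1/8 * \<bar>v\<bar>)"
    by (intro add_mono mult_left_mono sum_abs_power_le) (auto simp: P_def)
  also have "... \<le> log_moment_bound (C, t)"
  proof (cases "0 < A_real (C, t)")
    case True
    thus ?thesis using exp_abs_ln_inverse_le[OF C] exp_abs_ln_A_ratio_le[OF C True]
      by (simp add: log_moment_bound_def P_def u_def v_def)
  next
    case False
    have "exp (1/8 * \<bar>v\<bar>) \<le> 3 * (1/(C - 1)) powr (-1/8)"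
      unfolding v_def by (rule exp_abs_ln_inverse_le[OF C])
    also have "... \<le> 5 * (1/(C - 1)) powr (-1/8)" by (intro mult_right_mono) auto
    finally show ?thesis using False by (simp add: log_moment_bound_def P_def)
  qed
  finally show ?thesis .
qed

lemma log_moment_series_le_near:
  assumes C: "1 < C" "C - 1 < 1/6"
  shows "(\<Sum>N<n. (1/8)^N/fact N * \<bar>log_moment_integrand N (C, t)\<bar>) \<le> log_moment_bound (C, t)"
proof -
  define c u v where "c = C - 1" and "u = ln (A_ratio (C, t))" and "v = ln (1/(C - 1))"
  note A = A_real_near_1[OF C, of t, folded c_def]
  have c: "0 < c" "c < 1/6" using C by (auto simp: c_def)
  have v: "v = -ln c" by (simp add: v_def c_def ln_div)
  have "u - v = ln (A_real (C, t)) - ln C"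
    using ln_A_ratio[OF C(1), of t] A(1) by (simp add: u_def v c_def)
  moreover have "0 \<le> ln C" "ln C \<le> c" using C ln_le_minus_one[of C] by (auto simp: c_def)
  ultimately have diff: "\<bar>u - v\<bar> \<le> 7 * c" using A(2) by linarith
  have "0 \<le> v" unfolding v using c by simp
  hence "\<bar>u\<bar> \<le> v + 2" "\<bar>v\<bar> \<le> v + 2" using diff c by linarith+
  hence "(\<Sum>N<n. (1/8)^N/fact N * \<bar>u^N - v^N\<bar>) \<le> 1/8 * (7 * c) * exp (1/8 * (v + 2))"
    by (intro sum_abs_power_diff_le diff) auto
  also have "exp (1/8 * (v + 2)) = exp (1/4) * c powr (-1/8)"
    using c by (simp add: v powr_def exp_add[symmetric] field_simps)
  also have "1/8 * (7 * c) * (exp (1/4) * c powr (-1/8)) = 7/8 * exp (1/4) * c powr (7/8)"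
    using c by (simp add: powr_mult_base)
  also have "... \<le> 5 * c powr (1/8)"
  proof (intro mult_mono)
    have "exp (1/4::real) \<le> 1 + 1/4 + (1/4)\<^sup>2" by (rule exp_bound) auto
    thus "7/8 * exp (1/4) \<le> (5::real)" by (simp add: power2_eq_square)
  qed (use c in \<open>auto intro: powr_mono'\<close>)
  also have "c powr (1/8) = (1/(C - 1)) powr (-1/8)"
    using c by (simp add: c_def powr_divide powr_minus_divide)
  finally show ?thesis using A(1)
    by (simp add: log_moment_integrand_def log_moment_bound_def u_def v_def add_increasing)
qed

lemma integrable_log_moment_bound: "integrable kernel_measure log_moment_bound"
  unfolding log_moment_bound_def[abs_def]
  using has_bochner_integral_A_ratio_powr[of "-1/8"] has_bochner_integral_inverse_powr[of "-1/8"]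
  by (intro Bochner_Integration.integrable_add integrable_mult_right)
    (simp_all add: has_bochner_integral_iff)

lemma integral_sums_dominated:
  fixes g :: "nat \<Rightarrow> 'a \<Rightarrow> real"
  assumes [measurable]: "\<And>N. g N \<in> borel_measurable M"
    and H: "integrable M H"
    and dominated: "AE x in M. \<forall>n. (\<Sum>N<n. \<bar>g N x\<bar>) \<le> H x"
  shows "integrable M (g N)" "summable (\<lambda>N. norm (\<integral>x. g N x \<partial>M))"
    "(\<lambda>N. \<integral>x. g N x \<partial>M) sums (\<integral>x. suminf (\<lambda>N. g N x) \<partial>M)" (is ?sums)
proof -
  show int: "integrable M (g N)" for N using H
  proof (rule Bochner_Integration.integrable_bound)
    show "AE x in M. norm (g N x) \<le> norm (H x)" using dominated
    proof eventually_elim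
      case (elim x)
      have "\<bar>g N x\<bar> \<le> (\<Sum>N<Suc N. \<bar>g N x\<bar>)" by (intro member_le_sum) auto
      also have "... \<le> H x" using elim by blast
      finally show ?case by simp
    qed
  qed measurable
  have pointwise: "AE x in M. summable (\<lambda>N. norm (g N x))" using dominated
    by eventually_elim (rule summableI_nonneg_bounded, auto)
  have norms: "summable (\<lambda>N. \<integral>x. norm (g N x) \<partial>M)"
  proof (rule summableI_nonneg_bounded)
    fix n
    have "(\<Sum>N<n. \<integral>x. norm (g N x) \<partial>M) = (\<integral>x. (\<Sum>N<n. norm (g N x)) \<partial>M)"
      by (rule Bochner_Integration.integral_sum[symmetric]) (use int in \<open>rule integrable_norm\<close>)
    also have "... \<le> (\<integral>x. H x \<partial>M)"
      using dominated
      by (intro integral_mono_AE[OF Bochner_Integration.integrable_sum[OF integrable_norm[OF int]]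
        H]) auto
    finally show "(\<Sum>N<n. \<integral>x. norm (g N x) \<partial>M) \<le> (\<integral>x. H x \<partial>M)" .
  qed (rule Bochner_Integration.integral_nonneg, simp)
  show ?sums by (rule sums_integral[OF int pointwise norms])
  show "summable (\<lambda>N. norm (\<integral>x. g N x \<partial>M))"
  proof (rule summable_comparison_test'[OF norms])
    show "norm (norm (\<integral>x. g N x \<partial>M)) \<le> (\<integral>x. norm (g N x) \<partial>M)" for N
      using integral_norm_bound[of M "g N"] by simp
  qed
qed

lemma integral_exponential_series:
  fixes f :: "nat \<Rightarrow> 'a \<Rightarrow> real"
  assumes [measurable]: "\<And>N. f N \<in> borel_measurable M"
    and H: "integrable M H"
    and dominated: "AE x in M. \<forall>n. (\<Sum>N<n. b^N/fact N * \<bar>f N x\<bar>) \<le> H x"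
    and a: "\<bar>a\<bar> \<le> b"
  shows "summable (\<lambda>N. norm (a^N/fact N * (\<integral>x. f N x \<partial>M)))" (is ?summable)
    and "(\<lambda>N. a^N/fact N * (\<integral>x. f N x \<partial>M)) sums (\<integral>x. suminf (\<lambda>N. a^N/fact N * f N x) \<partial>M)" (is ?sums)
proof -
  have "AE x in M. \<forall>n. (\<Sum>N<n. \<bar>a^N/fact N * f N x\<bar>) \<le> H x" using dominated
  proof eventually_elim
    case (elim x)
    have "(\<Sum>N<n. \<bar>a^N/fact N * f N x\<bar>) \<le> (\<Sum>N<n. b^N/fact N * \<bar>f N x\<bar>)" for n
      using a
      by (intro sum_mono) (auto simp: abs_mult power_abs intro!: mult_right_mono divide_right_mono
        power_mono)
    thus ?case using elim order.trans by blast
  qed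
  note series = integral_sums_dominated[OF _ H this]
  show ?summable using series(2) by simp
  show ?sums using series(3) by simp
qed

definition log_moment :: "nat \<Rightarrow> real" where
  "log_moment N = (\<integral>x. log_moment_integrand N x \<partial>kernel_measure)"

definition torus_log_moment :: "nat \<Rightarrow> real" where
  "torus_log_moment k = (\<integral>x. ln (torus_square x)^k \<partial>torus)"

lemma exp_series_powr: "0 < r \<Longrightarrow> (\<lambda>N. a^N/fact N * ln r^N) sums (r powr a)" for r a :: real
  using exp_converges[of "a * ln r"]
  by (simp add: powr_def power_mult_distrib divide_inverse mult_ac)

lemma log_moment_dominated:
  "AE x in kernel_measure. \<forall>n. (\<Sum>N<n. (1/8)^N/fact N * \<bar>log_moment_integrand N x\<bar>) \<le>
    log_moment_bound x"
  using AE_kernel_measure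
proof eventually_elim
  case (elim x)
  thus ?case
    using log_moment_series_le_near[of "fst x" "snd x"] log_moment_series_le_away[of "fst x"
      "snd x"]
    by (cases "fst x - 1 < 1/6") simp_all
qed

lemma log_moment_series:
  assumes a: "-1/8 < a" "a < 0"
  shows "(\<lambda>N. a^N/fact N * log_moment N) sums (pi/sqrt 3 * mellin_factor a * (torus_zeta a - 1))"
proof -
  have "(\<lambda>N. a^N/fact N * log_moment N) sums
    (\<integral>x. suminf (\<lambda>N. a^N/fact N * log_moment_integrand N x) \<partial>kernel_measure)"
    unfolding log_moment_def
    by (rule integral_exponential_series(2)[OF _ integrable_log_moment_bound log_moment_dominated])
      (use a in auto)
  also have "(\<integral>x. suminf (\<lambda>N. a^N/fact N * log_moment_integrand N x) \<partial>kernel_measure) =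
    (\<integral>x. (if 0 < A_real x then A_ratio x powr a else 0) - (1/(fst x - 1)) powr a \<partial>kernel_measure)"
  proof (rule integral_cong_AE)
    show "AE x in kernel_measure. suminf (\<lambda>N. a^N/fact N * log_moment_integrand N x) =
      (if 0 < A_real x then A_ratio x powr a else 0) - (1/(fst x - 1)) powr a"
      using AE_kernel_measure
    proof eventually_elim
      case (elim x)
      have "(\<lambda>N. a^N/fact N * (if 0 < A_real x then ln (A_ratio x)^N else 0)) sums (if 0 <
        A_real x then A_ratio x powr a else 0)"
        using exp_series_powr[OF A_ratio_pos[OF elim], of a] by simp
      moreover have "(\<lambda>N. a^N/fact N * ln (1/(fst x - 1))^N) sums ((1/(fst x - 1)) powr a)"
        using elim by (intro exp_series_powr) auto
      ultimately show ?case unfolding log_moment_integrand_def right_diff_distrib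
        by (rule sums_unique[OF sums_diff, symmetric])
    qed
  qed measurable
  also have "... = pi/sqrt 3 * mellin_factor a * torus_zeta a - pi/sqrt 3 * mellin_factor a"
    using has_bochner_integral_diff[OF has_bochner_integral_A_ratio_powr
      has_bochner_integral_inverse_powr, of a a] a
    by (simp add: has_bochner_integral_iff)
  finally show ?thesis by (simp only: right_diff_distrib mult_1_right)
qed

lemma ln_torus_square_dominated:
  "AE x in torus. \<forall>n. (\<Sum>k<n. (1/8)^k/fact k * \<bar>ln (torus_square x)^k\<bar>) \<le>
    torus_square x powr (-1/8) + torus_square x powr (1/8)"
  using AE_torus_square_pos
proof eventually_elim
  case (elim x)
  show ?case using sum_abs_power_le[of "1/8" "ln (torus_square x)"] exp_abs_ln_le[OF elim, of "1/8"]
    by (auto intro: order.trans)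
qed

lemma integrable_ln_torus_square_power: "integrable torus (\<lambda>x. ln (torus_square x)^k)"
proof -
  have "AE x in torus. \<forall>n. (\<Sum>k<n. \<bar>(1/8)^k/fact k * ln (torus_square x)^k\<bar>) \<le>
    torus_square x powr (-1/8) + torus_square x powr (1/8)"
    using ln_torus_square_dominated by (simp add: abs_mult)
  hence "integrable torus (\<lambda>x. (1/8)^k/fact k * ln (torus_square x)^k)"
    by (intro integral_sums_dominated(1)[where g="\<lambda>k x. (1/8)^k/fact k * ln (torus_square x)^k"])
      (auto intro!: Bochner_Integration.integrable_add integrable_torus_square_powr)
  from integrable_mult_right[OF this, of "fact k/(1/8)^k"] show ?thesis by simp
qed

lemma torus_log_moment_series:
  assumes a: "\<bar>a\<bar> \<le> 1/8"
  shows "(\<lambda>k. a^k/fact k * torus_log_moment k) sums torus_zeta a"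
proof -
  have "(\<lambda>k. a^k/fact k * torus_log_moment k) sums
    (\<integral>x. suminf (\<lambda>k. a^k/fact k * ln (torus_square x)^k) \<partial>torus)"
    unfolding torus_log_moment_def
    by (rule integral_exponential_series(2)[OF _ _ ln_torus_square_dominated a])
      (auto intro!: Bochner_Integration.integrable_add integrable_torus_square_powr)
  also have "(\<integral>x. suminf (\<lambda>k. a^k/fact k * ln (torus_square x)^k) \<partial>torus) = torus_zeta a"
    unfolding torus_zeta_def
  proof (rule integral_cong_AE)
    show "AE x in torus. suminf (\<lambda>k. a^k/fact k * ln (torus_square x)^k) = torus_square x powr a"
      using AE_torus_square_pos by eventually_elim (rule sums_unique[OF exp_series_powr, symmetric])
  qed measurable
  finally show ?thesis .
qed

definition sin_log_moment :: "nat \<Rightarrow> real" where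
  "sin_log_moment k = (\<Sum>j\<le>k. sin_coeff j * pi^j * (log_moment (k - j)/fact (k - j)))"

lemma sin_log_moment_series:
  assumes a: "\<bar>a\<bar> < 1/8"
  shows "(\<lambda>k. sin_log_moment k * a^k) sums (sin (pi * a) * suminf (\<lambda>N. a^N/fact N * log_moment N))"
proof -
  have "summable (\<lambda>N. norm (a^N/fact N * log_moment N))" unfolding log_moment_def
    by (rule integral_exponential_series(1)[OF _ integrable_log_moment_bound log_moment_dominated])
      (use a in auto)
  moreover have "summable (\<lambda>n. norm (sin_coeff n * (pi * a)^n))"
    using summable_norm_sin[of "pi * a"] by simp
  ultimately have
    "(\<lambda>k. \<Sum>j\<le>k. sin_coeff j * (pi * a)^j * (a^(k - j)/fact (k - j) * log_moment (k - j))) sums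
    (suminf (\<lambda>n. sin_coeff n * (pi * a)^n) * suminf (\<lambda>N. a^N/fact N * log_moment N))"
    by (intro Cauchy_product_sums)
  moreover have "suminf (\<lambda>n. sin_coeff n * (pi * a)^n) = sin (pi * a)"
    using sums_unique[OF sin_converges[of "pi * a"]] by simp
  moreover have "(\<Sum>j\<le>k. sin_coeff j * (pi * a)^j * (a^(k - j)/fact (k - j) * log_moment (k - j))) =
    sin_log_moment k * a^k" for k
    unfolding sin_log_moment_def sum_distrib_right
  proof (rule sum.cong)
    fix j assume "j \<in> {..k}"
    hence "a^k = a^j * a^(k - j)" by (simp add: power_add[symmetric])
    thus "sin_coeff j * (pi * a)^j * (a^(k - j)/fact (k - j) * log_moment (k - j)) =
      sin_coeff j * pi^j * (log_moment (k - j)/fact (k - j)) * a^k"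
      by (simp add: power_mult_distrib)
  qed simp
  ultimately show ?thesis by simp
qed

lemma powser_eq_0_on_left:
  fixes d :: "nat \<Rightarrow> real"
  assumes r: "0 < r"
    and sums: "\<And>a. \<bar>a\<bar> < r \<Longrightarrow> (\<lambda>k. d k * a^k) sums g a"
    and zero: "\<And>a. -r < a \<Longrightarrow> a < 0 \<Longrightarrow> g a = 0"
  shows "d k = 0"
proof (rule ccontr)
  assume dk: "d k \<noteq> 0"
  have "(g \<longlongrightarrow> d 0) (at 0)" by (rule powser_limit_0[OF r]) (simp add: sums)
  hence "(g \<longlongrightarrow> d 0) (at_left 0)" by (rule tendsto_within_subset) simp
  moreover have "\<forall>\<^sub>F a in at_left 0. g a = 0"
    using eventually_at_left_real[of "-r" 0] r by (auto elim!: eventually_mono intro: zero)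
  hence "(g \<longlongrightarrow> 0) (at_left 0)" by (rule tendsto_eventually)
  ultimately have d0: "d 0 = 0" by (rule tendsto_unique[OF trivial_limit_at_left_real])
  moreover have "(\<lambda>k. d k * 0^k) sums d 0" by (rule powser_sums_zero)
  ultimately have "g 0 = 0" using sums_unique2[OF sums[of 0]] r by simp
  obtain s where s: "0 < s" "\<And>z. z \<in> cball 0 s - {0} \<Longrightarrow> g z \<noteq> 0"
  proof (rule powser_0_nonzero[of r 0 d g k])
    show "\<And>x. norm (x - 0) < r \<Longrightarrow> (\<lambda>n. d n * (x - 0)^n) sums g x" using sums by simp
    show "0 < k" using dk d0 by (cases k) auto
  qed (use dk r \<open>g 0 = 0\<close> in auto)
  have "g (-min s (r/2)) \<noteq> 0" using s r by (intro s(2)) auto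
  moreover have "g (-min s (r/2)) = 0" using s(1) r by (intro zero) auto
  ultimately show False by simp
qed

theorem moment_identity:
  assumes k: "k > 0"
  shows "sin_log_moment k = -(pi\<^sup>2/sqrt 3) * (torus_log_moment k/fact k)"
proof -
  define d where
    "d k = sin_log_moment k + pi\<^sup>2/sqrt 3 * (torus_log_moment k/fact k - (if k = 0 then 1 else 0))"
    for k
  define g where
    "g a = sin (pi * a) * suminf (\<lambda>N. a^N/fact N * log_moment N) + pi\<^sup>2/sqrt 3 * (torus_zeta a - 1)"
    for a
  have "d k = 0"
  proof (rule powser_eq_0_on_left[where r="1/8" and g=g])
    fix a :: real assume a: "\<bar>a\<bar> < 1/8"
    have "(\<lambda>k. pi\<^sup>2/sqrt 3 * (a^k/fact k * torus_log_moment k - (if k = 0 then 1 else 0))) sums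
      (pi\<^sup>2/sqrt 3 * (torus_zeta a - 1))"
      by (intro sums_mult sums_diff torus_log_moment_series sums_single[of 0 "\<lambda>_. 1"])
        (use a in auto)
    from sums_add[OF sin_log_moment_series[OF a] this]
    show "(\<lambda>k. d k * a^k) sums g a" unfolding g_def[symmetric]
      by (rule sums_cong[THEN iffD1, rotated]) (simp add: d_def algebra_simps)
  next
    fix a :: real assume a: "-(1/8) < a" "a < 0"
    have "suminf (\<lambda>N. a^N/fact N * log_moment N) = pi/sqrt 3 * mellin_factor a * (torus_zeta a - 1)"
      using sums_unique[OF log_moment_series] a by simp
    moreover have "sin (pi * a) * (pi/sqrt 3 * mellin_factor a * x) = -(pi\<^sup>2/sqrt 3 * x)" for x
      using sin_pi_neg[of a] a by (simp add: mellin_factor_def power2_eq_square)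
    ultimately show "g a = 0" unfolding g_def by simp
  qed simp
  thus ?thesis using k by (simp add: d_def)
qed

definition B_real :: "real \<Rightarrow> real" where
  "B_real C = 1/(9 * C * (C - 1))"

definition log_product :: "nat \<Rightarrow> nat \<Rightarrow> real \<times> real \<Rightarrow> real" where
  "log_product n m x =
    ((if 0 < A_real x then ln (A_real x)^n else 0) - ln (fst x)^n) * ln (B_real (fst x))^m"

lemma borel_measurable_B_real [measurable]: "B_real \<in> borel_measurable borel"
  unfolding B_real_def[abs_def] by measurable

lemma borel_measurable_log_product [measurable]:
  "log_product n m \<in> borel_measurable (borel \<Otimes>\<^sub>M borel)"
  unfolding log_product_def[abs_def] by measurable

lemma ln_B_real:
  assumes C: "1 < C"
  shows "ln (B_real C) = -(2 * ln 3) - ln C - ln (C - 1)"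
proof -
  have "ln (9::real) = 2 * ln 3" using ln_realpow[of 3 2] by simp
  thus ?thesis unfolding B_real_def using C by (simp add: ln_div ln_mult)
qed

definition log_moment_coeff :: "nat \<Rightarrow> nat \<Rightarrow> nat \<Rightarrow> real" where
  "log_moment_coeff N n m = real (N choose n) * real ((N - n) choose m) * (2 * ln 3)^(N - n - m)"

lemma log_moment_integrand_expansion:
  assumes C: "1 < fst x"
  shows "log_moment_integrand N x = (\<Sum>n\<le>N. \<Sum>m\<le>N - n. log_moment_coeff N n m * log_product n m x)"
proof -
  define w where "w = ln (B_real (fst x)) + 2 * ln 3"
  have w: "w = -ln (fst x) - ln (fst x - 1)" unfolding w_def ln_B_real[OF C] by simp
  have "ln (1/(fst x - 1)) = ln (fst x) + w" unfolding w using C by (simp add: ln_div)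
  moreover have "0 < A_real x \<Longrightarrow> ln (A_ratio x) = ln (A_real x) + w"
    using ln_A_ratio[OF C, of "snd x"] w by simp
  ultimately have "log_moment_integrand N x = (if 0 < A_real x then (ln (A_real x) + w)^N else 0)
    - (ln (fst x) + w)^N"
    by (simp add: log_moment_integrand_def)
  also have "... =
    (\<Sum>n\<le>N. real (N choose n) * ((if 0 < A_real x then ln (A_real x)^n else 0) - ln (fst x)^n) *
    w^(N - n))"
    unfolding binomial_ring
    by (cases "0 < A_real x") (simp_all add: sum_subtractf sum_negf algebra_simps)
  also have "... = (\<Sum>n\<le>N. \<Sum>m\<le>N - n. log_moment_coeff N n m * log_product n m x)"
  proof (rule sum.cong[OF refl])
    fix n
    let ?d = "(if 0 < A_real x then ln (A_real x)^n else 0) - ln (fst x)^n"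
    have "w^(N - n) =
      (\<Sum>m\<le>N - n. real ((N - n) choose m) * ln (B_real (fst x))^m * (2 * ln 3)^(N - n - m))"
      unfolding w_def by (rule binomial_ring)
    thus "real (N choose n) * ?d * w^(N - n) =
      (\<Sum>m\<le>N - n. log_moment_coeff N n m * log_product n m x)"
      by (simp only: sum_distrib_left log_moment_coeff_def log_product_def mult_ac)
  qed
  finally show ?thesis .
qed

lemma power_le_exp:
  fixes x q :: real
  assumes x: "0 \<le> x" and q: "0 < q"
  shows "x^p \<le> fact p * q^p * exp (x/q)"
proof -
  have "(x/q)^p/fact p \<le> (\<Sum>N<Suc p. (x/q)^N/fact N)" using x q by (intro member_le_sum) auto
  also have "... \<le> exp (x/q)" using x q by (intro exp_partial_sum_le) auto
  finally have "fact p * q^p * ((x/q)^p/fact p) \<le> fact p * q^p * exp (x/q)"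
    using q by (intro mult_left_mono) auto
  thus ?thesis using q by (simp add: power_divide)
qed

lemma abs_power_le_self:
  fixes x c :: real
  assumes "\<bar>x\<bar> \<le> c" "c \<le> 1" "0 < n"
  shows "\<bar>x^n\<bar> \<le> c"
proof -
  have "\<bar>x\<bar>^n \<le> c^n" using assms by (intro power_mono) auto
  also have "... \<le> c^1" using assms by (intro power_decreasing) auto
  finally show ?thesis by (simp add: power_abs)
qed

lemma log_product_le_near:
  assumes C: "1 < C" "C - 1 < 1/6"
  shows "\<bar>log_product n m (C, t)\<bar> \<le> 7 * (fact m * 2^m * exp (5/2)) * (1/(C - 1)) powr (-1/2)"
proof -
  define c where "c = C - 1"
  note A = A_real_near_1[OF C, of t, folded c_def]
  have c: "0 < c" "c < 1/6" using C by (auto simp: c_def)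
  have ln_C: "0 \<le> ln C" "ln C \<le> c" using C ln_le_minus_one[of C] by (auto simp: c_def)
  have "\<bar>ln (B_real C)\<bar> \<le> 5 - ln c"
  proof -
    have "0 \<le> ln (3::real)" "ln (3::real) \<le> 2" "ln c < 0" using ln_le_minus_one[of 3] c by simp_all
    thus ?thesis using ln_C c unfolding ln_B_real[OF C(1)] c_def[symmetric] by linarith
  qed
  hence "\<bar>ln (B_real C)\<bar>^m \<le> (5 - ln c)^m" by (intro power_mono) auto
  also have "... \<le> fact m * 2^m * exp ((5 - ln c)/2)"
    using c by (intro power_le_exp) (auto simp: ln_le_zero_iff intro: order.trans[of _ 0])
  also have "exp ((5 - ln c)/2) = exp (5/2) * c powr (-1/2)"
    using c by (simp add: powr_def exp_add[symmetric] diff_divide_distrib)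
  finally have B: "\<bar>ln (B_real C)\<bar>^m \<le> fact m * 2^m * exp (5/2) * c powr (-1/2)"
    by (simp add: mult_ac)
  have A_C: "\<bar>ln (A_real (C, t))^n - ln C^n\<bar> \<le> 7 * c"
  proof (cases "n = 0")
    case False
    hence "\<bar>ln (A_real (C, t))^n\<bar> \<le> 6 * c" "\<bar>ln C^n\<bar> \<le> c"
      using A(2) ln_C c by (intro abs_power_le_self; simp)+
    thus ?thesis using abs_triangle_ineq4[of "ln (A_real (C, t))^n" "ln C^n"] by linarith
  qed (use c in simp)
  have "\<bar>log_product n m (C, t)\<bar> = \<bar>ln (A_real (C, t))^n - ln C^n\<bar> * \<bar>ln (B_real C)\<bar>^m"
    using A(1) by (simp add: log_product_def abs_mult power_abs)
  also have "... \<le> 7 * c * (fact m * 2^m * exp (5/2) * c powr (-1/2))"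
    using A_C B c by (intro mult_mono) auto
  also have "... = 7 * (fact m * 2^m * exp (5/2)) * (c * c powr (-1/2))" by (simp only: mult_ac)
  also have "c * c powr (-1/2) = c powr (1/2)" using c by (simp add: powr_mult_base)
  also have "... = (1/(C - 1)) powr (-1/2)"
    using c by (simp add: c_def powr_divide powr_minus_divide)
  finally show ?thesis .
qed

definition log_scale :: "real \<Rightarrow> real" where
  "log_scale C = 4 + \<bar>ln C\<bar> + \<bar>ln (C - 1)\<bar>"

lemma abs_ln_le_log_scale:
  assumes "1 < C"
  shows "\<bar>ln C\<bar> \<le> log_scale C" "\<bar>ln (B_real C)\<bar> \<le> log_scale C" "0 < A_real (C, t) \<Longrightarrow>
    \<bar>ln (A_real (C, t))\<bar> \<le> \<bar>ln (A_ratio (C, t))\<bar> + log_scale C"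
proof -
  have "0 \<le> ln (3::real)" "ln (3::real) \<le> 2" using ln_le_minus_one[of 3] by simp_all
  thus "\<bar>ln C\<bar> \<le> log_scale C" "\<bar>ln (B_real C)\<bar> \<le> log_scale C"
    unfolding ln_B_real[OF assms] log_scale_def by linarith+
  assume "0 < A_real (C, t)"
  hence "ln (A_real (C, t)) = ln (A_ratio (C, t)) + (ln C + ln (C - 1))"
    using ln_A_ratio[OF assms] by simp
  moreover have "\<bar>ln C + ln (C - 1)\<bar> \<le> log_scale C" unfolding log_scale_def by linarith
  ultimately show "\<bar>ln (A_real (C, t))\<bar> \<le> \<bar>ln (A_ratio (C, t))\<bar> + log_scale C"
    using abs_triangle_ineq[of "ln (A_ratio (C, t))" "ln C + ln (C - 1)"] by simp
qed

lemma exp_log_scale_le: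
  assumes C: "1 < C" "1/6 \<le> C - 1"
  shows "exp (log_scale C/8) \<le> exp (5/2) * (1/(C - 1)) powr (-1/4)"
proof -
  have "ln C \<le> ln (7 * (C - 1))" using C by (intro ln_mono) auto
  also have "... = ln 7 + ln (C - 1)" using C by (intro ln_mult_pos) auto
  finally have "ln C \<le> 6 + ln (C - 1)" using ln_le_minus_one[of 7] by simp
  moreover have "ln (1/6) \<le> ln (C - 1)" using C by (intro ln_mono) auto
  hence "\<bar>ln (C - 1)\<bar> \<le> ln (C - 1) + 10" using ln_le_minus_one[of 6] by (simp add: abs_if ln_div)
  moreover have "0 \<le> ln C" using C by simp
  ultimately have "log_scale C/8 \<le> 5/2 + ln (C - 1)/4" unfolding log_scale_def by simp
  hence "exp (log_scale C/8) \<le> exp (5/2 + ln (C - 1)/4)" by simp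
  also have "... = exp (5/2) * (1/(C - 1)) powr (-1/4)"
    using C by (simp add: exp_add powr_def ln_div)
  finally show ?thesis .
qed

lemma exp_add_half_le: "exp ((u + v)/16) \<le> exp (u/8) + exp (v/8)" for u v :: real
proof -
  have "2 * exp (u/16) * exp (v/16) \<le> (exp (u/16))\<^sup>2 + (exp (v/16))\<^sup>2" by (rule sum_squares_bound)
  moreover have "exp ((u + v)/16) = exp (u/16) * exp (v/16)" "(exp (u/16))\<^sup>2 = exp (u/8)"
    "(exp (v/16))\<^sup>2 = exp (v/8)"
    by (simp_all add: exp_add[symmetric] power2_eq_square add_divide_distrib)
  moreover have "0 \<le> exp (u/16) * exp (v/16)" by simp
  ultimately show ?thesis by linarith
qed

lemma log_product_le_away:
  assumes C: "1 < C" "1/6 \<le> C - 1"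
  shows "\<bar>log_product n m (C, t)\<bar> \<le>
    2 * (fact (n + m) * 16^(n + m)) * (log_moment_bound (C, t) + 2 * (exp (5/2) * (1/(C - 1)) powr
    (-1/4)))"
proof -
  define u where "u = (if 0 < A_real (C, t) then \<bar>ln (A_ratio (C, t))\<bar> else 0)"
  define z where "z = log_scale C"
  have z: "0 \<le> z" by (simp add: z_def log_scale_def)
  have u: "0 \<le> u" by (simp add: u_def)
  have "\<bar>if 0 < A_real (C, t) then ln (A_real (C, t))^n else 0\<bar> \<le> (u + z)^n"
    using abs_ln_le_log_scale(3)[OF C(1), of t] z by (simp add: u_def z_def power_abs power_mono)
  moreover have "\<bar>ln C^n\<bar> \<le> z^n" "\<bar>ln (B_real C)^m\<bar> \<le> z^m"
    unfolding power_abs z_def by (intro power_mono abs_ln_le_log_scale[OF C(1)]; simp)+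
  ultimately have "\<bar>log_product n m (C, t)\<bar> \<le> ((u + z)^n + z^n) * z^m"
    unfolding log_product_def abs_mult fst_conv using u z
    by (intro mult_mono order.trans[OF abs_triangle_ineq4] add_mono) auto
  also have "... \<le> ((u + z)^n + (u + z)^n) * (u + z)^m"
    using u z by (intro mult_mono add_mono power_mono) auto
  also have "... = 2 * (u + z)^(n + m)" by (simp add: power_add)
  also have "(u + z)^(n + m) \<le> fact (n + m) * 16^(n + m) * exp ((u + z)/16)"
    using u z by (intro power_le_exp) auto
  also have "exp ((u + z)/16) \<le> log_moment_bound (C, t) + 2 * exp (z/8)"
  proof (cases "0 < A_real (C, t)")
    case True
    hence "exp (u/8) \<le> log_moment_bound (C, t)"
      using exp_abs_ln_A_ratio_le[OF C True]
      by (simp add: u_def log_moment_bound_def add_increasing2 order.trans)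
    thus ?thesis using exp_add_half_le[of u z] exp_ge_zero[of "z/8"] by linarith
  next
    case False
    hence "exp (u/8) \<le> exp (z/8)" using z by (simp add: u_def)
    thus ?thesis using exp_add_half_le[of u z] log_moment_bound_nonneg[of "(C, t)"] by linarith
  qed
  also have "exp (z/8) \<le> exp (5/2) * (1/(C - 1)) powr (-1/4)"
    unfolding z_def by (rule exp_log_scale_le[OF C])
  finally show ?thesis by (simp add: mult.assoc)
qed

lemma integrable_log_product: "integrable kernel_measure (log_product n m)"
proof (rule Bochner_Integration.integrable_bound)
  define near where "near x = 7 * (fact m * 2^m * exp (5/2)) * (1/(fst x - 1)) powr (-1/2)"
    for x :: "real \<times> real"
  define away where
    "away x = 2 * (fact (n + m) * 16^(n + m)) *
    (log_moment_bound x + 2 * (exp (5/2) * (1/(fst x - 1)) powr (-1/4)))" for x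
  show "integrable kernel_measure (\<lambda>x. near x + away x)"
    unfolding near_def away_def
    using has_bochner_integral_inverse_powr[of "-1/2"] has_bochner_integral_inverse_powr[of "-1/4"]
    by (intro Bochner_Integration.integrable_add integrable_mult_right integrable_log_moment_bound)
      (simp_all add: has_bochner_integral_iff)
  show "AE x in kernel_measure. norm (log_product n m x) \<le> norm (near x + away x)"
    using AE_kernel_measure
  proof eventually_elim
    case (elim x)
    have "0 \<le> near x" "0 \<le> away x" by (simp_all add: near_def away_def log_moment_bound_nonneg)
    moreover have "\<bar>log_product n m x\<bar> \<le> near x \<or> \<bar>log_product n m x\<bar> \<le> away x"
      using log_product_le_near[OF elim, of n m "snd x"] log_product_le_away[OF elim, of n m
        "snd x"]
      by (cases "fst x - 1 < 1/6") (simp_all add: near_def away_def)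
    ultimately show ?case by auto
  qed
qed measurable

definition log_product_moment :: "nat \<Rightarrow> nat \<Rightarrow> real" where
  "log_product_moment n m = (\<integral>x. log_product n m x \<partial>kernel_measure)"

lemma log_moment_expansion:
  "log_moment N = (\<Sum>n\<le>N. \<Sum>m\<le>N - n. log_moment_coeff N n m * log_product_moment n m)"
proof -
  have "log_moment N =
    (\<integral>x. (\<Sum>n\<le>N. \<Sum>m\<le>N - n. log_moment_coeff N n m * log_product n m x) \<partial>kernel_measure)"
    unfolding log_moment_def
  proof (rule integral_cong_AE)
    show "AE x in kernel_measure. log_moment_integrand N x =
      (\<Sum>n\<le>N. \<Sum>m\<le>N - n. log_moment_coeff N n m * log_product n m x)"
      using AE_kernel_measure by eventually_elim (rule log_moment_integrand_expansion)
  qed measurable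
  also have "... = (\<Sum>n\<le>N. \<Sum>m\<le>N - n. log_moment_coeff N n m * log_product_moment n m)"
    unfolding log_product_moment_def
    by (subst Bochner_Integration.integral_sum | simp add: integrable_log_product)+
  finally show ?thesis .
qed

definition log_product_slice :: "nat \<Rightarrow> nat \<Rightarrow> real \<Rightarrow> real" where
  "log_product_slice n m C = (\<integral>t. kernel_density (C, t) * log_product n m (C, t) \<partial>lborel)"

lemma
  shows integrable_log_product_slice: "integrable lborel (log_product_slice n m)"
    and log_product_moment_eq_integral_slice:
      "log_product_moment n m = (\<integral>C. log_product_slice n m C \<partial>lborel)" (is ?fubini)
    and AE_integrable_log_product:
      "AE C in lborel. integrable lborel (\<lambda>t. kernel_density (C, t) * log_product n m (C, t))"
      (is ?AE)
proof -
  have integrable: "integrable (lborel \<Otimes>\<^sub>M lborel) (\<lambda>x. kernel_density x * log_product n m x)"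
    using integrable_log_product[of n m] unfolding kernel_measure_def
    by (subst (asm) integrable_density) (auto simp: kernel_density_nonneg)
  have moment: "log_product_moment n m =
    (\<integral>x. kernel_density x * log_product n m x \<partial>(lborel \<Otimes>\<^sub>M lborel))"
    unfolding log_product_moment_def kernel_measure_def
    by (subst integral_density) (auto simp: kernel_density_nonneg)
  show "integrable lborel (log_product_slice n m)"
    using lborel_pair.integrable_fst'[OF integrable] unfolding log_product_slice_def[abs_def]
    by simp
  show ?fubini
    using lborel_pair.integral_fst'[OF integrable] unfolding log_product_slice_def moment by simp
  show ?AE using lborel_pair.AE_integrable_fst'[OF integrable] by simp
qed

section \<open>The two ranges of \<open>C\<close>\<close>

lemma A3_eq_C3:
  assumes "w \<noteq> 0"
  shows "A3 (of_real t) w = 1 - of_real (3 * Q3_ratio t) * (C3 w - 1)"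
proof -
  have "complex_of_real (Q3_real t) \<noteq> 0" using Q3_real_pos[of t] by simp
  moreover have "1 + of_real (t\<^sup>2) - of_real t * (w + 1/w) =
    of_real (Q3_real t) - of_real t * (w + 1/w - 1)"
    by (simp add: Q3_real_def algebra_simps)
  ultimately show ?thesis
    unfolding A3_of_real[OF assms] Q3_real_def[symmetric] C3_minus_1(1)[OF assms, symmetric]
    by (simp add: diff_divide_distrib Q3_ratio_def)
qed

lemma Q3_of_real_eq: "Q3 (of_real t) = of_real (Q3_real t)"
  by (simp add: Q3_of_real Q3_real_def)

lemma integral_Ioo_eq_Icc: "integral {a<..<b} f = integral {a..b} f" for f :: "real \<Rightarrow> 'a :: banach"
  using integral_open_interval[of a b f] by (simp only: box_real)

lemma integral_of_real_complex: "integral S (\<lambda>x. complex_of_real (f x)) = of_real (integral S f)"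
proof (cases "f integrable_on S")
  case True
  thus ?thesis by (intro integral_unique has_integral_of_real integrable_integral)
next
  case False
  have "f integrable_on S" if "(\<lambda>x. complex_of_real (f x)) integrable_on S"
    using has_integral_Re[OF integrable_integral[OF that]] by auto
  hence "\<not> (\<lambda>x. complex_of_real (f x)) integrable_on S" using False by blast
  thus ?thesis using False by (simp add: not_integrable_integral)
qed

lemma AE_lborel_negligible:
  fixes P :: "real \<Rightarrow> bool"
  assumes "AE x in lborel. P x"
  obtains N where "negligible N" "\<And>x. x \<notin> N \<Longrightarrow> P x"
proof -
  obtain N where "N \<in> null_sets lborel" "{x. \<not> P x} \<subseteq> N"
    using assms by (auto simp: eventually_ae_filter)
  thus ?thesis by (intro that[of N]) (auto simp: negligible_iff_null_sets null_sets_completionI)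
qed

lemma integral_change_of_variables_negligible:
  fixes f g g' h :: "real \<Rightarrow> real"
  assumes S: "S \<in> sets lebesgue"
    and der: "\<And>x. x \<in> S \<Longrightarrow> (g has_field_derivative g' x) (at x within S)"
    and bij: "bij_betw g S T"
    and f: "f absolutely_integrable_on T"
    and N: "negligible N"
    and eq: "\<And>x. x \<in> S \<Longrightarrow> g x \<notin> N \<Longrightarrow> f (g x) = h x"
  shows "integral S (\<lambda>x. \<bar>g' x\<bar> * h x) = integral T f"
proof -
  have inj: "inj_on g S" and image: "g ` S = T" using bij by (auto simp: bij_betw_def)
  define F where "F y = h (inv_into S g y)" for y
  have F: "F y = f y" if y: "y \<in> T - N" for y
  proof -
    obtain x where "x \<in> S" "y = g x" using y image by blast
    thus ?thesis using eq[of x] y by (simp add: F_def inv_into_f_f[OF inj])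
  qed
  have "(\<lambda>x. \<bar>g' x\<bar> * F (g x)) absolutely_integrable_on S \<and> integral S (\<lambda>x. \<bar>g' x\<bar> * F (g x)) =
    integral T F"
    using has_absolute_integral_change_of_variables_1'[OF S der inj, of F "integral T F"]
      absolutely_integrable_spike[OF f N] F
    unfolding image by simp
  moreover have "integral S (\<lambda>x. \<bar>g' x\<bar> * F (g x)) = integral S (\<lambda>x. \<bar>g' x\<bar> * h x)"
    by (rule integral_cong) (simp add: F_def inv_into_f_f[OF inj])
  moreover have "integral T F = integral T f" by (rule integral_spike[OF N]) (simp add: F)
  ultimately show ?thesis by simp
qed

definition C_real :: "real \<Rightarrow> real" where
  "C_real x = (1 + x)\<^sup>2/(3 * x)"

lemma C3_of_real: "C3 (of_real x) = of_real (C_real x)"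
  by (simp add: C3_def C_real_def)

lemma C_real_minus_1: "0 < x \<Longrightarrow> C_real x - 1 = Q3_real x/(3 * x)"
  by (simp add: C_real_def Q3_real_def field_simps power2_eq_square)

lemma C_real_greater:
  assumes "0 < x" "x < 1"
  shows "4/3 < C_real x"
proof -
  have "C_real x - 4/3 = (1 - x)\<^sup>2/(3 * x)"
    using assms by (simp add: C_real_def field_simps power2_eq_square)
  moreover have "0 < (1 - x)\<^sup>2/(3 * x)" using assms by simp
  ultimately show ?thesis by linarith
qed

lemma A3_of_real_of_real: "0 < x \<Longrightarrow> A3 (of_real t) (of_real x) = of_real (A_real (C_real x, t))"
  by (simp add: A3_eq_C3 C3_of_real A_real_def)

lemma B3_of_real: "0 < x \<Longrightarrow> B3 (of_real x) = of_real (B_real (C_real x))"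
  by (simp add: B3_eq_C3 C3_of_real B_complex_def B_real_def)

lemma A_real_C_real_pos_iff:
  assumes x: "0 < x" "x < 1" and t: "t \<le> 1"
  shows "0 < A_real (C_real x, t) \<longleftrightarrow> t < x"
proof -
  have "A_real (C_real x, t) = 1 - t/Q3_real t * (Q3_real x/x)"
    unfolding A_real_def fst_conv snd_conv C_real_minus_1[OF x(1)] Q3_ratio_def using x by simp
  also have "... = (x * Q3_real t - t * Q3_real x)/(x * Q3_real t)"
    using x Q3_real_pos[of t] by (simp add: field_simps)
  also have "x * Q3_real t - t * Q3_real x = (x - t) * (1 - x * t)"
    by (simp add: Q3_real_def power2_eq_square algebra_simps)
  finally have A: "A_real (C_real x, t) = (x - t) * ((1 - x * t)/(x * Q3_real t))" by simp
  have "x * t \<le> x * 1" using x t by (intro mult_left_mono) auto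
  hence "0 < 1 - x * t" using x by linarith
  hence "0 < (1 - x * t)/(x * Q3_real t)" using x Q3_real_pos[of t] by simp
  thus ?thesis unfolding A by (simp only: zero_less_mult_iff) auto
qed

definition X_real :: "nat \<Rightarrow> real \<Rightarrow> real" where
  "X_real n x = integral {-1..x} (\<lambda>t. ln (A_real (C_real x, t))^n/Q3_real t)
    - pi * ln (C_real x)^n/sqrt 3"

definition Y_real :: "nat \<Rightarrow> real \<Rightarrow> real" where
  "Y_real m x = (x - 1)/(x + 1) * (ln (B_real (C_real x))^m/Q3_real x)"

lemma X3_of_real:
  assumes x: "0 < x" "x < 1"
  shows "X3 n (of_real x) = of_real (X_real n x)"
proof -
  have "contour_integral (linepath (-1) (of_real x)) (\<lambda>t. ln (A3 t (of_real x))^n/Q3 t) =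
    integral {-1..x} (\<lambda>t. ln (A3 (of_real t) (of_real x))^n/Q3 (of_real t))"
    using contour_integral_linepath_Reals_eq[of "-1" "of_real x" "\<lambda>t. ln (A3 t (of_real x))^n/Q3 t"]
      x
    by simp
  also have "... = integral {-1..x} (\<lambda>t. of_real (ln (A_real (C_real x, t))^n/Q3_real t))"
  proof (rule integral_spike[of "{x}"])
    fix t assume "t \<in> {-1..x} - {x}"
    hence "0 < A_real (C_real x, t)" using A_real_C_real_pos_iff[OF x, of t] x by auto
    thus "of_real (ln (A_real (C_real x, t))^n/Q3_real t) =
      ln (A3 (of_real t) (of_real x))^n/Q3 (of_real t)"
      by (simp add: A3_of_real_of_real[OF x(1)] Q3_of_real_eq Ln_of_real)
  qed simp
  also have "... = of_real (integral {-1..x} (\<lambda>t. ln (A_real (C_real x, t))^n/Q3_real t))"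
    by (rule integral_of_real_complex)
  moreover have "Ln (C3 (of_real x)) = of_real (ln (C_real x))"
    unfolding C3_of_real using C_real_greater[OF x] by (intro Ln_of_real) simp
  ultimately show ?thesis by (simp add: X3_def X_real_def)
qed

lemma Y3_of_real:
  assumes x: "0 < x" "x < 1"
  shows "Y3 m (of_real x) = of_real (Y_real m x)"
proof -
  have "0 < B_real (C_real x)" using C_real_greater[OF x] by (simp add: B_real_def)
  thus ?thesis by (simp add: Y3_def Y_real_def B3_of_real[OF x(1)] Q3_of_real_eq Ln_of_real)
qed

lemma has_bochner_integral_inverse_Q3_real:
  "has_bochner_integral lborel (\<lambda>t. indicator {-1<..<1} t * (1/Q3_real t)) (pi/sqrt 3)"
proof (rule has_bochner_integral_nn_integral)
  show "(\<integral>\<^sup>+t. ennreal (indicator {-1<..<1} t * (1/Q3_real t)) \<partial>lborel) = ennreal (pi/sqrt 3)"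
    using has_integral_inverse_Q3_real Q3_real_pos
    by (intro nn_integral_has_integral_lebesgue) (auto simp: has_integral_Icc_iff_Ioo less_imp_le)
qed (use Q3_real_pos in \<open>auto simp: less_imp_le\<close>)

lemma kernel_density_mult_log_product:
  assumes x: "0 < x" "x < 1"
  defines "C \<equiv> C_real x"
  shows "kernel_density (C, t) * log_product n m (C, t) =
    (indicator {-1<..<x} t *\<^sub>R (ln (A_real (C, t))^n/Q3_real t) - ln C^n *
    (indicator {-1<..<1} t * (1/Q3_real t))) * (ln (B_real C)^m/(C * (C - 1)))"
proof (cases "-1 < t \<and> t < 1")
  case True
  hence "0 < A_real (C, t) \<longleftrightarrow> t < x" unfolding C_def by (intro A_real_C_real_pos_iff x) auto
  hence "indicator {-1<..<x} t *\<^sub>R (ln (A_real (C, t))^n/Q3_real t) =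
    (if 0 < A_real (C, t) then ln (A_real (C, t))^n else 0)/Q3_real t" "indicator {-1<..<1} t *
    (1/Q3_real t) = 1/Q3_real t" "kernel_density (C, t) = 1/(C * (C - 1) * Q3_real t)"
    using True C_real_greater[OF x] by (simp_all add: C_def kernel_density_def)
  moreover have "1/(c * q) * ((a - b) * l) = (a/q - b * (1/q)) * (l/c)" for a b c l q :: real
    by (simp flip: diff_divide_distrib)
  ultimately show ?thesis by (simp only: log_product_def fst_conv)
qed (use x in \<open>auto simp: kernel_density_def\<close>)

lemma log_product_slice_C_real:
  assumes x: "0 < x" "x < 1"
    and int: "integrable lborel (\<lambda>t. kernel_density (C_real x, t) * log_product n 0 (C_real x, t))"
  shows "log_product_slice n m (C_real x) =
    X_real n x * ln (B_real (C_real x))^m/(C_real x * (C_real x - 1))"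
proof -
  define C where "C = C_real x"
  define p where "p t = indicator {-1<..<x} t *\<^sub>R (ln (A_real (C, t))^n/Q3_real t)" for t
  define r where "r t = indicator {-1<..<1} t * (1/Q3_real t)" for t
  have C: "1 < C" using C_real_greater[OF x] by (simp add: C_def)
  have slice: "kernel_density (C, t) * log_product n m (C, t) =
    (p t - ln C^n * r t) * (ln (B_real C)^m/(C * (C - 1)))" for m t
    unfolding C_def p_def r_def by (rule kernel_density_mult_log_product[OF x])
  note r = has_bochner_integral_inverse_Q3_real[folded r_def]
  have "integrable lborel (\<lambda>t. C * (C - 1) * (kernel_density (C, t) * log_product n 0 (C, t))
    + ln C^n * r t)"
    using int r unfolding C_def[symmetric]
    by (intro Bochner_Integration.integrable_add integrable_mult_right)
      (simp_all add: has_bochner_integral_iff)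
  moreover have "C * (C - 1) * (kernel_density (C, t) * log_product n 0 (C, t)) + ln C^n * r t =
    p t" for t
    unfolding slice using C by simp
  ultimately have p: "integrable lborel p" by simp
  hence "(\<integral>t. p t \<partial>lborel) = integral {-1<..<x} (\<lambda>t. ln (A_real (C, t))^n/Q3_real t)"
    using set_borel_integral_eq_integral(2)[of "{-1<..<x}" "\<lambda>t. ln (A_real (C, t))^n/Q3_real t"]
    by (simp add: set_integrable_def set_lebesgue_integral_def p_def[abs_def])
  hence p_eq: "(\<integral>t. p t \<partial>lborel) = integral {-1..x} (\<lambda>t. ln (A_real (C, t))^n/Q3_real t)"
    by (simp only: integral_Ioo_eq_Icc)
  have "log_product_slice n m C =
    (\<integral>t. p t - ln C^n * r t \<partial>lborel) * (ln (B_real C)^m/(C * (C - 1)))"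
    unfolding log_product_slice_def slice by (rule integral_mult_left_zero)
  also have "(\<integral>t. p t - ln C^n * r t \<partial>lborel) = X_real n x"
    using p r p_eq by (simp add: has_bochner_integral_iff X_real_def C_def mult.commute)
  finally show ?thesis by (simp add: C_def)
qed

lemma bij_betw_C_real: "bij_betw C_real {0<..<1} {4/3<..}"
  unfolding bij_betw_def
proof (intro conjI subset_antisym subsetI)
  show "inj_on C_real {0<..<1}"
  proof (rule inj_onI)
    fix x y :: real assume xy: "x \<in> {0<..<1}" "y \<in> {0<..<1}" "C_real x = C_real y"
    hence "(1 + x)\<^sup>2 * y = (1 + y)\<^sup>2 * x" by (simp add: C_real_def frac_eq_eq)
    hence "(x - y) * (1 - x * y) = 0" by algebra
    moreover have "x * y < 1 * 1" using xy by (intro mult_strict_mono) auto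
    ultimately show "x = y" by simp
  qed
  show "C \<in> {4/3<..}" if "C \<in> C_real ` {0<..<1}" for C using that C_real_greater by auto
  fix C :: real assume "C \<in> {4/3<..}"
  define p where "p = 3 * C - 2"
  define s where "s = sqrt (p\<^sup>2 - 4)"
  define x where "x = (p - s)/2"
  have p: "2 < p" using \<open>C \<in> _\<close> by (simp add: p_def)
  hence "(p - 2)\<^sup>2 < p\<^sup>2 - 4" by (simp add: power2_eq_square algebra_simps)
  hence "p - 2 < s" unfolding s_def by (rule real_less_rsqrt)
  moreover have "s < p" using p unfolding s_def by (intro real_less_lsqrt) auto
  ultimately have x: "0 < x" "x < 1" by (auto simp: x_def)
  have "s\<^sup>2 = p\<^sup>2 - 4" using p power_mono[of 2 p 2] by (simp add: s_def)
  hence "(1 + x)\<^sup>2 = (p + 2) * x" by (simp add: x_def power2_eq_square field_simps)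
  hence "C_real x = C" using x by (simp add: C_real_def p_def)
  thus "C \<in> C_real ` {0<..<1}" using x by (intro image_eqI[of _ _ x]) auto
qed

lemma C3_jacobian:
  fixes w q :: "'a :: field_char_0"
  assumes "w \<noteq> 0" "1 + w \<noteq> 0" "q \<noteq> 0"
  shows "(w\<^sup>2 - 1)/(3 * w\<^sup>2)/((1 + w)\<^sup>2/(3 * w) * (q/(3 * w))) = 3 * ((w - 1)/(w + 1)/q)"
proof -
  have "(a * b)/(3 * w\<^sup>2)/(b\<^sup>2/(3 * w) * (q/(3 * w))) = 3 * (a/b/q)" if "b \<noteq> 0" for a b
    using assms that by (simp add: divide_simps power2_eq_square)
  from this[OF assms(2), of "w - 1"] show ?thesis by (simp add: power2_eq_square algebra_simps)
qed

lemma has_field_derivative_C_real: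
  "x \<noteq> 0 \<Longrightarrow> (C_real has_field_derivative (x\<^sup>2 - 1)/(3 * x\<^sup>2)) (at x within S)"
  unfolding C_real_def[abs_def]
  by (auto intro!: derivative_eq_intros simp: divide_simps) (simp add: power2_eq_square
    algebra_simps)

lemma C_real_jacobian:
  assumes x: "0 < x" "x < 1"
  shows "\<bar>(x\<^sup>2 - 1)/(3 * x\<^sup>2)\<bar> * (y * ln (B_real (C_real x))^m/(C_real x * (C_real x - 1))) =
    -3 * (y * Y_real m x)"
proof -
  let ?d = "(x\<^sup>2 - 1)/(3 * x\<^sup>2)"
  have "?d \<le> 0" using x by (intro divide_nonpos_pos) (auto simp: power_le_one)
  hence "\<bar>?d\<bar> * (y * ln (B_real (C_real x))^m/(C_real x * (C_real x - 1))) =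
    -(?d/(C_real x * (C_real x - 1))) * (y * ln (B_real (C_real x))^m)"
    by (simp only: abs_of_nonpos) simp
  also have "?d/(C_real x * (C_real x - 1)) = 3 * ((x - 1)/(x + 1)/Q3_real x)"
    unfolding C_real_minus_1[OF x(1)] unfolding C_real_def using x Q3_real_pos[of x]
    by (intro C3_jacobian) auto
  finally show ?thesis by (simp add: Y_real_def mult_ac)
qed

lemma set_integrable_log_product_slice:
  "S \<in> sets borel \<Longrightarrow> set_integrable lborel S (log_product_slice n m)"
  unfolding set_integrable_def
  by (rule integrable_mult_indicator[OF _ integrable_log_product_slice]) simp

lemma absolutely_integrable_log_product_slice:
  "S \<in> sets borel \<Longrightarrow> log_product_slice n m absolutely_integrable_on S"
  using set_integrable_log_product_slice[of S n m] unfolding set_integrable_def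
  by (simp add: integrable_completion)

lemma contour_integral_X3_Y3:
  "contour_integral (linepath 0 1) (\<lambda>\<tau>. X3 n \<tau> * Y3 m \<tau>) =
    of_real (integral {0<..<1} (\<lambda>x. X_real n x * Y_real m x))"
proof -
  have "contour_integral (linepath 0 1) (\<lambda>\<tau>. X3 n \<tau> * Y3 m \<tau>) =
    integral {0<..<1} (\<lambda>x. X3 n (of_real x) * Y3 m (of_real x))"
    using contour_integral_linepath_Reals_eq[of 0 1] by (simp add: integral_Ioo_eq_Icc)
  also have "... = integral {0<..<1} (\<lambda>x. complex_of_real (X_real n x * Y_real m x))"
    by (rule integral_cong) (simp add: X3_of_real Y3_of_real)
  finally show ?thesis by (simp only: integral_of_real_complex)
qed

theorem integral_slice_eq_X3_Y3:
  "complex_of_real (integral {4/3<..} (log_product_slice n m)) =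
    -3 * contour_integral (linepath 0 1) (\<lambda>\<tau>. X3 n \<tau> * Y3 m \<tau>)"
proof -
  let ?h = "\<lambda>x. X_real n x * ln (B_real (C_real x))^m/(C_real x * (C_real x - 1))"
  obtain N where N: "negligible N" "\<And>C. C \<notin> N \<Longrightarrow>
    integrable lborel (\<lambda>t. kernel_density (C, t) * log_product n 0 (C, t))"
    using AE_lborel_negligible[OF AE_integrable_log_product] by blast
  have "integral {4/3<..} (log_product_slice n m) =
    integral {0<..<1} (\<lambda>x. \<bar>(x\<^sup>2 - 1)/(3 * x\<^sup>2)\<bar> * ?h x)"
  proof (rule integral_change_of_variables_negligible[OF _ _ bij_betw_C_real
    absolutely_integrable_log_product_slice N(1), symmetric])
    fix x :: real assume x: "x \<in> {0<..<1}"
    show "(C_real has_field_derivative (x\<^sup>2 - 1)/(3 * x\<^sup>2)) (at x within {0<..<1})"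
      using x by (intro has_field_derivative_C_real) auto
    show "log_product_slice n m (C_real x) = ?h x" if "C_real x \<notin> N"
      using x N(2)[OF that] by (intro log_product_slice_C_real) auto
  qed simp_all
  also have "... = integral {0<..<1} (\<lambda>x. -3 * (X_real n x * Y_real m x))"
    by (rule integral_cong, rule C_real_jacobian) auto
  also have "... = -3 * integral {0<..<1} (\<lambda>x. X_real n x * Y_real m x)"
    by (rule integral_mult_right)
  finally show ?thesis by (simp add: contour_integral_X3_Y3)
qed

definition C_box :: "complex set" where
  "C_box = box (Complex 1 (-1)) (Complex (4/3) 1)"

lemma C_box_iff: "C \<in> C_box \<longleftrightarrow> 1 < Re C \<and> Re C < 4/3 \<and> \<bar>Im C\<bar> < 1"
  by (auto simp: C_box_def in_box_complex_iff)

lemma open_C_box: "open C_box" and convex_C_box: "convex C_box"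
  by (simp_all add: C_box_def open_box convex_box)

lemma C_box_notin_nonpos_Reals: "C \<in> C_box \<Longrightarrow> C \<notin> \<real>\<^sub>\<le>\<^sub>0"
  by (intro nonpos_Reals_Re) (auto simp: C_box_iff)

definition A_complex :: "complex \<Rightarrow> real \<Rightarrow> complex" where
  "A_complex C t = 1 - of_real (3 * Q3_ratio t) * (C - 1)"

lemma A_complex_of_real: "A_complex (of_real C) t = of_real (A_real (C, t))"
  by (simp add: A_complex_def A_real_def)

lemma Re_A_complex:
  assumes "C \<in> C_box"
  shows "4 - 3 * Re C \<le> Re (A_complex C t)" "0 < Re (A_complex C t)"
proof -
  have C: "0 < Re C - 1" "Re C - 1 < 1/3" using assms by (auto simp: C_box_iff)
  have "Q3_ratio t * (Re C - 1) \<le> 1 * (Re C - 1)"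
    using C Q3_ratio_le_1[of t] by (intro mult_right_mono) auto
  thus "4 - 3 * Re C \<le> Re (A_complex C t)" unfolding A_complex_def by (simp add: mult.assoc)
  thus "0 < Re (A_complex C t)" using C by linarith
qed

lemma A_complex_notin_nonpos_Reals: "C \<in> C_box \<Longrightarrow> A_complex C t \<notin> \<real>\<^sub>\<le>\<^sub>0"
  by (intro nonpos_Reals_Re Re_A_complex)

lemma A_real_pos:
  assumes "1 < C" "C < 4/3"
  shows "0 < A_real (C, t)"
  using Re_A_complex(2)[of "of_real C" t] assms by (simp add: C_box_iff A_complex_of_real)

definition fibre_integral :: "nat \<Rightarrow> complex \<Rightarrow> complex" where
  "fibre_integral n C = integral {-1..1} (\<lambda>t. (Ln (A_complex C t)^n - Ln C^n)/of_real (Q3_real t))"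

definition holomorphic_slice :: "nat \<Rightarrow> nat \<Rightarrow> complex \<Rightarrow> complex" where
  "holomorphic_slice n m C = fibre_integral n C * (Ln (B_complex C)^m/(C * (C - 1)))"

lemma continuous_on_fibre_integrand:
  assumes "C \<in> C_box"
  shows "continuous_on {-1..1} (\<lambda>t. (Ln (A_complex C t)^n - Ln C^n)/of_real (Q3_real t))"
proof -
  have "continuous_on {-1..1} (A_complex C)"
    unfolding A_complex_def[abs_def] by (intro continuous_intros continuous_on_Q3_ratio)
  thus ?thesis using A_complex_notin_nonpos_Reals[OF assms] Q3_real_pos
    by (intro continuous_intros continuous_on_Q3_real) (auto simp: less_le)
qed

lemma has_field_derivative_fibre_integrand:
  assumes C: "C \<in> C_box"
  shows "((\<lambda>C. (Ln (A_complex C t)^n - Ln C^n)/of_real (Q3_real t)) has_field_derivative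
    (of_nat n * Ln (A_complex C t)^(n - 1) * (-of_real (3 * Q3_ratio t)/A_complex C t) - of_nat n *
    Ln C^(n - 1) * (1/C))/of_real (Q3_real t)) (at C within S)"
proof -
  have "((\<lambda>C. A_complex C t) has_field_derivative -of_real (3 * Q3_ratio t)) (at C within S)"
    unfolding A_complex_def by (auto intro!: derivative_eq_intros)
  from DERIV_chain2[OF has_field_derivative_Ln[OF A_complex_notin_nonpos_Reals[OF C]] this]
  have A: "((\<lambda>C. Ln (A_complex C t)) has_field_derivative -of_real (3 * Q3_ratio t)/A_complex C t)
    (at C within S)"
    by (simp add: divide_inverse mult.commute)
  have "(Ln has_field_derivative 1/C) (at C within S)"
    using has_field_derivative_at_within[OF has_field_derivative_Ln[OF C_box_notin_nonpos_Reals[OF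
      C]]]
    by (simp add: inverse_eq_divide)
  from DERIV_cdivide[OF DERIV_diff[OF DERIV_power[OF A, of n] DERIV_power[OF this, of n]], of
    "of_real (Q3_real t)"]
  show ?thesis by (simp add: mult_ac)
qed

lemma holomorphic_fibre_integral: "fibre_integral n holomorphic_on C_box"
proof -
  let ?f = "\<lambda>C t. (Ln (A_complex C t)^n - Ln C^n)/of_real (Q3_real t)"
  let ?g = "\<lambda>C t. (of_nat n * Ln (A_complex C t)^(n - 1) * (-of_real (3 * Q3_ratio t)/A_complex C t)
    - of_nat n * Ln C^(n - 1) * (1/C))/of_real (Q3_real t)"
  have "(\<lambda>C. integral (cbox (-1) 1) (?f C)) holomorphic_on C_box"
  proof (rule leibniz_rule_holomorphic[OF has_field_derivative_fibre_integrand _ _ convex_C_box])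
    show "?f C integrable_on cbox (-1) 1" if "C \<in> C_box" for C
      using continuous_on_fibre_integrand[OF that, of n]
      by (auto intro!: integrable_continuous_interval)
    have ratio: "continuous_on (C_box \<times> cbox (-1) 1) (\<lambda>x. Q3_ratio (snd x))"
      and Q3: "continuous_on (C_box \<times> cbox (-1) 1) (\<lambda>x. Q3_real (snd x))"
      by (intro continuous_on_compose2[OF continuous_on_Q3_ratio[of UNIV]] continuous_on_compose2[OF
        continuous_on_Q3_real[of UNIV]] continuous_intros; simp)+
    hence "continuous_on (C_box \<times> cbox (-1) 1) (\<lambda>x. A_complex (fst x) (snd x))"
      unfolding A_complex_def by (intro continuous_intros)
    moreover have "A_complex C t \<noteq> 0" "C \<noteq> 0" if "C \<in> C_box" for C t
      using A_complex_notin_nonpos_Reals[OF that, of t] C_box_notin_nonpos_Reals[OF that] by auto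
    ultimately have "continuous_on (C_box \<times> cbox (-1) 1) (\<lambda>x. ?g (fst x) (snd x))"
      using A_complex_notin_nonpos_Reals C_box_notin_nonpos_Reals Q3_real_pos
      by (intro continuous_intros ratio Q3) (auto simp: less_le)
    thus "continuous_on (C_box \<times> cbox (-1) 1) (\<lambda>(C, t). ?g C t)" by (simp add: case_prod_unfold)
  qed
  thus ?thesis unfolding fibre_integral_def[abs_def] by simp
qed

lemma holomorphic_on_holomorphic_slice: "holomorphic_slice n m holomorphic_on C_box"
  unfolding holomorphic_slice_def B_complex_def
  by (intro holomorphic_intros holomorphic_fibre_integral) (auto simp: C_box_iff dest:
    B_complex_notin_nonpos_Reals[unfolded B_complex_def])

lemma norm_Ln_le: "z \<noteq> 0 \<Longrightarrow> cmod (Ln z) \<le> \<bar>ln (cmod z)\<bar> + pi"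
  using cmod_le[of "Ln z"] Im_Ln_le_pi[of z] mpi_less_Im_Ln[of z] by (simp add: Re_Ln)

lemma norm_Ln_half_plane:
  assumes "1/2 \<le> Re z"
  shows "cmod (Ln z) \<le> 2 * cmod (z - 1)"
proof -
  let ?S = "{z. Re z \<ge> 1/2}"
  have "cmod (Ln z - Ln 1) \<le> 2 * cmod (z - 1)"
  proof (rule field_differentiable_bound[of ?S Ln inverse 2])
    show "convex ?S" by (rule convex_halfspace_Re_ge)
    fix w assume w: "w \<in> ?S"
    thus "(Ln has_field_derivative inverse w) (at w within ?S)"
      by (intro has_field_derivative_at_within[OF has_field_derivative_Ln] nonpos_Reals_Re) auto
    have "1/2 \<le> cmod w" using w complex_Re_le_cmod[of w] by simp
    hence "inverse (cmod w) \<le> inverse (1/2)" by (intro le_imp_inverse_le) auto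
    thus "cmod (inverse w) \<le> 2" by (simp only: norm_inverse) simp
  qed (use assms in auto)
  thus ?thesis by simp
qed

lemma log_power_bound:
  fixes a r :: real
  assumes "0 \<le> a" "0 < r"
  shows "(a + \<bar>ln r\<bar>)^p \<le> (fact p * 2^p * exp (a/2)) * (r powr (-1/2) + r powr (1/2))"
proof -
  have "(a + \<bar>ln r\<bar>)^p \<le> fact p * 2^p * exp ((a + \<bar>ln r\<bar>)/2)"
    using assms by (intro power_le_exp) auto
  also have "exp ((a + \<bar>ln r\<bar>)/2) = exp (a/2) * exp (1/2 * \<bar>ln r\<bar>)"
    by (simp add: exp_add[symmetric] add_divide_distrib)
  also have "fact p * 2^p * (exp (a/2) * exp (1/2 * \<bar>ln r\<bar>)) \<le>
    fact p * 2^p * (exp (a/2) * (r powr (-(1/2)) + r powr (1/2)))"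
    using exp_abs_ln_le[OF assms(2), of "1/2"] by (intro mult_left_mono) auto
  finally show ?thesis by (simp add: mult.assoc)
qed

lemma norm_fibre_integral_le:
  assumes C: "C \<in> C_box" and D: "\<And>t. cmod (Ln (A_complex C t)^n - Ln C^n) \<le> D"
  shows "cmod (fibre_integral n C) \<le> D * (pi/sqrt 3)"
proof -
  have int: "((\<lambda>t. D * (1/Q3_real t)) has_integral D * (pi/sqrt 3)) {-1..1}"
    by (rule has_integral_mult_right[OF has_integral_inverse_Q3_real])
  have "cmod (fibre_integral n C) \<le> integral {-1..1} (\<lambda>t. D * (1/Q3_real t))"
    unfolding fibre_integral_def
  proof (rule integral_norm_bound_integral)
    show "(\<lambda>t. (Ln (A_complex C t)^n - Ln C^n)/of_real (Q3_real t)) integrable_on {-1..1}"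
      by (rule integrable_continuous_interval[OF continuous_on_fibre_integrand[OF C]])
    show "(\<lambda>t. D * (1/Q3_real t)) integrable_on {-1..1}" using int by blast
    show "cmod ((Ln (A_complex C t)^n - Ln C^n)/of_real (Q3_real t)) \<le> D * (1/Q3_real t)" for t
      using D[of t] Q3_real_pos[of t] by (simp add: norm_divide divide_right_mono)
  qed
  thus ?thesis using integral_unique[OF int] by simp
qed

lemma C_box_norm_bounds:
  assumes "C \<in> C_box"
  shows "0 < Re C - 1" "0 < 4 - 3 * Re C" "4 - 3 * Re C \<le> 1" "Re C - 1 \<le> cmod (C - 1)"
    "cmod (C - 1) \<le> 2" "1 \<le> cmod C" "cmod C \<le> 3"
proof -
  show Re: "0 < Re C - 1" "0 < 4 - 3 * Re C" "4 - 3 * Re C \<le> 1"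
    using assms(1) by (auto simp: C_box_iff)
  show "Re C - 1 \<le> cmod (C - 1)" using complex_Re_le_cmod[of "C - 1"] by simp
  show "cmod (C - 1) \<le> 2" using cmod_le[of "C - 1"] assms Re by (simp add: C_box_iff)
  thus "1 \<le> cmod C" "cmod C \<le> 3"
    using complex_Re_le_cmod[of C] Re norm_triangle_ineq[of 1 "C - 1"] by auto
qed

lemma norm_Ln_product_power_le:
  obtains K :: real where "0 \<le> K" "\<And>C. C \<in> C_box \<Longrightarrow>
    cmod (Ln (B_complex C))^m \<le> K * cmod (C - 1) powr (-1/2)"
proof
  define K :: real where "K = fact m * 2^m * exp ((ln 27 + pi)/2)"
  show "0 \<le> 3 * K" by (simp add: K_def)
  fix C assume C: "C \<in> C_box"
  define r where "r = cmod (C - 1)"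
  note bounds = C_box_norm_bounds[OF C, folded r_def]
  have r: "0 < r" "r \<le> 2" using bounds by linarith+
  have nonzero: "B_complex C \<noteq> 0" using bounds r by (auto simp: B_complex_def r_def)
  have "cmod (B_complex C) = inverse ((9 * cmod C) * r)"
    by (simp add: B_complex_def norm_divide norm_mult r_def inverse_eq_divide)
  hence "\<bar>ln (cmod (B_complex C))\<bar> = \<bar>ln ((9 * cmod C) * r)\<bar>"
    by (simp only: ln_inverse abs_minus_cancel)
  also have "ln ((9 * cmod C) * r) = ln (9 * cmod C) + ln r"
    using bounds r by (intro ln_mult_pos) auto
  also have "\<bar>ln (9 * cmod C) + ln r\<bar> \<le> ln 27 + \<bar>ln r\<bar>"
  proof -
    have "0 \<le> ln (9 * cmod C)" "ln (9 * cmod C) \<le> ln 27"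
      using bounds by (auto intro!: ln_ge_zero ln_mono)
    thus ?thesis by linarith
  qed
  finally have "cmod (Ln (B_complex C)) \<le> (ln 27 + pi) + \<bar>ln r\<bar>"
    using norm_Ln_le[OF nonzero] by linarith
  hence "cmod (Ln (B_complex C))^m \<le> ((ln 27 + pi) + \<bar>ln r\<bar>)^m" by (intro power_mono) auto
  also have "... \<le> K * (r powr (-1/2) + r powr (1/2))"
    unfolding K_def using r by (intro log_power_bound) auto
  also have "r powr (1/2) = r * r powr (-1/2)" using r by (simp add: powr_mult_base)
  also have "K * (r powr (-1/2) + r * r powr (-1/2)) \<le> K * (3 * r powr (-1/2))"
    using mult_right_mono[OF r(2), of "r powr (-1/2)"] by (intro mult_left_mono) (auto simp: K_def)
  finally show "cmod (Ln (B_complex C))^m \<le> 3 * K * cmod (C - 1) powr (-1/2)"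
    by (simp add: r_def mult_ac)
qed

lemma norm_A_complex_minus_1_le: "cmod (A_complex C t - 1) \<le> 3 * cmod (C - 1)"
  using mult_right_mono[OF abs_Q3_ratio_le_1[of t] norm_ge_zero[of "C - 1"]]
  by (simp add: A_complex_def norm_mult)

lemma norm_Ln_diff_near:
  assumes C: "C \<in> C_box" "Re C - 1 \<le> 1/6"
  shows "cmod (Ln (A_complex C t)^n - Ln C^n) \<le> (12^n + 4^n) * cmod (C - 1)"
proof (cases n)
  case (Suc k)
  define r where "r = cmod (C - 1)"
  have r: "0 \<le> r" "r/2 \<le> 1" using C_box_norm_bounds(5)[OF C(1)] by (auto simp: r_def)
  have power: "(c * r)^n \<le> (2 * c)^n * r" if "0 \<le> c" for c
  proof -
    have "(c * r)^n = (2 * c)^n * ((r/2)^k * (r/2))"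
      using Suc by (simp add: power_mult_distrib power_divide)
    also have "... \<le> (2 * c)^n * (1 * r)"
      using r that by (intro mult_left_mono mult_mono power_le_one) auto
    finally show ?thesis by simp
  qed
  have "cmod (Ln (A_complex C t)) \<le> 2 * cmod (A_complex C t - 1)"
    using Re_A_complex(1)[OF C(1), of t] C(2) by (intro norm_Ln_half_plane) auto
  also have "... \<le> 6 * r" using norm_A_complex_minus_1_le[of C t] by (simp add: r_def)
  finally have "cmod (Ln (A_complex C t)^n) \<le> (6 * r)^n"
    unfolding norm_power by (intro power_mono) auto
  moreover have "cmod (Ln C) \<le> 2 * r"
    unfolding r_def using C_box_norm_bounds(1)[OF C(1)] by (intro norm_Ln_half_plane) auto
  hence "cmod (Ln C^n) \<le> (2 * r)^n" unfolding norm_power by (intro power_mono) auto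
  ultimately have "cmod (Ln (A_complex C t)^n) \<le> 12^n * r" "cmod (Ln C^n) \<le> 4^n * r"
    using power[of 6] power[of 2] by simp_all
  thus ?thesis using norm_triangle_ineq4[of "Ln (A_complex C t)^n" "Ln C^n"]
    by (simp add: r_def distrib_right)
qed simp

lemma norm_Ln_diff_away:
  assumes C: "C \<in> C_box"
  shows "cmod (Ln (A_complex C t)^n - Ln C^n) \<le>
    (2 * (fact n * 2^n * exp (11/2)) + 4^n) * (4 - 3 * Re C) powr (-1/2)"
proof -
  define r where "r = 4 - 3 * Re C"
  define K :: real where "K = fact n * 2^n * exp (11/2)"
  note bounds = C_box_norm_bounds[OF C, folded r_def]
  have lower: "r \<le> cmod (A_complex C t)"
    using Re_A_complex(1)[OF C, of t] complex_Re_le_cmod[of "A_complex C t"] by (simp add: r_def)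
  have upper: "cmod (A_complex C t) \<le> 7"
    using norm_triangle_ineq[of "A_complex C t - 1" 1] norm_A_complex_minus_1_le[of C t] bounds
    by simp
  have A: "0 < cmod (A_complex C t)" using lower bounds by linarith
  have "ln r \<le> ln (cmod (A_complex C t))" using lower bounds by (intro ln_mono) auto
  moreover have "ln (cmod (A_complex C t)) \<le> 6" using ln_le_minus_one[OF A] upper by linarith
  moreover have "ln r \<le> 0" using bounds by simp
  ultimately have "\<bar>ln (cmod (A_complex C t))\<bar> \<le> 6 + \<bar>ln r\<bar>" by linarith
  hence "cmod (Ln (A_complex C t)) \<le> 11 + \<bar>ln r\<bar>"
    using norm_Ln_le[of "A_complex C t"] A pi_less_4 by auto
  hence "cmod (Ln (A_complex C t)^n) \<le> (11 + \<bar>ln r\<bar>)^n"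
    unfolding norm_power by (intro power_mono) auto
  also have "... \<le> K * (r powr (-1/2) + r powr (1/2))"
    unfolding K_def using bounds by (intro log_power_bound) auto
  also have "... \<le> K * (2 * r powr (-1/2))"
    using powr_mono'[of "-1/2" "1/2" r] bounds by (intro mult_left_mono) (auto simp: K_def)
  finally have A_power: "cmod (Ln (A_complex C t)^n) \<le> 2 * K * r powr (-1/2)" by simp
  have "cmod (Ln C) \<le> 4" using norm_Ln_half_plane[of C] bounds by simp
  hence "cmod (Ln C^n) \<le> 4^n * 1" unfolding norm_power by (simp add: power_mono)
  also have "... \<le> 4^n * r powr (-1/2)"
    using bounds powr_mono'[of "-1/2" 0 r] by (intro mult_left_mono) auto
  finally show ?thesis using A_power norm_triangle_ineq4[of "Ln (A_complex C t)^n" "Ln C^n"]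
    by (simp add: r_def K_def distrib_right)
qed

lemma norm_Ln_diff_le:
  obtains K :: real where "0 \<le> K" "\<And>C t. C \<in> C_box \<Longrightarrow>
    cmod (Ln (A_complex C t)^n - Ln C^n) \<le> K * cmod (C - 1) * (4 - 3 * Re C) powr (-1/2)"
proof
  define near away :: real where "near = 12^n + 4^n"
    and "away = 2 * (fact n * 2^n * exp (11/2)) + 4^n"
  have K: "0 \<le> near" "0 \<le> away" by (simp_all add: near_def away_def)
  thus "0 \<le> near + 6 * away" by simp
  fix C t assume C: "C \<in> C_box"
  define r where "r = (4 - 3 * Re C) powr (-1/2)"
  note bounds = C_box_norm_bounds[OF C]
  have r: "1 \<le> r" using powr_mono'[of "-1/2" 0 "4 - 3 * Re C"] bounds by (simp add: r_def)
  show "cmod (Ln (A_complex C t)^n - Ln C^n) \<le>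
    (near + 6 * away) * cmod (C - 1) * (4 - 3 * Re C) powr (-1/2)"
  proof (cases "Re C - 1 \<le> 1/6")
    case True
    have "cmod (Ln (A_complex C t)^n - Ln C^n) \<le> near * cmod (C - 1) * 1"
      using norm_Ln_diff_near[OF C True] by (simp add: near_def)
    also have "... \<le> (near + 6 * away) * cmod (C - 1) * r" using K r by (intro mult_mono) auto
    finally show ?thesis by (simp add: r_def)
  next
    case False
    have "cmod (Ln (A_complex C t)^n - Ln C^n) \<le> away * 1 * r"
      using norm_Ln_diff_away[OF C] by (simp add: away_def r_def)
    also have "... \<le> away * (6 * cmod (C - 1)) * r"
      using False bounds K r by (intro mult_right_mono mult_left_mono) auto
    also have "... = (6 * away) * cmod (C - 1) * r" by simp
    also have "... \<le> (near + 6 * away) * cmod (C - 1) * r" using K r by (intro mult_right_mono) auto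
    finally show ?thesis by (simp add: r_def)
  qed
qed

lemma norm_holomorphic_slice_le:
  obtains K :: real where "0 \<le> K" "\<And>C. C \<in> C_box \<Longrightarrow>
    cmod (holomorphic_slice n m C) \<le> K * (Re C - 1) powr (-1/2) * (4 - 3 * Re C) powr (-1/2)"
proof -
  obtain L :: real where L: "0 \<le> L" "\<And>C. C \<in> C_box \<Longrightarrow>
    cmod (Ln (B_complex C))^m \<le> L * cmod (C - 1) powr (-1/2)"
    by (rule norm_Ln_product_power_le[of m]) blast
  obtain D :: real where D: "0 \<le> D" "\<And>C t. C \<in> C_box \<Longrightarrow>
    cmod (Ln (A_complex C t)^n - Ln C^n) \<le> D * cmod (C - 1) * (4 - 3 * Re C) powr (-1/2)"
    by (rule norm_Ln_diff_le[of n]) blast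
  show thesis
  proof
    show "0 \<le> D * (pi/sqrt 3) * L" using L(1) D(1) by simp
    fix C assume C: "C \<in> C_box"
    define r where "r = (4 - 3 * Re C) powr (-1/2)"
    note bounds = C_box_norm_bounds[OF C]
    have pos: "0 < cmod (C - 1)" using bounds by linarith
    have "cmod (holomorphic_slice n m C) =
      cmod (fibre_integral n C) * cmod (Ln (B_complex C))^m/(cmod C * cmod (C - 1))"
      by (simp add: holomorphic_slice_def norm_mult norm_divide norm_power)
    also have "... \<le>
      (D * cmod (C - 1) * r * (pi/sqrt 3)) * (L * cmod (C - 1) powr (-1/2))/(1 * cmod (C - 1))"
    proof (intro frac_le mult_mono norm_fibre_integral_le[OF C])
      show "cmod (Ln (A_complex C t)^n - Ln C^n) \<le> D * cmod (C - 1) * r" for t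
        unfolding r_def by (rule D(2)[OF C])
    qed (use L D C bounds pos in \<open>auto simp: r_def\<close>)
    also have "... = D * (pi/sqrt 3) * L * (cmod (C - 1) powr (-1/2) * r)" using pos by simp
    also have "... \<le> D * (pi/sqrt 3) * L * ((Re C - 1) powr (-1/2) * r)"
      using bounds L(1) D(1)
      by (intro mult_left_mono mult_right_mono powr_mono2') (auto simp: r_def)
    finally show "cmod (holomorphic_slice n m C) \<le>
      D * (pi/sqrt 3) * L * (Re C - 1) powr (-1/2) * (4 - 3 * Re C) powr (-1/2)"
      by (simp only: r_def mult.assoc)
  qed
qed

lemma log_product_slice_eq_holomorphic_slice:
  assumes C: "1 < C" "C < 4/3"
  shows "of_real (log_product_slice n m C) = holomorphic_slice n m (of_real C)"
proof -
  have box: "of_real C \<in> C_box" using C by (simp add: C_box_iff)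
  note A = A_real_pos[OF C]
  let ?f = "\<lambda>t. (ln (A_real (C, t))^n - ln C^n)/Q3_real t"
  have f: "(Ln (A_complex (of_real C) t)^n - Ln (of_real C)^n)/of_real (Q3_real t) = of_real (?f t)"
    for t
    unfolding A_complex_of_real using A[of t] C by (simp add: Ln_of_real)
  have "continuous_on {-1..1} ?f"
    using continuous_on_Re[OF continuous_on_fibre_integrand[OF box, of n]] unfolding f by simp
  hence int: "set_integrable lborel {-1<..<1} ?f"
    by (intro set_integrable_subset[OF borel_integrable_atLeastAtMost']) auto
  have "kernel_density (C, t) * log_product n m (C, t) =
    (indicator {-1<..<1} t *\<^sub>R ?f t) * (ln (B_real C)^m/(C * (C - 1)))" for t
    using A[of t] C by (auto simp: kernel_density_def log_product_def indicator_def)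
  hence "log_product_slice n m C =
    (LINT t:{-1<..<1}|lborel. ?f t) * (ln (B_real C)^m/(C * (C - 1)))"
    unfolding log_product_slice_def set_lebesgue_integral_def
    by (simp only: integral_mult_left_zero)
  also have "(LINT t:{-1<..<1}|lborel. ?f t) = integral {-1..1} ?f"
    unfolding set_borel_integral_eq_integral(2)[OF int] by (rule integral_Ioo_eq_Icc)
  finally have slice:
    "log_product_slice n m C = integral {-1..1} ?f * (ln (B_real C)^m/(C * (C - 1)))" .
  have "fibre_integral n (of_real C) = of_real (integral {-1..1} ?f)"
    unfolding fibre_integral_def f by (rule integral_of_real_complex)
  moreover have "B_complex (of_real C) = of_real (B_real C)" "0 < B_real C"
    using C by (simp_all add: B_complex_def B_real_def)
  ultimately show ?thesis unfolding holomorphic_slice_def slice by (simp add: Ln_of_real)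
qed

definition chord_excess :: "real \<Rightarrow> real" where
  "chord_excess s = s * (3 - 2 * s + s\<^sup>2)/(6 * (1 - s + s\<^sup>2))"

lemma chord_nonzero: "chord s \<noteq> 0" and chord_quadratic_pos: "0 < 1 - s + s\<^sup>2"
proof -
  show "0 < 1 - s + s\<^sup>2" using quadratic_pos[of s] by simp
  thus "chord s \<noteq> 0" using norm_chord_square[of s] by auto
qed

lemma Re_C3_chord: "Re (C3 (chord s)) = 1 + chord_excess s"
proof -
  define q where "q = 1 - s + s\<^sup>2"
  have q: "0 < q" unfolding q_def by (rule chord_quadratic_pos)
  have "((1/2 + s/2) * (1 + 1/q) - 1)/3 = ((1 + s) * (q + 1) - 2 * q)/(6 * q)"
    using q by (simp add: field_simps)
  also have "(1 + s) * (q + 1) - 2 * q = s * (3 - 2 * s + s\<^sup>2)"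
    by (simp add: q_def power2_eq_square algebra_simps)
  finally show ?thesis
    unfolding Re_C3[OF chord_nonzero] Re_chord norm_chord_square chord_excess_def q_def[symmetric]
    by simp
qed

lemma one_minus_chord_excess: "1 - 3 * chord_excess s = (1 - s)\<^sup>2 * (2 - s)/(2 * (1 - s + s\<^sup>2))"
proof -
  define q where "q = 1 - s + s\<^sup>2"
  have "0 < q" unfolding q_def by (rule chord_quadratic_pos)
  hence "1 - 3 * chord_excess s = (2 * q - s * (3 - 2 * s + s\<^sup>2))/(2 * q)"
    unfolding chord_excess_def q_def[symmetric] by (simp add: field_simps)
  also have "2 * q - s * (3 - 2 * s + s\<^sup>2) = (1 - s)\<^sup>2 * (2 - s)"
    by (simp add: q_def power2_eq_square algebra_simps)
  finally show ?thesis by (simp add: q_def)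
qed

lemma chord_excess_bounds:
  assumes "0 < s" "s < 1"
  shows "0 < chord_excess s" "chord_excess s < 1/3"
proof -
  have "0 < (s - 1)\<^sup>2 + 2" by (intro add_nonneg_pos) auto
  hence "0 < 3 - 2 * s + s\<^sup>2" by (simp add: power2_eq_square algebra_simps)
  thus "0 < chord_excess s" unfolding chord_excess_def using assms chord_quadratic_pos[of s] by simp
  have "0 < 1 - 3 * chord_excess s"
    unfolding one_minus_chord_excess using assms chord_quadratic_pos[of s] by simp
  thus "chord_excess s < 1/3" by simp
qed

lemma abs_Im_C3_chord_le:
  assumes s: "0 < s" "s < 1"
  shows "\<bar>Im (C3 (chord s))\<bar> \<le> 2 * (chord_excess s * (1 - 3 * chord_excess s))"
proof -
  define q where "q = 1 - s + s\<^sup>2"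
  have "s\<^sup>2 \<le> s" using s by (simp add: power2_eq_square mult_left_le)
  hence q: "0 < q" "q \<le> 1" unfolding q_def using chord_quadratic_pos[of s] by simp_all
  have "1 - 1/q = -(s * (1 - s))/q"
    using q by (simp add: field_simps) (simp add: q_def power2_eq_square algebra_simps)
  hence "Im (C3 (chord s)) = -(sqrt 3/6 * (s * (1 - s)\<^sup>2/q))"
    unfolding Im_C3[OF chord_nonzero] Im_chord norm_chord_square q_def[symmetric]
    by (simp add: power2_eq_square)
  hence "\<bar>Im (C3 (chord s))\<bar> = sqrt 3/6 * (s * (1 - s)\<^sup>2/q)" using s q by simp
  also have "... \<le> 2/6 * (s * (1 - s)\<^sup>2/q)"
    using s q real_sqrt_le_iff[of 3 4] by (intro mult_right_mono) auto
  also have "... \<le> 2/6 * (s * (1 - s)\<^sup>2/(q * q))"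
    using s q by (intro mult_left_mono divide_left_mono mult_pos_pos) (auto simp: mult_left_le)
  also have "... = 2 * ((s * 2/(6 * q)) * ((1 - s)\<^sup>2 * 1/(2 * q)))" by simp
  also have "... \<le> 2 * (chord_excess s * (1 - 3 * chord_excess s))"
    unfolding one_minus_chord_excess unfolding chord_excess_def q_def[symmetric]
  proof (intro mult_left_mono mult_mono divide_right_mono)
    have "0 \<le> (s - 1)\<^sup>2" by simp
    thus "2 \<le> 3 - 2 * s + s\<^sup>2" by (simp add: power2_eq_square algebra_simps)
  qed (use s q in auto)
  finally show ?thesis .
qed

lemma C3_chord_in_C_box:
  assumes "0 < s" "s < 1"
  shows "C3 (chord s) \<in> C_box"
proof -
  note bounds = chord_excess_bounds[OF assms]
  have "chord_excess s * (1 - 3 * chord_excess s) \<le> 1/3 * 1" using bounds by (intro mult_mono) auto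
  hence "\<bar>Im (C3 (chord s))\<bar> < 1" using abs_Im_C3_chord_le[OF assms] by linarith
  thus ?thesis using bounds by (simp add: C_box_iff Re_C3_chord)
qed

lemma isCont_chord_excess: "isCont chord_excess s"
  unfolding chord_excess_def[abs_def] using chord_quadratic_pos[of s]
  by (intro continuous_intros) auto

lemma tendsto_chord_excess: "(chord_excess \<longlongrightarrow> 0) (at_right 0)" "(chord_excess \<longlongrightarrow> 1/3) (at_left 1)"
proof -
  have "(chord_excess \<longlongrightarrow> chord_excess 0) (at_right 0)" "(chord_excess \<longlongrightarrow> chord_excess 1) (at_left 1)"
    using isCont_chord_excess by (auto simp: isCont_def intro: tendsto_within_subset)
  thus "(chord_excess \<longlongrightarrow> 0) (at_right 0)" "(chord_excess \<longlongrightarrow> 1/3) (at_left 1)"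
    by (simp_all add: chord_excess_def)
qed

lemma tendsto_sqrt_chord_excess:
  "((\<lambda>s. sqrt (chord_excess s * (1 - 3 * chord_excess s))) \<longlongrightarrow> 0) (at_right 0)"
    "((\<lambda>s. sqrt (chord_excess s * (1 - 3 * chord_excess s))) \<longlongrightarrow> 0) (at_left 1)"
  by (rule tendsto_eq_intros tendsto_chord_excess refl | simp)+

lemma filterlim_chord_excess_at_right_0:
  "filterlim (\<lambda>s. 1 + chord_excess s) (at_right 1) (at_right 0)"
  using tendsto_add[OF tendsto_const[of 1] tendsto_chord_excess(1)] eventually_at_right_0_1
  by (intro filterlim_at_withinI) (auto elim!: eventually_mono dest: chord_excess_bounds)

lemma filterlim_chord_excess_at_left_1:
  "filterlim (\<lambda>s. 1 + chord_excess s) (at_left (4/3)) (at_left 1)"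
  using tendsto_add[OF tendsto_const[of 1] tendsto_chord_excess(2)] eventually_at_left_real[of 0
    "1::real"]
  by (intro filterlim_at_withinI) (auto elim!: eventually_mono dest: chord_excess_bounds)

lemma Xi3_eq_fibre_integral:
  assumes "w \<noteq> 0"
  shows "Xi3 n w = fibre_integral n (C3 w)"
proof -
  have "Xi3 n w = integral {-1..1} (\<lambda>t. (ln (A3 (of_real t) w)^n - ln (C3 w)^n)/Q3 (of_real t))"
    unfolding Xi3_def using contour_integral_linepath_Reals_eq[of "-1" 1] by simp
  thus ?thesis by (simp add: fibre_integral_def A3_eq_C3[OF assms] A_complex_def Q3_of_real_eq)
qed

lemma has_field_derivative_C3: "w \<noteq> 0 \<Longrightarrow> (C3 has_field_derivative (w\<^sup>2 - 1)/(3 * w\<^sup>2)) (at w)"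
  unfolding C3_def[abs_def]
  by (auto intro!: derivative_eq_intros simp: divide_simps) (simp add: power2_eq_square
    algebra_simps)

lemma holomorphic_slice_C3:
  assumes "w \<noteq> 0" "1 + w \<noteq> 0" "Q3 w \<noteq> 0"
  shows "holomorphic_slice n m (C3 w) * ((w\<^sup>2 - 1)/(3 * w\<^sup>2)) = 3 * (Xi3 n w * Y3 m w)"
proof -
  have "holomorphic_slice n m (C3 w) * ((w\<^sup>2 - 1)/(3 * w\<^sup>2)) =
    Xi3 n w * Ln (B3 w)^m * ((w\<^sup>2 - 1)/(3 * w\<^sup>2)/(C3 w * (C3 w - 1)))"
    unfolding holomorphic_slice_def Xi3_eq_fibre_integral[OF assms(1)] B3_eq_C3[OF assms(1)] by simp
  also have "(w\<^sup>2 - 1)/(3 * w\<^sup>2)/(C3 w * (C3 w - 1)) = 3 * ((w - 1)/(w + 1)/Q3 w)"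
    unfolding C3_minus_1(2)[OF assms(1)] unfolding C3_def using assms by (rule C3_jacobian)
  finally show ?thesis by (simp add: Y3_def)
qed

lemma antiderivative_limits:
  fixes f G :: "real \<Rightarrow> 'a :: banach"
  assumes ab: "a < b"
    and f: "f integrable_on {a..b}"
    and G: "\<And>x. a < x \<Longrightarrow> x < b \<Longrightarrow> (G has_vector_derivative f x) (at x)"
  obtains l r where "(G \<longlongrightarrow> l) (at_right a)" "(G \<longlongrightarrow> r) (at_left b)" "integral {a..b} f = r - l"
proof -
  define F where "F x = integral {a..x} f" for x
  define c where "c = (a + b)/2"
  have c: "a < c" "c < b" using ab by (auto simp: c_def)
  have increment: "G y - G x = F y - F x" if xy: "a < x" "x \<le> y" "y < b" for x y
  proof -
    have "(f has_integral G y - G x) {x..y}"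
      using xy by (intro fundamental_theorem_of_calculus has_vector_derivative_at_within[OF G]) auto
    moreover have "F x + integral {x..y} f = F y"
      unfolding F_def using xy
      by (intro Henstock_Kurzweil_Integration.integral_combine integrable_on_subinterval[OF f]) auto
    ultimately show ?thesis by (simp add: integral_unique flip: \<open>F x + integral {x..y} f = F y\<close>)
  qed
  have G_eq: "F x + (G c - F c) = G x" if "a < x" "x < b" for x
    using increment[of x c] increment[of c x] that c by (cases "x \<le> c") (auto simp: algebra_simps)
  have "continuous_on {a..b} F" unfolding F_def by (rule indefinite_integral_continuous_1[OF f])
  hence lim: "(F \<longlongrightarrow> F a) (at_right a)" "(F \<longlongrightarrow> F b) (at_left b)"
    using ab by (auto intro: continuous_on_Icc_at_rightD continuous_on_Icc_at_leftD)
  show thesis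
  proof (rule that)
    show "(G \<longlongrightarrow> F a + (G c - F c)) (at_right a)"
      by (rule Lim_transform_eventually[OF tendsto_add[OF lim(1) tendsto_const]])
        (use eventually_at_right_real[OF ab] in \<open>auto elim!: eventually_mono simp: G_eq\<close>)
    show "(G \<longlongrightarrow> F b + (G c - F c)) (at_left b)"
      by (rule Lim_transform_eventually[OF tendsto_add[OF lim(2) tendsto_const]])
        (use eventually_at_left_real[OF ab] in \<open>auto elim!: eventually_mono simp: G_eq\<close>)
    show "integral {a..b} f = F b + (G c - F c) - (F a + (G c - F c))" by (simp add: F_def)
  qed
qed

lemma vertical_increment_le:
  assumes G: "\<And>C. C \<in> C_box \<Longrightarrow> (G has_field_derivative G' C) (at C)"
    and K: "0 \<le> K" "\<And>C. C \<in> C_box \<Longrightarrow>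
      cmod (G' C) \<le> K * (Re C - 1) powr (-1/2) * (4 - 3 * Re C) powr (-1/2)"
    and x: "0 < x" "x < 1/3"
    and z: "Re z = 1 + x" "\<bar>Im z\<bar> \<le> 2 * (x * (1 - 3 * x))"
  shows "cmod (G z - G (of_real (1 + x))) \<le> 2 * K * sqrt (x * (1 - 3 * x))"
proof -
  let ?S = "closed_segment (of_real (1 + x)) z"
  let ?B = "K * x powr (-1/2) * (1 - 3 * x) powr (-1/2)"
  have "x * (1 - 3 * x) \<le> 1/3 * 1" using x by (intro mult_mono) auto
  hence Im_z: "\<bar>Im z\<bar> < 1" using z(2) by linarith
  have segment: "Re w = 1 + x" "\<bar>Im w\<bar> < 1" if w: "w \<in> ?S" for w
  proof -
    obtain u where u: "0 \<le> u" "u \<le> 1" "w = (1 - u) *\<^sub>R of_real (1 + x) + u *\<^sub>R z"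
      using w by (auto simp: in_segment)
    hence "Re w = (1 - u) * (1 + x) + u * (1 + x)" using z(1) by simp
    thus "Re w = 1 + x" by (simp add: algebra_simps)
    have "u * \<bar>Im z\<bar> \<le> 1 * \<bar>Im z\<bar>" using u by (intro mult_right_mono) auto
    thus "\<bar>Im w\<bar> < 1" using u Im_z by (simp add: abs_mult)
  qed
  have "cmod (G z - G (of_real (1 + x))) \<le> ?B * cmod (z - of_real (1 + x))"
  proof (rule field_differentiable_bound[of ?S G G'])
    fix w assume w: "w \<in> ?S"
    have box: "w \<in> C_box" using segment[OF w] x by (simp add: C_box_iff)
    show "(G has_field_derivative G' w) (at w within ?S)"
      by (rule has_field_derivative_at_within[OF G[OF box]])
    show "cmod (G' w) \<le> ?B" using K(2)[OF box] segment[OF w] by simp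
  qed auto
  also have "cmod (z - of_real (1 + x)) = \<bar>Im z\<bar>" using z(1) by (simp add: cmod_def)
  also have "?B * \<bar>Im z\<bar> \<le> ?B * (2 * (x * (1 - 3 * x)))"
    using z(2) K(1) by (intro mult_left_mono) auto
  also have "... = 2 * K * ((x * x powr (-1/2)) * ((1 - 3 * x) * (1 - 3 * x) powr (-1/2)))"
    by (simp only: mult_ac)
  also have "... = 2 * K * (sqrt x * sqrt (1 - 3 * x))"
    using x by (simp add: powr_mult_base powr_half_sqrt)
  finally show ?thesis by (simp add: real_sqrt_mult)
qed

lemma slice_antiderivative_limits:
  assumes G: "\<And>C. C \<in> C_box \<Longrightarrow> (G has_field_derivative holomorphic_slice n m C) (at C)"
  obtains l r where "((\<lambda>s. G (C3 (chord s))) \<longlongrightarrow> l) (at_right 0)"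
    "((\<lambda>s. G (C3 (chord s))) \<longlongrightarrow> r) (at_left 1)"
    "of_real (integral {1..4/3} (log_product_slice n m)) = r - l"
proof -
  have "log_product_slice n m integrable_on {1..4/3}"
    using integrable_on_lborel[OF integrable_log_product_slice, of n m] integrable_on_subinterval
    by blast
  hence integrable: "(\<lambda>x. complex_of_real (log_product_slice n m x)) integrable_on {1..4/3}"
    using has_integral_of_real by blast
  have "((\<lambda>x. G (of_real x)) has_vector_derivative of_real (log_product_slice n m x)) (at x)"
    if x: "1 < x" "x < 4/3" for x
  proof -
    have "of_real x \<in> C_box" using x by (simp add: C_box_iff)
    from has_vector_derivative_real_field[OF G[OF this]]
    show ?thesis unfolding log_product_slice_eq_holomorphic_slice[OF x] .
  qed
  from antiderivative_limits[OF _ integrable this]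
  obtain l r where lim: "((\<lambda>x. G (of_real x)) \<longlongrightarrow> l) (at_right 1)"
    "((\<lambda>x. G (of_real x)) \<longlongrightarrow> r) (at_left (4/3))"
    and slice: "integral {1..4/3} (\<lambda>x. of_real (log_product_slice n m x)) = r - l"
    by auto
  obtain K where K: "0 \<le> K" "\<And>C. C \<in> C_box \<Longrightarrow>
    cmod (holomorphic_slice n m C) \<le> K * (Re C - 1) powr (-1/2) * (4 - 3 * Re C) powr (-1/2)"
    by (rule norm_holomorphic_slice_le[of n m]) blast
  define d where "d s = G (C3 (chord s)) - G (of_real (1 + chord_excess s))" for s
  have d: "cmod (d s) \<le> 2 * K * sqrt (chord_excess s * (1 - 3 * chord_excess s))" if "s \<in> {0<..<1}"
    for s
    unfolding d_def using that
    by (intro vertical_increment_le[OF G K] chord_excess_bounds Re_C3_chord abs_Im_C3_chord_le) auto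
  have "(d \<longlongrightarrow> 0) (at_right 0)" "(d \<longlongrightarrow> 0) (at_left 1)"
    using eventually_at_right_0_1 eventually_at_left_real[of 0 "1::real"]
    by (auto intro!: Lim_null_comparison[OF eventually_mono[OF _ d]] tendsto_mult_right_zero
      tendsto_sqrt_chord_excess)
  from tendsto_add[OF this(1) filterlim_compose[OF lim(1) filterlim_chord_excess_at_right_0]]
    tendsto_add[OF this(2) filterlim_compose[OF lim(2) filterlim_chord_excess_at_left_1]]
  have "((\<lambda>s. G (C3 (chord s))) \<longlongrightarrow> l) (at_right 0)" "((\<lambda>s. G (C3 (chord s))) \<longlongrightarrow> r) (at_left 1)"
    by (simp_all add: d_def)
  thus thesis using slice unfolding integral_of_real_complex by (rule that)
qed

lemma has_vector_derivative_slice_chord: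
  assumes G: "\<And>C. C \<in> C_box \<Longrightarrow> (G has_field_derivative holomorphic_slice n m C) (at C)"
    and s: "0 < s" "s < 1"
  shows "((\<lambda>s. G (C3 (chord s))) has_vector_derivative
    3 * (Xi3 n (chord s) * Y3 m (chord s) * (1 - rho))) (at s)"
proof -
  let ?w = "chord s"
  have corner: "?w \<in> upper_corner" by (rule chord_in_upper_corner[OF s])
  have nonzero: "1 + ?w \<noteq> 0" "Q3 ?w \<noteq> 0"
    using half_disc_neq[OF subsetD[OF upper_corner_subset corner]]
    by (auto simp: Q3_factors add.commute)
  have "C3 ?w \<in> C_box" using C3_chord_in_C_box[OF s] .
  note deriv = DERIV_chain2[OF G[OF this] has_field_derivative_C3[OF chord_nonzero]]
  have "(chord has_vector_derivative (1 - rho)) (at s)"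
    unfolding chord_eq_linepath[abs_def] by (rule has_vector_derivative_linepath_within)
  from field_vector_diff_chain_at[OF this deriv]
  have "((\<lambda>s. G (C3 (chord s))) has_vector_derivative
    (1 - rho) * (holomorphic_slice n m (C3 ?w) * ((?w\<^sup>2 - 1)/(3 * ?w\<^sup>2)))) (at s)"
    by (simp add: o_def)
  thus ?thesis unfolding holomorphic_slice_C3[OF chord_nonzero nonzero] by (simp add: mult_ac)
qed

theorem integral_slice_eq_Xi3_Y3:
  "of_real (integral {1..4/3} (log_product_slice n m)) =
    -3 * contour_integral (linepath 1 rho) (\<lambda>\<tau>. Xi3 n \<tau> * Y3 m \<tau>)"
proof -
  let ?f = "\<lambda>\<tau>. Xi3 n \<tau> * Y3 m \<tau>"
  obtain G where "\<And>C. C \<in> C_box \<Longrightarrow>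
    (G has_field_derivative holomorphic_slice n m C) (at C within C_box)"
    using holomorphic_convex_primitive'[OF convex_C_box open_C_box holomorphic_on_holomorphic_slice]
    by blast
  hence G: "(G has_field_derivative holomorphic_slice n m C) (at C)" if "C \<in> C_box" for C
    using that at_within_open[OF that open_C_box] by metis
  obtain l r where lim: "((\<lambda>s. G (C3 (chord s))) \<longlongrightarrow> l) (at_right 0)"
    "((\<lambda>s. G (C3 (chord s))) \<longlongrightarrow> r) (at_left 1)"
    and slice: "of_real (integral {1..4/3} (log_product_slice n m)) = r - l"
    by (rule slice_antiderivative_limits[OF G]) blast
  have "((\<lambda>s. 3 * (?f (chord s) * (1 - rho))) has_integral (r - l)) {0..1}"
    by (rule has_integral_derivative_limits[OF zero_less_one has_vector_derivative_slice_chord[OF G]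
      lim])
  from has_integral_mult_right[OF this, of "1/3"]
  have "(?f has_contour_integral (r - l)/3) (linepath rho 1)"
    unfolding has_contour_integral_linepath chord_eq_linepath by simp
  from has_contour_integral_reversepath[OF _ this]
  have "(?f has_contour_integral -((r - l)/3)) (linepath 1 rho)" by simp
  from contour_integral_unique[OF this] show ?thesis
    unfolding slice by (simp add: diff_divide_distrib)
qed

lemma log_product_moment_eq:
  "of_real (-log_product_moment n m/3) = contour_integral (linepath 0 1) (\<lambda>\<tau>. X3 n \<tau> * Y3 m \<tau>)
    + contour_integral (linepath 1 rho) (\<lambda>\<tau>. Xi3 n \<tau> * Y3 m \<tau>)"
proof -
  have "log_product_slice n m C = 0" if "C \<le> 1" for C
    using that by (simp add: log_product_slice_def kernel_density_def)
  hence "log_product_moment n m = (LINT C:{1..4/3} \<union> {4/3<..}|lborel. log_product_slice n m C)"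
    unfolding log_product_moment_eq_integral_slice set_lebesgue_integral_def
    by (intro Bochner_Integration.integral_cong) (auto simp: indicator_def)
  also have "... = (LINT C:{1..4/3}|lborel. log_product_slice n m C)
    + (LINT C:{4/3<..}|lborel. log_product_slice n m C)"
    by (rule set_integral_Un) (auto intro: set_integrable_log_product_slice)
  also have "... = integral {1..4/3} (log_product_slice n m)
    + integral {4/3<..} (log_product_slice n m)"
    by (simp add: set_borel_integral_eq_integral(2) set_integrable_log_product_slice)
  finally show ?thesis
    using integral_slice_eq_X3_Y3[of n m] integral_slice_eq_Xi3_Y3[of n m] by simp
qed

lemma laurent_eval_linear_form: "laurent_eval (1 + laurent_var 1 + laurent_var 2) z = 1 + z 1 + z 2"
proof -
  let ?P = "1 + laurent_var 1 + laurent_var 2"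
  let ?x1 = "Poly_Mapping.single 1 1 :: nat \<Rightarrow>\<^sub>0 int"
    and ?x2 = "Poly_Mapping.single 2 1 :: nat \<Rightarrow>\<^sub>0 int"
  have "Poly_Mapping.lookup ?x1 1 = 1" "Poly_Mapping.lookup ?x2 1 = 0"
    "Poly_Mapping.lookup ?x2 2 = 1"
    by (simp_all add: lookup_single)
  hence distinct: "?x1 \<noteq> 0" "?x2 \<noteq> 0" "?x1 \<noteq> ?x2" by (metis lookup_zero zero_neq_one)+
  have coeff: "Poly_Mapping.lookup ?P m = (if m = 0 then 1 else 0) + (if m = ?x1 then 1 else 0)
    + (if m = ?x2 then 1 else 0)" for m
    unfolding laurent_var_def lookup_add lookup_one lookup_single by (auto simp: when_def)
  have "Poly_Mapping.keys ?P \<subseteq> {0, ?x1, ?x2}"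
  proof
    fix m assume "m \<in> Poly_Mapping.keys ?P"
    hence "Poly_Mapping.lookup ?P m \<noteq> 0" by (simp add: in_keys_iff)
    thus "m \<in> {0, ?x1, ?x2}" unfolding coeff by (auto split: if_splits)
  qed
  hence "laurent_eval ?P z =
    (\<Sum>m\<in>{0, ?x1, ?x2}. Poly_Mapping.lookup ?P m * (\<Prod>j\<in>Poly_Mapping.keys m. z j powi
    Poly_Mapping.lookup m j))"
    unfolding laurent_eval_def by (intro sum.mono_neutral_left) (auto simp: in_keys_iff)
  also have "... = 1 + z 1 + z 2" using distinct unfolding coeff by (simp add: lookup_single)
  finally show ?thesis .
qed

lemma integral_torus:
  fixes f :: "real \<times> real \<Rightarrow> real"
  assumes [measurable]: "f \<in> borel_measurable (borel \<Otimes>\<^sub>M borel)" and int: "integrable torus f"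
  shows "(\<integral>x. f x \<partial>torus) = integral {0..1} (\<lambda>s. integral {0..1} (\<lambda>t. f (s, t)))"
proof -
  let ?U = "{0<..<1} :: real set"
  have torus: "torus = density (lborel \<Otimes>\<^sub>M lborel) (\<lambda>x. ennreal (indicator (?U \<times> ?U) x))"
    by (simp add: torus_def ennreal_indicator)
  have int_pair: "integrable (lborel \<Otimes>\<^sub>M lborel) (\<lambda>x. indicator (?U \<times> ?U) x *\<^sub>R f x)"
    using int unfolding torus by (subst (asm) integrable_density) auto
  define g where "g s = (\<integral>t. indicator (?U \<times> ?U) (s, t) *\<^sub>R f (s, t) \<partial>lborel)" for s
  obtain N where N: "negligible N" "\<And>s. s \<notin> N \<Longrightarrow>
    integrable lborel (\<lambda>t. indicator (?U \<times> ?U) (s, t) *\<^sub>R f (s, t))"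
    using AE_lborel_negligible[OF lborel_pair.AE_integrable_fst'[OF int_pair]] by blast
  have g_eq: "g s = integral {0..1} (\<lambda>t. f (s, t))" if "s \<in> ?U - N" for s
  proof -
    have "set_integrable lborel ?U (\<lambda>t. f (s, t))"
      using N(2)[of s] that by (simp add: set_integrable_def indicator_times)
    from set_borel_integral_eq_integral(2)[OF this] show ?thesis
      using that by (simp add: g_def set_lebesgue_integral_def indicator_times integral_Ioo_eq_Icc)
  qed
  have g_indicator: "g s = indicator ?U s *\<^sub>R g s" for s
    by (simp add: g_def indicator_times split: split_indicator)
  have "integrable lborel g"
    using lborel_pair.integrable_fst'[OF int_pair] unfolding g_def[abs_def] by simp
  hence set_int: "set_integrable lborel ?U g" unfolding set_integrable_def g_indicator[symmetric] .
  have "(\<integral>x. f x \<partial>torus) = (\<integral>x. indicator (?U \<times> ?U) x *\<^sub>R f x \<partial>(lborel \<Otimes>\<^sub>M lborel))"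
    unfolding torus by (subst integral_density) auto
  also have "... = (\<integral>s. g s \<partial>lborel)"
    using lborel_pair.integral_fst'[OF int_pair] by (simp add: g_def)
  also have "... = (LINT s:?U|lborel. g s)"
    unfolding set_lebesgue_integral_def g_indicator[symmetric] ..
  also have "... = integral ?U g" by (rule set_borel_integral_eq_integral(2)[OF set_int])
  also have "... = integral ?U (\<lambda>s. integral {0..1} (\<lambda>t. f (s, t)))"
    by (rule integral_spike[OF N(1)]) (simp add: g_eq)
  finally show ?thesis by (simp only: integral_Ioo_eq_Icc)
qed

lemma ln_torus_square: "ln (cmod (1 + unit_point t + unit_point s)) = ln (torus_square (s, t))/2"
  by (cases "1 + unit_point t + unit_point s = 0") (simp_all add: torus_square_def ln_realpow)

lemma k_mahler_measure_eq_torus_log_moment: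
  "k_mahler_measure 2 k (1 + laurent_var 1 + laurent_var 2) = (1/2)^k * torus_log_moment k"
proof -
  have "cube_integral 2 h = integral {0..1} (\<lambda>s. integral {0..1} (\<lambda>t. h ((\<lambda>_. 0)(1 := t, 2 := s))))"
    for h
    by (simp add: numeral_2_eq_2)
  hence "k_mahler_measure 2 k (1 + laurent_var 1 + laurent_var 2) =
    integral {0..1} (\<lambda>s. integral {0..1} (\<lambda>t. ln (cmod (1 + unit_point t + unit_point s))^k))"
    unfolding k_mahler_measure_def laurent_eval_linear_form by (simp add: unit_point_def)
  also have "... = (1/2)^k * integral {0..1} (\<lambda>s. integral {0..1} (\<lambda>t. ln (torus_square (s, t))^k))"
    by (simp add: ln_torus_square power_divide)
  also have "integral {0..1} (\<lambda>s. integral {0..1} (\<lambda>t. ln (torus_square (s, t))^k)) =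
    torus_log_moment k"
    unfolding torus_log_moment_def
    by (rule integral_torus[symmetric, OF _ integrable_ln_torus_square_power]) measurable
  finally show ?thesis .
qed

interpretation rat: vector_space "\<lambda>(q::rat) (z::complex). of_rat q * z"
  by (rule vector_space_rat_complex)

definition generators :: "nat \<Rightarrow> (nat \<Rightarrow> nat \<Rightarrow> complex) \<Rightarrow> complex set" where
  "generators k I =
    {of_real (sqrt 3 * pi^(2 * n2) * ln 3^n1) * I n3 n4 | n1 n2 n3 n4. n1 + (2 * n2 + 1) + n3 + n4 =
    k}"

definition mahler_coeff :: "nat \<Rightarrow> nat \<Rightarrow> nat \<Rightarrow> nat \<Rightarrow> real" where
  "mahler_coeff k j n m = (1/2)^k * (3 * sqrt 3 * fact k) * (sin_coeff j * pi^j/pi)/fact (k - j) *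
    log_moment_coeff (k - j) n m"

lemma of_rat_fact: "of_rat (fact n) = (fact n :: real)"
  by (metis of_nat_fact of_rat_of_nat_eq)

lemma complex_of_real_of_rat: "complex_of_real (of_rat q) = of_rat q"
  by (cases q) (simp add: of_rat_rat)

lemma mahler_coeff_odd:
  "\<exists>q. mahler_coeff k (2 * i + 1) n m =
    of_rat q * (sqrt 3 * pi^(2 * i) * ln 3^(k - (2 * i + 1) - n - m))"
proof -
  let ?N = "k - (2 * i + 1)"
  define q :: rat where
    "q = (1/2)^k * (3 * fact k) * ((-1)^i/fact (2 * i + 1))/fact ?N * of_nat (?N choose n) *
    of_nat ((?N - n) choose m) * 2^(?N - n - m)"
  have "sin_coeff (2 * i + 1) * pi^(2 * i + 1)/pi = (-1)^i/fact (2 * i + 1) * pi^(2 * i)"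
    by (simp add: sin_coeff_def)
  hence "mahler_coeff k (2 * i + 1) n m =
    (1/2)^k * (3 * sqrt 3 * fact k) * ((-1)^i/fact (2 * i + 1) * pi^(2 * i))/fact ?N *
    (real (?N choose n) * real ((?N - n) choose m) * (2^(?N - n - m) * ln 3^(?N - n - m)))"
    unfolding mahler_coeff_def log_moment_coeff_def power_mult_distrib by (simp only:)
  also have "... = of_rat q * (sqrt 3 * pi^(2 * i) * ln 3^(?N - n - m))"
    by (simp add: q_def of_rat_mult of_rat_divide of_rat_power of_rat_minus of_rat_add of_rat_fact)
  finally show ?thesis by blast
qed

lemma mahler_coeff_in_rat_span:
  assumes "j \<le> k" "n \<le> k - j" "m \<le> k - j - n"
  shows "of_real (mahler_coeff k j n m) * I n m \<in> rat_span (generators k I)"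
proof (cases "even j")
  case True
  hence "mahler_coeff k j n m = 0" by (simp add: mahler_coeff_def sin_coeff_def)
  thus ?thesis unfolding rat_span_def using rat.span_zero by simp
next
  case False
  then obtain i where j: "j = 2 * i + 1" by (auto elim: oddE)
  then obtain q where
    "mahler_coeff k j n m = of_rat q * (sqrt 3 * pi^(2 * i) * ln 3^(k - j - n - m))"
    using mahler_coeff_odd by blast
  hence "of_real (mahler_coeff k j n m) * I n m =
    of_rat q * (of_real (sqrt 3 * pi^(2 * i) * ln 3^(k - j - n - m)) * I n m)"
    by (simp add: complex_of_real_of_rat)
  moreover have "of_real (sqrt 3 * pi^(2 * i) * ln 3^(k - j - n - m)) * I n m \<in> generators k I"
    unfolding generators_def using assms j by force
  ultimately show ?thesis unfolding rat_span_def by (simp only: rat.span_scale rat.span_base)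
qed

lemma sum_mahler_coeff_in_rat_span:
  "(\<Sum>j\<le>k. \<Sum>n\<le>k - j. \<Sum>m\<le>k - j - n. of_real (mahler_coeff k j n m) * I n m) \<in>
    rat_span (generators k I)"
  unfolding rat_span_def
  by (intro rat.span_sum mahler_coeff_in_rat_span[unfolded rat_span_def]) auto

lemma pi_k_mahler_measure_eq_sum:
  assumes "k > 0"
  shows "pi * k_mahler_measure 2 k (1 + laurent_var 1 + laurent_var 2) =
    (\<Sum>j\<le>k. \<Sum>n\<le>k - j. \<Sum>m\<le>k - j - n. mahler_coeff k j n m * (-log_product_moment n m/3))"
proof -
  have "sin_log_moment k * (sqrt 3 * fact k) = -(pi\<^sup>2 * torus_log_moment k)"
    unfolding moment_identity[OF assms] by simp
  hence "pi * torus_log_moment k = -(sin_log_moment k * (sqrt 3 * fact k))/pi"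
    by (simp add: power2_eq_square)
  hence "pi * k_mahler_measure 2 k (1 + laurent_var 1 + laurent_var 2) =
    (1/2)^k * (-(sin_log_moment k * (sqrt 3 * fact k))/pi)"
    unfolding k_mahler_measure_eq_torus_log_moment by (metis mult.left_commute)
  also have "... =
    (\<Sum>j\<le>k. -((1/2)^k * (sqrt 3 * fact k)/pi) *
    (sin_coeff j * pi^j * (log_moment (k - j)/fact (k - j))))"
    unfolding sum_distrib_left[symmetric] by (simp add: sin_log_moment_def)
  also have "... =
    (\<Sum>j\<le>k. \<Sum>n\<le>k - j. \<Sum>m\<le>k - j - n. mahler_coeff k j n m * (-log_product_moment n m/3))"
    unfolding log_moment_expansion sum_divide_distrib sum_distrib_left
    by (intro sum.cong refl) (simp add: mahler_coeff_def)
  finally show ?thesis .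
qed

lemma subspace_i_polylog_space: "rat.subspace ((\<lambda>z. \<i> * z) ` polylog_space (Suc k) N)"
proof -
  have subspace: "rat.subspace (polylog_space (Suc k) N)"
    unfolding polylog_space_def rat_span_def by (simp add: rat.subspace_span)
  have "module_hom (\<lambda>(q::rat) z. of_rat q * z) (\<lambda>q z. of_rat q * z) (\<lambda>z. \<i> * z)"
    by unfold_locales (simp_all add: algebra_simps)
  from module_hom.subspace_image[OF this subspace] show ?thesis .
qed

lemma subspace_set_plus_subset: "rat.subspace S \<Longrightarrow> A \<subseteq> S \<Longrightarrow> B \<subseteq> S \<Longrightarrow> A + B \<subseteq> S"
  using rat.subspace_add by (blast elim: set_plus_elim)

lemma rat_span_generators_subset:
  assumes "\<And>n m. polylog_value (n + m + 2) (i_sqrt3 * I n m)"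
  shows "rat_span (generators k I) \<subseteq> (\<lambda>z. \<i> * z) ` polylog_space (k + 1) 6"
proof -
  have "generators k I \<subseteq> (\<lambda>z. \<i> * z) ` polylog_space (k + 1) 6"
    unfolding generators_def using generator_in_polylog_space[OF assms] by blast
  thus ?thesis
    unfolding rat_span_def using subspace_i_polylog_space[of k 6]
    by (intro rat.span_minimal) simp_all
qed

theorem mainTheorem2:
  fixes k :: nat
  assumes "k > 0"
  defines "V \<equiv>
      rat_span
        {of_real (sqrt 3 * pi ^ (2 * n2) * ln 3 ^ n1) *
           contour_integral (linepath 0 1) (\<lambda>\<tau>. X3 n3 \<tau> * Y3 n4 \<tau>)
         | n1 n2 n3 n4. n1 + (2 * n2 + 1) + n3 + n4 = k}
      + rat_span
        {of_real (sqrt 3 * pi ^ (2 * n2) * ln 3 ^ n1) *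
           contour_integral (linepath 1 rho) (\<lambda>\<tau>. Xi3 n3 \<tau> * Y3 n4 \<tau>)
         | n1 n2 n3 n4. n1 + (2 * n2 + 1) + n3 + n4 = k}"
  shows "of_real (pi * k_mahler_measure 2 k (1 + laurent_var 1 + laurent_var 2)) \<in> V
       \<and> V \<subseteq> (\<lambda>z. \<i> * z) ` polylog_space (k + 1) 6"
proof
  define IX where "IX n m = contour_integral (linepath 0 1) (\<lambda>\<tau>. X3 n \<tau> * Y3 m \<tau>)" for n m
  define IXi where "IXi n m = contour_integral (linepath 1 rho) (\<lambda>\<tau>. Xi3 n \<tau> * Y3 m \<tau>)" for n m
  have V: "V = rat_span (generators k IX) + rat_span (generators k IXi)"
    unfolding V_def generators_def IX_def IXi_def ..
  let ?sum = "\<lambda>I. \<Sum>j\<le>k. \<Sum>n\<le>k - j. \<Sum>m\<le>k - j - n. complex_of_real (mahler_coeff k j n m) * I n m"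
  have "of_real (pi * k_mahler_measure 2 k (1 + laurent_var 1 + laurent_var 2)) =
    ?sum IX + ?sum IXi"
    unfolding pi_k_mahler_measure_eq_sum[OF assms(1)] IX_def IXi_def
    by (simp only: of_real_sum of_real_mult log_product_moment_eq distrib_left sum.distrib)
  thus "of_real (pi * k_mahler_measure 2 k (1 + laurent_var 1 + laurent_var 2)) \<in> V"
    unfolding V by (simp only: set_plus_intro sum_mahler_coeff_in_rat_span)
  have "rat_span (generators k IX) \<subseteq> (\<lambda>z. \<i> * z) ` polylog_space (k + 1) 6"
    "rat_span (generators k IXi) \<subseteq> (\<lambda>z. \<i> * z) ` polylog_space (k + 1) 6"
    unfolding IX_def IXi_def
    by (intro rat_span_generators_subset polylog_value_X3_Y3 polylog_value_Xi3_Y3)+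
  thus "V \<subseteq> (\<lambda>z. \<i> * z) ` polylog_space (k + 1) 6"
    unfolding V by (simp add: subspace_set_plus_subset subspace_i_polylog_space)
qed

end
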